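(* Let $d\ge 2$, $T>0$, and let $b:[0,T]\times\mathbb{T}^d\to\mathbb{R}^d$ be a deterministic vector field such that (A1) $b\in L^2(0,T;L^2)$ and $\operatorname{div} b\in L^2(0,T;L^2)$; (A2) $\operatorname{div} b\in L^1(0,T;L^\infty)$; (A3) for every $\nu>0$ and every $u_0\in L^2$, uniqueness holds in the class of weak $L^\infty(0,T;L^2)$ solutions of the parabolic Cauchy problem $$\partial_t u=\nu\Delta u+b\cdot\nabla u,\qquad u(0)=u_0. \qquad (P_\nu)$$ Let $\{\theta^N_k: k\in\mathbb{Z}^d_0, N\in\mathbb{N}\}$ be real coefficients such that: (i) for each $N$: $\theta^N_{-k}=\theta^N_k$ for all $k$, $0<\sum_k(\theta^N_k)^2<\infty$, and $\theta^N_{Ok}=\theta^N_k$ for all $k$ and all $O\in E_{\mathbb{Z}}(d)$; (ii) $$\lim_{N\to\infty}\frac{\sup_k(\theta^N_k)^2}{\sum_k(\theta^N_k)^2}=0.$$ Let $W^N$ be the divergence free noise constructed from $\{\theta^N_k\}_k$ (all $W^N$ being built from the same fixed family of Brownian motions on the same fixed filtered probability space). Then for every $\nu>0$ there exists a sequence of positive constants $\varepsilon^N$, depending only on $\nu$ and the coefficients $\{\theta^N_k\}$ (and $d$), such that for every $u_0\in L^2$ and every sequence $(u^N)_N$ with $u^N$ an energy solution of $$\mathrm{d}u^N=b\cdot\nabla u^N\,\mathrm{d}t+\sqrt{\varepsilon^N}\circ \mathrm{d}W^N\cdot\nabla u^N,\qquad u^N(0)=u_0,$$ the sequence $u^N$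 converges in probability, in $L^\infty(0,T;L^2)$ endowed with the weak-$\star$ topology, to the unique weak solution $u$ of the deterministic problem $(P_\nu)$. In particular, one can take $$\varepsilon^N=\nu\,\frac{d}{d-1}\Big(\sum_k(\theta^N_k)^2\Big)^{-1}.$$
   Context: Notation. $\mathbb{T}^d=\mathbb{R}^d/(2\pi\mathbb{Z}^d)$; $L^2=L^2(\mathbb{T}^d)$ is the space of real-valued square integrable functions with normalized inner product $\langle f,g\rangle=(2\pi)^{-d}\int_{\mathbb{T}^d}fg\,\mathrm{d}x$ and norm $|\cdot|_{L^2}$ (for vector fields, $L^2$ is understood componentwise). $\langle\cdot,\cdot\rangle$ is extended bilinearly (no complex conjugation) to complex-valued functions. $e_k(x)=e^{ik\cdot x}$ for $k\in\mathbb{Z}^d$; $\mathbb{Z}^d_0=\mathbb{Z}^d\setminus\{0\}$. $E_{\mathbb{Z}}(d)$ is the group of linear isometries of $\mathbb{R}^d$ leaving $\mathbb{Z}^d$ invariant (generated by permutations of coordinates and sign changes of coordinates). $C([0,T];L^2_w)$ is the space of functions $[0,T]\to L^2$ continuous for the weak topology of $L^2$. Noise. Fix a filtered probability space $(\Omega,\mathcal{F},\mathcal{F}_t,\mathbb{P})$ with normal (complete, right-continuous) filtration, carrying independent standard real $\mathcal{F}_t$-Brownian motions $\{B^{(j)}_k: k\in\mathbb{Z}^d_0, 1\le j\le d-1\}$. Fix $\Lambda\subset\mathbb{Z}^d_0$ such that $\Lambda,-\Lambda$ partition $\mathbb{Z}^d_0$. Set $W^{(j)}_k=B^{(j)}_k+iB^{(j)}_{-k}$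 for $k\in\Lambda$ and $W^{(j)}_k=\overline{W^{(j)}_{-k}}$ for $k\in-\Lambda$, so that the (bilinear) quadratic covariation is $[W^{(j)}_k,W^{(m)}_l]_t=2t\,\delta_{j,m}\delta_{k,-l}$. For $k\in\Lambda$ let $\{a_k^{(1)},\dots,a_k^{(d-1)}\}$ be an orthonormal basis of $k^\perp\subset\mathbb{R}^d$, and $a_{-k}^{(j)}=a_k^{(j)}$. For real coefficients $\{\theta_k\}_{k\in\mathbb{Z}^d_0}$ with $\theta_{-k}=\theta_k$, $\sum_k\theta_k^2<\infty$ and $\theta_{Ok}=\theta_k$ for all $O\in E_{\mathbb{Z}}(d)$, the associated divergence free noise is $$W(t,x)=\sum_{k\in\mathbb{Z}^d_0}\theta_k\Big(\sum_{j=1}^{d-1}a_k^{(j)}W_k^{(j)}(t)\Big)e_k(x),$$ and $c:=\frac{d-1}{d}\sum_k\theta_k^2$. The noise $\sqrt{\varepsilon}\,W$ is the one associated with the coefficients $\sqrt{\varepsilon}\,\theta_k$ (whose constant is $\varepsilon c$). Weak solution. An $\mathcal{F}_t$-progressively measurable, $L^2$-valued process $u$ with paths in $C([0,T];L^2_w)$ and $\int_0^T\mathbb{E}[|u(t)|^2_{L^2}]\mathrm{d}t<\infty$ is a weak solution on $[0,T]$ of $\mathrm{d}u=b\cdot\nabla u\,\mathrm{d}t+\circ\mathrm{d}W\cdot\nabla u$ if for every $\varphi\in C^\infty(\mathbb{T}^d)$, $\mathbb{P}$-a.s., for all $t\in[0,T]$, $$\langle u(t),\varphi\rangle-\langle u(0),\varphi\rangle=-\int_0^t\langle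 u(s),\operatorname{div}(b\varphi)\rangle\mathrm{d}s+c\int_0^t\langle u(s),\Delta\varphi\rangle\mathrm{d}s-\sum_{j,k}\theta_k\int_0^t\langle u(s),e_k\,a_k^{(j)}\cdot\nabla\varphi\rangle\mathrm{d}W^{(j)}_k(s),$$ with It\^o integrals, the series converging in $L^2(\Omega)$. Energy solution. For deterministic $u_0\in L^2$, an energy solution of the Cauchy problem with initial condition $u_0$ is a weak solution with $u(0)=u_0$ such that $\mathbb{P}$-a.s. $$\sup_{t\in[0,T]}\Big\{e^{-\frac12\int_0^t\|\operatorname{div}b(s,\cdot)\|_\infty\mathrm{d}s}\,|u(t)|_{L^2}\Big\}\le|u_0|_{L^2}.$$ Weak solution of $(P_\nu)$. $u\in L^\infty(0,T;L^2)$ is a weak solution of $(P_\nu)$ if for every $\varphi\in C^\infty(\mathbb{T}^d)$, for a.e. $t\in[0,T]$, $\langle u(t),\varphi\rangle-\langle u_0,\varphi\rangle=-\int_0^t\langle u(s),\operatorname{div}(b\varphi)\rangle\mathrm{d}s+\nu\int_0^t\langle u(s),\Delta\varphi\rangle\mathrm{d}s$. Convergence in probability in a topological space. If $X_n,X$ are random variables on the same probability space with values in a topological space $(E,\tau)$ (with its Borel $\sigma$-algebra), $X_n\to X$ in probability means that every subsequence of $(X_n)$ contains a further subsequence converging to $X$ in $\tau$, $\mathbb{P}$-a.s. *)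

theory Defs
  imports "HOL-Probability.Probability"
begin

section \<open>Functions on the torus\<close>

text \<open>
  Functions on \<open>\<real>\<^sup>d / (2 \<pi> \<int>\<^sup>d)\<close> are functions on \<open>\<real>\<^sup>d\<close> that are \<open>2 \<pi>\<close>-periodic in every
  coordinate. Integrals are taken over one period cell, with total mass one.
\<close>

definition periodic :: "(real ^ 'd::finite \<Rightarrow> 'a) \<Rightarrow> bool" where
  "periodic f \<longleftrightarrow> (\<forall>x i. f (x + axis i (2 * pi)) = f x)"

definition torus :: "(real ^ 'd::finite) measure" where
  "torus = uniform_measure lborel (cbox 0 (\<chi> i. 2 * pi))"

text \<open>Bilinear also for complex-valued functions: there is no conjugation.\<close>

definition ip :: "(real ^ 'd::finite \<Rightarrow> 'a::{real_normed_field, banach, second_countable_topology})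
    \<Rightarrow> (real ^ 'd \<Rightarrow> 'a) \<Rightarrow> 'a" where
  "ip f g = (LINT x|torus. f x * g x)"

definition L2 :: "(real ^ 'd::finite \<Rightarrow> real) set" where
  "L2 = {f. periodic f \<and> f \<in> borel_measurable borel \<and> integrable torus (\<lambda>x. (f x)\<^sup>2)}"

definition L2norm :: "(real ^ 'd::finite \<Rightarrow> real) \<Rightarrow> real" where
  "L2norm f = sqrt (ip f f)"

definition eqT :: "(real ^ 'd::finite \<Rightarrow> real) \<Rightarrow> (real ^ 'd \<Rightarrow> real) \<Rightarrow> bool" where
  "eqT f g \<longleftrightarrow> (AE x in torus. f x = g x)"

definition Linf_norm :: "(real ^ 'd::finite \<Rightarrow> real) \<Rightarrow> ennreal" where
  "Linf_norm f = esssup torus (\<lambda>x. ennreal \<bar>f x\<bar>)"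

text \<open>
  Elements of \<^const>\<open>L2\<close> are functions, not classes, so the norm topology is that of a seminorm. Its
  open sets are unions of classes of almost everywhere equal functions, hence topology and Borel
  sets are those of the usual quotient.
\<close>

definition L2_open :: "(real ^ 'd::finite \<Rightarrow> real) set \<Rightarrow> bool" where
  "L2_open U \<longleftrightarrow> U \<subseteq> L2 \<and> (\<forall>f\<in>U. \<exists>r>0. \<forall>g\<in>L2. L2norm (\<lambda>x. g x - f x) < r \<longrightarrow> g \<in> U)"

definition L2_topology :: "(real ^ 'd::finite \<Rightarrow> real) topology" where
  "L2_topology = topology L2_open"

lemma istopology_L2_open: "istopology L2_open"
  unfolding istopology_def
proof (intro conjI allI impI)
  fix S U :: "(real ^ 'd \<Rightarrow> real) set"
  assume S: "L2_open S" and U: "L2_open U"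
  show "L2_open (S \<inter> U)"
    unfolding L2_open_def
  proof (intro conjI ballI)
    show "S \<inter> U \<subseteq> L2" using S by (auto simp: L2_open_def)
    fix f assume f: "f \<in> S \<inter> U"
    obtain r where r: "r > 0" "\<forall>g\<in>L2. L2norm (\<lambda>x. g x - f x) < r \<longrightarrow> g \<in> S"
      using S f unfolding L2_open_def by blast
    obtain q where q: "q > 0" "\<forall>g\<in>L2. L2norm (\<lambda>x. g x - f x) < q \<longrightarrow> g \<in> U"
      using U f unfolding L2_open_def by blast
    show "\<exists>r>0. \<forall>g\<in>L2. L2norm (\<lambda>x. g x - f x) < r \<longrightarrow> g \<in> S \<inter> U"
      using r q by (intro exI[of _ "min r q"]) auto
  qed
next
  fix \<K> :: "(real ^ 'd \<Rightarrow> real) set set"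
  assume K: "\<forall>K\<in>\<K>. L2_open K"
  show "L2_open (\<Union> \<K>)"
    unfolding L2_open_def
  proof (intro conjI ballI)
    show "\<Union> \<K> \<subseteq> L2" using K by (auto simp: L2_open_def)
    fix f assume "f \<in> \<Union> \<K>"
    then obtain K where "K \<in> \<K>" "f \<in> K" by blast
    moreover obtain r where "r > 0" "\<forall>g\<in>L2. L2norm (\<lambda>x. g x - f x) < r \<longrightarrow> g \<in> K"
      using K calculation unfolding L2_open_def by blast
    ultimately show "\<exists>r>0. \<forall>g\<in>L2. L2norm (\<lambda>x. g x - f x) < r \<longrightarrow> g \<in> \<Union> \<K>"
      by blast
  qed
qed

lemma openin_L2_topology: "openin L2_topology = L2_open"
  unfolding L2_topology_def by (rule topology_inverse'[OF istopology_L2_open])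

lemma topspace_L2_topology: "topspace L2_topology = (L2 :: (real ^ 'd::finite \<Rightarrow> real) set)"
proof (rule antisym)
  show "topspace L2_topology \<subseteq> (L2 :: (real ^ 'd \<Rightarrow> real) set)"
    unfolding topspace_def openin_L2_topology L2_open_def by blast
  have "L2_open (L2 :: (real ^ 'd \<Rightarrow> real) set)"
    unfolding L2_open_def by (auto intro: exI[of _ 1])
  then show "(L2 :: (real ^ 'd \<Rightarrow> real) set) \<subseteq> topspace L2_topology"
    by (intro openin_subset) (simp add: openin_L2_topology)
qed

definition borel_of :: "'a topology \<Rightarrow> 'a measure" where
  "borel_of X = sigma (topspace X) {U. openin X U}"

subsection \<open>Smooth functions and weak divergence\<close>

definition pdiff :: "'d::finite \<Rightarrow> (real ^ 'd \<Rightarrow> real) \<Rightarrow> real ^ 'd \<Rightarrow> real" where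
  "pdiff i f x = frechet_derivative f (at x) (axis i 1)"

definition grad :: "(real ^ 'd::finite \<Rightarrow> real) \<Rightarrow> real ^ 'd \<Rightarrow> real ^ 'd" where
  "grad f x = (\<chi> i. pdiff i f x)"

definition laplacian :: "(real ^ 'd::finite \<Rightarrow> real) \<Rightarrow> real ^ 'd \<Rightarrow> real" where
  "laplacian f x = (\<Sum>i\<in>UNIV. pdiff i (pdiff i f) x)"

text \<open>All iterated partial derivatives are differentiable, hence also continuous.\<close>

definition Csmooth :: "(real ^ 'd::finite \<Rightarrow> real) set" where
  "Csmooth = {\<phi>. periodic \<phi> \<and> (\<forall>is x. foldr pdiff is \<phi> differentiable (at x))}"

definition has_weak_div :: "(real ^ 'd::finite \<Rightarrow> real ^ 'd) \<Rightarrow> (real ^ 'd \<Rightarrow> real) \<Rightarrow> bool" where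
  "has_weak_div f g \<longleftrightarrow> (\<forall>i. (\<lambda>x. f x $ i) \<in> L2) \<and> g \<in> L2 \<and>
     (\<forall>\<phi>\<in>Csmooth. ip g \<phi> = - (LINT x|torus. f x \<bullet> grad \<phi> x))"

text \<open>Meaningful only if a weak divergence in \<^const>\<open>L2\<close> exists; it is then unique almost everywhere.\<close>

definition wdiv :: "(real ^ 'd::finite \<Rightarrow> real ^ 'd) \<Rightarrow> real ^ 'd \<Rightarrow> real" where
  "wdiv f = (SOME g. has_weak_div f g)"

section \<open>Functions of time with values in \<open>L2\<close>\<close>

text \<open>
  Time integrals use the completed measure \<^const>\<open>lebesgue\<close>, so that changing the integrand on a null
  set of times, where for instance \<^const>\<open>wdiv\<close> may be undefined, does not affect them.
\<close>

definition strongly_measurable :: "real \<Rightarrow> (real \<Rightarrow> real ^ 'd::finite \<Rightarrow> real) \<Rightarrow> bool" where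
  "strongly_measurable T f \<longleftrightarrow>
     (\<exists>g \<in> restrict_space borel {0..T} \<rightarrow>\<^sub>M borel_of L2_topology.
        AE t in lebesgue_on {0..T}. f t \<in> L2 \<and> eqT (f t) (g t))"

definition Lp_L2 :: "real \<Rightarrow> real \<Rightarrow> (real \<Rightarrow> real ^ 'd::finite \<Rightarrow> real) set" where
  "Lp_L2 p T = {f. strongly_measurable T f \<and>
     (\<integral>\<^sup>+t\<in>{0..T}. ennreal (L2norm (f t) powr p) \<partial>lebesgue) < \<infinity>}"

definition Linf_L2 :: "real \<Rightarrow> (real \<Rightarrow> real ^ 'd::finite \<Rightarrow> real) set" where
  "Linf_L2 T = {f. strongly_measurable T f \<and>
     (\<exists>C. AE t in lebesgue_on {0..T}. L2norm (f t) \<le> C)}"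

text \<open>
  The topology of \<open>L\<^sup>\<infinity>(0,T;L\<^sup>2)\<close> as dual of \<open>L\<^sup>1(0,T;L\<^sup>2)\<close>: the coarsest one making all the pairings
  continuous.
\<close>

definition weak_star :: "real \<Rightarrow> (real \<Rightarrow> real ^ 'd::finite \<Rightarrow> real) topology" where
  "weak_star T = pullback_topology (Linf_L2 T)
     (\<lambda>u. \<lambda>g\<in>Lp_L2 1 T. (LINT t:{0..T}|lebesgue. ip (u t) (g t)))
     (product_topology (\<lambda>_. euclideanreal) (Lp_L2 1 T))"

lemma topspace_weak_star: "topspace (weak_star T) = Linf_L2 T"
  unfolding weak_star_def topspace_pullback_topology by auto

definition weakly_continuous :: "real \<Rightarrow> (real \<Rightarrow> real ^ 'd::finite \<Rightarrow> real) \<Rightarrow> bool" where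
  "weakly_continuous T u \<longleftrightarrow> (\<forall>t\<in>{0..T}. u t \<in> L2) \<and>
     (\<forall>f\<in>L2. continuous_on {0..T} (\<lambda>t. ip (u t) f))"

section \<open>The deterministic parabolic problem\<close>

definition parabolic_weak_solution ::
  "real \<Rightarrow> (real \<Rightarrow> real ^ 'd::finite \<Rightarrow> real ^ 'd) \<Rightarrow> real \<Rightarrow> (real ^ 'd \<Rightarrow> real)
    \<Rightarrow> (real \<Rightarrow> real ^ 'd \<Rightarrow> real) \<Rightarrow> bool" where
  "parabolic_weak_solution T b \<nu> u0 u \<longleftrightarrow> u \<in> Linf_L2 T \<and>
     (\<forall>\<phi>\<in>Csmooth. AE t in lebesgue_on {0..T}.
        ip (u t) \<phi> - ip u0 \<phi> =
          - (LINT s:{0..t}|lebesgue. ip (u s) (wdiv (\<lambda>x. \<phi> x *\<^sub>R b s x)))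
          + \<nu> * (LINT s:{0..t}|lebesgue. ip (u s) (laplacian \<phi>)))"

section \<open>Brownian motions and Ito integrals\<close>

definition normal_filtration :: "'w measure \<Rightarrow> (real \<Rightarrow> 'w measure) \<Rightarrow> bool" where
  "normal_filtration M F \<longleftrightarrow>
     (\<forall>t\<ge>0. subalgebra M (F t)) \<and>
     (\<forall>s t. 0 \<le> s \<and> s \<le> t \<longrightarrow> sets (F s) \<subseteq> sets (F t)) \<and>
     (\<forall>N\<in>null_sets M. \<forall>A\<subseteq>N. A \<in> sets (F 0)) \<and>
     (\<forall>t\<ge>0. sets (F t) = (\<Inter>s\<in>{t<..}. sets (F s)))"

definition brownian_motion ::
  "'w measure \<Rightarrow> (real \<Rightarrow> 'w measure) \<Rightarrow> (real \<Rightarrow> 'w \<Rightarrow> real) \<Rightarrow> bool" where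
  "brownian_motion M F X \<longleftrightarrow>
     (\<forall>t\<ge>0. X t \<in> borel_measurable (F t)) \<and>
     (AE \<omega> in M. X 0 \<omega> = 0) \<and>
     (AE \<omega> in M. continuous_on {0..} (\<lambda>t. X t \<omega>)) \<and>
     (\<forall>s t. 0 \<le> s \<and> s < t \<longrightarrow>
        distributed M lborel (\<lambda>\<omega>. X t \<omega> - X s \<omega>) (\<lambda>x. ennreal (normal_density 0 (sqrt (t - s)) x)) \<and>
        prob_space.indep_set M (sets (F s))
          (sets (vimage_algebra (space M) (\<lambda>\<omega>. X t \<omega> - X s \<omega>) borel)))"

definition progressive ::
  "(real \<Rightarrow> 'w measure) \<Rightarrow> real \<Rightarrow> 'a measure \<Rightarrow> (real \<Rightarrow> 'w \<Rightarrow> 'a) \<Rightarrow> bool" where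
  "progressive F T N X \<longleftrightarrow>
     (\<forall>t\<in>{0..T}. (\<lambda>(s, \<omega>). X s \<omega>) \<in> restrict_space borel {0..t} \<Otimes>\<^sub>M F t \<rightarrow>\<^sub>M N)"

text \<open>
  The simple process \<open>\<Sum>i<n. \<xi>\<^sub>i 1\<^bsub>(\<tau>\<^sub>i, \<tau>\<^sub>i\<^sub>+\<^sub>1]\<^esub>\<close> and its stochastic integral.
\<close>

definition simple_process ::
  "'w measure \<Rightarrow> (real \<Rightarrow> 'w measure) \<Rightarrow> real \<Rightarrow> nat \<Rightarrow> (nat \<Rightarrow> real) \<Rightarrow> (nat \<Rightarrow> 'w \<Rightarrow> complex) \<Rightarrow> bool" where
  "simple_process M F T n \<tau> \<xi> \<longleftrightarrow>
     (\<forall>i<n. 0 \<le> \<tau> i \<and> \<tau> i \<le> \<tau> (Suc i) \<and> \<tau> (Suc i) \<le> T \<and> \<xi> i \<in> borel_measurable (F (\<tau> i))) \<and>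
     (\<exists>C. \<forall>i<n. \<forall>\<omega>\<in>space M. norm (\<xi> i \<omega>) \<le> C)"

definition simple_value ::
  "nat \<Rightarrow> (nat \<Rightarrow> real) \<Rightarrow> (nat \<Rightarrow> 'w \<Rightarrow> complex) \<Rightarrow> real \<Rightarrow> 'w \<Rightarrow> complex" where
  "simple_value n \<tau> \<xi> t \<omega> = (\<Sum>i<n. indicator {\<tau> i<..\<tau> (Suc i)} t * \<xi> i \<omega>)"

definition simple_integral ::
  "(real \<Rightarrow> 'w \<Rightarrow> complex) \<Rightarrow> nat \<Rightarrow> (nat \<Rightarrow> real) \<Rightarrow> (nat \<Rightarrow> 'w \<Rightarrow> complex) \<Rightarrow> real \<Rightarrow> 'w \<Rightarrow> complex" where
  "simple_integral W n \<tau> \<xi> t \<omega> =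
     (\<Sum>i<n. \<xi> i \<omega> * (W (min t (\<tau> (Suc i))) \<omega> - W (min t (\<tau> i)) \<omega>))"

text \<open>
  \<open>I\<close> is (a continuous version of) the Ito integral process \<open>t \<mapsto> \<integral>\<^sub>0\<^sup>t H dW\<close> on \<open>[0,T]\<close>, for a
  complex combination \<open>W\<close> of Brownian motions: the mean square limit of integrals of simple
  processes approximating \<open>H\<close>. It is determined up to indistinguishability.
\<close>

definition is_ito_integral ::
  "'w measure \<Rightarrow> (real \<Rightarrow> 'w measure) \<Rightarrow> real \<Rightarrow> (real \<Rightarrow> 'w \<Rightarrow> complex) \<Rightarrow> (real \<Rightarrow> 'w \<Rightarrow> complex)
    \<Rightarrow> (real \<Rightarrow> 'w \<Rightarrow> complex) \<Rightarrow> bool" where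
  "is_ito_integral M F T W H I \<longleftrightarrow>
     progressive F T borel H \<and>
     (\<integral>\<^sup>+t\<in>{0..T}. (\<integral>\<^sup>+\<omega>. ennreal ((norm (H t \<omega>))\<^sup>2) \<partial>M) \<partial>lebesgue) < \<infinity> \<and>
     (\<forall>t\<in>{0..T}. I t \<in> borel_measurable (F t)) \<and>
     (AE \<omega> in M. continuous_on {0..T} (\<lambda>t. I t \<omega>)) \<and>
     (\<exists>n \<tau> \<xi>.
        (\<forall>m. simple_process M F T (n m) (\<tau> m) (\<xi> m)) \<and>
        (\<lambda>m. \<integral>\<^sup>+t\<in>{0..T}. (\<integral>\<^sup>+\<omega>. ennreal ((norm (H t \<omega> - simple_value (n m) (\<tau> m) (\<xi> m) t \<omega>))\<^sup>2) \<partial>M) \<partial>lebesgue)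
          \<longlonglongrightarrow> 0 \<and>
        (\<forall>t\<in>{0..T}.
           (\<lambda>m. \<integral>\<^sup>+\<omega>. ennreal ((norm (I t \<omega> - simple_integral W (n m) (\<tau> m) (\<xi> m) t \<omega>))\<^sup>2) \<partial>M)
             \<longlonglongrightarrow> 0))"

section \<open>The noise\<close>

definition of_lattice :: "int ^ 'd \<Rightarrow> real ^ 'd::finite" where
  "of_lattice k = (\<chi> i. real_of_int (k $ i))"

definition lattice_isometry :: "(real ^ 'd::finite \<Rightarrow> real ^ 'd) \<Rightarrow> bool" where
  "lattice_isometry Q \<longleftrightarrow> orthogonal_transformation Q \<and> Q ` range of_lattice = range of_lattice"

definition fourier :: "int ^ 'd \<Rightarrow> real ^ 'd::finite \<Rightarrow> complex" where
  "fourier k x = exp (\<i> * complex_of_real (of_lattice k \<bullet> x))"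

definition half_lattice :: "(int ^ 'd::finite) set \<Rightarrow> bool" where
  "half_lattice \<Lambda> \<longleftrightarrow> \<Lambda> \<inter> uminus ` \<Lambda> = {} \<and> \<Lambda> \<union> uminus ` \<Lambda> = UNIV - {0}"

definition noise_frame :: "(int ^ 'd::finite) set \<Rightarrow> (int ^ 'd \<Rightarrow> nat \<Rightarrow> real ^ 'd) \<Rightarrow> bool" where
  "noise_frame \<Lambda> a \<longleftrightarrow> (\<forall>k\<in>\<Lambda>.
     (\<forall>j\<in>{1..CARD('d) - 1}. \<forall>m\<in>{1..CARD('d) - 1}. a k j \<bullet> a k m = (if j = m then 1 else 0)) \<and>
     span (a k ` {1..CARD('d) - 1}) = {x. orthogonal (of_lattice k) x} \<and>
     (\<forall>j\<in>{1..CARD('d) - 1}. a (- k) j = a k j))"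

definition brownian_family ::
  "'w measure \<Rightarrow> (real \<Rightarrow> 'w measure) \<Rightarrow> (int ^ 'd::finite \<Rightarrow> nat \<Rightarrow> real \<Rightarrow> 'w \<Rightarrow> real) \<Rightarrow> bool" where
  "brownian_family M F B \<longleftrightarrow>
     (\<forall>k\<in>UNIV - {0}. \<forall>j\<in>{1..CARD('d) - 1}. brownian_motion M F (B k j)) \<and>
     prob_space.indep_vars M (\<lambda>_. Pi\<^sub>M {0..} (\<lambda>_. borel)) (\<lambda>(k, j) \<omega>. \<lambda>t\<in>{0..}. B k j t \<omega>)
       ((UNIV - {0}) \<times> {1..CARD('d) - 1})"

definition cplx_bm ::
  "(int ^ 'd::finite) set \<Rightarrow> (int ^ 'd \<Rightarrow> nat \<Rightarrow> real \<Rightarrow> 'w \<Rightarrow> real)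
    \<Rightarrow> int ^ 'd \<Rightarrow> nat \<Rightarrow> real \<Rightarrow> 'w \<Rightarrow> complex" where
  "cplx_bm \<Lambda> B k j t \<omega> =
     (if k \<in> \<Lambda> then Complex (B k j t \<omega>) (B (- k) j t \<omega>)
      else cnj (Complex (B (- k) j t \<omega>) (B k j t \<omega>)))"

text \<open>Square summable, symmetric coefficients; the value at \<open>k = 0\<close> is never used.\<close>

definition noise_coeffs :: "(int ^ 'd::finite \<Rightarrow> real) \<Rightarrow> bool" where
  "noise_coeffs \<theta> \<longleftrightarrow>
     (\<forall>k\<in>UNIV - {0}. \<theta> (- k) = \<theta> k) \<and>
     (\<lambda>k. (\<theta> k)\<^sup>2) summable_on (UNIV - {0}) \<and>
     (\<forall>Q k l. lattice_isometry Q \<and> k \<noteq> 0 \<and> of_lattice l = Q (of_lattice k) \<longrightarrow> \<theta> l = \<theta> k)"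

definition noise_const :: "(int ^ 'd::finite \<Rightarrow> real) \<Rightarrow> real" where
  "noise_const \<theta> = (real CARD('d) - 1) / real CARD('d) * (\<Sum>\<^sub>\<infinity>k\<in>UNIV - {0}. (\<theta> k)\<^sup>2)"

section \<open>Stochastic transport equation\<close>

text \<open>
  In the last clause \<open>I k j\<close> is the Ito integral for mode \<open>(k, j)\<close> and \<open>S t\<close> the \<open>L\<^sup>2(\<Omega>)\<close>-sum of the
  series; the identity forces the version \<open>S\<close> to be almost surely continuous.
\<close>

definition spde_weak_solution ::
  "'w measure \<Rightarrow> (real \<Rightarrow> 'w measure) \<Rightarrow> (int ^ 'd::finite) set
    \<Rightarrow> (int ^ 'd \<Rightarrow> nat \<Rightarrow> real \<Rightarrow> 'w \<Rightarrow> real) \<Rightarrow> (int ^ 'd \<Rightarrow> nat \<Rightarrow> real ^ 'd)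
    \<Rightarrow> real \<Rightarrow> (real \<Rightarrow> real ^ 'd \<Rightarrow> real ^ 'd) \<Rightarrow> (int ^ 'd \<Rightarrow> real)
    \<Rightarrow> (real \<Rightarrow> 'w \<Rightarrow> real ^ 'd \<Rightarrow> real) \<Rightarrow> bool" where
  "spde_weak_solution M F \<Lambda> B a T b \<theta> u \<longleftrightarrow>
     progressive F T (borel_of L2_topology) u \<and>
     (\<forall>\<omega>\<in>space M. weakly_continuous T (\<lambda>t. u t \<omega>)) \<and>
     (\<integral>\<^sup>+t\<in>{0..T}. (\<integral>\<^sup>+\<omega>. ennreal ((L2norm (u t \<omega>))\<^sup>2) \<partial>M) \<partial>lebesgue) < \<infinity> \<and>
     (\<forall>\<phi>\<in>Csmooth. \<exists>I S.
        (\<forall>k\<in>UNIV - {0}. \<forall>j\<in>{1..CARD('d) - 1}.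
           is_ito_integral M F T (cplx_bm \<Lambda> B k j)
             (\<lambda>s \<omega>. ip (\<lambda>x. complex_of_real (u s \<omega> x))
                       (\<lambda>x. fourier k x * complex_of_real (a k j \<bullet> grad \<phi> x)))
             (I k j)) \<and>
        (\<forall>t\<in>{0..T}. S t \<in> borel_measurable M \<and>
           ((\<lambda>A. \<integral>\<^sup>+\<omega>. ennreal ((norm (S t \<omega> - (\<Sum>(k, j)\<in>A. complex_of_real (\<theta> k) * I k j t \<omega>)))\<^sup>2) \<partial>M)
              \<longlongrightarrow> 0) (finite_subsets_at_top ((UNIV - {0}) \<times> {1..CARD('d) - 1}))) \<and>
        (AE \<omega> in M. \<forall>t\<in>{0..T}.
           complex_of_real (ip (u t \<omega>) \<phi> - ip (u 0 \<omega>) \<phi>) =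
             complex_of_real
               (- (LINT s:{0..t}|lebesgue. ip (u s \<omega>) (wdiv (\<lambda>x. \<phi> x *\<^sub>R b s x)))
                + noise_const \<theta> * (LINT s:{0..t}|lebesgue. ip (u s \<omega>) (laplacian \<phi>)))
             - S t \<omega>))"

definition energy_solution ::
  "'w measure \<Rightarrow> (real \<Rightarrow> 'w measure) \<Rightarrow> (int ^ 'd::finite) set
    \<Rightarrow> (int ^ 'd \<Rightarrow> nat \<Rightarrow> real \<Rightarrow> 'w \<Rightarrow> real) \<Rightarrow> (int ^ 'd \<Rightarrow> nat \<Rightarrow> real ^ 'd)
    \<Rightarrow> real \<Rightarrow> (real \<Rightarrow> real ^ 'd \<Rightarrow> real ^ 'd) \<Rightarrow> (int ^ 'd \<Rightarrow> real) \<Rightarrow> (real ^ 'd \<Rightarrow> real)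
    \<Rightarrow> (real \<Rightarrow> 'w \<Rightarrow> real ^ 'd \<Rightarrow> real) \<Rightarrow> bool" where
  "energy_solution M F \<Lambda> B a T b \<theta> u0 u \<longleftrightarrow>
     spde_weak_solution M F \<Lambda> B a T b \<theta> u \<and>
     (AE \<omega> in M. eqT (u 0 \<omega>) u0) \<and>
     (AE \<omega> in M.
        (SUP t\<in>{0..T}. ennreal
           (exp (- (1/2) * enn2real (\<integral>\<^sup>+s\<in>{0..t}. Linf_norm (wdiv (b s)) \<partial>lebesgue)) * L2norm (u t \<omega>)))
        \<le> ennreal (L2norm u0))"

section \<open>Convergence in probability in a topological space\<close>

definition converges_in_prob ::
  "'w measure \<Rightarrow> 'a topology \<Rightarrow> (nat \<Rightarrow> 'w \<Rightarrow> 'a) \<Rightarrow> ('w \<Rightarrow> 'a) \<Rightarrow> bool" where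
  "converges_in_prob M E X Y \<longleftrightarrow>
     (\<forall>n. X n \<in> M \<rightarrow>\<^sub>M borel_of E) \<and> Y \<in> M \<rightarrow>\<^sub>M borel_of E \<and>
     (\<forall>r :: nat \<Rightarrow> nat. strict_mono r \<longrightarrow>
        (\<exists>s :: nat \<Rightarrow> nat. strict_mono s \<and>
           (AE \<omega> in M. limitin E (\<lambda>n. X (r (s n)) \<omega>) (Y \<omega>) sequentially)))"

end

theory Submission
  imports Defs
begin

text \<open>
  Duality reduces the theorem to testing against functions of time and space. Integrating the weak
  formulation against \<open>\<eta>(t) \<phi>(x)\<close> shows that the pairing of a solution with the backward
  parabolic operator applied to \<open>\<Sum> (\<integral>\<^sub>t\<^sup>T \<eta>) \<phi>\<close> depends only on the initial condition, up to
  a stochastic integral in the random case. By Ito's isometry and Bessel's inequality the variance of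
  that integral is at most \<open>sup\<^sub>k (\<epsilon>\<^sup>N \<theta>\<^sup>N\<^sub>k\<^sup>2)\<close> times a constant, which tends to zero while
  \<open>\<epsilon>\<^sup>N\<close> keeps the corrector equal to \<open>\<nu> \<Delta>\<close>. By Hahn--Banach and the uniqueness assumption the range
  of the backward operator is dense in \<open>L\<^sup>1(0,T;L\<^sup>2)\<close>; with the uniform energy bound this identifies
  the limit without any compactness argument.
\<close>

text \<open>The variance estimate only reaches test functions in the range of the backward operator,
  while weak-star convergence asks for every \<open>g\<close> in L1(0,T;L2). The energy bound puts
  all solutions into one ball, so replacing \<open>g\<close> by an approximation costs an error
  uniform in \<open>N\<close>, and density of that range is what remains to be shown. A nonzero
  \<open>w\<close> annihilating the range would be a weak solution with zero data. The limit itself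
  has to be produced as well. Gronwall's inequality bounds the initial value of a test function by
  the backward operator applied to it, so prescribing the pairings with the range is a bounded
  linear problem, which Hahn--Banach solves. The corrector of the rescaled noise is
  \<open>eps * (d - 1) / d\<close> times the sum of squared coefficients. Setting it equal to
  \<open>nu\<close> determines \<open>eps\<close>, and the largest squared coefficient becomes
  \<open>nu * d / (d - 1)\<close> times the ratio of supremum and sum, which vanishes by hypothesis.
  Products of cosines in time and trigonometric functions in space form a countable family. It
  permits Hahn--Banach by induction, measurability for the weak-star topology, and one subsequence
  serving all test functions.\<close>

section \<open>Square integrable functions as a seminormed space\<close>

definition sqi :: "'a measure => ('a => real) set" where
 "sqi M = {f \<in> borel_measurable M. integrable M (%x. (f x)\<^sup>2)}"

definition inn :: "'a measure => ('a => real) => ('a => real) => real" where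
 "inn M f g = (LINT x|M. f x * g x)"

definition nrm :: "'a measure => ('a => real) => real" where
 "nrm M f = sqrt (inn M f f)"

lemma sqi_measurable: "f \<in> sqi M ==> f \<in> borel_measurable M"
 by (simp add: sqi_def)

lemma sqi_integrable_power2: "f \<in> sqi M ==> integrable M (%x. (f x)\<^sup>2)"
 by (simp add: sqi_def)

lemma sqi_integrable_mult:
 assumes f: "f \<in> sqi M" and g: "g \<in> sqi M"
 shows "integrable M (%x. f x * g x)"
proof (rule Bochner_Integration.integrable_bound)
 show "integrable M (%x. (f x)\<^sup>2 + (g x)\<^sup>2)"
  using f g by (intro Bochner_Integration.integrable_add sqi_integrable_power2)
 show "(%x. f x * g x) \<in> borel_measurable M"
  using f g by (intro borel_measurable_times sqi_measurable)
 have "\<bar>a * c\<bar> <= a\<^sup>2 + c\<^sup>2" for a c :: real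
 proof -
  have "2 * (\<bar>a\<bar> * \<bar>c\<bar>) <= a\<^sup>2 + c\<^sup>2"
   using sum_squares_bound[of "\<bar>a\<bar>" "\<bar>c\<bar>"] by simp
  moreover have "0 <= \<bar>a\<bar> * \<bar>c\<bar>" by simp
  ultimately show ?thesis unfolding abs_mult by linarith
 qed
 then show "AE x in M. norm (f x * g x) <= norm ((f x)\<^sup>2 + (g x)\<^sup>2)"
  by (simp add: order_trans[OF _ abs_ge_self])
qed

lemma sqi_add: "f \<in> sqi M ==> g \<in> sqi M ==> (%x. f x + g x) \<in> sqi M"
 using sqi_integrable_mult[of f M g]
 by (auto simp: sqi_def power2_sum mult.assoc intro!: Bochner_Integration.integrable_add)

lemma sqi_scale: "f \<in> sqi M ==> (%x. c * f x) \<in> sqi M"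
 by (auto simp: sqi_def power_mult_distrib)

lemma sqi_minus: "f \<in> sqi M ==> (%x. - f x) \<in> sqi M"
 by (auto simp: sqi_def)

lemma sqi_diff: "f \<in> sqi M ==> g \<in> sqi M ==> (%x. f x - g x) \<in> sqi M"
 using sqi_add[OF _ sqi_minus, of f M g] by simp

lemma sqi_zero: "(%x. 0) \<in> sqi M"
 by (auto simp: sqi_def)

lemma sqi_sum: "(!!i. i \<in> A ==> f i \<in> sqi M) ==> (%x. \<Sum>i\<in>A. f i x) \<in> sqi M"
 by (induction A rule: infinite_finite_induct) (auto intro: sqi_add sqi_zero)

lemma sqi_lincomb: "(!!i. i \<in> A ==> f i \<in> sqi M) ==> (%x. \<Sum>i\<in>A. c i * f i x) \<in> sqi M"
 by (intro sqi_sum sqi_scale)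

lemma sqi_mult_bounded:
 assumes f: "f \<in> sqi M" and g: "g \<in> borel_measurable M" and b: "AE x in M. \<bar>g x\<bar> <= C"
 shows "(%x. g x * f x) \<in> sqi M"
 unfolding sqi_def
proof (intro CollectI conjI)
 show "(%x. g x * f x) \<in> borel_measurable M" by (intro borel_measurable_times g sqi_measurable[OF f])
 show "integrable M (%x. (g x * f x)\<^sup>2)"
 proof (rule Bochner_Integration.integrable_bound)
  show "integrable M (%x. C\<^sup>2 * (f x)\<^sup>2)"
   using f by (intro integrable_mult_right sqi_integrable_power2) auto
  show "(%x. (g x * f x)\<^sup>2) \<in> borel_measurable M"
   by (intro borel_measurable_power borel_measurable_times g sqi_measurable[OF f])
  show "AE x in M. norm ((g x * f x)\<^sup>2) <= norm (C\<^sup>2 * (f x)\<^sup>2)"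
   using b
  proof eventually_elim
   case (elim x)
   then have "(g x)\<^sup>2 <= C\<^sup>2" by (metis abs_le_square_iff abs_of_nonneg abs_ge_zero order_trans)
   then show ?case by (simp add: power_mult_distrib mult_right_mono)
  qed
 qed
qed

lemma sqi_bounded:
 assumes "finite_measure M" "f \<in> borel_measurable M" "AE x in M. \<bar>f x\<bar> <= C"
 shows "f \<in> sqi M"
proof -
 interpret finite_measure M by fact
 have "(%x. 1) \<in> sqi M" by (auto simp: sqi_def)
 from sqi_mult_bounded[OF this assms(2,3)] show ?thesis by simp
qed

lemma inn_commute: "inn M f g = inn M g f"
 by (simp add: inn_def mult.commute)

lemma inn_add_left: "f \<in> sqi M ==> g \<in> sqi M ==> k \<in> sqi M ==>
  inn M (%x. f x + g x) k = inn M f k + inn M g k"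
 unfolding inn_def distrib_right
 by (intro Bochner_Integration.integral_add sqi_integrable_mult)

lemma inn_diff_left: "f \<in> sqi M ==> g \<in> sqi M ==> k \<in> sqi M ==>
  inn M (%x. f x - g x) k = inn M f k - inn M g k"
 unfolding inn_def left_diff_distrib
 by (intro Bochner_Integration.integral_diff sqi_integrable_mult)

lemma inn_scale_left: "inn M (%x. c * f x) k = c * inn M f k"
 unfolding inn_def by (simp add: mult.assoc)

lemma inn_scale_right: "inn M k (%x. c * f x) = c * inn M k f"
 using inn_scale_left[of M c f k] by (simp add: inn_commute)

lemma inn_add_right: "f \<in> sqi M ==> g \<in> sqi M ==> k \<in> sqi M ==>
  inn M k (%x. f x + g x) = inn M k f + inn M k g"
 using inn_add_left[of f M g k] by (simp add: inn_commute)

lemma inn_diff_right: "f \<in> sqi M ==> g \<in> sqi M ==> k \<in> sqi M ==>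
  inn M k (%x. f x - g x) = inn M k f - inn M k g"
 using inn_diff_left[of f M g k] by (simp add: inn_commute)

lemma inn_minus_left: "inn M (%x. - f x) k = - inn M f k"
 using inn_scale_left[of M "-1" f k] by simp

lemma inn_minus_right: "inn M k (%x. - f x) = - inn M k f"
 using inn_scale_right[of M k "-1" f] by simp

lemma inn_zero [simp]: "inn M (%x. 0) k = 0" "inn M k (%x. 0) = 0"
 by (simp_all add: inn_def)

lemma inn_sum_left: "(!!i. i \<in> A ==> f i \<in> sqi M) ==> k \<in> sqi M ==>
  inn M (%x. \<Sum>i\<in>A. f i x) k = (\<Sum>i\<in>A. inn M (f i) k)"
 by (induction A rule: infinite_finite_induct) (auto simp: inn_add_left sqi_sum)

lemma inn_lincomb_left: "(!!i. i \<in> A ==> f i \<in> sqi M) ==> k \<in> sqi M ==>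
  inn M (%x. \<Sum>i\<in>A. c i * f i x) k = (\<Sum>i\<in>A. c i * inn M (f i) k)"
 by (subst inn_sum_left) (auto simp: inn_scale_left intro: sqi_scale)

lemma inn_lincomb_right: "(!!i. i \<in> A ==> f i \<in> sqi M) ==> k \<in> sqi M ==>
  inn M k (%x. \<Sum>i\<in>A. c i * f i x) = (\<Sum>i\<in>A. c i * inn M k (f i))"
 using inn_lincomb_left[of A f M k c] by (simp add: inn_commute)

lemma inn_self_nonneg [simp]: "0 <= inn M f f"
 unfolding inn_def by (intro Bochner_Integration.integral_nonneg) auto

lemma nrm_nonneg [simp]: "0 <= nrm M f"
 by (simp add: nrm_def)

lemma nrm_power2: "(nrm M f)\<^sup>2 = inn M f f"
 by (simp add: nrm_def)

lemma nrm_scale: "nrm M (%x. c * f x) = \<bar>c\<bar> * nrm M f"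
 by (simp add: nrm_def inn_scale_left inn_scale_right real_sqrt_mult flip: mult.assoc)

lemma nrm_zero [simp]: "nrm M (%x. 0) = 0"
 by (simp add: nrm_def)

lemma nrm_minus_commute: "nrm M (%x. f x - g x) = nrm M (%x. g x - f x)"
 using nrm_scale[of M "-1" "%x. f x - g x"] by simp

lemma nrm_eq_0_AE: "f \<in> sqi M ==> nrm M f = 0 \<longleftrightarrow> (AE x in M. f x = 0)"
 using integral_nonneg_eq_0_iff_AE[of M "%x. f x * f x"]
 by (simp add: nrm_def inn_def sqi_integrable_mult)

lemma inn_cong_AE:
 assumes "AE x in M. f x = f' x" "f \<in> borel_measurable M" "f' \<in> borel_measurable M"
  "k \<in> borel_measurable M"
 shows "inn M f k = inn M f' k"
 unfolding inn_def using assms by (intro integral_cong_AE) auto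

text \<open>With \<open>p\<close> and \<open>q\<close> the two norms, the square of
  \<open>q * f - p * g\<close> expands to \<open>2 * p * q * (p * q - inn M f g)\<close>. Only a
  seminorm is at hand, so a vanishing norm is treated apart, through almost everywhere equality with
  zero.\<close>

lemma cauchy_schwarz_inn:
 assumes f: "f \<in> sqi M" and g: "g \<in> sqi M"
 shows "\<bar>inn M f g\<bar> <= nrm M f * nrm M g"
proof -
 have zero: "inn M f' g' = 0" if "f' \<in> sqi M" "g' \<in> sqi M" "nrm M f' = 0" for f' g'
 proof -
  have "inn M f' g' = inn M (%x. 0) g'"
   using that by (intro inn_cong_AE) (auto simp: nrm_eq_0_AE sqi_measurable)
  then show ?thesis by simp
 qed
 have key: "inn M f' g <= nrm M f' * nrm M g" if f': "f' \<in> sqi M" and p: "0 < nrm M f'" "0 < nrm M g" for f'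
 proof -
  define p q where "p = nrm M f'" and "q = nrm M g"
  have pq: "(%x. q * f' x) \<in> sqi M" "(%x. p * g x) \<in> sqi M" using f' g by (auto intro: sqi_scale)
  have "0 <= inn M (%x. q * f' x - p * g x) (%x. q * f' x - p * g x)" by simp
  also have "... = q * q * inn M f' f' - 2 * (p * q * inn M f' g) + p * p * inn M g g"
   by (subst inn_diff_left[OF pq sqi_diff[OF pq]], subst (1 2) inn_diff_right[OF pq])
    (use pq in \<open>simp_all add: inn_scale_left inn_scale_right inn_commute[of M g f'] algebra_simps\<close>)
  also have "... = 2 * (p * q) * (p * q - inn M f' g)"
   by (simp flip: nrm_power2 p_def q_def add: algebra_simps power2_eq_square)
  finally have "0 <= 2 * (p * q) * (p * q - inn M f' g)" .
  moreover have "0 < 2 * (p * q)" using p by (simp add: p_def q_def)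
  ultimately have "0 <= p * q - inn M f' g" by (simp add: zero_le_mult_iff)
  then show ?thesis by (simp add: p_def q_def)
 qed
 consider "nrm M f = 0" | "nrm M g = 0" | "0 < nrm M f" "0 < nrm M g"
  using nrm_nonneg[of M f] nrm_nonneg[of M g] by linarith
 then show ?thesis
 proof cases
  case 1 then show ?thesis using zero[OF f g] by simp
 next
  case 2 then show ?thesis using zero[OF g f] by (simp add: inn_commute)
 next
  case 3
  have "nrm M (%x. - f x) = nrm M f" using nrm_scale[of M "-1" f] by simp
  then show ?thesis using key[OF f] key[OF sqi_minus[OF f]] 3 by (simp add: inn_minus_left abs_le_iff)
 qed
qed

lemma nrm_add_power2:
 assumes "f \<in> sqi M" "g \<in> sqi M"
 shows "(nrm M (%x. f x + g x))\<^sup>2 = (nrm M f)\<^sup>2 + 2 * inn M f g + (nrm M g)\<^sup>2"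
 using assms by (simp add: nrm_power2 inn_add_left inn_add_right sqi_add inn_commute[of M g f])

lemma nrm_triangle:
 assumes f: "f \<in> sqi M" and g: "g \<in> sqi M"
 shows "nrm M (%x. f x + g x) <= nrm M f + nrm M g"
proof (rule power2_le_imp_le)
 show "(nrm M (%x. f x + g x))\<^sup>2 <= (nrm M f + nrm M g)\<^sup>2"
  using cauchy_schwarz_inn[OF f g] by (simp add: nrm_add_power2[OF f g] power2_sum)
qed simp

lemma nrm_diff_triangle:
 assumes "f \<in> sqi M" "g \<in> sqi M" "k \<in> sqi M"
 shows "nrm M (%x. f x - k x) <= nrm M (%x. f x - g x) + nrm M (%x. g x - k x)"
 using nrm_triangle[of "%x. f x - g x" M "%x. g x - k x"] assms by (simp add: sqi_diff)

lemma nrm_le_add_diff: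
 assumes "f \<in> sqi M" "g \<in> sqi M"
 shows "nrm M f <= nrm M g + nrm M (%x. f x - g x)"
 using nrm_triangle[of "g" M "%x. f x - g x"] assms by (simp add: sqi_diff)

lemma nrm_cong_AE:
 assumes "AE x in M. f x = f' x" "f \<in> borel_measurable M" "f' \<in> borel_measurable M"
 shows "nrm M f = nrm M f'"
proof -
 have "inn M f f = inn M f' f'"
  unfolding inn_def using assms by (intro integral_cong_AE) auto
 then show ?thesis by (simp add: nrm_def)
qed

lemma inn_tendsto:
 assumes "!!n. f n \<in> sqi M" "s \<in> sqi M" "k \<in> sqi M"
  and "((%n. nrm M (%x. f n x - s x)) \<longlongrightarrow> 0) F"
 shows "((%n. inn M (f n) k) \<longlongrightarrow> inn M s k) F"
proof (rule LIM_zero_cancel)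
 have "((%n. nrm M (%x. f n x - s x) * nrm M k) \<longlongrightarrow> 0) F"
  using tendsto_mult_right[OF assms(4), of "nrm M k"] by simp
 then show "((%n. inn M (f n) k - inn M s k) \<longlongrightarrow> 0) F"
 proof (rule Lim_null_comparison[rotated], intro always_eventually allI)
  fix n
  show "norm (inn M (f n) k - inn M s k) <= nrm M (%x. f n x - s x) * nrm M k"
   using cauchy_schwarz_inn[of "%x. f n x - s x" M k] assms by (simp add: inn_diff_left sqi_diff)
 qed
qed

lemma nrm_tendsto:
 assumes "!!n. f n \<in> sqi M" "s \<in> sqi M"
  and "((%n. nrm M (%x. f n x - s x)) \<longlongrightarrow> 0) F"
 shows "((%n. nrm M (f n)) \<longlongrightarrow> nrm M s) F"
proof (rule LIM_zero_cancel)
 show "((%n. nrm M (f n) - nrm M s) \<longlongrightarrow> 0) F"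
  using assms(3)
 proof (rule Lim_null_comparison[rotated], intro always_eventually allI)
  fix n
  show "norm (nrm M (f n) - nrm M s) <= nrm M (%x. f n x - s x)"
   using nrm_le_add_diff[of "f n" M s] nrm_le_add_diff[of s M "f n"] assms nrm_minus_commute[of M s "f n"]
   by (auto simp: abs_le_iff)
 qed
qed

lemma nn_integral_nrm: "f \<in> sqi M ==> (\<integral>\<^sup>+x. ennreal ((f x)\<^sup>2) \<partial>M) = ennreal ((nrm M f)\<^sup>2)"
 unfolding nrm_power2 inn_def using nn_integral_eq_integral[OF sqi_integrable_power2, of f M]
 by (simp add: power2_eq_square)

lemma sqi_of_nn_integral:
 assumes "f \<in> borel_measurable M" "(\<integral>\<^sup>+x. ennreal ((f x)\<^sup>2) \<partial>M) <= ennreal c"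
 shows "f \<in> sqi M" "0 <= c ==> (nrm M f)\<^sup>2 <= c"
proof -
 have "integrable M (%x. (f x)\<^sup>2)"
  using assms by (intro integrableI_bounded) (auto simp: le_less_trans)
 then show *: "f \<in> sqi M" using assms by (simp add: sqi_def)
 show "(nrm M f)\<^sup>2 <= c" if "0 <= c"
  using assms(2) that unfolding nn_integral_nrm[OF *] by simp
qed

lemma integral_abs_le_nrm:
 assumes "finite_measure M" "f \<in> sqi M"
 shows "integrable M f" "(LINT x|M. \<bar>f x\<bar>) <= sqrt (measure M (space M)) * nrm M f"
proof -
 interpret finite_measure M by fact
 have one: "(%x. 1) \<in> sqi M" by (auto simp: sqi_def)
 have a: "(%x. \<bar>f x\<bar>) \<in> sqi M" using assms(2) by (auto simp: sqi_def)
 show "integrable M f" using sqi_integrable_mult[OF one assms(2)] by simp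
 have "(LINT x|M. \<bar>f x\<bar>) = inn M (%x. 1) (%x. \<bar>f x\<bar>)" by (simp add: inn_def)
 also have "... <= nrm M (%x. 1) * nrm M (%x. \<bar>f x\<bar>)"
  using cauchy_schwarz_inn[OF one a] by linarith
 also have "... = sqrt (measure M (space M)) * nrm M f" by (simp add: nrm_def inn_def)
 finally show "(LINT x|M. \<bar>f x\<bar>) <= sqrt (measure M (space M)) * nrm M f" .
qed

text \<open>The limit is taken pointwise with \<^const>\<open>lim\<close>, so that it inherits every symmetry of the sequence.\<close>

lemma sqi_complete:
 assumes fin: "finite_measure M" and f: "!!n. f n \<in> sqi M"
  and c: "!!n. nrm M (%x. f (Suc n) x - f n x) <= C * (1 / 2) ^ n"
 shows "(%x. lim (%n. f n x)) \<in> sqi M"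
  and "(%n. nrm M (%x. f n x - lim (%n. f n x))) \<longlonglongrightarrow> 0"
proof -
 interpret finite_measure M by fact
 define s where "s x = lim (%n. f n x)" for x
 have C: "0 <= C" using order_trans[OF nrm_nonneg c[of 0]] by simp
 have [measurable]: "f n \<in> borel_measurable M" for n using f by (rule sqi_measurable)
 have s_meas [measurable]: "s \<in> borel_measurable M" unfolding s_def by measurable
 \<comment> \<open>On a finite measure space the L1 norms of the increments are at most
   \<open>V\<close> times their L2 norms, hence summable. The series of absolute increments is
   therefore finite almost everywhere, which gives pointwise convergence.\<close>
 define V where "V = sqrt (measure M (space M))"
 have V: "0 <= V" by (simp add: V_def)
 have "(\<integral>\<^sup>+x. ennreal \<bar>f (Suc n) x - f n x\<bar> \<partial>M) <= ennreal (V * C * (1 / 2) ^ n)" for n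
 proof -
  have sq: "(%x. f (Suc n) x - f n x) \<in> sqi M" by (intro sqi_diff f)
  have "(\<integral>\<^sup>+x. ennreal \<bar>f (Suc n) x - f n x\<bar> \<partial>M) = ennreal (LINT x|M. \<bar>f (Suc n) x - f n x\<bar>)"
   using integral_abs_le_nrm(1)[OF fin sq] by (intro nn_integral_eq_integral) auto
  also have "... <= ennreal (V * C * (1 / 2) ^ n)"
   using integral_abs_le_nrm(2)[OF fin sq] mult_left_mono[OF c[of n] V]
   by (intro ennreal_leI) (simp add: V_def mult.assoc)
  finally show ?thesis .
 qed
 then have "(\<Sum>n. \<integral>\<^sup>+x. ennreal \<bar>f (Suc n) x - f n x\<bar> \<partial>M) <= (\<Sum>n. ennreal (V * C * (1 / 2) ^ n))"
  by (intro suminf_le) auto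
 also have "... < \<infinity>"
  using C V by (subst suminf_ennreal2) (auto intro!: summable_mult summable_geometric)
 finally have "(\<integral>\<^sup>+x. (\<Sum>n. ennreal \<bar>f (Suc n) x - f n x\<bar>) \<partial>M) ~= \<infinity>"
  by (subst nn_integral_suminf) auto
 then have "AE x in M. (\<Sum>n. ennreal \<bar>f (Suc n) x - f n x\<bar>) ~= \<infinity>"
  by (intro nn_integral_PInf_AE) auto
 then have ae: "AE x in M. (%n. f n x) \<longlonglongrightarrow> s x"
 proof eventually_elim
  case (elim x)
  then have "summable (%n. \<bar>f (Suc n) x - f n x\<bar>)"
   by (intro summable_suminf_not_top) (auto simp: top_ennreal_def)
  then have "summable (%n. f (Suc n) x - f n x)" by (rule summable_rabs_cancel)
  then have "convergent (%n. \<Sum>i<n. f (Suc i) x - f i x)" by (simp add: summable_iff_convergent)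
  then have "convergent (%n. f n x - f 0 x)" using sum_lessThan_telescope[of "%n. f n x"] by simp
  then have "convergent (%n. f n x - f 0 x + f 0 x)" by (intro convergent_add) (auto simp: convergent_const)
  then show ?case by (simp add: s_def convergent_LIMSEQ_iff)
 qed
 have step: "nrm M (%x. f (n + m) x - f n x) <= 2 * C * (1 / 2) ^ n" for n m
 proof -
  have "nrm M (%x. f (n + m) x - f n x) <= 2 * C * (1 / 2) ^ n * (1 - (1 / 2) ^ m)"
  proof (induction m)
   case 0 then show ?case by simp
  next
   case (Suc m)
   have "nrm M (%x. f (n + Suc m) x - f n x)
     <= nrm M (%x. f (n + Suc m) x - f (n + m) x) + nrm M (%x. f (n + m) x - f n x)"
    by (intro nrm_diff_triangle f)
   also have "... <= C * (1 / 2) ^ (n + m) + 2 * C * (1 / 2) ^ n * (1 - (1 / 2) ^ m)"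
    using c[of "n + m"] Suc by simp
   also have "... = 2 * C * (1 / 2) ^ n * (1 - (1 / 2) ^ Suc m)"
    by (simp add: power_add algebra_simps)
   finally show ?case .
  qed
  also have "... <= 2 * C * (1 / 2) ^ n * 1"
   using C by (intro mult_left_mono) auto
  finally show ?thesis by simp
 qed
 \<comment> \<open>Fatou's lemma carries the Cauchy estimate \<open>step\<close> over to the
   pointwise limit.\<close>
 have lim: "(\<integral>\<^sup>+x. ennreal ((f n x - s x)\<^sup>2) \<partial>M) <= ennreal ((2 * C * (1 / 2) ^ n)\<^sup>2)" for n
 proof -
  have "(\<integral>\<^sup>+x. ennreal ((f n x - s x)\<^sup>2) \<partial>M) = (\<integral>\<^sup>+x. liminf (%m. ennreal ((f n x - f (n + m) x)\<^sup>2)) \<partial>M)"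
  proof (rule nn_integral_cong_AE, use ae in eventually_elim)
   case (elim x)
   have "(%m. f (n + m) x) \<longlonglongrightarrow> s x"
    using LIMSEQ_ignore_initial_segment[OF elim, of n] by (simp add: add.commute)
   then have "(%m. ennreal ((f n x - f (n + m) x)\<^sup>2)) \<longlonglongrightarrow> ennreal ((f n x - s x)\<^sup>2)"
    by (intro tendsto_ennrealI tendsto_intros)
   then show ?case by (intro lim_imp_Liminf[symmetric]) auto
  qed
  also have "... <= liminf (%m. \<integral>\<^sup>+x. ennreal ((f n x - f (n + m) x)\<^sup>2) \<partial>M)"
   by (intro nn_integral_liminf) auto
  also have "... <= ennreal ((2 * C * (1 / 2) ^ n)\<^sup>2)"
  proof (rule Liminf_le, simp, intro always_eventually allI)
   fix m
   have "(nrm M (%x. f n x - f (n + m) x))\<^sup>2 <= (2 * C * (1 / 2) ^ n)\<^sup>2"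
    using step[of n m] by (intro power_mono) (auto simp: nrm_minus_commute[of M "f n"])
   then show "(\<integral>\<^sup>+x. ennreal ((f n x - f (n + m) x)\<^sup>2) \<partial>M) <= ennreal ((2 * C * (1 / 2) ^ n)\<^sup>2)"
    using nn_integral_nrm[OF sqi_diff[OF f[of n] f[of "n + m"]]] by (simp add: ennreal_leI)
  qed
  finally show ?thesis .
 qed
 have d: "(%x. f n x - s x) \<in> sqi M" "nrm M (%x. f n x - s x) <= 2 * C * (1 / 2) ^ n" for n
 proof -
  show "(%x. f n x - s x) \<in> sqi M" using sqi_of_nn_integral(1)[OF _ lim] by auto
  have "(nrm M (%x. f n x - s x))\<^sup>2 <= (2 * C * (1 / 2) ^ n)\<^sup>2"
   using sqi_of_nn_integral(2)[OF _ lim] by simp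
  then show "nrm M (%x. f n x - s x) <= 2 * C * (1 / 2) ^ n"
   by (rule power2_le_imp_le) (use C in simp)
 qed
 have "s \<in> sqi M" using sqi_diff[OF f[of 0] d(1)[of 0]] by simp
 then show "(%x. lim (%n. f n x)) \<in> sqi M" by (simp add: s_def[abs_def])
 have "(%n. 2 * C * (1 / 2) ^ n) \<longlonglongrightarrow> 0"
  by (intro tendsto_mult_right_zero LIMSEQ_power_zero) auto
 then have "(%n. nrm M (%x. f n x - s x)) \<longlonglongrightarrow> 0"
  by (rule Lim_null_comparison[rotated]) (use d(2) in auto)
 then show "(%n. nrm M (%x. f n x - lim (%n. f n x))) \<longlonglongrightarrow> 0" by (simp add: s_def)
qed

section \<open>Orthonormal bases\<close>

locale onb =
 fixes M :: "'a measure" and e :: "'i => 'a => real"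
 assumes finite_M: "finite_measure M"
  and e_sqi [simp]: "!!i. e i \<in> sqi M"
  and ortho: "!!i j. inn M (e i) (e j) = (if i = j then 1 else 0)"
  and total: "!!f. f \<in> sqi M ==> (!!i. inn M f (e i) = 0) ==> AE x in M. f x = 0"
begin

lemma lincomb_coeff:
 "finite A ==> inn M (%x. \<Sum>i\<in>A. c i * e i x) (e j) = (if j \<in> A then c j else 0)"
 by (subst inn_lincomb_left) (auto simp: ortho if_distrib[where f = "%x. _ * x"] cong: if_cong)

lemma lincomb_nrm:
 assumes "finite A"
 shows "(nrm M (%x. \<Sum>i\<in>A. c i * e i x))\<^sup>2 = (\<Sum>i\<in>A. (c i)\<^sup>2)"
proof -
 have "(nrm M (%x. \<Sum>i\<in>A. c i * e i x))\<^sup>2 = (\<Sum>j\<in>A. c j * inn M (%x. \<Sum>i\<in>A. c i * e i x) (e j))"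
  unfolding nrm_power2 by (intro inn_lincomb_right sqi_lincomb) auto
 also have "... = (\<Sum>i\<in>A. (c i)\<^sup>2)"
  using assms by (intro sum.cong) (auto simp: lincomb_coeff power2_eq_square)
 finally show ?thesis .
qed

lemma residual_nrm:
 assumes f: "f \<in> sqi M" and A: "finite A"
 shows "(nrm M (%x. f x - (\<Sum>i\<in>A. inn M f (e i) * e i x)))\<^sup>2 = (nrm M f)\<^sup>2 - (\<Sum>i\<in>A. (inn M f (e i))\<^sup>2)"
proof -
 let ?s = "%x. \<Sum>i\<in>A. inn M f (e i) * e i x"
 have s: "?s \<in> sqi M" by (intro sqi_lincomb) simp
 have c: "inn M f ?s = (\<Sum>i\<in>A. (inn M f (e i))\<^sup>2)"
  by (subst inn_lincomb_right) (auto simp: f power2_eq_square)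
 have "(nrm M (%x. f x + (- ?s x)))\<^sup>2 = (nrm M f)\<^sup>2 + 2 * inn M f (%x. - ?s x) + (nrm M (%x. - ?s x))\<^sup>2"
  by (intro nrm_add_power2 f sqi_minus s)
 also have "(nrm M (%x. - ?s x))\<^sup>2 = (\<Sum>i\<in>A. (inn M f (e i))\<^sup>2)"
  using lincomb_nrm[OF A] by (simp add: nrm_power2 inn_minus_left inn_minus_right)
 also have "inn M f (%x. - ?s x) = - (\<Sum>i\<in>A. (inn M f (e i))\<^sup>2)"
  by (simp add: inn_minus_right c)
 finally show ?thesis by simp
qed

lemma bessel:
 assumes "f \<in> sqi M" "finite A"
 shows "(\<Sum>i\<in>A. (inn M f (e i))\<^sup>2) <= (nrm M f)\<^sup>2"
 using residual_nrm[OF assms] zero_le_power2[of "nrm M (%x. f x - (\<Sum>i\<in>A. inn M f (e i) * e i x))"]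
 by linarith

text \<open>Finite index sets whose remainder is below \<open>(1/4)^n\<close> give partial sums with
  increments of norm below \<open>(1/2)^n\<close>, as \<open>sqi_complete\<close> requires. The last
  clause holds because the sum is a pointwise limit of finite sums; it later yields genuine
  periodicity, which membership in \<open>L2\<close> demands everywhere and not just almost
  everywhere.\<close>

lemma riesz_fischer:
 assumes a: "(%i. (a i)\<^sup>2) summable_on UNIV"
 obtains s where "s \<in> sqi M" "!!i. inn M s (e i) = a i" "(nrm M s)\<^sup>2 = (\<Sum>\<^sub>\<infinity>i. (a i)\<^sup>2)"
  "!!p x. (!!i. e i (p x) = e i x) ==> s (p x) = s x"
proof -
 define \<Sigma> where "\<Sigma> = (\<Sum>\<^sub>\<infinity>i. (a i)\<^sup>2)"
 have hs: "((%i. (a i)\<^sup>2) has_sum \<Sigma>) UNIV" using a by (simp add: \<Sigma>_def)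
 have up: "(\<Sum>i\<in>A. (a i)\<^sup>2) <= \<Sigma>" if "finite A" for A
  by (rule finite_sum_le_has_sum[OF hs that]) auto
 have "\<exists>A. finite A & \<Sigma> - (1 / 4) ^ n < (\<Sum>i\<in>A. (a i)\<^sup>2)" for n :: nat
 proof -
  have "eventually (%A. \<Sigma> - (1 / 4) ^ n < (\<Sum>i\<in>A. (a i)\<^sup>2)) (finite_subsets_at_top UNIV)"
   using hs unfolding has_sum_def by (rule order_tendstoD) simp
  then show ?thesis
   unfolding eventually_finite_subsets_at_top by (metis order_refl subset_UNIV)
 qed
 then obtain A0 where A0: "!!n :: nat. finite (A0 n)" "!!n. \<Sigma> - (1 / 4) ^ n < (\<Sum>i\<in>A0 n. (a i)\<^sup>2)"
  by metis
 define A where "A n = (\<Union>m\<le>n. A0 m)" for n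
 have fin: "finite (A n)" for n using A0 by (auto simp: A_def)
 have mono: "A m \<subseteq> A n" if "m <= n" for m n using that by (force simp: A_def)
 have big: "\<Sigma> - (1 / 4) ^ n < (\<Sum>i\<in>A n. (a i)\<^sup>2)" for n
 proof -
  have "(\<Sum>i\<in>A0 n. (a i)\<^sup>2) <= (\<Sum>i\<in>A n. (a i)\<^sup>2)"
   using fin by (intro sum_mono2) (auto simp: A_def)
  then show ?thesis using A0(2)[of n] by linarith
 qed
 \<comment> \<open>All finite sums stay below the total, and \<open>A n\<close> already carries all
   but \<open>(1/4)^n\<close> of it.\<close>
 have tail: "(\<Sum>i\<in>B. (a i)\<^sup>2) < (1 / 4) ^ n" if "finite B" "B \<inter> A n = {}" for B n
 proof -
  have "(\<Sum>i\<in>B. (a i)\<^sup>2) + (\<Sum>i\<in>A n. (a i)\<^sup>2) = (\<Sum>i\<in>B \<union> A n. (a i)\<^sup>2)"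
   using that fin by (intro sum.union_disjoint[symmetric]) auto
  also have "... <= \<Sigma>" using that fin by (intro up) auto
  finally show ?thesis using big[of n] by linarith
 qed
 define f where "f n x = (\<Sum>i\<in>A n. a i * e i x)" for n x
 have f: "f n \<in> sqi M" for n unfolding f_def by (intro sqi_lincomb) simp
 have diff: "nrm M (%x. f (Suc n) x - f n x) <= 1 * (1 / 2) ^ n" for n
 proof (rule power2_le_imp_le)
  have "f (Suc n) x - f n x = (\<Sum>i\<in>A (Suc n) - A n. a i * e i x)" for x
   unfolding f_def using sum_diff[OF fin[of "Suc n"] mono[of n "Suc n"], of "%i. a i * e i x"] by simp
  then have "(nrm M (%x. f (Suc n) x - f n x))\<^sup>2 = (\<Sum>i\<in>A (Suc n) - A n. (a i)\<^sup>2)"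
   using lincomb_nrm[of "A (Suc n) - A n" a] fin by simp
  also have "... <= (1 / 4) ^ n" using tail[of "A (Suc n) - A n" n] fin[of "Suc n"] by (simp add: less_imp_le Diff_Int_distrib2)
  also have "... = (1 * (1 / 2) ^ n)\<^sup>2" by (simp add: power_divide flip: power_mult power_mult_distrib)
   (simp add: power_mult power2_eq_square mult.commute[of n])
  finally show "(nrm M (%x. f (Suc n) x - f n x))\<^sup>2 <= (1 * (1 / 2) ^ n)\<^sup>2" .
 qed simp
 define s where "s x = lim (%n. f n x)" for x
 have s: "s \<in> sqi M" and conv: "(%n. nrm M (%x. f n x - s x)) \<longlonglongrightarrow> 0"
  using sqi_complete[OF finite_M f diff] by (simp_all add: s_def[abs_def])
 show thesis
 proof
  show "s \<in> sqi M" by fact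
  show "inn M s (e i) = a i" for i
  proof -
   have "(%n. inn M (f n) (e i)) \<longlonglongrightarrow> inn M s (e i)"
    by (intro inn_tendsto f s conv) simp
   moreover have "(%n. inn M (f n) (e i)) \<longlonglongrightarrow> a i"
   proof (cases "\<exists>m. i \<in> A m")
    case True
    then obtain m where m: "i \<in> A m" by blast
    show ?thesis
    proof (rule tendsto_eventually, rule eventually_sequentiallyI)
     fix n assume "m <= n"
     then have "i \<in> A n" using m mono by blast
     then show "inn M (f n) (e i) = a i"
      unfolding f_def[abs_def] by (simp add: lincomb_coeff fin)
    qed
   next
    \<comment> \<open>An index that never enters some \<open>A n\<close> has a square below every
      \<open>(1/4)^n\<close>, so its coefficient is zero.\<close>
    case False
    then have "(a i)\<^sup>2 <= (1 / 4) ^ n" for n using tail[of "{i}" n] by auto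
    moreover have "(%n. (1 / 4 :: real) ^ n) \<longlonglongrightarrow> 0" by (intro LIMSEQ_power_zero) auto
    ultimately have "(a i)\<^sup>2 <= 0" by (intro LIMSEQ_le_const) auto
    then have "a i = 0" by simp
    then show ?thesis using False unfolding f_def[abs_def] by (simp add: lincomb_coeff fin)
   qed
   ultimately show ?thesis by (rule LIMSEQ_unique)
  qed
  have "(%n. (nrm M (f n))\<^sup>2) \<longlonglongrightarrow> (nrm M s)\<^sup>2" by (intro tendsto_power nrm_tendsto f s conv)
  moreover have "(%n. (nrm M (f n))\<^sup>2) \<longlonglongrightarrow> \<Sigma>"
  proof (rule tendsto_sandwich)
   show "\<forall>\<^sub>F n in sequentially. \<Sigma> - (1 / 4) ^ n <= (nrm M (f n))\<^sup>2"
    using big unfolding f_def[abs_def] by (auto simp: lincomb_nrm fin less_imp_le)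
   show "\<forall>\<^sub>F n in sequentially. (nrm M (f n))\<^sup>2 <= \<Sigma>"
    using up unfolding f_def[abs_def] by (auto simp: lincomb_nrm fin)
   have "(%n. \<Sigma> - (1 / 4) ^ n) \<longlonglongrightarrow> \<Sigma> - 0"
    by (intro tendsto_diff tendsto_const LIMSEQ_power_zero) auto
   then show "(%n. \<Sigma> - (1 / 4) ^ n) \<longlonglongrightarrow> \<Sigma>" by simp
  qed simp
  ultimately show "(nrm M s)\<^sup>2 = (\<Sum>\<^sub>\<infinity>i. (a i)\<^sup>2)"
   using LIMSEQ_unique by (force simp: \<Sigma>_def)
  show "s (p x) = s x" if "!!i. e i (p x) = e i x" for p x
   using that by (simp add: s_def f_def)
 qed
qed

lemma coeff_square_summable: "f \<in> sqi M ==> (%i. (inn M f (e i))\<^sup>2) summable_on UNIV"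
 using bessel by (intro nonneg_bdd_above_summable_on bdd_aboveI2) auto

lemma eq_AE_of_coeff:
 assumes "f \<in> sqi M" "g \<in> sqi M" "!!i. inn M f (e i) = inn M g (e i)"
 shows "AE x in M. f x = g x"
 using total[of "%x. f x - g x"] assms by (simp add: sqi_diff inn_diff_left)

text \<open>Riesz--Fischer builds a function with the same coefficients whose norm is the full
  square sum. Totality identifies it with \<open>f\<close>, so Bessel's inequality is an
  equality.\<close>

lemma parseval:
 assumes f: "f \<in> sqi M"
 shows "((%i. (inn M f (e i))\<^sup>2) has_sum (nrm M f)\<^sup>2) UNIV"
proof -
 have sm: "(%i. (inn M f (e i))\<^sup>2) summable_on UNIV" by (rule coeff_square_summable[OF f])
 obtain s where s: "s \<in> sqi M" "!!i. inn M s (e i) = inn M f (e i)"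
  "(nrm M s)\<^sup>2 = (\<Sum>\<^sub>\<infinity>i. (inn M f (e i))\<^sup>2)"
  by (rule riesz_fischer[OF sm], rule that)
 have "AE x in M. s x = f x" by (rule eq_AE_of_coeff[OF s(1) f s(2)])
 then have "nrm M s = nrm M f" using s(1) f by (intro nrm_cong_AE) (auto simp: sqi_measurable)
 then show ?thesis using s(3) has_sum_infsum[OF sm] by simp
qed

lemma expansion_tendsto:
 assumes f: "f \<in> sqi M"
 shows "((%A. nrm M (%x. f x - (\<Sum>i\<in>A. inn M f (e i) * e i x))) \<longlongrightarrow> 0) (finite_subsets_at_top UNIV)"
proof -
 have "((%A. sqrt ((nrm M f)\<^sup>2 - (\<Sum>i\<in>A. (inn M f (e i))\<^sup>2))) \<longlongrightarrow> sqrt ((nrm M f)\<^sup>2 - (nrm M f)\<^sup>2))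
   (finite_subsets_at_top UNIV)"
  using parseval[OF f] unfolding has_sum_def by (intro tendsto_intros)
 then have "((%A. sqrt ((nrm M f)\<^sup>2 - (\<Sum>i\<in>A. (inn M f (e i))\<^sup>2))) \<longlongrightarrow> 0) (finite_subsets_at_top UNIV)"
  by simp
 then show ?thesis
 proof (rule tendsto_cong[THEN iffD1, rotated])
  show "\<forall>\<^sub>F A in finite_subsets_at_top UNIV. sqrt ((nrm M f)\<^sup>2 - (\<Sum>i\<in>A. (inn M f (e i))\<^sup>2))
    = nrm M (%x. f x - (\<Sum>i\<in>A. inn M f (e i) * e i x))"
  proof (rule eventually_mono[OF eventually_finite_subsets_at_top_weakI[of UNIV finite]])
   fix A :: "'i set" assume "finite A"
   then show "sqrt ((nrm M f)\<^sup>2 - (\<Sum>i\<in>A. (inn M f (e i))\<^sup>2))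
     = nrm M (%x. f x - (\<Sum>i\<in>A. inn M f (e i) * e i x))"
    by (simp flip: residual_nrm[OF f])
  qed simp
 qed
qed

lemma inn_has_sum:
 assumes f: "f \<in> sqi M" and g: "g \<in> sqi M"
 shows "((%i. inn M f (e i) * inn M g (e i)) has_sum inn M f g) UNIV"
proof -
 have "((%A. inn M (%x. \<Sum>i\<in>A. inn M f (e i) * e i x) g) \<longlongrightarrow> inn M f g) (finite_subsets_at_top UNIV)"
  using expansion_tendsto[OF f] by (intro inn_tendsto f g sqi_lincomb) (auto simp: nrm_minus_commute)
 then show ?thesis
  unfolding has_sum_def by (subst (asm) inn_lincomb_left) (auto simp: g inn_commute[of M _ g])
qed

end

section \<open>Totality through Stone--Weierstrass\<close>

text \<open>On the compact set containing the range of \<open>P\<close>, polynomials are uniformly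
  dense in the continuous functions, so orthogonality passes to continuous functions of
  \<open>P\<close>. Indicators of open sets are bounded pointwise limits of those.\<close>

lemma integral_comp_open_eq_0:
 fixes P :: "'a => 'b::euclidean_space"
 assumes f: "integrable M f" and [measurable]: "P \<in> borel_measurable M"
  and K: "compact K" "!!x. x \<in> space M ==> P x \<in> K"
  and zero: "!!p. real_polynomial_function p ==> (LINT x|M. f x * p (P x)) = 0"
  and U: "open U"
 shows "(LINT x|M. f x * indicator U (P x)) = (0::real)"
proof -
 have [measurable]: "f \<in> borel_measurable M" using f by auto
 have cont: "(LINT x|M. f x * F (P x)) = 0" if F: "continuous_on UNIV F" for F :: "'b => real"
 proof -
  have [measurable]: "F \<in> borel_measurable borel" using F by (rule borel_measurable_continuous_onI)
  obtain C where C: "!!y. y \<in> K ==> norm (F y) <= C"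
  proof -
   have "bounded (F ` K)"
    using F K(1) by (intro compact_imp_bounded compact_continuous_image) (auto intro: continuous_on_subset)
   then show thesis using that unfolding bounded_iff by blast
  qed
  have int: "integrable M (%x. f x * F (P x))"
  proof (rule Bochner_Integration.integrable_bound)
   show "integrable M (%x. C * f x)" using f by simp
   show "AE x in M. norm (f x * F (P x)) <= norm (C * f x)"
   proof (rule AE_I2)
    fix x assume "x \<in> space M"
    then have "\<bar>F (P x)\<bar> <= \<bar>C\<bar>" using C[OF K(2)[of x]] by simp
    then show "norm (f x * F (P x)) <= norm (C * f x)"
     using mult_left_mono[of "\<bar>F (P x)\<bar>" "\<bar>C\<bar>" "\<bar>f x\<bar>"] by (simp add: abs_mult mult.commute)
   qed
  qed simp
  have "\<bar>LINT x|M. f x * F (P x)\<bar> <= e * (LINT x|M. \<bar>f x\<bar>)" if e: "0 < e" for e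
  proof -
   obtain p where p: "real_polynomial_function p" "!!y. y \<in> K ==> \<bar>F y - p y\<bar> < e"
    using Stone_Weierstrass_real_polynomial_function[OF K(1) continuous_on_subset[OF F subset_UNIV] e]
    by blast
   have "continuous_on UNIV p"
    using p(1) continuous_on_polymonial_function real_polynomial_function_eq by blast
   then have [measurable]: "p \<in> borel_measurable borel" by (rule borel_measurable_continuous_onI)
   have bd: "norm (f x * (F (P x) - p (P x))) <= e * \<bar>f x\<bar>" if "x \<in> space M" for x
    using mult_left_mono[OF less_imp_le[OF p(2)[OF K(2)[OF that]]], of "\<bar>f x\<bar>"]
    by (simp add: abs_mult mult.commute)
   have int1: "integrable M (%x. f x * (F (P x) - p (P x)))"
    by (rule Bochner_Integration.integrable_bound[where f = "%x. e * \<bar>f x\<bar>"])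
     (use f bd e in \<open>auto intro!: AE_I2 simp: abs_mult\<close>)
   have int2: "integrable M (%x. f x * p (P x))"
    using Bochner_Integration.integrable_diff[OF int int1] by (simp add: algebra_simps)
   have "(LINT x|M. f x * F (P x)) = (LINT x|M. f x * (F (P x) - p (P x)) + f x * p (P x))"
    by (simp add: algebra_simps)
   also have "... = (LINT x|M. f x * (F (P x) - p (P x)))"
    using int1 int2 zero[OF p(1)] by simp
   also have "\<bar>...\<bar> <= (LINT x|M. \<bar>f x * (F (P x) - p (P x))\<bar>)" by (rule integral_abs_bound)
   also have "... <= (LINT x|M. e * \<bar>f x\<bar>)"
    using bd int1 f by (intro integral_mono) auto
   finally show ?thesis by simp
  qed
  note small = this
  define I where "I = (LINT x|M. \<bar>f x\<bar>)"
  have "0 <= I" by (simp add: I_def)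
  have "\<bar>LINT x|M. f x * F (P x)\<bar> <= e" if "0 < e" for e
  proof -
   have "\<bar>LINT x|M. f x * F (P x)\<bar> <= e / (I + 1) * I"
    unfolding I_def by (rule small) (intro divide_pos_pos that add_nonneg_pos integral_nonneg, auto)
   also have "... <= e" using that \<open>0 <= I\<close> by (simp add: field_simps)
   finally show ?thesis .
  qed
  then have "\<bar>LINT x|M. f x * F (P x)\<bar> <= 0" by (rule field_le_epsilon) simp
  then show ?thesis by simp
 qed
 show ?thesis
 proof (cases "U = UNIV")
  case True
  then show ?thesis using cont[of "%_. 1"] by simp
 next
  case False
  \<comment> \<open>Truncated multiples of the distance to the complement converge to the indicator
    of \<open>U\<close>. The distance to the empty set is zero by convention, hence the separate
    case \<open>U = UNIV\<close>.\<close>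
  define g where "g n y = min 1 (real n * infdist y (- U))" for n y
  have ne: "- U ~= {}" using False by auto
  have lim: "(%n. g n y) \<longlonglongrightarrow> indicator U y" for y
  proof (cases "y \<in> U")
   case True
   then have pos: "0 < infdist y (- U)"
    using U ne by (metis ComplD closed_Compl in_closed_iff_infdist_zero infdist_nonneg less_eq_real_def)
   obtain N where N: "1 < real N * infdist y (- U)" using reals_Archimedean3[OF pos] by blast
   show ?thesis
   proof (rule tendsto_eventually, rule eventually_sequentiallyI[of N])
    fix n assume "N <= n"
    then have "real N * infdist y (- U) <= real n * infdist y (- U)"
     by (intro mult_right_mono) (auto simp: infdist_nonneg)
    then show "g n y = indicator U y" using N True by (simp add: g_def)
   qed
  next
   case False
   then show ?thesis by (simp add: g_def infdist_zero)
  qed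
  have [measurable]: "g n \<in> borel_measurable borel" for n
   unfolding g_def[abs_def] by (intro borel_measurable_continuous_onI continuous_intros)
  have [measurable]: "U \<in> sets borel" using U by auto
  have "(%n. LINT x|M. f x * g n (P x)) \<longlonglongrightarrow> (LINT x|M. f x * indicator U (P x))"
  proof (rule integral_dominated_convergence[where w = "%x. \<bar>f x\<bar>"])
   show "AE x in M. norm (f x * g n (P x)) <= \<bar>f x\<bar>" for n
   proof (intro AE_I2)
    fix x
    have "\<bar>g n (P x)\<bar> <= 1" by (auto simp: g_def infdist_nonneg)
    then have "\<bar>f x\<bar> * \<bar>g n (P x)\<bar> <= \<bar>f x\<bar> * 1" by (intro mult_left_mono) auto
    then show "norm (f x * g n (P x)) <= \<bar>f x\<bar>" by (simp add: abs_mult)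
   qed
   show "AE x in M. (%n. f x * g n (P x)) \<longlonglongrightarrow> f x * indicator U (P x)"
    using lim by (intro AE_I2 tendsto_intros)
  qed (use f in auto)
  moreover have "(LINT x|M. f x * g n (P x)) = 0" for n
   unfolding g_def by (intro cont continuous_intros)
  ultimately show ?thesis by (simp add: LIMSEQ_const_iff)
 qed
qed

text \<open>Open sets are closed under intersection and generate the Borel sets, so Dynkin's theorem
  applies; disjoint unions are handled by dominated convergence.\<close>

lemma integral_comp_borel_eq_0:
 fixes P :: "'a => 'b::euclidean_space"
 assumes f: "integrable M f" and [measurable]: "P \<in> borel_measurable M"
  and op: "!!U. open U ==> (LINT x|M. f x * indicator U (P x)) = (0::real)"
  and A: "A \<in> sets borel"
 shows "(LINT x|M. f x * indicator A (P x)) = 0"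
proof -
 have [measurable]: "f \<in> borel_measurable M" using f by auto
 have int: "integrable M (%x. f x * indicator A (P x))" if [measurable]: "A \<in> sets borel" for A
  by (rule Bochner_Integration.integrable_bound[OF f]) (auto simp: indicator_def)
 have "Int_stable {S :: 'b set. open S}" by (auto simp: Int_stable_def)
 moreover have "{S :: 'b set. open S} \<subseteq> Pow UNIV" by auto
 moreover have "A \<in> sigma_sets UNIV {S. open S}" using A by (simp add: borel_def)
 ultimately show ?thesis
 proof (induction rule: sigma_sets_induct_disjoint)
  case (basic A) then show ?case using op by simp
 next
  case empty show ?case by simp
 next
  case (compl A)
  have [measurable]: "A \<in> sets borel" using compl by (simp add: borel_def)
  have "(LINT x|M. f x * indicator (UNIV - A) (P x)) = (LINT x|M. f x * indicator UNIV (P x) - f x * indicator A (P x))"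
   by (intro Bochner_Integration.integral_cong) (auto simp: indicator_def)
  also have "... = 0" using compl(2) op[of UNIV] by (subst Bochner_Integration.integral_diff) (auto intro!: int f)
  finally show ?case .
 next
  case (union A)
  have [measurable]: "A i \<in> sets borel" for i using union(2) by (auto simp: borel_def)
  have "(%n. LINT x|M. f x * indicator (\<Union>i<n. A i) (P x)) \<longlonglongrightarrow> (LINT x|M. f x * indicator (\<Union>i. A i) (P x))"
  proof (rule integral_dominated_convergence[where w = "%x. \<bar>f x\<bar>"])
   show "AE x in M. (%n. f x * indicator (\<Union>i<n. A i) (P x)) \<longlonglongrightarrow> f x * indicator (\<Union>i. A i) (P x)"
    using LIMSEQ_indicator_UN[of A] by (intro AE_I2 tendsto_intros) auto
  qed (use f in \<open>auto simp: indicator_def\<close>)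
  moreover have "(LINT x|M. f x * indicator (\<Union>i<n. A i) (P x)) = 0" for n
  proof -
   have d: "disjoint_family_on A {..<n}" using union(1) by (auto simp: disjoint_family_on_def)
   have "(LINT x|M. f x * indicator (\<Union>i<n. A i) (P x)) = (LINT x|M. (\<Sum>i<n. f x * indicator (A i) (P x)))"
    by (simp add: indicator_UN_disjoint[OF _ d] sum_distrib_left)
   also have "... = (\<Sum>i<n. (LINT x|M. f x * indicator (A i) (P x)))"
    by (intro Bochner_Integration.integral_sum int) auto
   finally show ?thesis using union(3) by simp
  qed
  ultimately show ?case by (simp add: LIMSEQ_const_iff)
 qed
qed

text \<open>A Borel left inverse \<open>Q\<close> of \<open>P\<close> turns Stone--Weierstrass for polynomials in \<open>P\<close> into totality.\<close>

lemma polynomials_total: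
 fixes P :: "'a => 'b::euclidean_space"
 assumes f: "integrable M f" and [measurable]: "P \<in> borel_measurable M"
  and K: "compact K" "!!x. x \<in> space M ==> P x \<in> K"
  and zero: "!!p. real_polynomial_function p ==> (LINT x|M. f x * p (P x)) = 0"
  and Q [measurable]: "Q \<in> borel \<rightarrow>\<^sub>M M" and QP: "AE x in M. Q (P x) = x"
 shows "AE x in M. f x = (0::real)"
proof -
 have pos: "AE x in M. g x <= 0"
  if g: "integrable M g" and z: "!!p. real_polynomial_function p ==> (LINT x|M. g x * p (P x)) = 0" for g :: "'a => real"
 proof -
  have [measurable]: "g \<in> borel_measurable M" using g by auto
  \<comment> \<open>The indicator of the set where \<open>g\<close> is positive is a Borel function
    of \<open>P\<close>, namely that of the preimage of \<open>C\<close> under \<open>Q\<close>, up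
    to a null set. Testing with it forces the positive part of \<open>g\<close> to vanish.\<close>
  define C where "C = {x \<in> space M. 0 < g x}"
  have C [measurable]: "C \<in> sets M" by (simp add: C_def)
  have QC: "Q -` C \<in> sets borel" using measurable_sets[OF Q C] by simp
  have "(LINT x|M. g x * indicator (Q -` C) (P x)) = 0"
   by (rule integral_comp_borel_eq_0[OF g \<open>P \<in> _\<close> integral_comp_open_eq_0[OF g \<open>P \<in> _\<close> K z] QC])
  also have "(LINT x|M. g x * indicator (Q -` C) (P x)) = (LINT x|M. g x * indicator C x)"
   using QP QC by (intro integral_cong_AE) (auto simp: indicator_def)
  finally have "(LINT x|M. g x * indicator C x) = 0" .
  moreover have "integrable M (%x. g x * indicator C x)"
   by (rule Bochner_Integration.integrable_bound[OF g]) (auto simp: indicator_def)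
  moreover have "AE x in M. 0 <= g x * indicator C x"
   by (rule AE_I2) (auto simp: C_def indicator_def)
  ultimately have "AE x in M. g x * indicator C x = 0"
   using integral_nonneg_eq_0_iff_AE by blast
  then show ?thesis by (rule AE_mp) (auto intro!: AE_I2 simp: C_def indicator_def)
 qed
 have "AE x in M. f x <= 0" by (rule pos[OF f zero])
 moreover have "AE x in M. - f x <= 0" using f zero by (intro pos) auto
 ultimately show ?thesis by eventually_elim auto
qed

subsection \<open>The torus\<close>

lemma sets_torus [simp, measurable_cong]: "sets torus = sets borel"
 by (simp add: torus_def)

lemma space_torus [simp]: "space torus = UNIV"
 by (simp add: torus_def)

lemma emeasure_cell:
 "emeasure lborel (cbox 0 (\<chi> i. 2 * pi) :: (real ^ 'd::finite) set) = ennreal ((2 * pi) ^ CARD('d))"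
proof -
 have "(\<Prod>b\<in>(Basis :: (real ^ 'd) set). ((\<chi> i. 2 * pi) - 0) \<bullet> b) = (\<Prod>b\<in>(Basis :: (real ^ 'd) set). 2 * pi)"
  by (intro prod.cong) (auto simp: Basis_vec_def inner_axis)
 also have "... = (2 * pi) ^ CARD('d)" by simp
 finally have "(\<Prod>b\<in>(Basis :: (real ^ 'd) set). ((\<chi> i. 2 * pi) - 0) \<bullet> b) = (2 * pi) ^ CARD('d)" .
 then show ?thesis
  by (subst emeasure_lborel_cbox) (auto simp: Basis_vec_def inner_axis)
qed

lemma prob_space_torus: "prob_space (torus :: (real ^ 'd::finite) measure)"
 unfolding torus_def by (rule prob_space_uniform_measure) (auto simp: emeasure_cell)

lemma finite_measure_torus: "finite_measure (torus :: (real ^ 'd::finite) measure)"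
 using prob_space_torus by (rule prob_space.finite_measure)

lemma AE_torus:
 "(AE x in torus. P x) \<longleftrightarrow> (AE x in lborel. x \<in> cbox 0 (\<chi> i. 2 * pi :: real ^ 'd::finite) --> P x)"
 unfolding torus_def by (rule AE_uniform_measure) (auto simp: emeasure_cell)

lemma AE_lborel_neq_component: "AE x in lborel. x $ i ~= (c :: real)" for i :: "'d::finite"
proof -
 have "{x :: real ^ 'd. x $ i = c} \<in> null_sets lebesgue"
  using negligible_standard_hyperplane[of "axis i (1 :: real)" c]
  by (auto simp: negligible_iff_null_sets inner_axis Basis_vec_def)
 then have "AE x in lebesgue. x \<notin> {x :: real ^ 'd. x $ i = c}" by (rule AE_not_in)
 then show ?thesis by (simp add: AE_completion_iff)
qed

lemma AE_torus_cell: "AE x in torus. \<forall>i. 0 <= x $ i & x $ i < 2 * pi"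
proof -
 have "AE x in lborel. \<forall>i. (x :: real ^ 'd::finite) $ i ~= 2 * pi"
  using AE_lborel_neq_component by (subst AE_all_countable) auto
 then show ?thesis
  unfolding AE_torus by eventually_elim (auto simp: mem_box_cart less_le)
qed

text \<open>The box is half-open so that slabs with adjacent \<open>i\<close>-th sides are disjoint
  and a translation in direction \<open>i\<close> maps slabs exactly onto slabs.\<close>

definition slab :: "'d::finite => real => real => (real ^ 'd) set" where
 "slab i s t = {x. s <= x $ i & x $ i < t & (\<forall>j. j ~= i --> 0 <= x $ j & x $ j < 2 * pi)}"

lemma slab_measurable [measurable]: "slab i s t \<in> sets borel"
 unfolding slab_def by measurable

lemma integral_torus_slab:
 fixes f :: "real ^ 'd::finite => real"
 assumes [measurable]: "f \<in> borel_measurable borel"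
 shows "(LINT x|torus. f x) = (LINT x|lborel. indicator (slab i 0 (2 * pi)) x * f x) / (2 * pi) ^ CARD('d)"
proof -
 let ?c = "cbox 0 (\<chi> i. 2 * pi) :: (real ^ 'd) set"
 have d: "torus = density lborel (%x :: real ^ 'd. ennreal (indicator ?c x / (2 * pi) ^ CARD('d)))"
  unfolding torus_def uniform_measure_def emeasure_cell
  using divide_ennreal[of 1 "(2 * pi) ^ CARD('d)"]
  by (intro arg_cong2[where f = density]) (auto simp: indicator_def fun_eq_iff)
 have "(LINT x|torus. f x) = (LINT x|lborel. (indicator ?c x / (2 * pi) ^ CARD('d)) *\<^sub>R f x)"
  unfolding d by (subst integral_density) auto
 also have "... = (LINT x|lborel. (indicator (slab i 0 (2 * pi)) x * f x) / (2 * pi) ^ CARD('d))"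
 proof (rule integral_cong_AE)
  have "AE x in lborel. \<forall>i. (x :: real ^ 'd) $ i ~= 2 * pi"
   using AE_lborel_neq_component by (subst AE_all_countable) auto
  then show "AE x in lborel. (indicator ?c x / (2 * pi) ^ CARD('d)) *\<^sub>R f x
    = (indicator (slab i 0 (2 * pi)) x * f x) / (2 * pi) ^ CARD('d)"
  proof eventually_elim
   case (elim x)
   have "x \<in> ?c \<longleftrightarrow> x \<in> slab i 0 (2 * pi)"
    using elim by (auto simp: mem_box_cart slab_def less_le)
   then show ?case by (simp add: indicator_def)
  qed
 qed auto
 finally show ?thesis by simp
qed

lemma integral_lborel_shift:
 fixes f :: "real ^ 'd::finite => real"
 assumes "f \<in> borel_measurable borel"
 shows "(LINT x|lborel. f (c + x)) = (LINT x|lborel. f x)"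
proof -
 have "(LINT x|lborel. f x) = (LINT x|distr lborel borel ((+) c). f x)" by (simp add: lborel_distr_plus)
 also have "... = (LINT x|lborel. f (c + x))" using assms by (intro integral_distr) auto
 finally show ?thesis by simp
qed

lemma integrable_slab:
 fixes f :: "real ^ 'd::finite => real"
 assumes f: "continuous_on UNIV f"
 shows "integrable lborel (%x. indicator (slab i s t) x * f x)"
proof -
 have [measurable]: "f \<in> borel_measurable borel" using f by (rule borel_measurable_continuous_onI)
 let ?K = "cbox (\<chi> j. min s 0) (\<chi> j. max t (2 * pi)) :: (real ^ 'd) set"
 have sub: "slab i s t \<subseteq> ?K"
 proof
  fix x assume x: "x \<in> slab i s t"
  show "x \<in> ?K"
   unfolding mem_box_cart
  proof
   fix j show "(\<chi> j. min s 0) $ j <= x $ j & x $ j <= (\<chi> j. max t (2 * pi)) $ j"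
    using x by (cases "j = i") (auto simp: slab_def min_le_iff_disj le_max_iff_disj less_imp_le)
  qed
 qed
 have "integrable lborel (%x. indicator ?K x *\<^sub>R f x)"
  by (rule borel_integrable_compact) (use f in \<open>auto intro: continuous_on_subset\<close>)
 then show ?thesis
  by (rule Bochner_Integration.integrable_bound) (use sub in \<open>auto simp: indicator_def\<close>)
qed

text \<open>The shifted cell overhangs by a slab of width \<open>s\<close>. Cutting it off at
  \<open>2 * pi\<close> and moving it back by one period fills the gap at the other end.\<close>

lemma periodic_shift_integral:
 fixes f :: "real ^ 'd::finite => real"
 assumes f: "continuous_on UNIV f" and p: "periodic f" and s: "0 <= s" "s <= 2 * pi"
 shows "(LINT x|torus. f (x + axis i s)) = (LINT x|torus. f x)"
proof -
 have [measurable]: "f \<in> borel_measurable borel" using f by (rule borel_measurable_continuous_onI)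
 let ?I = "%s t. (LINT x|lborel. indicator (slab i s t) x * f x)"
 have sum: "?I r t = ?I r s + ?I s t" if "r <= s" "s <= t" for r s t
 proof -
  have "indicator (slab i r t) x * f x = indicator (slab i r s) x * f x + indicator (slab i s t) x * f x" for x
   using that by (auto simp: indicator_def slab_def)
  then show ?thesis by (simp add: integrable_slab[OF f])
 qed
 have sh: "(LINT x|lborel. indicator (slab i r t) x * f (x + axis i s)) = ?I (r + s) (t + s)" for r t s
 proof -
  have "indicator (slab i r t) x * f (x + axis i s)
    = (%y. indicator (slab i (r + s) (t + s)) y * f y) (axis i s + x)" for x
   by (auto simp: indicator_def slab_def axis_def add.commute)
  then show ?thesis
   using integral_lborel_shift[of "%y. indicator (slab i (r + s) (t + s)) y * f y" "axis i s"] by simp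
 qed
 have "(LINT x|lborel. indicator (slab i 0 (2 * pi)) x * f (x + axis i s)) = ?I s (2 * pi) + ?I (2 * pi) (2 * pi + s)"
  using s by (simp add: sh sum[of s "2 * pi" "2 * pi + s"])
 also have "?I (2 * pi) (2 * pi + s) = ?I 0 s"
  using sh[of 0 s "2 * pi"] p by (simp add: periodic_def add.commute)
 also have "?I s (2 * pi) + ?I 0 s = ?I 0 (2 * pi)"
  using s by (simp add: sum[of 0 s "2 * pi"])
 finally have "(LINT x|lborel. indicator (slab i 0 (2 * pi)) x * f (x + axis i s)) = ?I 0 (2 * pi)" .
 then show ?thesis by (simp add: integral_torus_slab[where i = i])
qed

subsection \<open>Smooth functions\<close>

lemma pdiff_eq: "(f has_derivative f') (at x) ==> pdiff i f x = f' (axis i 1)"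
 using frechet_derivative_at[of f f' x] by (simp add: pdiff_def)

lemma pdiff_works:
 "f differentiable (at x) ==> (f has_derivative frechet_derivative f (at x)) (at x)"
 by (simp add: frechet_derivative_works)

lemma pdiff_add: "f differentiable (at x) ==> g differentiable (at x) ==>
  pdiff i (%x. f x + g x) x = pdiff i f x + pdiff i g x"
 by (subst pdiff_eq[OF has_derivative_add[OF pdiff_works pdiff_works]]) (auto simp: pdiff_def)

lemma pdiff_mult: "f differentiable (at x) ==> g differentiable (at x) ==>
  pdiff i (%x. f x * g x) x = f x * pdiff i g x + pdiff i f x * g x"
 by (subst pdiff_eq[OF has_derivative_mult[OF pdiff_works pdiff_works]]) (auto simp: pdiff_def)

text \<open>Iterated partial derivatives never leave a class closed under \<open>pdiff\<close>, so
  differentiability has to be checked only once for its members.\<close>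

lemma Csmooth_coinduct:
 assumes "f \<in> A" and "!!f. f \<in> A ==> periodic f & (\<forall>x. f differentiable (at x))"
  and "!!f i. f \<in> A ==> pdiff i f \<in> A"
 shows "f \<in> Csmooth"
proof -
 have "foldr pdiff is f \<in> A" for "is" by (induction "is") (use assms in auto)
 then show ?thesis using assms by (auto simp: Csmooth_def)
qed

lemma Csmooth_periodic: "f \<in> Csmooth ==> periodic f"
 by (simp add: Csmooth_def)

lemma Csmooth_differentiable: "f \<in> Csmooth ==> f differentiable (at x)"
 unfolding Csmooth_def using foldr_Nil by (metis (mono_tags, lifting) id_apply mem_Collect_eq)

lemma Csmooth_pdiff: "f \<in> Csmooth ==> pdiff i f \<in> Csmooth"
proof -
 assume f: "f \<in> Csmooth"
 have "pdiff i f (x + axis j (2 * pi)) = pdiff i f x" for x j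
 proof -
  let ?D = "frechet_derivative f (at (x + axis j (2 * pi)))"
  have "(f has_derivative ?D) (at (x + axis j (2 * pi)))"
   by (intro pdiff_works Csmooth_differentiable f)
  moreover have "((%y. y + axis j (2 * pi)) has_derivative (%h. h)) (at x)"
   by (auto intro!: derivative_eq_intros)
  ultimately have "(f \<circ> (%y. y + axis j (2 * pi)) has_derivative (?D \<circ> (%h. h))) (at x)"
   by (intro diff_chain_at) auto
  moreover have "f \<circ> (%y. y + axis j (2 * pi)) = f"
   using Csmooth_periodic[OF f] by (auto simp: periodic_def fun_eq_iff)
  ultimately have "(f has_derivative ?D) (at x)" by (simp add: comp_def)
  then show ?thesis by (simp add: pdiff_eq) (simp add: pdiff_def)
 qed
 moreover have "foldr pdiff is (pdiff i f) differentiable (at x)" for "is" x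
 proof -
  have "foldr pdiff (is @ [i]) f differentiable (at x)" using f unfolding Csmooth_def by blast
  then show ?thesis by simp
 qed
 ultimately show ?thesis by (simp add: Csmooth_def periodic_def)
qed

text \<open>Products alone are not stable under differentiation, but finite sums of products are, by
  the Leibniz rule. Sums of smooth functions are the special case of constant second
  factors.\<close>

lemma Csmooth_sum_list_mult:
 assumes "!!f g. (f, g) \<in> set ps ==> f \<in> Csmooth & g \<in> Csmooth"
 shows "(%x. \<Sum>(f, g)\<leftarrow>ps. f x * g x) \<in> Csmooth"
proof -
 let ?S = "%ps x. \<Sum>(f, g)\<leftarrow>ps. f x * (g x :: real)"
 let ?A = "{?S ps | ps. \<forall>(f, g)\<in>set ps. f \<in> Csmooth & g \<in> Csmooth}"
 have d: "?S ps differentiable (at x)" if "\<forall>(f, g)\<in>set ps. f \<in> Csmooth & g \<in> Csmooth" for ps x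
  using that
 proof (induction ps)
  case (Cons p ps)
  obtain f g where p: "p = (f, g)" by fastforce
  have "(%x. f x * g x + ?S ps x) differentiable (at x)"
   using Cons p by (intro derivative_intros) (auto intro: Csmooth_differentiable)
  then show ?case by (simp add: p)
 qed simp
 show ?thesis
 proof (rule Csmooth_coinduct[where A = ?A])
  show "?S ps \<in> ?A" using assms by (intro CollectI exI[of _ ps] conjI refl) auto
 next
  fix F assume "F \<in> ?A"
  then obtain ps where ps: "F = ?S ps" "\<forall>(f, g)\<in>set ps. f \<in> Csmooth & g \<in> Csmooth" by blast
  have "periodic F" unfolding ps(1) using ps(2)
   by (induction ps) (auto simp: periodic_def dest!: Csmooth_periodic)
  then show "periodic F & (\<forall>x. F differentiable (at x))" using d[OF ps(2)] ps(1) by blast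
  fix i
  let ?q = "concat (map (%(f, g). [(f, pdiff i g), (pdiff i f, g)]) ps)"
  have "pdiff i (?S ps) x = ?S ?q x" for x
   using ps(2)
  proof (induction ps)
   case Nil then show ?case by (simp add: pdiff_def)
  next
   case (Cons p ps)
   obtain f g where p: "p = (f, g)" by fastforce
   have fg: "f \<in> Csmooth" "g \<in> Csmooth" using Cons.prems p by auto
   have "pdiff i (%x. f x * g x + ?S ps x) x = pdiff i (%x. f x * g x) x + pdiff i (?S ps) x"
    using Cons.prems fg by (intro pdiff_add d derivative_intros Csmooth_differentiable) auto
   also have "pdiff i (%x. f x * g x) x = f x * pdiff i g x + pdiff i f x * g x"
    using fg by (intro pdiff_mult Csmooth_differentiable)
   finally show ?case using Cons p by (simp add: add.assoc)
  qed
  then have "pdiff i F = ?S ?q" by (simp add: ps(1) fun_eq_iff)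
  moreover have "\<forall>(f, g)\<in>set ?q. f \<in> Csmooth & g \<in> Csmooth" using ps(2) by (fastforce intro: Csmooth_pdiff)
  ultimately show "pdiff i F \<in> ?A" by (intro CollectI exI[of _ ?q] conjI)
 qed
qed

lemma Csmooth_const: "(%x. c) \<in> Csmooth"
proof (rule Csmooth_coinduct[where A = "{%x. c | c. True}"])
 fix f :: "real ^ 'a => real" and i assume "f \<in> {%x. c | c. True}"
 then obtain c where "f = (%x. c)" by blast
 then show "periodic f & (\<forall>x. f differentiable (at x))" "pdiff i f \<in> {%x. c | c. True}"
  by (auto simp: periodic_def pdiff_def[abs_def])
qed auto

lemma Csmooth_mult: "f \<in> Csmooth ==> g \<in> Csmooth ==> (%x. f x * g x) \<in> Csmooth"
 using Csmooth_sum_list_mult[of "[(f, g)]"] by simp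

lemma Csmooth_add: "f \<in> Csmooth ==> g \<in> Csmooth ==> (%x. f x + g x) \<in> Csmooth"
 using Csmooth_sum_list_mult[of "[(f, %x. 1), (g, %x. 1)]"] Csmooth_const[of 1] by force

lemma Csmooth_scale: "f \<in> Csmooth ==> (%x. c * f x) \<in> Csmooth"
 by (intro Csmooth_mult Csmooth_const)

lemma pdiff_scale: "f \<in> Csmooth ==> pdiff i (%x. c * f x) x = c * pdiff i f x"
 by (subst pdiff_mult) (auto intro: Csmooth_differentiable simp: pdiff_def)

lemma Csmooth_sum_list:
 "(!!p. p \<in> set ps ==> F p \<in> Csmooth) ==> (%x. \<Sum>p\<leftarrow>ps. F p x) \<in> Csmooth"
 by (induction ps) (auto intro: Csmooth_add Csmooth_const)

lemma pdiff_sum_list: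
 "(!!p. p \<in> set ps ==> F p \<in> Csmooth) ==> pdiff i (%x. \<Sum>p\<leftarrow>ps. F p x) x = (\<Sum>p\<leftarrow>ps. pdiff i (F p) x)"
proof (induction ps)
 case Nil then show ?case by (simp add: pdiff_def)
next
 case (Cons p ps)
 then show ?case by (simp add: pdiff_add Csmooth_differentiable Csmooth_sum_list)
qed

lemma Csmooth_continuous: "f \<in> Csmooth ==> continuous_on UNIV f"
 by (intro continuous_at_imp_continuous_on ballI differentiable_imp_continuous_within Csmooth_differentiable)

lemma Csmooth_measurable: "f \<in> Csmooth ==> f \<in> borel_measurable borel"
 by (intro borel_measurable_continuous_onI Csmooth_continuous)

lemma Csmooth_bounded:
 assumes "f \<in> Csmooth"
 obtains C where "0 <= C" "AE x in torus. \<bar>f x\<bar> <= C"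
proof -
 have "bounded (f ` cbox 0 (\<chi> i. 2 * pi))"
  using Csmooth_continuous[OF assms]
  by (intro compact_imp_bounded compact_continuous_image) (auto intro: continuous_on_subset)
 then obtain C where C: "!!x. x \<in> cbox 0 (\<chi> i. 2 * pi) ==> norm (f x) <= C"
  unfolding bounded_iff by blast
 have "AE x in torus. \<bar>f x\<bar> <= max C 0"
  unfolding AE_torus using C by (intro AE_I2) (auto simp: le_max_iff_disj)
 then show ?thesis using that[of "max C 0"] by simp
qed

lemma Csmooth_sqi: "f \<in> Csmooth ==> f \<in> sqi torus"
proof -
 assume f: "f \<in> Csmooth"
 obtain C where "AE x in torus. \<bar>f x\<bar> <= C" using Csmooth_bounded[OF f] by blast
 then show ?thesis using Csmooth_measurable[OF f] by (intro sqi_bounded finite_measure_torus) auto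
qed

lemma ip_real: "ip f g = inn torus f (g :: real ^ 'd::finite => real)"
 by (simp add: ip_def inn_def)

lemma L2norm_eq: "L2norm f = nrm torus f"
 by (simp add: L2norm_def nrm_def ip_real)

lemma L2_iff: "f \<in> L2 \<longleftrightarrow> periodic f & f \<in> sqi torus"
 by (auto simp: L2_def sqi_def)

lemma L2_sqi: "f \<in> L2 ==> f \<in> sqi torus" by (simp add: L2_iff)

lemma Csmooth_L2: "f \<in> Csmooth ==> f \<in> L2"
 by (simp add: L2_iff Csmooth_periodic Csmooth_sqi)

text \<open>Difference quotients in direction \<open>i\<close> have zero integral by translation
  invariance. They converge pointwise to the partial derivative and are bounded by the mean value
  theorem, so dominated convergence applies.\<close>

lemma integral_pdiff:
 assumes f: "f \<in> Csmooth"
 shows "(LINT x|torus. pdiff i f x) = 0"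
proof -
 interpret finite_measure "torus :: (real ^ 'a) measure" by (rule finite_measure_torus)
 have [measurable]: "f \<in> borel_measurable borel" "pdiff i f \<in> borel_measurable borel"
  using f by (auto intro: Csmooth_measurable Csmooth_pdiff)
 have cont: "continuous_on UNIV (pdiff i f)" by (intro Csmooth_continuous Csmooth_pdiff f)
 \<comment> \<open>The side is doubled to \<open>4 * pi\<close> so that the intermediate points of
   the mean value theorem, up to one unit outside the period cell, stay in a compact set.\<close>
 let ?K = "cbox 0 (\<chi> i. 4 * pi) :: (real ^ 'a) set"
 have "bounded (pdiff i f ` ?K)"
  using cont by (intro compact_imp_bounded compact_continuous_image) (auto intro: continuous_on_subset)
 then obtain C where C: "!!x. x \<in> ?K ==> \<bar>pdiff i f x\<bar> <= C" unfolding bounded_iff by auto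
 have der: "((%r. f (x + axis i r)) has_real_derivative pdiff i f (x + axis i r)) (at r)" for x r
 proof -
  have axis: "axis i r = r *\<^sub>R axis i (1 :: real)" for r by (simp add: vec_eq_iff axis_def)
  have "((%r. x + r *\<^sub>R axis i (1 :: real)) has_derivative (%h. h *\<^sub>R axis i 1)) (at r)"
   by (auto intro!: derivative_eq_intros)
  then have "((%r. x + axis i r) has_derivative (%h. axis i h)) (at r)"
   by (simp flip: axis)
  moreover have "(f has_derivative frechet_derivative f (at (x + axis i r))) (at (x + axis i r))"
   by (intro pdiff_works Csmooth_differentiable f)
  ultimately have "((%r. f (x + axis i r)) has_derivative (%h. frechet_derivative f (at (x + axis i r)) (axis i h))) (at r)"
   using diff_chain_at[of "%r. x + axis i r" "%h. axis i h" r f] by (simp add: comp_def)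
  moreover have "frechet_derivative f (at (x + axis i r)) (axis i h) = pdiff i f (x + axis i r) * h" for h
   using linear_scale[OF linear_frechet_derivative[OF Csmooth_differentiable[OF f]], of "x + axis i r" h "axis i 1"]
   by (simp add: pdiff_def axis[of h] mult.commute)
  ultimately show ?thesis by (simp add: has_field_derivative_def)
 qed
 define q where "q n x = real (Suc n) * (f (x + axis i (1 / real (Suc n))) - f x)" for n x
 have "(%n. LINT x|torus. q n x) \<longlonglongrightarrow> (LINT x|torus. pdiff i f x)"
 proof (rule integral_dominated_convergence[where w = "%_. C"])
  show "AE x in torus. (%n. q n x) \<longlonglongrightarrow> pdiff i f x"
  proof (rule AE_I2)
   fix x
   have "((%h. (f (x + axis i h) - f x) / h) \<longlongrightarrow> pdiff i f x) (at 0)"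
    using der[of x 0] by (simp add: has_field_derivative_iff axis_def[of i 0] flip: zero_vec_def)
   moreover have "filterlim (%n. 1 / real (Suc n)) (at 0) sequentially"
    unfolding filterlim_at using LIMSEQ_inverse_real_of_nat by (simp add: inverse_eq_divide)
   ultimately have "(%n. (f (x + axis i (1 / real (Suc n))) - f x) / (1 / real (Suc n))) \<longlonglongrightarrow> pdiff i f x"
    by (rule filterlim_compose)
   then show "(%n. q n x) \<longlonglongrightarrow> pdiff i f x" by (simp add: q_def mult.commute)
  qed
  show "AE x in torus. norm (q n x) <= C" for n
   using AE_torus_cell
  proof eventually_elim
   case (elim x)
   define h where "h = 1 / real (Suc n)"
   have h: "0 < h" "h <= 1" by (auto simp: h_def)
   obtain z where z: "0 < z" "z < h" "f (x + axis i h) - f (x + axis i 0) = (h - 0) * pdiff i f (x + axis i z)"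
    using MVT2[OF h(1) der] by blast
   have "x + axis i z \<in> ?K"
    unfolding mem_box_cart
   proof
    fix j
    have "0 <= x $ j" "x $ j < 2 * pi" using elim by auto
    moreover have "z <= 2 * pi" using z h pi_gt3 by linarith
    ultimately show "0 $ j <= (x + axis i z) $ j & (x + axis i z) $ j <= (\<chi> i. 4 * pi) $ j"
     using z by (auto simp: axis_def)
   qed
   then have "\<bar>pdiff i f (x + axis i z)\<bar> <= C" by (rule C)
   moreover have "q n x = pdiff i f (x + axis i z)"
    using z(3) h by (simp add: q_def h_def axis_def[of i 0] flip: zero_vec_def)
   ultimately show ?case by simp
  qed
 qed (auto simp: q_def)
 moreover have "(LINT x|torus. q n x) = 0" for n
 proof -
  have c: "continuous_on UNIV f" by (rule Csmooth_continuous[OF f])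
  have "1 / real (Suc n) <= 1" by simp
  then have s: "0 <= 1 / real (Suc n)" "1 / real (Suc n) <= 2 * pi" using pi_gt3 by (simp, linarith)
  have "integrable torus f" using integral_abs_le_nrm(1)[OF finite_measure_torus Csmooth_sqi[OF f]] .
  moreover have "integrable torus (%x. f (x + axis i (1 / real (Suc n))))"
  proof -
   have "bounded ((%x. f (x + axis i (1 / real (Suc n)))) ` cbox 0 (\<chi> i. 2 * pi))"
    by (intro compact_imp_bounded compact_continuous_image continuous_intros continuous_on_subset[OF c]
      continuous_on_compose2[OF c]) auto
   then obtain B where "!!x. x \<in> cbox 0 (\<chi> i. 2 * pi) ==> norm (f (x + axis i (1 / real (Suc n)))) <= B"
    unfolding bounded_iff by auto
   then have "AE x in torus. norm (f (x + axis i (1 / real (Suc n)))) <= B"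
    unfolding AE_torus by auto
   then show ?thesis by (intro integrable_const_bound) auto
  qed
  ultimately show ?thesis
   using periodic_shift_integral[OF c Csmooth_periodic[OF f] s, of i] by (simp add: q_def)
 qed
 ultimately show ?thesis by (simp add: LIMSEQ_const_iff)
qed

subsection \<open>The trigonometric basis\<close>

text \<open>
  The functions \<open>cos (k \<bullet> x) + sin (k \<bullet> x)\<close>, one for each lattice point, form a real orthonormal
  basis, and differentiation maps the one for \<open>k\<close> to a multiple of the one for \<open>- k\<close>.
\<close>

definition cas :: "int ^ 'd => real ^ 'd::finite => real" where
 "cas k x = cos (of_lattice k \<bullet> x) + sin (of_lattice k \<bullet> x)"

lemma of_lattice_simps [simp]:
 "of_lattice (k + l) = of_lattice k + of_lattice l" "of_lattice (k - l) = of_lattice k - of_lattice l"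
 "of_lattice (- k) = - of_lattice k" "of_lattice 0 = 0" "of_lattice k $ i = real_of_int (k $ i)"
 by (simp_all add: of_lattice_def vec_eq_iff)

lemma cos_cas: "cos (of_lattice k \<bullet> x) = (cas k x + cas (- k) x) / 2"
 by (simp add: cas_def)

lemma sin_cas: "sin (of_lattice k \<bullet> x) = (cas k x - cas (- k) x) / 2"
 by (simp add: cas_def)

lemma cas_0 [simp]: "cas 0 x = 1"
 by (simp add: cas_def)

lemma cas_mult: "cas k x * cas l x = cos (of_lattice (k - l) \<bullet> x) + sin (of_lattice (k + l) \<bullet> x)"
 by (simp add: cas_def inner_diff_left inner_add_left cos_diff sin_add algebra_simps)

lemma cas_has_derivative:
 "(cas k has_derivative (%v. (of_lattice k \<bullet> v) * cas (- k) x)) (at x)"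
proof -
 have "((%x. cos (of_lattice k \<bullet> x) + sin (of_lattice k \<bullet> x)) has_derivative
   (%v. (of_lattice k \<bullet> v) * (cos (of_lattice k \<bullet> x) - sin (of_lattice k \<bullet> x)))) (at x)"
  by (auto intro!: derivative_eq_intros simp: algebra_simps)
 then show ?thesis by (simp add: cas_def[abs_def])
qed

lemma pdiff_cas: "pdiff i (cas k) x = real_of_int (k $ i) * cas (- k) x"
 by (subst pdiff_eq[OF cas_has_derivative]) (simp add: inner_axis)

lemma cas_periodic: "periodic (cas k)"
proof -
 have "cas k (x + axis i (2 * pi)) = cas k x" for x i
  using cos.plus_of_int[of "of_lattice k \<bullet> x" "k $ i"] sin.plus_of_int[of "of_lattice k \<bullet> x" "k $ i"]
  by (simp add: cas_def inner_add_right inner_axis)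
 then show ?thesis by (simp add: periodic_def)
qed

lemma cas_Csmooth: "cas k \<in> Csmooth"
proof (rule Csmooth_coinduct[where A = "{%x. c * cas k x | c k. True}"])
 have "cas k = (%x. 1 * cas k x)" by simp
 then show "cas k \<in> {%x. c * cas k x | c k. True}" by blast
next
 fix f :: "real ^ 'a => real" assume "f \<in> {%x. c * cas k x | c k. True}"
 then obtain c k where f: "f = (%x. c * cas k x)" by blast
 have d: "cas k differentiable (at x)" for x :: "real ^ 'a"
  using cas_has_derivative by (auto simp: differentiable_def)
 show "periodic f & (\<forall>x. f differentiable (at x))"
  using cas_periodic[of k] d by (auto simp: f periodic_def intro!: derivative_intros)
 fix i
 have "pdiff i f x = (c * real_of_int (k $ i)) * cas (- k) x" for x
  unfolding f using d by (subst pdiff_mult) (auto simp: pdiff_cas pdiff_def[of i "%x. c"])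
 then show "pdiff i f \<in> {%x. c * cas k x | c k. True}" by (auto simp: fun_eq_iff)
qed

lemma cas_sqi [simp]: "cas k \<in> sqi torus"
 by (intro Csmooth_sqi cas_Csmooth)

lemma cas_L2: "cas k \<in> L2"
 by (intro Csmooth_L2 cas_Csmooth)

lemma cas_measurable [measurable]: "cas k \<in> borel_measurable borel"
 by (intro Csmooth_measurable cas_Csmooth)

lemma integrable_cas: "integrable torus (cas k)"
 by (rule integral_abs_le_nrm(1)[OF finite_measure_torus]) simp

text \<open>For a nonzero frequency, \<open>cas k\<close> is up to a factor a partial derivative of
  \<open>cas (- k)\<close>.\<close>

lemma integral_cas: "(LINT x|torus. cas k x) = (if k = 0 then 1 else 0)"
proof (cases "k = 0")
 case True
 then show ?thesis using prob_space.prob_space[OF prob_space_torus] by simp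
next
 case False
 then obtain i where i: "k $ i ~= 0" by (auto simp: vec_eq_iff)
 have "0 = (LINT x|torus. pdiff i (cas (- k)) x)" by (simp add: integral_pdiff cas_Csmooth)
 also have "... = - real_of_int (k $ i) * (LINT x|torus. cas k x)" by (simp add: pdiff_cas)
 finally show ?thesis using i False by simp
qed

text \<open>The product formula leaves frequencies \<open>k - l\<close> and \<open>k + l\<close>.
  The latter enter through a difference of \<open>cas (k + l)\<close> and
  \<open>cas (- (k + l))\<close>, which have equal means even when \<open>k + l = 0\<close>.\<close>

lemma cas_orthonormal: "inn torus (cas k) (cas l) = (if k = l then 1 else 0)"
proof -
 have "inn torus (cas k) (cas l) = (LINT x|torus. (cas (k - l) x + cas (l - k) x) / 2 + (cas (k + l) x - cas (- (k + l)) x) / 2)"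
  unfolding inn_def cas_mult cos_cas sin_cas by simp
 also have "... = (if k = l then 1 else 0)"
  by (auto simp: integrable_cas integral_cas add_eq_0_iff)
 finally show ?thesis .
qed

inductive trig_poly :: "(real ^ 'd::finite => real) => bool" where
 scale: "trig_poly (%x. c * cas k x)"
| add: "trig_poly f ==> trig_poly g ==> trig_poly (%x. f x + g x)"

lemma trig_poly_mult_cas: "trig_poly f ==> trig_poly (%x. c * cas l x * f x)"
proof (induction rule: trig_poly.induct)
 case (scale e k)
 let ?c = "%k x. (c * e / 2) * cas k x"
 have "trig_poly (%x. ((?c (l - k) x + ?c (k - l) x) + ?c (l + k) x) + (- c * e / 2) * cas (- (l + k)) x)"
  by (intro trig_poly.intros)
 moreover have "c * cas l x * (e * cas k x) = ((?c (l - k) x + ?c (k - l) x) + ?c (l + k) x) + (- c * e / 2) * cas (- (l + k)) x" for x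
 proof -
  have "c * cas l x * (e * cas k x) = c * e * (cas l x * cas k x)" by simp
  then show ?thesis unfolding cas_mult cos_cas sin_cas minus_diff_eq by (simp add: field_simps)
 qed
 ultimately show ?case by simp
next
 case (add f g)
 show ?case unfolding distrib_left
  by (rule trig_poly.add; rule add.IH)
qed

lemma trig_poly_mult: "trig_poly f ==> trig_poly g ==> trig_poly (%x. f x * g x)"
proof (induction rule: trig_poly.induct)
 case (scale c k) then show ?case by (rule trig_poly_mult_cas)
next
 case (add f g')
 show ?case unfolding distrib_right
  by (rule trig_poly.add; rule add.IH; rule add.prems)
qed

lemma trig_poly_sum: "(!!i. i \<in> A ==> trig_poly (f i)) ==> trig_poly (%x. \<Sum>i\<in>A. f i x)"
proof (induction A rule: infinite_finite_induct)
 case (insert i A) then show ?case using trig_poly.add[of "f i" "%x. \<Sum>i\<in>A. f i x"] by simp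
qed (use trig_poly.scale[of 0 0] in auto)

text \<open>This embeds the torus into a compact set of a Euclidean space; polynomials in the
  embedding are trigonometric polynomials.\<close>

definition circle_map :: "real ^ 'd::finite => (real ^ 'd) \<times> (real ^ 'd)" where
 "circle_map x = ((\<chi> i. cos (x $ i)), (\<chi> i. sin (x $ i)))"

text \<open>The cosine determines an angle up to reflection and the sign of the sine selects the
  branch. Clamping to the interval from -1 to 1 keeps the map Borel on the whole space.\<close>

definition circle_inverse :: "(real ^ 'd::finite) \<times> (real ^ 'd) => real ^ 'd" where
 "circle_inverse y = (\<chi> i. let c = arccos (max (- 1) (min 1 (fst y $ i)))
  in if 0 <= snd y $ i then c else 2 * pi - c)"

lemma trig_poly_circle_map:
 "real_polynomial_function p ==> trig_poly (%x :: real ^ 'd::finite. p (circle_map x))"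
proof (induction rule: real_polynomial_function.induct)
 case (linear p)
 then interpret bounded_linear p .
 have comp: "cos (x $ i) = (cas (axis i 1) x + cas (- axis i 1) x) / 2"
  "sin (x $ i) = (cas (axis i 1) x - cas (- axis i 1) x) / 2" for x :: "real ^ 'd" and i
 proof -
  have "of_lattice (axis i 1) = (axis i 1 :: real ^ 'd)" by (simp add: of_lattice_def axis_def vec_eq_iff)
  then have "of_lattice (axis i 1) \<bullet> x = x $ i" by (simp add: inner_axis')
  then show "cos (x $ i) = (cas (axis i 1) x + cas (- axis i 1) x) / 2"
   "sin (x $ i) = (cas (axis i 1) x - cas (- axis i 1) x) / 2"
   by (simp_all add: cas_def)
 qed
 have exp: "p (u, v) = (\<Sum>i\<in>UNIV. u $ i * p (axis i 1, 0)) + (\<Sum>i\<in>UNIV. v $ i * p (0, axis i 1))" for u v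
 proof -
  have u: "(\<Sum>i\<in>UNIV. (u $ i) *\<^sub>R axis i 1) = u" for u :: "real ^ 'd"
   using basis_expansion[of u] by (simp add: scalar_mult_eq_scaleR)
  have "p (u, v) = p (\<Sum>i\<in>UNIV. (u $ i) *\<^sub>R axis i 1, 0) + p (0, \<Sum>i\<in>UNIV. (v $ i) *\<^sub>R axis i 1)"
   unfolding u by (simp flip: add)
  also have "(\<Sum>i\<in>UNIV. (u $ i) *\<^sub>R axis i (1 :: real), 0 :: real ^ 'd) = (\<Sum>i\<in>UNIV. (u $ i) *\<^sub>R (axis i 1, 0))"
   by (simp add: prod_eq_iff fst_sum snd_sum)
  also have "(0 :: real ^ 'd, \<Sum>i\<in>UNIV. (v $ i) *\<^sub>R axis i (1 :: real)) = (\<Sum>i\<in>UNIV. (v $ i) *\<^sub>R (0, axis i 1))"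
   by (simp add: prod_eq_iff fst_sum snd_sum)
  finally show ?thesis by (simp only: sum scaleR) simp
 qed
 have *: "trig_poly (%x :: real ^ 'd. (cas k x + cas l x) / 2 * c)"
  "trig_poly (%x :: real ^ 'd. (cas k x - cas l x) / 2 * c)" for k l c
  using trig_poly.add[OF trig_poly.scale[of "c / 2" k] trig_poly.scale[of "c / 2" l]]
   trig_poly.add[OF trig_poly.scale[of "c / 2" k] trig_poly.scale[of "- c / 2" l]]
  by (simp_all add: field_simps)
 have "p (circle_map x) = (\<Sum>i\<in>UNIV. (cas (axis i 1) x + cas (- axis i 1) x) / 2 * p (axis i 1, 0))
   + (\<Sum>i\<in>UNIV. (cas (axis i 1) x - cas (- axis i 1) x) / 2 * p (0, axis i 1))" for x
  unfolding circle_map_def by (subst exp) (simp only: vec_lambda_beta comp)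
 then show ?case
  by (simp only:) (rule trig_poly.add; rule trig_poly_sum; rule *)
next
 case (const c)
 show ?case using trig_poly.scale[of c 0] by simp
next
 case (add f g) then show ?case by (intro trig_poly.add)
next
 case (mult f g) then show ?case by (intro trig_poly_mult)
qed

text \<open>Trigonometric polynomials contain all polynomials in \<open>circle_map\<close>, and
  \<open>circle_inverse\<close> recovers a point of the half-open period cell, hence almost every
  point.\<close>

lemma cas_total:
 assumes f: "f \<in> sqi (torus :: (real ^ 'd::finite) measure)" and z: "!!k. inn torus f (cas k) = 0"
 shows "AE x in torus. f x = 0"
proof (rule polynomials_total[where P = circle_map and Q = circle_inverse])
 show "integrable torus f" using f by (rule integral_abs_le_nrm(1)[OF finite_measure_torus])
 have "continuous_on UNIV (circle_map :: real ^ 'd => _)"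
  unfolding circle_map_def[abs_def] by (intro continuous_intros)
 then have "circle_map \<in> borel_measurable (borel :: (real ^ 'd) measure)" by (rule borel_measurable_continuous_onI)
 then show "circle_map \<in> borel_measurable (torus :: (real ^ 'd) measure)" by simp
 let ?K = "cbox (\<chi> i. - 1, \<chi> i. - 1) (\<chi> i. 1, \<chi> i. 1) :: ((real ^ 'd) \<times> (real ^ 'd)) set"
 show "compact ?K" by (rule compact_cbox)
 show "circle_map x \<in> ?K" for x :: "real ^ 'd"
  by (simp add: circle_map_def cbox_Pair_eq mem_box_cart)
next
 fix p :: "(real ^ 'd) \<times> (real ^ 'd) => real" assume "real_polynomial_function p"
 then have "trig_poly (%x :: real ^ 'd. p (circle_map x))" by (rule trig_poly_circle_map)
 then have "(%x. p (circle_map x)) \<in> sqi torus & inn torus f (%x. p (circle_map x)) = 0"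
 proof (induction rule: trig_poly.induct)
  case (scale c k) then show ?case using z by (auto simp: inn_scale_right intro: sqi_scale)
 next
  case (add g h) then show ?case using f by (auto simp: inn_add_right intro: sqi_add)
 qed
 then show "(LINT x|torus. f x * p (circle_map x)) = 0" by (simp add: inn_def)
next
 have "continuous_on UNIV (%y. arccos (max (- 1) (min 1 y)))"
  by (intro continuous_on_arccos continuous_intros) auto
 then have [measurable]: "(%y. arccos (max (- 1) (min 1 y))) \<in> borel_measurable borel"
  by (rule borel_measurable_continuous_onI)
 have [measurable]: "(%y :: (real ^ 'd) \<times> (real ^ 'd). fst y $ i) \<in> borel_measurable borel"
  "(%y :: (real ^ 'd) \<times> (real ^ 'd). snd y $ i) \<in> borel_measurable borel" for i
  by (intro borel_measurable_continuous_onI continuous_intros)+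
 have "(%y :: (real ^ 'd) \<times> (real ^ 'd). circle_inverse y $ i) \<in> borel_measurable borel" for i
  unfolding circle_inverse_def Let_def vec_lambda_beta by measurable
 then have "circle_inverse \<in> borel_measurable (borel :: ((real ^ 'd) \<times> (real ^ 'd)) measure)"
  by (subst borel_measurable_euclidean_space) (auto simp: Basis_vec_def inner_axis)
 then show "circle_inverse \<in> borel \<rightarrow>\<^sub>M (torus :: (real ^ 'd) measure)" by simp
 show "AE x in torus. circle_inverse (circle_map x) = (x :: real ^ 'd)"
  using AE_torus_cell
 proof eventually_elim
  case (elim x)
  have "circle_inverse (circle_map x) $ i = x $ i" for i
  proof -
   have x: "0 <= x $ i" "x $ i < 2 * pi" using elim by auto
   show ?thesis
   proof (cases "x $ i <= pi")
    case True
    then have "0 <= sin (x $ i)" using x by (intro sin_ge_zero) auto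
    then show ?thesis using x True by (simp add: circle_inverse_def circle_map_def arccos_cos)
   next
    case False
    then have "sin (x $ i) < 0" using x by (intro sin_lt_zero) auto
    moreover have "cos (x $ i) = cos (2 * pi - x $ i)" by simp
    then have "arccos (cos (x $ i)) = 2 * pi - x $ i" using x False by (simp add: arccos_cos del: cos_2pi_minus)
    ultimately show ?thesis by (simp add: circle_inverse_def circle_map_def)
   qed
  qed
  then show ?case by (simp add: vec_eq_iff)
 qed
qed

interpretation torus: onb "torus :: (real ^ 'd::finite) measure" cas
 by (rule onb.intro) (auto intro: finite_measure_torus cas_total simp: cas_orthonormal)

section \<open>Operations in L2 and the weak divergence\<close>

lemma eqT_inn:
 assumes "eqT f g" "f \<in> sqi torus" "g \<in> sqi torus" "k \<in> sqi torus"
 shows "inn torus f k = inn torus g k"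
 using assms by (intro inn_cong_AE) (auto simp: eqT_def intro: sqi_measurable)

lemma L2_add: "f \<in> L2 ==> g \<in> L2 ==> (%x. f x + g x) \<in> L2"
 by (auto simp: L2_iff periodic_def intro: sqi_add)

lemma L2_scale: "f \<in> L2 ==> (%x. c * f x) \<in> L2"
 by (auto simp: L2_iff periodic_def intro: sqi_scale)

lemma L2_zero: "(%x. 0) \<in> L2"
 by (auto simp: L2_iff periodic_def intro: sqi_zero)

lemma L2_sum: "(!!i. i \<in> A ==> f i \<in> L2) ==> (%x. \<Sum>i\<in>A. f i x) \<in> L2"
 by (induction A rule: infinite_finite_induct) (auto intro: L2_add L2_zero)

lemma L2_sum_list: "(!!i. i \<in> set A ==> f i \<in> L2) ==> (%x. \<Sum>i\<leftarrow>A. f i x) \<in> L2"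
 by (induction A) (auto intro: L2_add L2_zero)

lemma L2_smooth_mult:
 assumes "f \<in> L2" and p: "ph \<in> Csmooth"
 shows "(%x. ph x * f x) \<in> L2"
proof -
 obtain C where "AE x in torus. \<bar>ph x\<bar> <= C" using Csmooth_bounded[OF p] by blast
 then have "(%x. ph x * f x) \<in> sqi torus"
  using assms Csmooth_measurable[OF p] by (intro sqi_mult_bounded) (auto simp: L2_iff)
 then show ?thesis using assms Csmooth_periodic[OF p] by (auto simp: L2_iff periodic_def)
qed

lemma inner_grad: "f x \<bullet> grad ph x = (\<Sum>i\<in>UNIV. pdiff i ph x * f x $ i)"
 by (simp add: inner_vec_def grad_def mult.commute)

lemma L2_inner_grad:
 assumes "!!i. (%x. f x $ i) \<in> L2" "ph \<in> Csmooth"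
 shows "(%x. f x \<bullet> grad ph x) \<in> L2"
 unfolding inner_grad using assms by (intro L2_sum L2_smooth_mult Csmooth_pdiff)

lemma has_weak_div_unique:
 assumes "has_weak_div f g" "has_weak_div f g'"
 shows "eqT g g'"
 unfolding eqT_def
proof (rule torus.eq_AE_of_coeff)
 show "g \<in> sqi torus" "g' \<in> sqi torus" using assms by (auto simp: has_weak_div_def L2_iff)
 show "inn torus g (cas k) = inn torus g' (cas k)" for k
  using assms cas_Csmooth[of k] by (simp add: has_weak_div_def ip_real)
qed

text \<open>Test the divergence of \<open>f\<close> with the product of \<open>ph\<close> and the
  given test function, and expand the gradient of the product.\<close>

lemma has_weak_div_smooth_mult:
 assumes w: "has_weak_div f g" and p: "ph \<in> Csmooth"
 shows "has_weak_div (%x. ph x *\<^sub>R f x) (%x. ph x * g x + f x \<bullet> grad ph x)"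
 unfolding has_weak_div_def
proof (intro conjI allI ballI)
 have f: "(%x. f x $ i) \<in> L2" and g: "g \<in> L2" for i using w by (auto simp: has_weak_div_def)
 show "(%x. (ph x *\<^sub>R f x) $ i) \<in> L2" for i using L2_smooth_mult[OF f p] by simp
 show "(%x. ph x * g x + f x \<bullet> grad ph x) \<in> L2"
  by (intro L2_add L2_smooth_mult L2_inner_grad f g p)
 fix \<psi> :: "real ^ 'a => real" assume c: "\<psi> \<in> Csmooth"
 have gr: "f x \<bullet> grad (%x. ph x * \<psi> x) x = (f x \<bullet> grad ph x) * \<psi> x + (ph x *\<^sub>R f x) \<bullet> grad \<psi> x" for x
  using p c
  by (simp add: inner_vec_def grad_def pdiff_mult Csmooth_differentiable algebra_simps sum.distrib sum_distrib_left)
 have i1: "integrable torus (%x. (f x \<bullet> grad ph x) * \<psi> x)"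
  by (rule sqi_integrable_mult[OF L2_sqi[OF L2_inner_grad[OF f p]] Csmooth_sqi[OF c]])
 have i2: "integrable torus (%x. (ph x *\<^sub>R f x) \<bullet> grad \<psi> x)"
  using sqi_integrable_mult[OF Csmooth_sqi[OF p] L2_sqi[OF L2_inner_grad[OF f c]]] by simp
 have i3: "integrable torus (%x. (ph x * g x) * \<psi> x)"
  by (rule sqi_integrable_mult[OF L2_sqi[OF L2_smooth_mult[OF g p]] Csmooth_sqi[OF c]])
 have "ip (%x. ph x * g x + f x \<bullet> grad ph x) \<psi> = (LINT x|torus. ph x * g x * \<psi> x) + (LINT x|torus. (f x \<bullet> grad ph x) * \<psi> x)"
  unfolding ip_def distrib_right by (rule Bochner_Integration.integral_add[OF i3 i1])
 also have "(LINT x|torus. ph x * g x * \<psi> x) = ip g (%x. ph x * \<psi> x)"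
  unfolding ip_def by (simp add: mult_ac)
 also have "... = - (LINT x|torus. f x \<bullet> grad (%x. ph x * \<psi> x) x)"
  using w Csmooth_mult[OF p c] by (simp add: has_weak_div_def)
 also have "(LINT x|torus. f x \<bullet> grad (%x. ph x * \<psi> x) x)
   = (LINT x|torus. (f x \<bullet> grad ph x) * \<psi> x) + (LINT x|torus. (ph x *\<^sub>R f x) \<bullet> grad \<psi> x)"
  unfolding gr by (rule Bochner_Integration.integral_add[OF i1 i2])
 finally show "ip (%x. ph x * g x + f x \<bullet> grad ph x) \<psi> = - (LINT x|torus. (ph x *\<^sub>R f x) \<bullet> grad \<psi> x)"
  by simp
qed

lemma has_weak_div_wdiv: "\<exists>g. has_weak_div f g ==> has_weak_div f (wdiv f)"
 unfolding wdiv_def by (rule someI_ex[of "has_weak_div f"])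

text \<open>Since \<open>wdiv\<close> picks an arbitrary representative, the Leibniz formula can
  hold only up to \<open>eqT\<close>. The explicit divergence of the product guarantees that the
  choice on the left is meaningful.\<close>

lemma wdiv_smooth_mult:
 assumes w: "has_weak_div f g" and p: "ph \<in> Csmooth"
 shows "wdiv (%x. ph x *\<^sub>R f x) \<in> L2"
  and "eqT (wdiv (%x. ph x *\<^sub>R f x)) (%x. ph x * wdiv f x + f x \<bullet> grad ph x)"
proof -
 have "has_weak_div f (wdiv f)" using w by (intro has_weak_div_wdiv) blast
 then have *: "has_weak_div (%x. ph x *\<^sub>R f x) (%x. ph x * wdiv f x + f x \<bullet> grad ph x)"
  by (rule has_weak_div_smooth_mult[OF _ p])
 then have **: "has_weak_div (%x. ph x *\<^sub>R f x) (wdiv (%x. ph x *\<^sub>R f x))" by (intro has_weak_div_wdiv) blast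
 then show "wdiv (%x. ph x *\<^sub>R f x) \<in> L2" by (simp add: has_weak_div_def)
 show "eqT (wdiv (%x. ph x *\<^sub>R f x)) (%x. ph x * wdiv f x + f x \<bullet> grad ph x)"
  by (rule has_weak_div_unique[OF ** *])
qed

lemma Csmooth_sum: "(!!i. i \<in> A ==> f i \<in> Csmooth) ==> (%x. \<Sum>i\<in>A. f i x) \<in> Csmooth"
 by (induction A rule: infinite_finite_induct) (auto intro: Csmooth_add Csmooth_const)

lemma laplacian_Csmooth: "ph \<in> Csmooth ==> laplacian ph \<in> Csmooth"
 unfolding laplacian_def[abs_def] by (intro Csmooth_sum Csmooth_pdiff)

text \<open>Integrating the \<open>i\<close>-th derivative of \<open>pdiff i ph * ph\<close> gives
  zero, which is integration by parts on the torus.\<close>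

lemma laplacian_nonpos:
 assumes p: "ph \<in> Csmooth"
 shows "inn torus (laplacian ph) ph <= 0"
proof -
 have s: "pdiff i (pdiff i ph) \<in> sqi torus" "pdiff i ph \<in> sqi torus" for i
  by (intro Csmooth_sqi Csmooth_pdiff p)+
 have "inn torus (laplacian ph) ph = (\<Sum>i\<in>UNIV. inn torus (pdiff i (pdiff i ph)) ph)"
  unfolding laplacian_def[abs_def] by (intro inn_sum_left s Csmooth_sqi p)
 also have "... = (\<Sum>i\<in>UNIV. - inn torus (pdiff i ph) (pdiff i ph))"
 proof (rule sum.cong[OF refl])
  fix i
  have "0 = (LINT x|torus. pdiff i (%x. pdiff i ph x * ph x) x)"
   by (intro integral_pdiff[symmetric] Csmooth_mult Csmooth_pdiff p)
  also have "... = (LINT x|torus. pdiff i ph x * pdiff i ph x + pdiff i (pdiff i ph) x * ph x)"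
   by (simp add: pdiff_mult Csmooth_differentiable Csmooth_pdiff p)
  also have "... = inn torus (pdiff i ph) (pdiff i ph) + inn torus (pdiff i (pdiff i ph)) ph"
   unfolding inn_def by (intro Bochner_Integration.integral_add sqi_integrable_mult s Csmooth_sqi p)
  finally show "inn torus (pdiff i (pdiff i ph)) ph = - inn torus (pdiff i ph) (pdiff i ph)" by simp
 qed
 also have "... <= 0" by (intro sum_nonpos) simp
 finally show ?thesis .
qed

subsection \<open>Measurability in \<open>L2\<close>\<close>

text \<open>Enumerating the index set turns an unordered sum into the limit of a sequence, the form
  in which measurability survives.\<close>

lemma has_sum_LIMSEQ_to_nat:
 fixes f :: "'i::countable => real"
 assumes "(f has_sum s) UNIV"
 shows "(%n. \<Sum>i\<in>to_nat -` {..n}. f i) \<longlonglongrightarrow> s"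
proof -
 have "filterlim (%n. to_nat -` {..n} :: 'i set) (finite_subsets_at_top UNIV) sequentially"
  unfolding filterlim_finite_subsets_at_top
 proof (intro allI impI)
  fix X :: "'i set" assume "finite X & X \<subseteq> UNIV"
  then have "X \<subseteq> to_nat -` {..n}" if "Max (insert 0 (to_nat ` X)) <= n" for n
   using that by auto
  then show "\<forall>\<^sub>F n in sequentially. finite (to_nat -` {..n} :: 'i set) & X \<subseteq> to_nat -` {..n} & to_nat -` {..n} \<subseteq> (UNIV :: 'i set)"
   by (intro eventually_sequentiallyI[of "Max (insert 0 (to_nat ` X))"] conjI finite_vimageI
     finite_atMost inj_to_nat subset_UNIV)
 qed
 then show ?thesis using assms unfolding has_sum_def by (rule filterlim_compose[rotated])
qed

text \<open>Parseval's identity writes the inner product as a limit of finite sums of products of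
  coefficients, so measurable coefficients suffice.\<close>

lemma inn_torus_measurable:
 fixes X Y :: "'w => real ^ 'd::finite => real"
 assumes "!!w. w \<in> space N ==> X w \<in> sqi torus" "!!w. w \<in> space N ==> Y w \<in> sqi torus"
  and [measurable]: "!!k. (%w. inn torus (X w) (cas k)) \<in> borel_measurable N"
   "!!k. (%w. inn torus (Y w) (cas k)) \<in> borel_measurable N"
 shows "(%w. inn torus (X w) (Y w)) \<in> borel_measurable N"
proof (rule borel_measurable_LIMSEQ_real)
 show "(%n. \<Sum>k\<in>to_nat -` {..n}. inn torus (X w) (cas k) * inn torus (Y w) (cas k)) \<longlonglongrightarrow> inn torus (X w) (Y w)"
  if "w \<in> space N" for w
  using assms(1,2)[OF that] by (intro has_sum_LIMSEQ_to_nat torus.inn_has_sum)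
qed measurable

lemma nrm_torus_measurable:
 fixes X :: "'w => real ^ 'd::finite => real"
 assumes "!!w. w \<in> space N ==> X w \<in> sqi torus"
  and "!!k. (%w. inn torus (X w) (cas k)) \<in> borel_measurable N"
 shows "(%w. nrm torus (X w)) \<in> borel_measurable N"
proof -
 have "(%w. inn torus (X w) (X w)) \<in> borel_measurable N"
  by (rule inn_torus_measurable[OF assms(1) assms(1) assms(2) assms(2)])
 moreover have "sqrt \<in> borel_measurable borel"
  by (intro borel_measurable_continuous_onI continuous_on_real_sqrt continuous_on_id)
 ultimately show ?thesis unfolding nrm_def by (rule measurable_compose)
qed

lemma space_borel_of_L2 [simp]: "space (borel_of L2_topology) = L2"
 by (simp add: borel_of_def topspace_L2_topology space_measure_of_conv)

lemma sets_borel_of_L2: "sets (borel_of L2_topology) = sigma_sets L2 {U. L2_open U}"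
proof -
 have "{U. L2_open U} \<subseteq> Pow L2" by (auto simp: L2_open_def)
 then show ?thesis
  unfolding borel_of_def topspace_L2_topology openin_L2_topology by (rule sets_measure_of)
qed

lemma L2_open_in_sets: "L2_open U ==> U \<in> sets (borel_of L2_topology)"
 by (auto simp: sets_borel_of_L2)

lemma inn_L2_measurable:
 assumes f: "f \<in> L2"
 shows "(%g. inn torus g f) \<in> borel_measurable (borel_of L2_topology)"
proof (rule borel_measurableI)
 fix S :: "real set" assume S: "open S"
 have "L2_open ((%g. inn torus g f) -` S \<inter> L2)"
  unfolding L2_open_def
 proof (intro conjI ballI)
  fix g assume g: "g \<in> (%g. inn torus g f) -` S \<inter> L2"
  then obtain e where e: "0 < e" "!!y. \<bar>y - inn torus g f\<bar> < e ==> y \<in> S"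
   using S unfolding open_dist by (auto simp: dist_real_def)
  show "\<exists>r>0. \<forall>k\<in>L2. L2norm (%x. k x - g x) < r --> k \<in> (%g. inn torus g f) -` S \<inter> L2"
  proof (intro exI[of _ "e / (nrm torus f + 1)"] conjI ballI impI)
   have p: "0 < nrm torus f + 1" by (intro add_nonneg_pos) auto
   then show "0 < e / (nrm torus f + 1)" using e by simp
   fix k assume k: "k \<in> L2" "L2norm (%x. k x - g x) < e / (nrm torus f + 1)"
   have "inn torus k f - inn torus g f = inn torus (%x. k x - g x) f"
    using f g k by (simp add: inn_diff_left L2_sqi)
   also have "\<bar>...\<bar> <= nrm torus (%x. k x - g x) * nrm torus f"
    using f g k by (intro cauchy_schwarz_inn sqi_diff) (auto simp: L2_sqi)
   also have "... <= nrm torus (%x. k x - g x) * (nrm torus f + 1)" by (intro mult_left_mono) auto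
   also have "... < e" using k(2) p by (simp add: L2norm_eq pos_less_divide_eq)
   finally show "k \<in> (%g. inn torus g f) -` S \<inter> L2" using e(2) k(1) by auto
  qed
 qed auto
 then show "(%g. inn torus g f) -` S \<inter> space (borel_of L2_topology) \<in> sets (borel_of L2_topology)"
  by (simp add: L2_open_in_sets)
qed

lemma L2_countable_dense:
 obtains D :: "(real ^ 'd::finite => real) set" where "countable D" "D \<subseteq> L2"
  "!!f e. f \<in> L2 ==> 0 < e ==> \<exists>d\<in>D. nrm torus (%x. f x - d x) < e"
proof -
 define p :: "((int ^ 'd) \<times> rat) list => real ^ 'd => real"
  where "p l x = (\<Sum>(k, q)\<leftarrow>l. of_rat q * cas k x)" for l x
 show thesis
 proof
  show "countable (range p)" by (intro countable_image countableI_type)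
  have "p l \<in> L2" for l
   unfolding p_def[abs_def] by (intro L2_sum_list) (auto intro: L2_scale cas_L2)
  then show "range p \<subseteq> L2" by auto
  fix f :: "real ^ 'd => real" and e :: real assume f: "f \<in> L2" and e: "0 < e"
  have "\<forall>\<^sub>F A in finite_subsets_at_top UNIV. nrm torus (%x. f x - (\<Sum>k\<in>A. inn torus f (cas k) * cas k x)) < e / 2"
   using e by (intro order_tendstoD(2)[OF torus.expansion_tendsto] L2_sqi f) auto
  then obtain A where A: "finite A" "nrm torus (%x. f x - (\<Sum>k\<in>A. inn torus f (cas k) * cas k x)) < e / 2"
   unfolding eventually_finite_subsets_at_top by blast
  \<comment> \<open>Accuracy per coefficient: the squared error of the combination is at most
    \<open>card A * d^2\<close>, which is at most \<open>(e / 2)^2\<close>. Adding 1 avoids division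
    by zero.\<close>
  define d where "d = e / (2 * (real (card A) + 1))"
  have d: "0 < d" using e by (simp add: d_def)
  have "\<exists>q. \<bar>inn torus f (cas k) - of_rat q\<bar> < d" for k
  proof -
   obtain q where "inn torus f (cas k) - d < of_rat q" "of_rat q < inn torus f (cas k) + d"
    using of_rat_dense[of "inn torus f (cas k) - d" "inn torus f (cas k) + d"] d by auto
   then show ?thesis by (intro exI[of _ q]) (simp add: abs_less_iff)
  qed
  then obtain q where q: "!!k. \<bar>inn torus f (cas k) - of_rat (q k)\<bar> < d" by metis
  obtain ks where ks: "set ks = A" "distinct ks" using finite_distinct_list[OF A(1)] by blast
  have pl: "p (map (%k. (k, q k)) ks) x = (\<Sum>k\<in>A. of_rat (q k) * cas k x)" for x
   using ks by (simp add: p_def comp_def sum_list_distinct_conv_sum_set)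
  have "nrm torus (%x. (\<Sum>k\<in>A. inn torus f (cas k) * cas k x) - (\<Sum>k\<in>A. of_rat (q k) * cas k x)) <= e / 2"
  proof (rule power2_le_imp_le)
   have "(nrm torus (%x. (\<Sum>k\<in>A. inn torus f (cas k) * cas k x) - (\<Sum>k\<in>A. of_rat (q k) * cas k x)))\<^sup>2
     = (\<Sum>k\<in>A. (inn torus f (cas k) - of_rat (q k))\<^sup>2)"
    using torus.lincomb_nrm[OF A(1), of "%k. inn torus f (cas k) - of_rat (q k)"]
    by (simp add: sum_subtractf left_diff_distrib)
   also have "... <= (\<Sum>k\<in>A. d\<^sup>2)"
    using q by (intro sum_mono) (metis abs_ge_zero less_imp_le power2_abs power_mono)
   also have "... = real (card A) * d\<^sup>2" by simp
   also have "... <= (real (card A) + 1)\<^sup>2 * d\<^sup>2"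
    by (intro mult_right_mono) (auto simp: power2_eq_square algebra_simps)
   also have "... = ((real (card A) + 1) * d)\<^sup>2" by (simp only: power_mult_distrib)
   also have "(real (card A) + 1) * d = e / 2"
    using add_nonneg_pos[of "real (card A)" 1] by (simp add: d_def field_simps)
   finally show "(nrm torus (%x. (\<Sum>k\<in>A. inn torus f (cas k) * cas k x) - (\<Sum>k\<in>A. of_rat (q k) * cas k x)))\<^sup>2 <= (e / 2)\<^sup>2" .
  qed (use e in simp)
  then have "nrm torus (%x. f x - p (map (%k. (k, q k)) ks) x) < e"
   using A(2) nrm_diff_triangle[OF L2_sqi[OF f], of "%x. \<Sum>k\<in>A. inn torus f (cas k) * cas k x" "%x. \<Sum>k\<in>A. of_rat (q k) * cas k x"]
   by (simp add: pl sqi_lincomb)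
  then show "\<exists>d\<in>range p. nrm torus (%x. f x - d x) < e" by blast
 qed
qed

text \<open>By separability an open set is a countable union of balls with centres in a dense set
  and rational radii. Preimages of balls are measurable because norms of differences are determined
  by the coefficients.\<close>

lemma measurable_L2I:
 fixes X :: "'w => real ^ 'd::finite => real"
 assumes X: "!!w. w \<in> space N ==> X w \<in> L2"
  and m: "!!k. (%w. inn torus (X w) (cas k)) \<in> borel_measurable N"
 shows "X \<in> N \<rightarrow>\<^sub>M borel_of L2_topology"
proof -
 obtain D :: "(real ^ 'd => real) set" where D: "countable D" "D \<subseteq> L2"
  "!!f e. f \<in> L2 ==> 0 < e ==> \<exists>d\<in>D. nrm torus (%x. f x - d x) < e"
  using L2_countable_dense by blast
 have nm: "(%w. nrm torus (%x. X w x - d x)) \<in> borel_measurable N" if "d \<in> D" for d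
 proof (rule nrm_torus_measurable)
  have d: "d \<in> sqi torus" using that D(2) by (auto simp: L2_sqi)
  then show "(%x. X w x - d x) \<in> sqi torus" if "w \<in> space N" for w
   using X[OF that] by (auto intro: sqi_diff L2_sqi)
  have "(%w. inn torus (%x. X w x - d x) (cas k)) \<in> borel_measurable N \<longleftrightarrow>
    (%w. inn torus (X w) (cas k) - inn torus d (cas k)) \<in> borel_measurable N" for k
   using X d by (intro measurable_cong) (auto simp: inn_diff_left L2_sqi)
  then show "(%w. inn torus (%x. X w x - d x) (cas k)) \<in> borel_measurable N" for k using m by simp
 qed
 have "X -` U \<inter> space N \<in> sets N" if U: "L2_open U" for U
 proof -
  define I where "I = {(d, r). d \<in> D & r \<in> \<rat> & (\<forall>g\<in>L2. nrm torus (%x. g x - d x) < r --> g \<in> U)}"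
  have "countable I"
   by (rule countable_subset[of _ "D \<times> \<rat>"]) (auto simp: I_def D(1) countable_rat)
  moreover have "X -` U \<inter> space N = (\<Union>(d, r)\<in>I. {w\<in>space N. nrm torus (%x. X w x - d x) < r})"
  proof (intro equalityI subsetI)
   fix w assume w: "w \<in> X -` U \<inter> space N"
   then obtain r where r: "0 < r" "!!g. g \<in> L2 ==> nrm torus (%x. g x - X w x) < r ==> g \<in> U"
    using U unfolding L2_open_def L2norm_eq by blast
   have Xw: "X w \<in> L2" using w X by auto
   obtain d where d: "d \<in> D" "nrm torus (%x. X w x - d x) < r / 3" using D(3)[OF Xw, of "r / 3"] r(1) by auto
   \<comment> \<open>The centre lies within \<open>r / 3\<close> of \<open>X w\<close>. A radius
     above \<open>r / 3\<close> captures \<open>X w\<close>, and one below \<open>r / 2\<close>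
     keeps the ball inside the \<open>r\<close>-ball around \<open>X w\<close>.\<close>
   obtain q where q: "q \<in> \<rat>" "r / 3 < q" "q < r / 2" using Rats_dense_in_real[of "r / 3" "r / 2"] r(1) by auto
   have "g \<in> U" if g: "g \<in> L2" "nrm torus (%x. g x - d x) < q" for g
   proof (rule r(2)[OF g(1)])
    have "d \<in> L2" using d D by auto
    then have "nrm torus (%x. g x - X w x) <= nrm torus (%x. g x - d x) + nrm torus (%x. d x - X w x)"
     using g Xw by (intro nrm_diff_triangle) (auto simp: L2_sqi)
    also have "... < r" using g(2) d(2) q by (simp add: nrm_minus_commute[of torus d])
    finally show "nrm torus (%x. g x - X w x) < r" .
   qed
   then have "(d, q) \<in> I" using d q by (simp add: I_def)
   then show "w \<in> (\<Union>(d, r)\<in>I. {w\<in>space N. nrm torus (%x. X w x - d x) < r})"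
    using w d q by force
  qed (use X in \<open>auto simp: I_def\<close>)
  moreover have "{w\<in>space N. nrm torus (%x. X w x - d x) < r} \<in> sets N" if "(d, r) \<in> I" for d r
   using nm[of d] that by (intro borel_measurable_less) (auto simp: I_def)
  ultimately show ?thesis by (auto intro!: sets.countable_UN')
 qed
 then show ?thesis
  unfolding borel_of_def topspace_L2_topology openin_L2_topology
  using X by (intro measurable_measure_of) (auto simp: L2_open_def)
qed

lemma measurable_L2_coeff:
 assumes "X \<in> N \<rightarrow>\<^sub>M borel_of L2_topology" "f \<in> L2"
 shows "(%w. inn torus (X w) f) \<in> borel_measurable N"
 by (rule measurable_compose[OF assms(1) inn_L2_measurable[OF assms(2)]])

text \<open>The essential supremum is lower semicontinuous in L2: if the modulus of \<open>f\<close>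
  exceeds \<open>z'\<close> on a set \<open>E\<close> of positive measure and that of
  \<open>g\<close> is at most \<open>c' < z'\<close> almost everywhere, the squared distance of
  \<open>f\<close> and \<open>g\<close> is at least
  \<open>(z' - c')^2 * measure torus E\<close>.\<close>

lemma Linf_norm_measurable:
 "(Linf_norm :: (real ^ 'd::finite => real) => ennreal) \<in> borel_measurable (borel_of L2_topology)"
proof (rule borel_measurableI_greater)
 fix c :: ennreal
 have "L2_open {f \<in> L2. c < Linf_norm (f :: real ^ 'd => real)}"
  unfolding L2_open_def
 proof (intro conjI ballI)
  fix f :: "real ^ 'd => real" assume "f \<in> {f \<in> L2. c < Linf_norm f}"
  then have f: "f \<in> L2" "c < Linf_norm f" by auto
  have [measurable]: "f \<in> borel_measurable borel" using f(1) by (simp add: L2_def)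
  obtain z where z: "c < z" "z < Linf_norm f" using dense[OF f(2)] by blast
  then obtain z' c' where zc: "z = ennreal z'" "c = ennreal c'" "0 <= c'" "c' < z'"
   by (cases z; cases c) (auto simp: ennreal_less_iff)
  interpret finite_measure "torus :: (real ^ 'd) measure" by (rule finite_measure_torus)
  define E where "E = {x. z' < \<bar>f x\<bar>}"
  have [measurable]: "E \<in> sets borel" unfolding E_def by measurable
  have "0 < emeasure torus {x \<in> space torus. z < ennreal \<bar>f x\<bar>}"
   using z(2) unfolding Linf_norm_def by (intro esssup_pos_measure) auto
  moreover have "{x \<in> space torus. z < ennreal \<bar>f x\<bar>} = E"
   using zc by (auto simp: E_def ennreal_less_iff)
  ultimately have dpos: "0 < measure torus E" by (simp add: emeasure_eq_measure)
  show "\<exists>r>0. \<forall>g\<in>L2. L2norm (%x. g x - f x) < r --> g \<in> {f \<in> L2. c < Linf_norm f}"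
  proof (intro exI[of _ "sqrt ((z' - c')\<^sup>2 * measure torus E)"] conjI ballI impI)
   show "0 < sqrt ((z' - c')\<^sup>2 * measure torus E)" using zc dpos by simp
   fix g :: "real ^ 'd => real" assume g: "g \<in> L2" "L2norm (%x. g x - f x) < sqrt ((z' - c')\<^sup>2 * measure torus E)"
   have [measurable]: "g \<in> borel_measurable borel" using g(1) by (simp add: L2_def)
   have "c < Linf_norm g"
   proof (rule ccontr)
    assume "\<not> c < Linf_norm g"
    then have "AE x in torus. ennreal \<bar>g x\<bar> <= c"
     using esssup_AE[of "%x. ennreal \<bar>g x\<bar>" torus] unfolding Linf_norm_def
     by (auto elim: eventually_mono)
    then have ae: "AE x in torus. \<bar>g x\<bar> <= c'" using zc by (auto simp: ennreal_le_iff)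
    have sq: "(%x. g x - f x) \<in> sqi torus" using f g by (intro sqi_diff L2_sqi)
    have "(z' - c')\<^sup>2 * measure torus E = (LINT x|torus. (z' - c')\<^sup>2 * indicator E x)" by simp
    also have "... <= (LINT x|torus. (g x - f x)\<^sup>2)"
    proof (rule integral_mono_AE)
     show "AE x in torus. (z' - c')\<^sup>2 * indicator E x <= (g x - f x)\<^sup>2"
      using ae
     proof eventually_elim
      case (elim x)
      show ?case
      proof (cases "x \<in> E")
       case True
       then have "z' - c' <= \<bar>g x - f x\<bar>" using elim by (auto simp: E_def)
       then have "(z' - c')\<^sup>2 <= \<bar>g x - f x\<bar>\<^sup>2" using zc by (intro power_mono) auto
       then show ?thesis using True by simp
      qed simp
     qed
    qed (use sqi_integrable_power2[OF sq] in \<open>auto simp: emeasure_eq_measure\<close>)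
    also have "... = (L2norm (%x. g x - f x))\<^sup>2"
     unfolding L2norm_eq nrm_power2 by (simp add: inn_def power2_eq_square)
    finally have "sqrt ((z' - c')\<^sup>2 * measure torus E) <= L2norm (%x. g x - f x)"
     by (intro real_le_lsqrt) (auto simp: L2norm_eq)
    then show False using g(2) by simp
   qed
   then show "g \<in> {f \<in> L2. c < Linf_norm f}" using g by simp
  qed
 qed auto
 then show "{f \<in> space (borel_of L2_topology). c < Linf_norm (f :: real ^ 'd => real)} \<in> sets (borel_of L2_topology)"
  by (simp add: L2_open_in_sets)
qed

subsection \<open>The time interval\<close>

abbreviation itv :: "real => real measure" where
 "itv T \<equiv> lebesgue_on {0..T}"

lemma finite_measure_itv: "finite_measure (itv T)"
 by (intro finite_measure_lebesgue_on) auto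

lemma space_itv [simp]: "space (itv T) = {0..T}"
 by (simp add: space_restrict_space)

lemma measure_itv: "0 <= T ==> measure (itv T) {0..T} = T"
 by (simp add: measure_restrict_space)

lemma AE_itv: "(AE t in itv T. P t) \<longleftrightarrow> (AE t in lborel. t \<in> {0..T} --> P t)"
 by (subst AE_restrict_space_iff) (auto simp: AE_completion_iff)

lemma AE_itv_null:
 assumes "AE t in itv T. P t"
 obtains N where "N \<in> null_sets lborel" "!!t. t \<in> {0..T} ==> t \<notin> N ==> P t"
proof -
 from assms have "AE t in lborel. t \<in> {0..T} --> P t" by (simp only: AE_itv)
 then obtain N where "{t \<in> space lborel. \<not> (t \<in> {0..T} --> P t)} \<subseteq> N" "N \<in> null_sets lborel"
  unfolding eventually_ae_filter by blast
 then show thesis by (intro that[of N]) auto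
qed

lemma measurable_itv_borel:
 assumes "f \<in> restrict_space borel {0..T} \<rightarrow>\<^sub>M N"
 shows "f \<in> itv T \<rightarrow>\<^sub>M N"
proof (rule measurableI)
 show "f t \<in> space N" if "t \<in> space (itv T)" for t
  using measurable_space[OF assms, of t] that by (simp add: space_restrict_space)
 fix A assume "A \<in> sets N"
 then have "f -` A \<inter> {0..T} \<in> sets (restrict_space borel {0..T})"
  using measurable_sets[OF assms] by (simp add: space_restrict_space)
 then obtain B where "B \<in> sets borel" "f -` A \<inter> {0..T} = {0..T} \<inter> B"
  unfolding sets_restrict_space by blast
 then have "B \<in> sets lebesgue" "f -` A \<inter> {0..T} = {0..T} \<inter> B" by auto
 then show "f -` A \<inter> space (itv T) \<in> sets (itv T)"
  unfolding sets_restrict_space space_itv by blast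
qed

lemma borel_measurable_itv_borel: "f \<in> borel_measurable borel ==> f \<in> borel_measurable (itv T)"
 by (intro measurable_itv_borel measurable_restrict_space1)

text \<open>Completeness of Lebesgue measure is what makes measurability insensitive to null sets of
  times, for instance those where \<open>wdiv\<close> is meaningless.\<close>

lemma borel_measurable_itv_AE:
 fixes f g :: "real => real"
 assumes f: "f \<in> borel_measurable (itv T)" and fg: "AE t in itv T. f t = g t"
 shows "g \<in> borel_measurable (itv T)"
proof -
 have "(%t. if t \<in> {0..T} then f t else 0) \<in> borel_measurable lebesgue"
  using f by (subst borel_measurable_if) auto
 moreover have "AE t in lebesgue. (if t \<in> {0..T} then f t else 0) = (if t \<in> {0..T} then g t else 0)"
  using fg by (subst (asm) AE_restrict_space_iff) (auto elim: eventually_mono)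
 ultimately have "(%t. if t \<in> {0..T} then g t else 0) \<in> borel_measurable lebesgue"
  by (rule borel_measurable_AE)
 then show ?thesis by (subst (asm) borel_measurable_if) auto
qed

lemma itv_borel_version:
 fixes f :: "real => real"
 assumes f: "f \<in> borel_measurable (itv T)"
 obtains g where "g \<in> borel_measurable borel" "AE t in itv T. f t = g t"
proof -
 have "(%t. if t \<in> {0..T} then f t else 0) \<in> borel_measurable lebesgue"
  using f by (subst borel_measurable_if) auto
 then obtain g where g: "g \<in> borel_measurable lborel"
  "AE t in lborel. (if t \<in> {0..T} then f t else 0) = g t"
  using completion_ex_borel_measurable_real by blast
 then have "AE t in itv T. f t = g t"
  unfolding AE_itv by (auto elim: eventually_mono)
 then show thesis using that g by auto
qed

lemma set_integral_itv: "(LINT t:{0..T}|lebesgue. f t) = (LINT t|itv T. (f t :: real))"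
 unfolding set_lebesgue_integral_def by (subst integral_restrict_space) auto

lemma set_nn_integral_itv: "(\<integral>\<^sup>+t\<in>{0..T}. f t \<partial>lebesgue) = (\<integral>\<^sup>+t. f t \<partial>itv T)"
 by (subst nn_integral_restrict_space) (auto simp: mult.commute)

lemma continuous_integrable_itv:
 "continuous_on {0..T} f ==> integrable (itv T) (f :: real => real)"
 by (rule continuous_imp_integrable_real)

lemma integral_itv_FTC:
 fixes F f :: "real => real"
 assumes T: "0 <= T" and F: "!!t. t \<in> {0..T} ==> (F has_real_derivative f t) (at t within {0..T})"
  and f: "continuous_on {0..T} f"
 shows "(LINT t|itv T. f t) = F T - F 0"
proof -
 have "(f has_integral F T - F 0) {0..T}"
  using F by (intro fundamental_theorem_of_calculus T) (simp add: has_real_derivative_iff_has_vector_derivative)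
 then show ?thesis
  using lebesgue_integral_eq_integral[OF continuous_integrable_itv[OF f]] by (simp add: integral_unique)
qed

section \<open>The cosine basis in time\<close>

lemma integral_cos_itv:
 assumes T: "0 < T"
 shows "(LINT t|itv T. cos (real_of_int j * pi * t / T)) = (if j = 0 then T else 0)"
proof (cases "j = 0")
 case True
 then show ?thesis using T by (simp add: measure_itv)
next
 case False
 have "(LINT t|itv T. cos (real_of_int j * pi * t / T))
   = (T / (j * pi)) * sin (j * pi * T / T) - (T / (j * pi)) * sin (j * pi * 0 / T)"
 proof (rule integral_itv_FTC)
  show "((%t. T / (j * pi) * sin (j * pi * t / T)) has_real_derivative cos (j * pi * t / T)) (at t within {0..T})" for t
   using T False by (auto intro!: derivative_eq_intros)
 qed (use T in \<open>auto intro!: continuous_intros\<close>)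
 also have "... = 0" using T sin_npi_int[of j] by (simp add: mult.commute)
 finally show ?thesis using False by simp
qed

text \<open>The normalized eigenfunctions of the second derivative with Neumann conditions. Cosines
  alone suffice on an interval because \<open>cos (pi * t / T)\<close> is injective there.\<close>

definition tcos :: "real => nat => real => real" where
 "tcos T m t = (if m = 0 then sqrt (1 / T) else sqrt (2 / T) * cos (real m * pi * t / T))"

lemma tcos_continuous: "continuous_on A (tcos T m)"
 unfolding tcos_def[abs_def] divide_inverse by (cases "m = 0") (auto intro!: continuous_intros)

lemma tcos_sqi [simp]: "tcos T m \<in> sqi (itv T)"
proof -
 have "continuous_on {0..T} (%t. (tcos T m t)\<^sup>2)" by (intro continuous_intros tcos_continuous)
 then have "integrable (itv T) (%t. (tcos T m t)\<^sup>2)" by (rule continuous_integrable_itv)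
 moreover have "tcos T m \<in> borel_measurable (itv T)"
  by (intro borel_measurable_itv_borel borel_measurable_continuous_onI tcos_continuous)
 ultimately show ?thesis by (simp add: sqi_def)
qed

lemma tcos_orthonormal:
 assumes T: "0 < T"
 shows "inn (itv T) (tcos T m) (tcos T n) = (if m = n then 1 else 0)"
proof -
 let ?c = "%j t. cos (real_of_int j * pi * t / T)"
 have int: "integrable (itv T) (?c j)" for j
  by (intro continuous_integrable_itv continuous_intros) (use T in auto)
 define a where "a m = (if m = 0 then sqrt (1 / T) else sqrt (2 / T))" for m :: nat
 have tc: "tcos T m t = a m * cos (real m * pi * t / T)" for m t by (simp add: tcos_def a_def)
 have "inn (itv T) (tcos T m) (tcos T n)
   = (LINT t|itv T. (a m * a n / 2) * (?c (int m - int n) t + ?c (int m + int n) t))"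
  unfolding inn_def tc
  by (intro Bochner_Integration.integral_cong) (auto simp: cos_add cos_diff ring_distribs add_divide_distrib diff_divide_distrib)
 also have "... = (a m * a n / 2) * ((if m = n then T else 0) + (if m = 0 & n = 0 then T else 0))"
  by (simp add: int integral_cos_itv[OF T] del: of_int_diff of_int_add of_int_of_nat_eq)
 also have "... = (if m = n then 1 else 0)"
  using T by (auto simp: a_def)
 finally show ?thesis .
qed


inductive cos_poly :: "real => (real => real) => bool" for T where
 scale: "cos_poly T (%t. c * cos (real m * pi * t / T))"
| add: "cos_poly T f ==> cos_poly T g ==> cos_poly T (%t. f t + g t)"

lemma cos_poly_mult_cos: "cos_poly T f ==> cos_poly T (%t. c * cos (real n * pi * t / T) * f t)"
proof (induction rule: cos_poly.induct)
 case (scale e m)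
 have "cos_poly T (%t. (c * e / 2) * cos (real (nat \<bar>int n - int m\<bar>) * pi * t / T)
   + (c * e / 2) * cos (real (n + m) * pi * t / T))"
  by (intro cos_poly.intros)
 moreover have "(c * e / 2) * cos (real (nat \<bar>int n - int m\<bar>) * pi * t / T) + (c * e / 2) * cos (real (n + m) * pi * t / T)
   = c * cos (real n * pi * t / T) * (e * cos (real m * pi * t / T))" for t
 proof -
  have "cos (real (nat \<bar>int n - int m\<bar>) * pi * t / T) = cos ((real n - real m) * pi * t / T)"
  proof (cases "m <= n")
   case False
   then have "cos ((real n - real m) * pi * t / T) = cos (- ((real n - real m) * pi * t / T))" by simp
   also have "- ((real n - real m) * pi * t / T) = real (nat \<bar>int n - int m\<bar>) * pi * t / T"
    using False by (simp add: of_nat_diff minus_divide_left algebra_simps)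
   finally show ?thesis by simp
  qed (simp add: of_nat_diff)
  then show ?thesis
   by (simp add: cos_add cos_diff ring_distribs add_divide_distrib diff_divide_distrib)
 qed
 ultimately show ?case by simp
next
 case (add f g)
 show ?case unfolding distrib_left by (rule cos_poly.add; rule add.IH)
qed

lemma cos_poly_mult: "cos_poly T f ==> cos_poly T g ==> cos_poly T (%t. f t * g t)"
proof (induction rule: cos_poly.induct)
 case (scale c m) then show ?case by (rule cos_poly_mult_cos)
next
 case (add f g')
 show ?case unfolding distrib_right by (rule cos_poly.add; rule add.IH; rule add.prems)
qed

lemma cos_poly_polynomial:
 "real_polynomial_function p ==> cos_poly T (%t. p (cos (pi * t / T)))"
proof (induction rule: real_polynomial_function.induct)
 case (linear p)
 then interpret bounded_linear p .
 have "p (cos (pi * t / T)) = p 1 * cos (real 1 * pi * t / T)" for t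
  using scaleR[of "cos (pi * t / T)" 1] by simp
 then show ?case by (simp only:) (rule cos_poly.scale)
next
 case (const c) show ?case using cos_poly.scale[of T c 0] by simp
next
 case (add f g) then show ?case by (intro cos_poly.add)
next
 case (mult f g) then show ?case by (intro cos_poly_mult)
qed

lemma integral_itv_lborel:
 fixes g :: "real => real"
 assumes g: "g \<in> borel_measurable borel"
 shows "(LINT t|restrict_space lborel {0..T}. g t) = (LINT t|itv T. g t)"
  and "integrable (restrict_space lborel {0..T}) g \<longleftrightarrow> integrable (itv T) g"
proof -
 have [measurable]: "(%t. indicator {0..T} t *\<^sub>R g t) \<in> borel_measurable lborel" using g by auto
 show "(LINT t|restrict_space lborel {0..T}. g t) = (LINT t|itv T. g t)"
  using integral_completion[OF \<open>(%t. indicator {0..T} t *\<^sub>R g t) \<in> _\<close>]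
  by (subst (1 2) integral_restrict_space) auto
 show "integrable (restrict_space lborel {0..T}) g \<longleftrightarrow> integrable (itv T) g"
  using integrable_completion[OF \<open>(%t. indicator {0..T} t *\<^sub>R g t) \<in> _\<close>]
  by (simp add: integrable_restrict_space)
qed

text \<open>Polynomials in \<open>cos (pi * t / T)\<close> are cosine sums, and
  \<open>arccos\<close> inverts this map on the interval. The function is first replaced by a Borel
  version, since the inverse has to be Borel measurable into the time interval and not into its
  completion.\<close>

lemma tcos_total:
 assumes T: "0 < T" and f: "f \<in> sqi (itv T)" and z: "!!m. inn (itv T) f (tcos T m) = 0"
 shows "AE t in itv T. f t = 0"
proof -
 have fi: "integrable (itv T) f" by (rule integral_abs_le_nrm(1)[OF finite_measure_itv f])
 obtain g where g [measurable]: "g \<in> borel_measurable borel" and fg: "AE t in itv T. f t = g t"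
  using itv_borel_version[OF sqi_measurable[OF f]] by blast
 have gm: "g \<in> borel_measurable (itv T)" by (intro borel_measurable_itv_borel g)
 have gi: "integrable (itv T) g"
  using fi fg sqi_measurable[OF f] gm by (subst integrable_cong_AE[of g _ f]) (auto elim: eventually_mono)
 have "AE t in restrict_space lborel {0..T}. g t = 0"
 proof (rule polynomials_total[where P = "%t. cos (pi * t / T)" and K = "{- 1..1}"
   and Q = "%y. T / pi * arccos (max (- 1) (min 1 y))"])
  show "integrable (restrict_space lborel {0..T}) g" using gi by (simp add: integral_itv_lborel(2))
  show "(%t. cos (pi * t / T)) \<in> borel_measurable (restrict_space lborel {0..T})"
   by (intro measurable_restrict_space1) measurable
  fix p :: "real => real" assume p: "real_polynomial_function p"
  then have "cos_poly T (%t. p (cos (pi * t / T)))" by (rule cos_poly_polynomial)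
  then have "(%t. p (cos (pi * t / T))) \<in> sqi (itv T) & inn (itv T) f (%t. p (cos (pi * t / T))) = 0"
  proof (induction rule: cos_poly.induct)
   case (scale c m)
   define a where "a = (if m = 0 then c / sqrt (1 / T) else c / sqrt (2 / T))"
   have e: "c * cos (real m * pi * t / T) = a * tcos T m t" for t
    using T by (auto simp: a_def tcos_def)
   show ?case unfolding e using z by (auto simp: inn_scale_right intro: sqi_scale)
  next
   case (add h k) then show ?case using f by (auto simp: inn_add_right intro: sqi_add)
  qed
  then have "(LINT t|itv T. f t * p (cos (pi * t / T))) = 0" by (simp add: inn_def)
  moreover have "continuous_on UNIV p"
   using p continuous_on_polymonial_function real_polynomial_function_eq by blast
  then have [measurable]: "p \<in> borel_measurable borel" by (rule borel_measurable_continuous_onI)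
  have m: "(%t. p (cos (pi * t / T))) \<in> borel_measurable borel" by measurable
  have "(LINT t|itv T. f t * p (cos (pi * t / T))) = (LINT t|itv T. g t * p (cos (pi * t / T)))"
   using fg sqi_measurable[OF f] gm borel_measurable_itv_borel[OF m, of T]
   by (intro integral_cong_AE borel_measurable_times) auto
  ultimately show "(LINT t|restrict_space lborel {0..T}. g t * p (cos (pi * t / T))) = 0"
   by (subst integral_itv_lborel(1)) auto
 next
  have "continuous_on UNIV (%y. arccos (max (- 1) (min 1 y)))"
   by (intro continuous_on_arccos continuous_intros) auto
  then have [measurable]: "(%y. arccos (max (- 1) (min 1 y))) \<in> borel_measurable borel"
   by (rule borel_measurable_continuous_onI)
  have "0 <= arccos (max (- 1) (min 1 y))" "arccos (max (- 1) (min 1 y)) <= pi" for y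
   by (auto intro!: arccos_lbound arccos_ubound)
  then show "(%y. T / pi * arccos (max (- 1) (min 1 y))) \<in> borel \<rightarrow>\<^sub>M restrict_space lborel {0..T}"
   using T by (intro measurable_restrict_space2) (auto simp: field_simps)
  show "AE t in restrict_space lborel {0..T}. T / pi * arccos (max (- 1) (min 1 (cos (pi * t / T)))) = t"
  proof (rule AE_I2)
   fix t assume "t \<in> space (restrict_space lborel {0..T})"
   then have t: "0 <= t" "t <= T" by (auto simp: space_restrict_space)
   then have "arccos (cos (pi * t / T)) = pi * t / T" using T by (intro arccos_cos) (auto simp: field_simps)
   then show "T / pi * arccos (max (- 1) (min 1 (cos (pi * t / T)))) = t" using T by simp
  qed
 qed auto
 then have "AE t in itv T. g t = 0" unfolding AE_itv by (subst (asm) AE_restrict_space_iff) auto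
 with fg show ?thesis by eventually_elim simp
qed

lemma onb_tcos: "0 < T ==> onb (itv T) (tcos T)"
 by (rule onb.intro) (auto intro: finite_measure_itv tcos_total simp: tcos_orthonormal)

subsection \<open>Strongly measurable functions of time\<close>

lemma strongly_measurableD:
 assumes "strongly_measurable T f"
 shows "AE t in itv T. f t \<in> L2"
  and "k \<in> L2 ==> (%t. inn torus (f t) k) \<in> borel_measurable (itv T)"
proof -
 obtain g where g: "g \<in> restrict_space borel {0..T} \<rightarrow>\<^sub>M borel_of L2_topology"
  and fg: "AE t in itv T. f t \<in> L2 & eqT (f t) (g t)"
  using assms unfolding strongly_measurable_def by blast
 show "AE t in itv T. f t \<in> L2" using fg by eventually_elim simp
 show "(%t. inn torus (f t) k) \<in> borel_measurable (itv T)" if k: "k \<in> L2"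
 proof (rule borel_measurable_itv_AE)
  show "(%t. inn torus (g t) k) \<in> borel_measurable (itv T)"
   by (rule measurable_L2_coeff[OF measurable_itv_borel[OF g] k])
  have "AE t in itv T. t \<in> {0..T}" unfolding AE_itv by simp
  then show "AE t in itv T. inn torus (g t) k = inn torus (f t) k"
   using fg
  proof eventually_elim
   case (elim t)
   then have "g t \<in> L2" using measurable_space[OF g, of t] by (simp add: space_restrict_space)
   then show ?case using elim k by (intro eqT_inn[symmetric] L2_sqi) auto
  qed
 qed
qed

text \<open>There are countably many coefficients. Each has a Borel version, and on the union of the
  exceptional null sets the function is replaced by zero; \<open>measurable_L2I\<close> then
  applies.\<close>

lemma strongly_measurableI:
 fixes f :: "real => real ^ 'd::finite => real"
 assumes f: "AE t in itv T. f t \<in> L2"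
  and m: "!!k. (%t. inn torus (f t) (cas k)) \<in> borel_measurable (itv T)"
 shows "strongly_measurable T f"
proof -
 have "\<exists>c. c \<in> borel_measurable borel & (AE t in itv T. inn torus (f t) (cas k) = c t)" for k
  using itv_borel_version[OF m[of k]] by blast
 then obtain c where c: "!!k. c k \<in> borel_measurable borel"
  "!!k. AE t in itv T. inn torus (f t) (cas k) = c k t" by metis
 have "AE t in itv T. f t \<in> L2 & (\<forall>k. inn torus (f t) (cas k) = c k t)"
  using f c(2) by (simp add: AE_all_countable)
 then obtain N where N: "N \<in> null_sets lborel"
  "!!t. t \<in> {0..T} ==> t \<notin> N ==> f t \<in> L2 & (\<forall>k. inn torus (f t) (cas k) = c k t)"
  by (rule AE_itv_null) blast
 define g where "g t = (if t \<in> N then (%x. 0) else f t)" for t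
 have [measurable]: "N \<in> sets borel" using N(1) by auto
 have "g \<in> restrict_space borel {0..T} \<rightarrow>\<^sub>M borel_of L2_topology"
 proof (rule measurable_L2I)
  show "g t \<in> L2" if "t \<in> space (restrict_space borel {0..T})" for t
   using N(2) that by (auto simp: g_def L2_zero space_restrict_space)
  fix k
  have "(%t. if t \<in> N then 0 else c k t) \<in> borel_measurable (restrict_space borel {0..T})"
   by (intro measurable_restrict_space1 measurable_If_set measurable_const c(1)) auto
  then show "(%t. inn torus (g t) (cas k)) \<in> borel_measurable (restrict_space borel {0..T})"
   by (rule measurable_cong[THEN iffD1, rotated]) (auto simp: g_def N(2) space_restrict_space)
 qed
 moreover have "AE t in itv T. f t \<in> L2 & eqT (f t) (g t)"
 proof -
  have "AE t in lborel. t \<notin> N" using N(1) by (rule AE_not_in)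
  then show ?thesis unfolding AE_itv by eventually_elim (use N(2) in \<open>auto simp: g_def eqT_def\<close>)
 qed
 ultimately show ?thesis unfolding strongly_measurable_def by blast
qed

lemma strongly_measurable_inn:
 fixes f g :: "real => real ^ 'd::finite => real"
 assumes f: "strongly_measurable T f" and g: "strongly_measurable T g"
 shows "(%t. inn torus (f t) (g t)) \<in> borel_measurable (itv T)"
proof -
 define f' where "f' t = (if f t \<in> L2 & g t \<in> L2 then f t else (%x. 0))" for t
 define g' where "g' t = (if f t \<in> L2 & g t \<in> L2 then g t else (%x. 0))" for t
 have ae: "AE t in itv T. f t = f' t & g t = g' t"
  using strongly_measurableD(1)[OF f] strongly_measurableD(1)[OF g]
  by eventually_elim (simp add: f'_def g'_def)
 have "(%t. inn torus (f' t) (cas k)) \<in> borel_measurable (itv T)"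
  "(%t. inn torus (g' t) (cas k)) \<in> borel_measurable (itv T)" for k
  by (rule borel_measurable_itv_AE[OF strongly_measurableD(2)[OF f cas_L2[of k]]],
    use ae in \<open>auto elim: eventually_mono\<close>)
   (rule borel_measurable_itv_AE[OF strongly_measurableD(2)[OF g cas_L2[of k]]],
    use ae in \<open>auto elim: eventually_mono\<close>)
 then have "(%t. inn torus (f' t) (g' t)) \<in> borel_measurable (itv T)"
  by (rule inn_torus_measurable[rotated 2]) (auto simp: f'_def g'_def sqi_zero L2_sqi)
 then show ?thesis by (rule borel_measurable_itv_AE) (use ae in \<open>auto elim: eventually_mono\<close>)
qed

lemma strongly_measurable_nrm:
 "strongly_measurable T f ==> (%t. nrm torus (f t)) \<in> borel_measurable (itv T)"
 unfolding nrm_def by (rule measurable_compose[OF strongly_measurable_inn borel_measurable_sqrt])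

lemma strongly_measurable_combine:
 fixes f g :: "real => real ^ 'd::finite => real"
 assumes f: "strongly_measurable T f" and g: "strongly_measurable T g"
  and a: "a \<in> borel_measurable (itv T)" and b: "b \<in> borel_measurable (itv T)"
 shows "strongly_measurable T (%t x. a t * f t x + b t * g t x)"
proof (rule strongly_measurableI)
 note ae = strongly_measurableD(1)[OF f] strongly_measurableD(1)[OF g]
 show "AE t in itv T. (%x. a t * f t x + b t * g t x) \<in> L2"
  using ae by eventually_elim (auto intro: L2_add L2_scale)
 fix k
 have "(%t. a t * inn torus (f t) (cas k) + b t * inn torus (g t) (cas k)) \<in> borel_measurable (itv T)"
  by (intro borel_measurable_add borel_measurable_times a b strongly_measurableD(2)[OF f] strongly_measurableD(2)[OF g] cas_L2)
 then show "(%t. inn torus (%x. a t * f t x + b t * g t x) (cas k)) \<in> borel_measurable (itv T)"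
 proof (rule borel_measurable_itv_AE)
  show "AE t in itv T. a t * inn torus (f t) (cas k) + b t * inn torus (g t) (cas k)
    = inn torus (%x. a t * f t x + b t * g t x) (cas k)"
   using ae by eventually_elim (simp add: inn_add_left inn_scale_left sqi_scale L2_sqi)
 qed
qed

lemma strongly_measurable_const: "f \<in> L2 ==> strongly_measurable T (%t. f)"
 by (rule strongly_measurableI) auto

subsection \<open>A Hahn--Banach theorem in countable dimension\<close>

text \<open>The one-dimensional extension step in coordinates: a functional on finitely supported
  sequences is its list of values \<open>a i\<close> on unit vectors, and the value at the next unit
  vector has to be found.\<close>

lemma hahn_banach_step:
 fixes p :: "(nat => real) => real"
 assumes sub: "!!c d. finite {i. c i ~= 0} ==> finite {i. d i ~= 0} ==> p (%i. c i + d i) <= p c + p d"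
  and hom: "!!c r. finite {i. c i ~= 0} ==> 0 <= r ==> p (%i. r * c i) <= r * p c"
  and a: "!!c. \<forall>i\<ge>n. c i = 0 ==> (\<Sum>i<n. c i * a i) <= p c"
 obtains al where "!!c. \<forall>i\<ge>Suc n. c i = 0 ==> (\<Sum>i<n. c i * a i) + c n * al <= p c"
proof -
 define e where "e i = (if i = n then 1 else 0 :: real)" for i
 define V where "V = {c :: nat => real. \<forall>i\<ge>n. c i = 0}"
 have finV: "finite {i. c i ~= 0}" if "\<forall>i\<ge>m. c i = 0" for c :: "nat => real" and m
  by (rule finite_subset[of _ "{..<m}"]) (use that in \<open>auto simp: not_le[symmetric]\<close>)
 define L where "L c = (\<Sum>i<n. c i * a i)" for c
 have L: "L (%i. c i + d i) = L c + L d" "L (%i. r * c i) = r * L c" for c d r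
  by (simp_all add: L_def sum.distrib distrib_right sum_distrib_left mult.assoc)
 have key: "L c - p (%i. c i - e i) <= p (%i. d i + e i) - L d" if "c \<in> V" "d \<in> V" for c d
 proof -
  have "L c + L d = L (%i. c i + d i)" by (simp add: L)
  also have "... <= p (%i. c i + d i)" unfolding L_def using that by (intro a) (auto simp: V_def)
  also have "... = p (%i. (c i - e i) + (d i + e i))" by simp
  also have "... <= p (%i. c i - e i) + p (%i. d i + e i)"
   using that by (intro sub finV[of "Suc n"]) (auto simp: V_def e_def)
  finally show ?thesis by simp
 qed
 have z: "(%i. 0) \<in> V" by (simp add: V_def)
 \<comment> \<open>Subadditivity puts every lower constraint, from vectors minus \<open>e\<close>,
   below every upper one, from vectors plus \<open>e\<close>. The supremum of the lower constraints
   therefore satisfies both. Other values of the last coordinate follow by rescaling it to 1 or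
   -1.\<close>
 define al where "al = (SUP c\<in>V. L c - p (%i. c i - e i))"
 have up: "L c - p (%i. c i - e i) <= al" if "c \<in> V" for c
  unfolding al_def using key[OF _ z] that by (intro cSUP_upper bdd_aboveI2) auto
 have lo: "al <= p (%i. d i + e i) - L d" if "d \<in> V" for d
  unfolding al_def using key[OF _ that] z by (intro cSUP_least) auto
 show thesis
 proof
  fix c :: "nat => real" assume c: "\<forall>i\<ge>Suc n. c i = 0"
  define d where "d i = (if i = n then 0 else c i)" for i
  have d: "d \<in> V" using c by (auto simp: V_def d_def)
  have Ld: "(\<Sum>i<n. c i * a i) = L d" unfolding L_def by (intro sum.cong) (auto simp: d_def)
  have cd: "d i = c i" if "c n = 0" for i using that by (simp add: d_def)
  have sc: "(%i. r * d i) \<in> V" for r using d by (simp add: V_def)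
  have fin: "finite {i. c i ~= 0}" by (rule finV[OF c])
  have "L d + c n * al <= p c"
  proof (cases "c n" "0 :: real" rule: linorder_cases)
   case equal
   then have "d = c" using cd by blast
   then show ?thesis using a[of d] d equal by (simp add: L_def V_def)
  next
   case greater
   have "al <= p (%i. 1 / c n * d i + e i) - L (%i. 1 / c n * d i)" by (rule lo[OF sc])
   also have "(%i. 1 / c n * d i + e i) = (%i. 1 / c n * c i)"
    using greater by (simp add: d_def e_def fun_eq_iff)
   also have "p (%i. 1 / c n * c i) <= 1 / c n * p c" using greater by (intro hom fin) auto
   finally have "al <= 1 / c n * p c - 1 / c n * L d" by (simp only: L)
   then have "c n * al <= c n * (1 / c n * p c - 1 / c n * L d)" using greater by (intro mult_left_mono) auto
   also have "... = p c - L d" using greater by (simp add: right_diff_distrib)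
   finally show ?thesis by simp
  next
   case less
   let ?r = "1 / (- c n)"
   have "L (%i. ?r * d i) - p (%i. ?r * d i - e i) <= al" by (rule up[OF sc])
   moreover have "(%i. ?r * d i - e i) = (%i. ?r * c i)"
    using less by (simp add: d_def e_def fun_eq_iff)
   moreover have "p (%i. ?r * c i) <= ?r * p c" using less by (intro hom fin) auto
   ultimately have "?r * L d - ?r * p c <= al" by (simp only: L)
   then have "(- c n) * (?r * L d - ?r * p c) <= (- c n) * al" using less by (intro mult_left_mono) auto
   moreover have "(- c n) * (?r * L d - ?r * p c) = L d - p c" using less by (simp add: right_diff_distrib)
   ultimately show ?thesis by simp
  qed
  then show "(\<Sum>i<n. c i * a i) + c n * al <= p c" by (simp add: Ld)
 qed
qed

text \<open>Dependent choice extends the functional by one coordinate at a time, never altering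
  earlier values, so the values stabilize and define one sequence. A finitely supported vector sees
  only one of the stages.\<close>

lemma hahn_banach_nat:
 fixes p :: "(nat => real) => real"
 assumes sub: "!!c d. finite {i. c i ~= 0} ==> finite {i. d i ~= 0} ==> p (%i. c i + d i) <= p c + p d"
  and hom: "!!c r. finite {i. c i ~= 0} ==> 0 <= r ==> p (%i. r * c i) <= r * p c"
 obtains a where "!!c. finite {i. c i ~= 0} ==> (\<Sum>i | c i ~= 0. c i * a i) <= p c"
proof -
 define P where "P n a \<longleftrightarrow> (\<forall>c :: nat => real. (\<forall>i\<ge>n. c i = 0) --> (\<Sum>i<n. c i * a i) <= p c)" for n and a :: "nat => real"
 define Q where "Q n a b \<longleftrightarrow> (\<forall>i<n. b i = a i)" for n :: nat and a b :: "nat => real"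
 have "\<exists>f. \<forall>n. P n (f n) & Q n (f n) (f (Suc n))"
 proof (rule dependent_nat_choice)
  have "0 <= p (%i. 0)" using sub[of "%i. 0" "%i. 0"] by simp
  then have "P 0 (%i. 0)" unfolding P_def
   by (auto simp: fun_eq_iff[of _ "%i. 0", symmetric])
  then show "\<exists>a. P 0 a" by blast
  fix a n assume "P n a"
  then have a: "!!c. \<forall>i\<ge>n. c i = 0 ==> (\<Sum>i<n. c i * a i) <= p c" by (auto simp: P_def)
  obtain al where al: "!!c. \<forall>i\<ge>Suc n. c i = 0 ==> (\<Sum>i<n. c i * a i) + c n * al <= p c"
   by (rule hahn_banach_step[OF sub hom a]) blast+
  have "P (Suc n) (a(n := al))"
   unfolding P_def
  proof (intro allI impI)
   fix c :: "nat => real" assume "\<forall>i\<ge>Suc n. c i = 0"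
   then have "(\<Sum>i<n. c i * a i) + c n * al <= p c" by (rule al)
   then show "(\<Sum>i<Suc n. c i * (a(n := al)) i) <= p c" by simp
  qed
  then show "\<exists>b. P (Suc n) b & Q n a b" by (intro exI[of _ "a(n := al)"]) (auto simp: Q_def)
 qed
 then obtain f where f: "!!n. P n (f n)" "!!n i. i < n ==> f (Suc n) i = f n i" unfolding Q_def by blast
 have stable: "f n i = f (Suc i) i" if "i < n" for n i
  using that
 proof (induction n)
  case (Suc n)
  show ?case
  proof (cases "i = n")
   case False
   then show ?thesis using Suc f(2)[of i n] by simp
  qed simp
 qed simp
 show thesis
 proof
  fix c :: "nat => real" assume fin: "finite {i. c i ~= 0}"
  then obtain n where n: "{i. c i ~= 0} \<subseteq> {..<n}" by (auto simp: finite_nat_iff_bounded)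
  have "(\<Sum>i | c i ~= 0. c i * f (Suc i) i) = (\<Sum>i<n. c i * f (Suc i) i)"
   using n by (intro sum.mono_neutral_left) auto
  also have "... = (\<Sum>i<n. c i * f n i)" by (intro sum.cong refl) (metis lessThan_iff stable)
  also have "... <= p c"
  proof -
   have "c i = 0" if "n <= i" for i
   proof (rule ccontr)
    assume "c i ~= 0"
    then have "i \<in> {..<n}" using n by blast
    then show False using that by simp
   qed
   then show ?thesis using f(1)[of n] unfolding P_def by blast
  qed
  finally show "(\<Sum>i | c i ~= 0. c i * f (Suc i) i) <= p c" .
 qed
qed

lemma hahn_banach_countable:
 fixes p :: "('i::countable => real) => real"
 assumes sub: "!!c d. finite {i. c i ~= 0} ==> finite {i. d i ~= 0} ==> p (%i. c i + d i) <= p c + p d"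
  and hom: "!!c r. finite {i. c i ~= 0} ==> 0 <= r ==> p (%i. r * c i) <= r * p c"
 obtains a where "!!c S. finite S ==> (!!i. i \<notin> S ==> c i = 0) ==> (\<Sum>i\<in>S. c i * a i) <= p c"
proof -
 have fin: "finite {i :: 'i. c (to_nat i) ~= 0}" if "finite {n. c n ~= 0}" for c :: "nat => real"
  using finite_vimageI[OF that inj_to_nat] by (simp add: vimage_def)
 have "\<exists>a. \<forall>c. finite {i. c i ~= 0} --> (\<Sum>i | c i ~= 0. c i * a i) <= p (%i. c (to_nat i))"
  by (rule hahn_banach_nat[where p = "%c. p (%i. c (to_nat i))"]) (auto intro: sub hom fin)
 then obtain a where a: "!!c. finite {i. c i ~= 0} ==> (\<Sum>i | c i ~= 0. c i * a i) <= p (%i. c (to_nat i))"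
  by blast
 show thesis
 proof
  fix c :: "'i => real" and S assume S: "finite S" "!!i. i \<notin> S ==> c i = 0"
  define d where "d n = (if n \<in> range (to_nat :: 'i => nat) then c (from_nat n) else 0)" for n
  have supp: "{n. d n ~= 0} \<subseteq> to_nat ` S"
  proof
   fix n assume "n \<in> {n. d n ~= 0}"
   then obtain i where i: "n = to_nat (i :: 'i)" "c i ~= 0" by (auto simp: d_def split: if_splits)
   then have "i \<in> S" using S(2) by blast
   then show "n \<in> to_nat ` S" using i by blast
  qed
  have "(\<Sum>i\<in>S. c i * a (to_nat i)) = (\<Sum>n\<in>to_nat ` S. d n * a n)"
   by (subst sum.reindex) (auto simp: d_def inj_to_nat intro: inj_on_subset)
  also have "... = (\<Sum>n | d n ~= 0. d n * a n)"
   using supp S(1) by (intro sum.mono_neutral_right) auto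
  also have "... <= p (%i. d (to_nat i))"
   using supp S(1) by (intro a) (auto intro: finite_subset)
  also have "(%i. d (to_nat i)) = c" by (auto simp: d_def)
  finally show "(\<Sum>i\<in>S. c i * a (to_nat i)) <= p c" .
 qed
qed

subsection \<open>Integrable functions with values in \<open>L2\<close> and their dual\<close>

definition nrm1 :: "real => (real => real ^ 'd::finite => real) => real" where
 "nrm1 T g = (LINT t|itv T. nrm torus (g t))"

definition pairing :: "real => (real => real ^ 'd::finite => real) => (real => real ^ 'd => real) => real" where
 "pairing T u g = (LINT t|itv T. inn torus (u t) (g t))"

lemma Lp_L2_1_iff:
 "g \<in> Lp_L2 1 T \<longleftrightarrow> strongly_measurable T g & integrable (itv T) (%t. nrm torus (g t))"
proof -
 have "(\<integral>\<^sup>+t\<in>{0..T}. ennreal (L2norm (g t) powr 1) \<partial>lebesgue) = (\<integral>\<^sup>+t. ennreal (norm (nrm torus (g t))) \<partial>itv T)"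
  unfolding set_nn_integral_itv by (simp add: L2norm_eq)
 then show ?thesis
  unfolding Lp_L2_def by (auto simp: integrable_iff_bounded intro: strongly_measurable_nrm)
qed

lemma nrm1_nonneg: "0 <= nrm1 T g"
 unfolding nrm1_def by (intro Bochner_Integration.integral_nonneg) simp

lemma L1_sm: "g \<in> Lp_L2 1 T ==> strongly_measurable T g"
 by (simp add: Lp_L2_1_iff)

lemma L1_AE: "g \<in> Lp_L2 1 T ==> AE t in itv T. g t \<in> L2"
 by (intro strongly_measurableD(1) L1_sm)

lemma L1_combine:
 assumes f: "f \<in> Lp_L2 1 T" and g: "g \<in> Lp_L2 1 T"
 shows "(%t x. a * f t x + b * g t x) \<in> Lp_L2 1 T"
  and "nrm1 T (%t x. a * f t x + b * g t x) <= \<bar>a\<bar> * nrm1 T f + \<bar>b\<bar> * nrm1 T g"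
proof -
 have sm: "strongly_measurable T (%t x. a * f t x + b * g t x)"
  using f g by (intro strongly_measurable_combine L1_sm) auto
 have le: "AE t in itv T. nrm torus (%x. a * f t x + b * g t x) <= \<bar>a\<bar> * nrm torus (f t) + \<bar>b\<bar> * nrm torus (g t)"
  using L1_AE[OF f] L1_AE[OF g]
 proof eventually_elim
  case (elim t)
  then show ?case
   using nrm_triangle[of "%x. a * f t x" torus "%x. b * g t x"] by (simp add: nrm_scale sqi_scale L2_sqi)
 qed
 have int: "integrable (itv T) (%t. \<bar>a\<bar> * nrm torus (f t) + \<bar>b\<bar> * nrm torus (g t))"
  using f g by (auto simp: Lp_L2_1_iff)
 have int2: "integrable (itv T) (%t. nrm torus (%x. a * f t x + b * g t x))"
  using le by (intro Bochner_Integration.integrable_bound[OF int] strongly_measurable_nrm[OF sm])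
   (auto elim: eventually_mono)
 show "(%t x. a * f t x + b * g t x) \<in> Lp_L2 1 T" using sm int2 by (simp add: Lp_L2_1_iff)
 have "nrm1 T (%t x. a * f t x + b * g t x) <= (LINT t|itv T. \<bar>a\<bar> * nrm torus (f t) + \<bar>b\<bar> * nrm torus (g t))"
  unfolding nrm1_def by (rule integral_mono_AE[OF int2 int le])
 also have "... = \<bar>a\<bar> * nrm1 T f + \<bar>b\<bar> * nrm1 T g"
  using f g by (simp add: nrm1_def Lp_L2_1_iff)
 finally show "nrm1 T (%t x. a * f t x + b * g t x) <= \<bar>a\<bar> * nrm1 T f + \<bar>b\<bar> * nrm1 T g" .
qed

lemma L1_add: "f \<in> Lp_L2 1 T ==> g \<in> Lp_L2 1 T ==> (%t x. f t x + g t x) \<in> Lp_L2 1 T"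
 using L1_combine(1)[of f T g 1 1] by simp

lemma L1_diff: "f \<in> Lp_L2 1 T ==> g \<in> Lp_L2 1 T ==> (%t x. f t x - g t x) \<in> Lp_L2 1 T"
 using L1_combine(1)[of f T g 1 "-1"] by simp

lemma L1_scale: "f \<in> Lp_L2 1 T ==> (%t x. c * f t x) \<in> Lp_L2 1 T"
 using L1_combine(1)[of f T f c 0] by simp

lemma nrm1_add: "f \<in> Lp_L2 1 T ==> g \<in> Lp_L2 1 T ==> nrm1 T (%t x. f t x + g t x) <= nrm1 T f + nrm1 T g"
 using L1_combine(2)[of f T g 1 1] by simp

lemma nrm1_scale: "nrm1 T (%t x. c * f t x) = \<bar>c\<bar> * nrm1 T f"
 by (simp add: nrm1_def nrm_scale)

lemma nrm1_minus_commute: "nrm1 T (%t x. f t x - g t x) = nrm1 T (%t x. g t x - f t x)"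
 using nrm1_scale[of T "-1" "%t x. f t x - g t x"] by simp

lemma L1_zero: "(%t x. 0) \<in> Lp_L2 1 T"
 by (simp add: Lp_L2_1_iff strongly_measurable_const L2_zero)

lemma L1_sum: "(!!i. i \<in> A ==> f i \<in> Lp_L2 1 T) ==> (%t x. \<Sum>i\<in>A. f i t x) \<in> Lp_L2 1 T"
 by (induction A rule: infinite_finite_induct) (auto intro: L1_add L1_zero)

lemma L1_product:
 assumes c: "integrable (itv T) c" and f: "f \<in> L2"
 shows "(%t x. c t * f x) \<in> Lp_L2 1 T"
proof -
 have "strongly_measurable T (%t x. c t * f x + 0 * f x)"
  using c f by (intro strongly_measurable_combine strongly_measurable_const) auto
 moreover have "integrable (itv T) (%t. \<bar>c t\<bar> * nrm torus f)" using c by (intro integrable_mult_left) auto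
 ultimately show ?thesis by (simp add: Lp_L2_1_iff nrm_scale)
qed

lemma Linf_sm: "u \<in> Linf_L2 T ==> strongly_measurable T u"
 by (simp add: Linf_L2_def)

lemma Linf_bound:
 assumes "u \<in> Linf_L2 T"
 obtains C where "0 <= C" "AE t in itv T. nrm torus (u t) <= C"
proof -
 obtain C where "AE t in itv T. nrm torus (u t) <= C" using assms by (auto simp: Linf_L2_def L2norm_eq)
 then have "AE t in itv T. nrm torus (u t) <= max C 0" by eventually_elim simp
 then show thesis using that[of "max C 0"] by simp
qed

lemma pairing_bound:
 assumes u: "strongly_measurable T u" "AE t in itv T. nrm torus (u t) <= C"
  and g: "g \<in> Lp_L2 1 T"
 shows "integrable (itv T) (%t. inn torus (u t) (g t))" "\<bar>pairing T u g\<bar> <= C * nrm1 T g"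
proof -
 have le: "AE t in itv T. \<bar>inn torus (u t) (g t)\<bar> <= C * nrm torus (g t)"
  using u(2) strongly_measurableD(1)[OF u(1)] L1_AE[OF g]
 proof eventually_elim
  case (elim t)
  then have "\<bar>inn torus (u t) (g t)\<bar> <= nrm torus (u t) * nrm torus (g t)" by (intro cauchy_schwarz_inn L2_sqi)
  also have "... <= C * nrm torus (g t)" using elim by (intro mult_right_mono) auto
  finally show ?case .
 qed
 have int: "integrable (itv T) (%t. C * nrm torus (g t))" using g by (simp add: Lp_L2_1_iff)
 show int2: "integrable (itv T) (%t. inn torus (u t) (g t))"
  using le by (intro Bochner_Integration.integrable_bound[OF int] strongly_measurable_inn u L1_sm g)
   (auto elim!: eventually_mono)
 have "\<bar>pairing T u g\<bar> <= (LINT t|itv T. \<bar>inn torus (u t) (g t)\<bar>)"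
  unfolding pairing_def by (rule integral_abs_bound)
 also have "... <= (LINT t|itv T. C * nrm torus (g t))"
  using int2 int le by (intro integral_mono_AE) auto
 finally show "\<bar>pairing T u g\<bar> <= C * nrm1 T g" by (simp add: nrm1_def)
qed

lemma pairing_combine:
 assumes u: "u \<in> Linf_L2 T" and f: "f \<in> Lp_L2 1 T" and g: "g \<in> Lp_L2 1 T"
 shows "pairing T u (%t x. a * f t x + b * g t x) = a * pairing T u f + b * pairing T u g"
proof -
 obtain C where C: "AE t in itv T. nrm torus (u t) <= C" using Linf_bound[OF u] by blast
 note i = pairing_bound(1)[OF Linf_sm[OF u] C]
 have "pairing T u (%t x. a * f t x + b * g t x) = (LINT t|itv T. a * inn torus (u t) (f t) + b * inn torus (u t) (g t))"
  unfolding pairing_def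
 proof (rule integral_cong_AE)
  show "AE t in itv T. inn torus (u t) (%x. a * f t x + b * g t x) = a * inn torus (u t) (f t) + b * inn torus (u t) (g t)"
   using strongly_measurableD(1)[OF Linf_sm[OF u]] L1_AE[OF f] L1_AE[OF g]
   by eventually_elim (simp add: inn_add_right inn_scale_right sqi_scale L2_sqi)
  show "(%t. inn torus (u t) (%x. a * f t x + b * g t x)) \<in> borel_measurable (itv T)"
   by (rule borel_measurable_integrable[OF i[OF L1_combine(1)[OF f g]]])
  show "(%t. a * inn torus (u t) (f t) + b * inn torus (u t) (g t)) \<in> borel_measurable (itv T)"
   using i[OF f] i[OF g] by auto
 qed
 also have "... = a * pairing T u f + b * pairing T u g"
  using i[OF f] i[OF g] by (simp add: pairing_def)
 finally show ?thesis .
qed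

lemma integrable_itv_sqi: "f \<in> sqi (itv T) ==> integrable (itv T) f"
 by (rule integral_abs_le_nrm(1)[OF finite_measure_itv])

section \<open>Density of trigonometric sums in time and space\<close>

text \<open>Truncation makes the function bounded, hence square integrable, at a small L1 cost. The
  cosine expansion then converges in L2, which controls L1 on a finite interval.\<close>

lemma tcos_dense_L1:
 assumes T: "0 < T" and f: "integrable (itv T) f" and e: "0 < e"
 obtains F c where "finite F" "(LINT t|itv T. \<bar>f t - (\<Sum>m\<in>F. c m * tcos T m t)\<bar>) < e"
proof -
 interpret onb "itv T" "tcos T" by (rule onb_tcos[OF T])
 interpret finite_measure "itv T" by (rule finite_measure_itv)
 define g where "g n t = max (- real n) (min (real n) (f t))" for n t
 have fm [measurable]: "f \<in> borel_measurable (itv T)" using f by auto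
 have gm [measurable]: "g n \<in> borel_measurable (itv T)" for n unfolding g_def[abs_def] by measurable
 have "(%n. LINT t|itv T. \<bar>f t - g n t\<bar>) \<longlonglongrightarrow> (LINT t|itv T. 0)"
 proof (rule integral_dominated_convergence[where w = "%t. \<bar>f t\<bar>"])
  show "AE t in itv T. (%n. \<bar>f t - g n t\<bar>) \<longlonglongrightarrow> 0"
  proof (rule AE_I2)
   fix t
   obtain N where N: "\<bar>f t\<bar> <= real N" using real_arch_simple by blast
   have "\<bar>f t - g n t\<bar> = 0" if "N <= n" for n
   proof -
    have "\<bar>f t\<bar> <= real n" using N that by linarith
    then show ?thesis by (auto simp: g_def)
   qed
   then show "(%n. \<bar>f t - g n t\<bar>) \<longlonglongrightarrow> 0"
    by (intro tendsto_eventually eventually_sequentiallyI[of N]) auto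
  qed
  show "AE t in itv T. norm \<bar>f t - g n t\<bar> <= \<bar>f t\<bar>" for n
   by (rule AE_I2) (auto simp: g_def)
 qed (use f in auto)
 then have "\<forall>\<^sub>F n in sequentially. (LINT t|itv T. \<bar>f t - g n t\<bar>) < e / 2"
  using e by (intro order_tendstoD) auto
 then obtain n where n: "(LINT t|itv T. \<bar>f t - g n t\<bar>) < e / 2" unfolding eventually_sequentially by blast
 have gs: "g n \<in> sqi (itv T)"
  by (rule sqi_bounded[OF finite_measure_itv gm, of _ "real n"]) (auto simp: g_def)
 have "((%A. sqrt T * nrm (itv T) (%x. g n x - (\<Sum>i\<in>A. inn (itv T) (g n) (tcos T i) * tcos T i x))) \<longlongrightarrow> sqrt T * 0)
   (finite_subsets_at_top UNIV)"
  by (intro tendsto_mult_left expansion_tendsto gs)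
 then have "\<forall>\<^sub>F A in finite_subsets_at_top UNIV.
   sqrt T * nrm (itv T) (%x. g n x - (\<Sum>i\<in>A. inn (itv T) (g n) (tcos T i) * tcos T i x)) < e / 2"
  using e by (intro order_tendstoD) auto
 then obtain A where A: "finite A"
  "sqrt T * nrm (itv T) (%x. g n x - (\<Sum>i\<in>A. inn (itv T) (g n) (tcos T i) * tcos T i x)) < e / 2"
  unfolding eventually_finite_subsets_at_top by blast
 define s where "s t = (\<Sum>i\<in>A. inn (itv T) (g n) (tcos T i) * tcos T i t)" for t
 have ss: "s \<in> sqi (itv T)" unfolding s_def[abs_def] by (intro sqi_lincomb) simp
 have d: "(%t. g n t - s t) \<in> sqi (itv T)" by (intro sqi_diff gs ss)
 have "(LINT t|itv T. \<bar>f t - s t\<bar>) <= (LINT t|itv T. \<bar>f t - g n t\<bar> + \<bar>g n t - s t\<bar>)"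
  using f integrable_itv_sqi[OF gs] integrable_itv_sqi[OF ss] by (intro integral_mono) auto
 also have "... = (LINT t|itv T. \<bar>f t - g n t\<bar>) + (LINT t|itv T. \<bar>g n t - s t\<bar>)"
  using f integrable_itv_sqi[OF gs] integrable_itv_sqi[OF ss] by (intro Bochner_Integration.integral_add) auto
 also have "(LINT t|itv T. \<bar>g n t - s t\<bar>) <= sqrt T * nrm (itv T) (%t. g n t - s t)"
  using integral_abs_le_nrm(2)[OF finite_measure_itv d] T by (simp add: measure_itv)
 finally have "(LINT t|itv T. \<bar>f t - s t\<bar>) < e" using n A(2) by (simp add: s_def)
 then show thesis using A(1) that by (auto simp: s_def)
qed

text \<open>The summation set is kept apart from the coefficients so that two combinations can be
  added over a common set.\<close>

definition trig_comb :: "real => (nat \<times> (int ^ 'd) => real) => (nat \<times> (int ^ 'd)) set => real => real ^ 'd::finite => real" where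
 "trig_comb T c S t x = (\<Sum>i\<in>S. c i * (tcos T (fst i) t * cas (snd i) x))"

lemma tcos_cas_L1: "(%t x. tcos T m t * cas k x) \<in> Lp_L2 1 T"
 by (intro L1_product integrable_itv_sqi cas_L2) simp

lemma trig_comb_L1: "trig_comb T c S \<in> Lp_L2 1 T"
 unfolding trig_comb_def[abs_def] by (intro L1_sum L1_scale tcos_cas_L1)

lemma trig_comb_superset:
 assumes "finite S" "finite S'" "!!i. i \<notin> S ==> c i = 0" "S \<subseteq> S'"
 shows "trig_comb T c S' = trig_comb T c S"
 unfolding trig_comb_def[abs_def]
 by (intro ext sum.mono_neutral_right) (use assms in auto)

lemma trig_comb_product:
 "trig_comb T c (F \<times> A) t x = (\<Sum>k\<in>A. (\<Sum>m\<in>F. c (m, k) * tcos T m t) * cas k x)"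
 unfolding trig_comb_def sum_distrib_right
 by (subst sum.swap) (simp add: sum.cartesian_product case_prod_beta mult.assoc)

text \<open>Projecting onto finitely many spatial modes converges in L1 in time, the residual being
  dominated by \<open>nrm torus (g t)\<close>. Each of the finitely many coefficients is then
  approximated by cosines.\<close>

lemma trig_comb_dense:
 fixes g :: "real => real ^ 'd::finite => real"
 assumes T: "0 < T" and g: "g \<in> Lp_L2 1 T" and e: "0 < e"
 obtains c S where "finite S" "!!i. i \<notin> S ==> c i = 0" "nrm1 T (%t x. g t x - trig_comb T c S t x) < e"
proof -
 define A where "A n = (to_nat -` {..n} :: (int ^ 'd) set)" for n
 have finA: "finite (A n)" for n unfolding A_def by (intro finite_vimageI inj_to_nat) auto
 define P where "P n t x = (\<Sum>k\<in>A n. inn torus (g t) (cas k) * cas k x)" for n t x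
 have coef: "integrable (itv T) (%t. inn torus (g t) (cas k))" for k
 proof (rule Bochner_Integration.integrable_bound)
  show "integrable (itv T) (%t. nrm torus (g t) * nrm torus (cas k))" using g by (simp add: Lp_L2_1_iff)
  show "(%t. inn torus (g t) (cas k)) \<in> borel_measurable (itv T)"
   by (intro strongly_measurableD(2) L1_sm g cas_L2)
  show "AE t in itv T. norm (inn torus (g t) (cas k)) <= norm (nrm torus (g t) * nrm torus (cas k))"
   using L1_AE[OF g]
  proof eventually_elim
   case (elim t)
   then show ?case using cauchy_schwarz_inn[OF L2_sqi[OF elim] cas_sqi[of k]] by simp
  qed
 qed
 have P: "P n \<in> Lp_L2 1 T" for n
  unfolding P_def[abs_def] by (intro L1_sum L1_product coef cas_L2)
 have "(%n. nrm1 T (%t x. g t x - P n t x)) \<longlonglongrightarrow> (LINT t|itv T. 0)"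
  unfolding nrm1_def
 proof (rule integral_dominated_convergence[where w = "%t. nrm torus (g t)"])
  show "(%t. nrm torus (%x. g t x - P n t x)) \<in> borel_measurable (itv T)" for n
   by (intro strongly_measurable_nrm L1_sm L1_diff g P)
  show "AE t in itv T. (%n. nrm torus (%x. g t x - P n t x)) \<longlonglongrightarrow> 0"
   using L1_AE[OF g]
  proof eventually_elim
   case (elim t)
   have "(%n. sqrt ((nrm torus (g t))\<^sup>2 - (\<Sum>k\<in>A n. (inn torus (g t) (cas k))\<^sup>2)))
     \<longlonglongrightarrow> sqrt ((nrm torus (g t))\<^sup>2 - (nrm torus (g t))\<^sup>2)"
    unfolding A_def by (intro tendsto_intros has_sum_LIMSEQ_to_nat torus.parseval L2_sqi elim)
   moreover have "sqrt ((nrm torus (g t))\<^sup>2 - (\<Sum>k\<in>A n. (inn torus (g t) (cas k))\<^sup>2)) = nrm torus (%x. g t x - P n t x)" for n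
    unfolding P_def torus.residual_nrm[OF L2_sqi[OF elim] finA, symmetric] by simp
   ultimately show ?case by simp
  qed
  show "AE t in itv T. norm (nrm torus (%x. g t x - P n t x)) <= nrm torus (g t)" for n
   using L1_AE[OF g]
  proof eventually_elim
   case (elim t)
   have "(nrm torus (%x. g t x - P n t x))\<^sup>2 <= (nrm torus (g t))\<^sup>2"
    unfolding P_def torus.residual_nrm[OF L2_sqi[OF elim] finA] by (simp add: sum_nonneg)
   then show ?case
    unfolding real_norm_def abs_of_nonneg[OF nrm_nonneg] by (rule power2_le_imp_le) simp
  qed
 qed (use g in \<open>auto simp: Lp_L2_1_iff\<close>)
 then have "\<forall>\<^sub>F n in sequentially. nrm1 T (%t x. g t x - P n t x) < e / 2"
  using e by (intro order_tendstoD) auto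
 then obtain n where n: "nrm1 T (%t x. g t x - P n t x) < e / 2" unfolding eventually_sequentially by blast
 \<comment> \<open>Shares half of the allowed error among the coefficients; the summand 1 avoids
   division by zero.\<close>
 define d where "d = e / (2 * (real (card (A n)) + 1))"
 have cpos: "0 < real (card (A n)) + 1" by (intro add_nonneg_pos) auto
 have d: "0 < d" unfolding d_def using e cpos by (intro divide_pos_pos mult_pos_pos) auto
 define R where "R k F c \<longleftrightarrow> finite F & (LINT t|itv T. \<bar>inn torus (g t) (cas k) - (\<Sum>m\<in>F. c m * tcos T m t)\<bar>) < d" for k F c
 have "\<exists>F c. R k F c" for k
  unfolding R_def by (rule tcos_dense_L1[OF T coef[of k] d]) blast
 then obtain F c where "!!k. R k (F k) (c k)" by metis
 then have F: "!!k. finite (F k)"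
  and c: "!!k. (LINT t|itv T. \<bar>inn torus (g t) (cas k) - (\<Sum>m\<in>F k. c k m * tcos T m t)\<bar>) < d"
  unfolding R_def by blast+
 define F' where "F' = (\<Union>k\<in>A n. F k)"
 have F': "finite F'" using finA F by (auto simp: F'_def)
 define c' where "c' = (%(m, k). if k \<in> A n & m \<in> F k then c k m else 0)"
 define S where "S = F' \<times> A n"
 have c'S: "c' i = 0" if "i \<notin> S" for i
  using that by (cases i) (auto simp: c'_def S_def F'_def)
 have comb: "trig_comb T c' S t x = (\<Sum>k\<in>A n. (\<Sum>m\<in>F k. c k m * tcos T m t) * cas k x)" for t x
  unfolding S_def trig_comb_product
 proof (rule sum.cong[OF refl])
  fix k assume k: "k \<in> A n"
  have "(\<Sum>m\<in>F'. c' (m, k) * tcos T m t) = (\<Sum>m\<in>F k. c k m * tcos T m t)"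
   using k F' F by (intro sum.mono_neutral_cong_right) (auto simp: c'_def F'_def)
  then show "(\<Sum>m\<in>F'. c' (m, k) * tcos T m t) * cas k x = (\<Sum>m\<in>F k. c k m * tcos T m t) * cas k x" by simp
 qed
 define r where "r k t = inn torus (g t) (cas k) - (\<Sum>m\<in>F k. c k m * tcos T m t)" for k t
 have ri: "integrable (itv T) (r k)" for k
  unfolding r_def by (intro Bochner_Integration.integrable_diff coef integrable_itv_sqi sqi_lincomb) simp
 have diff: "P n t x - trig_comb T c' S t x = (\<Sum>k\<in>A n. r k t * cas k x)" for t x
  by (simp add: P_def comb r_def left_diff_distrib sum_subtractf)
 have nle: "nrm torus (%x. \<Sum>k\<in>B. a k * cas k x) <= (\<Sum>k\<in>B. \<bar>a k\<bar>)" if "finite B" for B and a :: "int ^ 'd => real"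
  using real_sqrt_unique[OF torus.lincomb_nrm[OF that, of a] nrm_nonneg] L2_set_le_sum_abs[of a B]
  by (simp add: L2_set_def)
 have "nrm1 T (%t x. P n t x - trig_comb T c' S t x) <= (LINT t|itv T. (\<Sum>k\<in>A n. \<bar>r k t\<bar>))"
  unfolding nrm1_def
 proof (rule integral_mono)
  show "integrable (itv T) (%t. nrm torus (%x. P n t x - trig_comb T c' S t x))"
   using L1_diff[OF P trig_comb_L1] by (simp add: Lp_L2_1_iff)
  show "integrable (itv T) (%t. \<Sum>k\<in>A n. \<bar>r k t\<bar>)" using ri by auto
  show "nrm torus (%x. P n t x - trig_comb T c' S t x) <= (\<Sum>k\<in>A n. \<bar>r k t\<bar>)" for t
   unfolding diff by (rule nle[OF finA])
 qed
 also have "... = (\<Sum>k\<in>A n. (LINT t|itv T. \<bar>r k t\<bar>))"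
  using ri by (intro Bochner_Integration.integral_sum) auto
 also have "... <= (\<Sum>k\<in>A n. d)"
  using c by (intro sum_mono) (auto simp: r_def less_imp_le)
 also have "... <= (real (card (A n)) + 1) * d" using d by (simp add: distrib_right)
 also have "... = e / 2" using cpos by (simp add: d_def field_simps)
 finally have 2: "nrm1 T (%t x. P n t x - trig_comb T c' S t x) <= e / 2" .
 have "nrm1 T (%t x. (g t x - P n t x) + (P n t x - trig_comb T c' S t x))
   <= nrm1 T (%t x. g t x - P n t x) + nrm1 T (%t x. P n t x - trig_comb T c' S t x)"
  by (intro nrm1_add L1_diff g P trig_comb_L1)
 then have "nrm1 T (%t x. g t x - trig_comb T c' S t x) < e" using n 2 by simp
 moreover have "finite S" using F' finA by (simp add: S_def)
 ultimately show thesis using that c'S by blast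
qed

text \<open>
  A functional on trigonometric sums that is bounded in \<open>L\<^sup>1(0,T;L\<^sup>2)\<close> is given by its coefficients,
  which belong to an element of \<open>L\<^sup>\<infinity>(0,T;L\<^sup>2)\<close>: square summability comes from testing with the
  coefficients themselves, the uniform bound from testing with \<open>1\<^bsub>{\<rho> > C}\<^esub> w / \<rho>\<close>.
\<close>

lemma Linf_representation:
 fixes a :: "nat \<times> (int ^ 'd::finite) => real"
 assumes T: "0 < T" and C: "0 <= C"
  and a: "!!c S. finite S ==> (!!i. i \<notin> S ==> c i = 0) ==> (\<Sum>i\<in>S. c i * a i) <= C * nrm1 T (trig_comb T c S)"
 obtains w where "w \<in> Linf_L2 T" "AE t in itv T. nrm torus (w t) <= C"
  "!!c S. finite S ==> pairing T w (trig_comb T c S) = (\<Sum>i\<in>S. c i * a i)"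
proof -
 interpret onb "itv T" "tcos T" by (rule onb_tcos[OF T])
 interpret finite_measure "itv T" by (rule finite_measure_itv)
 \<comment> \<open>Orthonormality in space turns the norm of the combination at time
   \<open>t\<close> into the Euclidean norm of its vector of time-dependent coefficients.\<close>
 have ac: "(\<Sum>k\<in>A. \<Sum>m\<in>F. c m k * a (m, k)) <= C * (LINT t|itv T. sqrt (\<Sum>k\<in>A. (\<Sum>m\<in>F. c m k * tcos T m t)\<^sup>2))"
  if fin: "finite F" "finite A" for F A and c :: "nat => int ^ 'd => real"
 proof -
  define c' where "c' = (%(m, k). if m \<in> F & k \<in> A then c m k else 0)"
  have "(\<Sum>k\<in>A. \<Sum>m\<in>F. c m k * a (m, k)) = (\<Sum>i\<in>F \<times> A. c' i * a i)"
   by (subst sum.swap) (auto simp: sum.cartesian_product c'_def intro!: sum.cong)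
  also have "... <= C * nrm1 T (trig_comb T c' (F \<times> A))"
   using fin by (intro a) (auto simp: c'_def split: if_splits)
  finally have le: "(\<Sum>k\<in>A. \<Sum>m\<in>F. c m k * a (m, k)) <= C * nrm1 T (trig_comb T c' (F \<times> A))" .
  have "nrm torus (trig_comb T c' (F \<times> A) t) = sqrt (\<Sum>k\<in>A. (\<Sum>m\<in>F. c m k * tcos T m t)\<^sup>2)" for t
  proof -
   have "trig_comb T c' (F \<times> A) t = (%x. \<Sum>k\<in>A. (\<Sum>m\<in>F. c m k * tcos T m t) * cas k x)"
    unfolding trig_comb_product by (intro ext sum.cong refl arg_cong2[where f = "(*)"]) (auto simp: c'_def)
   then show ?thesis
    using real_sqrt_unique[OF torus.lincomb_nrm[OF fin(2), of "%k. \<Sum>m\<in>F. c m k * tcos T m t"] nrm_nonneg]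
    by simp
  qed
  then have "nrm1 T (trig_comb T c' (F \<times> A)) = (LINT t|itv T. sqrt (\<Sum>k\<in>A. (\<Sum>m\<in>F. c m k * tcos T m t)\<^sup>2))"
   by (simp add: nrm1_def)
  then show ?thesis using le by simp
 qed
 have sm: "(%m. (a (m, k))\<^sup>2) summable_on UNIV" for k
 proof (rule nonneg_bdd_above_summable_on)
  show "bdd_above (sum (%m. (a (m, k))\<^sup>2) ` {F. F \<subseteq> UNIV & finite F})"
  proof (rule bdd_aboveI2)
   fix F :: "nat set" assume "F \<in> {F. F \<subseteq> UNIV & finite F}"
   then have F: "finite F" by simp
   define s where "s = (\<Sum>m\<in>F. (a (m, k))\<^sup>2)"
   have s0: "0 <= s" unfolding s_def by (intro sum_nonneg) auto
   have sq: "(%t. \<Sum>m\<in>F. a (m, k) * tcos T m t) \<in> sqi (itv T)" by (intro sqi_lincomb) simp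
   \<comment> \<open>Testing with the coefficients themselves gives \<open>s\<close> on the left,
     and on the right an L1 norm bounded by \<open>sqrt T * sqrt s\<close>. Cancelling
     \<open>sqrt s\<close> bounds the square sum.\<close>
   have "s <= C * (LINT t|itv T. \<bar>\<Sum>m\<in>F. a (m, k) * tcos T m t\<bar>)"
    using ac[OF F, of "{k}" "%m k. a (m, k)"] by (simp add: s_def power2_eq_square)
   also have "... <= C * (sqrt T * nrm (itv T) (%t. \<Sum>m\<in>F. a (m, k) * tcos T m t))"
    using integral_abs_le_nrm(2)[OF finite_measure_itv sq] C T by (intro mult_left_mono) (auto simp: measure_itv)
   also have "nrm (itv T) (%t. \<Sum>m\<in>F. a (m, k) * tcos T m t) = sqrt s"
    using real_sqrt_unique[OF lincomb_nrm[OF F, of "%m. a (m, k)"] nrm_nonneg] by (simp add: s_def)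
   finally have le: "sqrt s * sqrt s <= C * sqrt T * sqrt s" using s0 by (simp add: mult.assoc)
   have "sqrt s <= C * sqrt T"
   proof (cases "s = 0")
    case False
    then have "0 < sqrt s" using s0 by simp
    then show ?thesis by (rule mult_right_le_imp_le[OF le])
   qed (use C T in auto)
   then have "(sqrt s)\<^sup>2 <= (C * sqrt T)\<^sup>2" by (intro power_mono) (auto simp: s0)
   then show "(\<Sum>m\<in>F. (a (m, k))\<^sup>2) <= (C * sqrt T)\<^sup>2" using s0 by (simp add: s_def)
  qed
 qed simp
 have "\<exists>v. v \<in> sqi (itv T) & (\<forall>m. inn (itv T) v (tcos T m) = a (m, k))" for k
  by (rule riesz_fischer[OF sm[of k]]) blast
 then obtain v where v: "!!k. v k \<in> sqi (itv T)" and va: "!!k m. inn (itv T) (v k) (tcos T m) = a (m, k)"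
  by metis
 have bound: "AE t in itv T. (\<Sum>k\<in>A. (v k t)\<^sup>2) <= C\<^sup>2" if A: "finite A" for A
 proof -
  define rho where "rho t = sqrt (\<Sum>k\<in>A. (v k t)\<^sup>2)" for t
  have vm [measurable]: "v k \<in> borel_measurable (itv T)" for k by (rule sqi_measurable[OF v])
  have [measurable]: "rho \<in> borel_measurable (itv T)" unfolding rho_def[abs_def] by measurable
  have rho_le: "\<bar>v k t\<bar> <= rho t" if "k \<in> A" for k t
   unfolding rho_def using that A by (intro real_le_rsqrt) (auto intro: member_le_sum)
  have rho_nn: "0 <= rho t" for t by (simp add: rho_def sum_nonneg)
  have rho_sq: "(\<Sum>k\<in>A. v k t * v k t) = rho t * rho t" for t
   by (simp add: rho_def sum_nonneg flip: power2_eq_square)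
  \<comment> \<open>The direction of the vector \<open>v\<close> at times where its length exceeds
    \<open>C\<close>: testing with it measures how far \<open>rho\<close> goes beyond
    \<open>C\<close>.\<close>
  define y where "y k t = (if C < rho t then v k t / rho t else 0)" for k t
  have ym [measurable]: "y k \<in> borel_measurable (itv T)" for k unfolding y_def[abs_def] by measurable
  have ys: "y k \<in> sqi (itv T)" if "k \<in> A" for k
   using rho_le[OF that] C
   by (intro sqi_bounded[OF finite_measure_itv ym, of _ 1]) (auto simp: y_def abs_divide divide_le_eq_1 intro!: AE_I2)
  define q where "q k F t = (\<Sum>m\<in>F. inn (itv T) (y k) (tcos T m) * tcos T m t)" for k F t
  have qs: "q k F \<in> sqi (itv T)" for k F unfolding q_def[abs_def] by (intro sqi_lincomb) simp
  have sqrt_diff: "\<bar>sqrt (\<Sum>k\<in>A. (b k)\<^sup>2) - sqrt (\<Sum>k\<in>A. (b' k)\<^sup>2)\<bar> <= (\<Sum>k\<in>A. \<bar>b k - b' k\<bar>)" for b b' :: "int ^ 'd => real"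
  proof -
   have "\<bar>L2_set b A - L2_set b' A\<bar> <= L2_set (%k. b k - b' k) A"
    using L2_set_triangle_ineq[of "%k. b k - b' k" b' A] L2_set_triangle_ineq[of "%k. b' k - b k" b A]
    by (simp add: L2_set_def power2_commute abs_le_iff)
   also have "... <= (\<Sum>k\<in>A. \<bar>b k - b' k\<bar>)" by (rule L2_set_le_sum_abs)
   finally show ?thesis by (simp add: L2_set_def)
  qed
  have dim: "integrable (itv T) (%t. sqrt (\<Sum>k\<in>A. (b k t)\<^sup>2))"
   if "!!k. k \<in> A ==> b k \<in> sqi (itv T)" for b :: "int ^ 'd => real => real"
  proof (rule Bochner_Integration.integrable_bound)
   show "integrable (itv T) (%t. \<Sum>k\<in>A. \<bar>b k t\<bar>)" by (intro Bochner_Integration.integrable_sum integrable_abs integrable_itv_sqi that)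
   show "(%t. sqrt (\<Sum>k\<in>A. (b k t)\<^sup>2)) \<in> borel_measurable (itv T)"
    using that by (intro measurable_compose[OF _ borel_measurable_sqrt] borel_measurable_sum borel_measurable_power)
     (auto intro: sqi_measurable)
   show "AE t in itv T. norm (sqrt (\<Sum>k\<in>A. (b k t)\<^sup>2)) <= norm (\<Sum>k\<in>A. \<bar>b k t\<bar>)"
    using sqrt_diff[of "%k. b k _" "%k. 0"] by (intro AE_I2) (auto simp: abs_of_nonneg sum_nonneg)
  qed
  have y_nrm: "sqrt (\<Sum>k\<in>A. (y k t)\<^sup>2) = (if C < rho t then 1 else 0)" for t
  proof (cases "C < rho t")
   case True
   have "(\<Sum>k\<in>A. (y k t)\<^sup>2) = (\<Sum>k\<in>A. v k t * v k t) / (rho t * rho t)"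
    using True by (simp add: y_def power_divide sum_divide_distrib power2_eq_square)
   then show ?thesis using True C by (simp add: rho_sq)
  qed (simp add: y_def)
  \<comment> \<open>The hypothesis concerns finite cosine sums only, so the coefficients
    \<open>y\<close> are approached by their partial expansions \<open>q\<close> and both sides pass
    to the limit.\<close>
  let ?\<F> = "finite_subsets_at_top (UNIV :: nat set)"
  have "(\<Sum>k\<in>A. inn (itv T) (v k) (y k)) <= C * (LINT t|itv T. sqrt (\<Sum>k\<in>A. (y k t)\<^sup>2))"
  proof (rule tendsto_le[where F = ?\<F>])
   show "((%F. C * (LINT t|itv T. sqrt (\<Sum>k\<in>A. (q k F t)\<^sup>2))) \<longlongrightarrow> C * (LINT t|itv T. sqrt (\<Sum>k\<in>A. (y k t)\<^sup>2))) ?\<F>"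
   proof (rule tendsto_mult_left, rule LIM_zero_cancel)
    have "((%F. (\<Sum>k\<in>A. sqrt T * nrm (itv T) (%t. y k t - q k F t))) \<longlongrightarrow> (\<Sum>k\<in>A. sqrt T * 0)) ?\<F>"
     unfolding q_def by (intro tendsto_sum tendsto_mult_left expansion_tendsto ys)
    then have "((%F. (\<Sum>k\<in>A. sqrt T * nrm (itv T) (%t. y k t - q k F t))) \<longlongrightarrow> 0) ?\<F>" by simp
    then show "((%F. (LINT t|itv T. sqrt (\<Sum>k\<in>A. (q k F t)\<^sup>2)) - (LINT t|itv T. sqrt (\<Sum>k\<in>A. (y k t)\<^sup>2))) \<longlongrightarrow> 0) ?\<F>"
    proof (rule Lim_null_comparison[rotated], intro always_eventually allI)
     fix F
     have "\<bar>(LINT t|itv T. sqrt (\<Sum>k\<in>A. (q k F t)\<^sup>2)) - (LINT t|itv T. sqrt (\<Sum>k\<in>A. (y k t)\<^sup>2))\<bar>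
       = \<bar>LINT t|itv T. sqrt (\<Sum>k\<in>A. (q k F t)\<^sup>2) - sqrt (\<Sum>k\<in>A. (y k t)\<^sup>2)\<bar>"
      by (subst Bochner_Integration.integral_diff) (auto intro!: dim qs ys)
     also have "... <= (LINT t|itv T. \<bar>sqrt (\<Sum>k\<in>A. (q k F t)\<^sup>2) - sqrt (\<Sum>k\<in>A. (y k t)\<^sup>2)\<bar>)"
      by (rule integral_abs_bound)
     also have "... <= (LINT t|itv T. (\<Sum>k\<in>A. \<bar>q k F t - y k t\<bar>))"
      by (intro integral_mono integrable_abs Bochner_Integration.integrable_diff Bochner_Integration.integrable_sum
        dim qs ys integrable_itv_sqi sqrt_diff)
     also have "... = (\<Sum>k\<in>A. (LINT t|itv T. \<bar>q k F t - y k t\<bar>))"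
      by (intro Bochner_Integration.integral_sum integrable_abs Bochner_Integration.integrable_diff
        qs ys integrable_itv_sqi)
     also have "... <= (\<Sum>k\<in>A. sqrt T * nrm (itv T) (%t. y k t - q k F t))"
     proof (rule sum_mono)
      fix k assume k: "k \<in> A"
      show "(LINT t|itv T. \<bar>q k F t - y k t\<bar>) <= sqrt T * nrm (itv T) (%t. y k t - q k F t)"
       using integral_abs_le_nrm(2)[OF finite_measure_itv sqi_diff[OF ys[OF k] qs[of k F]]] T
       by (simp add: measure_itv abs_minus_commute)
     qed
     finally show "norm ((LINT t|itv T. sqrt (\<Sum>k\<in>A. (q k F t)\<^sup>2)) - (LINT t|itv T. sqrt (\<Sum>k\<in>A. (y k t)\<^sup>2)))
       <= (\<Sum>k\<in>A. sqrt T * nrm (itv T) (%t. y k t - q k F t))" by simp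
    qed
   qed
   show "((%F. \<Sum>k\<in>A. inn (itv T) (v k) (q k F)) \<longlongrightarrow> (\<Sum>k\<in>A. inn (itv T) (v k) (y k))) ?\<F>"
   proof (rule tendsto_sum)
    fix k assume k: "k \<in> A"
    have "((%F. inn (itv T) (q k F) (v k)) \<longlongrightarrow> inn (itv T) (y k) (v k)) ?\<F>"
     using expansion_tendsto[OF ys[OF k]] unfolding q_def
     by (intro inn_tendsto sqi_lincomb ys[OF k] v) (auto simp: nrm_minus_commute)
    then show "((%F. inn (itv T) (v k) (q k F)) \<longlongrightarrow> inn (itv T) (v k) (y k)) ?\<F>"
     by (simp add: inn_commute)
   qed
   show "\<forall>\<^sub>F F in ?\<F>. (\<Sum>k\<in>A. inn (itv T) (v k) (q k F)) <= C * (LINT t|itv T. sqrt (\<Sum>k\<in>A. (q k F t)\<^sup>2))"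
   proof (rule eventually_mono[OF eventually_finite_subsets_at_top_weakI[of UNIV finite]])
    fix F :: "nat set" assume F: "finite F"
    have "inn (itv T) (v k) (q k F) = (\<Sum>m\<in>F. inn (itv T) (y k) (tcos T m) * a (m, k))" for k
     unfolding q_def[abs_def] by (subst inn_lincomb_right) (auto simp: va v)
    then show "(\<Sum>k\<in>A. inn (itv T) (v k) (q k F)) <= C * (LINT t|itv T. sqrt (\<Sum>k\<in>A. (q k F t)\<^sup>2))"
     using ac[OF F A, of "%m k. inn (itv T) (y k) (tcos T m)"] by (simp add: q_def)
   qed simp
  qed simp
  also have "(\<Sum>k\<in>A. inn (itv T) (v k) (y k)) = (LINT t|itv T. (if C < rho t then rho t else 0))"
  proof -
   have "(\<Sum>k\<in>A. v k t * y k t) = (if C < rho t then rho t else 0)" for t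
    using C by (auto simp: y_def rho_sq simp flip: sum_divide_distrib)
   moreover have "(\<Sum>k\<in>A. inn (itv T) (v k) (y k)) = (LINT t|itv T. (\<Sum>k\<in>A. v k t * y k t))"
    unfolding inn_def by (intro Bochner_Integration.integral_sum[symmetric] sqi_integrable_mult v ys)
   ultimately show ?thesis by simp
  qed
  finally have le: "(LINT t|itv T. (if C < rho t then rho t else 0)) <= C * (LINT t|itv T. (if C < rho t then 1 else 0))"
   by (simp only: y_nrm)
  have rhoi: "integrable (itv T) rho" unfolding rho_def[abs_def] by (intro dim v)
  have i1: "integrable (itv T) (%t. if C < rho t then rho t else 0)"
   by (rule Bochner_Integration.integrable_bound[OF rhoi]) auto
  have i2: "integrable (itv T) (%t. C * (if C < rho t then 1 else 0))"
   by (rule integrable_const_bound[of _ "C"]) (use C in auto)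
  \<comment> \<open>The difference is nonnegative while its integral is nonpositive, so it vanishes
    almost everywhere. This excludes \<open>rho t > C\<close>.\<close>
  have nn: "0 <= (if C < rho t then rho t else 0) - C * (if C < rho t then 1 else 0)" for t by simp
  have "(LINT t|itv T. (if C < rho t then rho t else 0) - C * (if C < rho t then 1 else 0)) <= 0"
   using le by (subst Bochner_Integration.integral_diff[OF i1 i2]) simp
  moreover have "0 <= (LINT t|itv T. (if C < rho t then rho t else 0) - C * (if C < rho t then 1 else 0))"
   by (rule Bochner_Integration.integral_nonneg[OF nn])
  ultimately have "(LINT t|itv T. (if C < rho t then rho t else 0) - C * (if C < rho t then 1 else 0)) = 0" by simp
  then have "AE t in itv T. (if C < rho t then rho t else 0) - C * (if C < rho t then 1 else 0) = 0"
   using integral_nonneg_eq_0_iff_AE[OF Bochner_Integration.integrable_diff[OF i1 i2]] nn by blast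
  then show ?thesis
  proof eventually_elim
   case (elim t)
   then have "rho t <= C" by (auto split: if_splits)
   then have "(rho t)\<^sup>2 <= C\<^sup>2" by (intro power_mono rho_nn)
   then show ?case by (simp add: rho_def sum_nonneg)
  qed
 qed
 define W where "W t f \<longleftrightarrow> f \<in> L2 & (\<forall>k. inn torus f (cas k) = v k t) & nrm torus f <= C" for t f
 \<comment> \<open>At almost every time the values \<open>v k t\<close> are square summable with sum
   at most \<open>C^2\<close>, hence the coefficients of a function. At the remaining times the
   value is zero by default.\<close>
 define w where "w t = (if \<exists>f. W t f then SOME f. W t f else (%x. 0))" for t
 have "AE t in itv T. \<forall>n. (\<Sum>k\<in>to_nat -` {..n}. (v k t)\<^sup>2) <= C\<^sup>2"
  by (subst AE_all_countable) (intro allI bound finite_vimageI inj_to_nat finite_atMost)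
 then have aeW: "AE t in itv T. W t (w t)"
 proof eventually_elim
  case (elim t)
  have fin: "(\<Sum>k\<in>B. (v k t)\<^sup>2) <= C\<^sup>2" if "finite B" for B :: "(int ^ 'd) set"
  proof -
   have "finite (to_nat ` B)" using that by simp
   then obtain n where "to_nat ` B \<subseteq> {..n}" unfolding finite_nat_iff_bounded_le by blast
   then have "(\<Sum>k\<in>B. (v k t)\<^sup>2) <= (\<Sum>k\<in>to_nat -` {..n}. (v k t)\<^sup>2)"
    by (intro sum_mono2 finite_vimageI inj_to_nat) auto
   then show ?thesis using elim by (meson order_trans)
  qed
  then have smt: "(%k. (v k t)\<^sup>2) summable_on UNIV"
   by (intro nonneg_bdd_above_summable_on bdd_aboveI2[where M = "C\<^sup>2"]) auto
  have "\<exists>f. f \<in> sqi torus & (\<forall>k. inn torus f (cas k) = v k t) & (nrm torus f)\<^sup>2 = (\<Sum>\<^sub>\<infinity>k. (v k t)\<^sup>2) & periodic f"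
  proof (rule torus.riesz_fischer[OF smt])
   fix s assume s: "s \<in> sqi torus" "!!k. inn torus s (cas k) = v k t" "(nrm torus s)\<^sup>2 = (\<Sum>\<^sub>\<infinity>k. (v k t)\<^sup>2)"
    and sym: "!!p x. (!!k. cas k (p x) = cas k x) ==> s (p x) = s x"
   \<comment> \<open>The symmetry clause of \<open>riesz_fischer\<close>, applied to translation by
     a period.\<close>
   have "s (x + axis i (2 * pi)) = s x" for x i
    using sym[of "%x. x + axis i (2 * pi)" x] cas_periodic unfolding periodic_def by blast
   then show ?thesis using s by (intro exI[of _ s]) (auto simp: periodic_def)
  qed
  then obtain f where f: "f \<in> sqi torus" "!!k. inn torus f (cas k) = v k t"
   "(nrm torus f)\<^sup>2 = (\<Sum>\<^sub>\<infinity>k. (v k t)\<^sup>2)" and "periodic f" by blast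
  have "(nrm torus f)\<^sup>2 <= C\<^sup>2"
   unfolding f(3) by (intro infsum_le_finite_sums[OF smt] fin)
  then have "nrm torus f <= C" using C by (rule power2_le_imp_le)
  with f \<open>periodic f\<close> have "W t f" by (simp add: W_def L2_iff)
  then show ?case unfolding w_def using someI[of "W t" f] by auto
 qed
 have wsm: "strongly_measurable T w"
 proof (rule strongly_measurableI)
  show "AE t in itv T. w t \<in> L2" using aeW by eventually_elim (simp add: W_def)
  show "(%t. inn torus (w t) (cas k)) \<in> borel_measurable (itv T)" for k
   by (rule borel_measurable_itv_AE[OF sqi_measurable[OF v[of k]]]) (use aeW in \<open>auto simp: W_def elim: eventually_mono\<close>)
 qed
 have wb: "AE t in itv T. nrm torus (w t) <= C" using aeW by eventually_elim (simp add: W_def)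
 show thesis
 proof
  show "w \<in> Linf_L2 T" using wsm wb by (auto simp: Linf_L2_def L2norm_eq)
  show "AE t in itv T. nrm torus (w t) <= C" by fact
  fix c :: "nat \<times> (int ^ 'd) => real" and S :: "(nat \<times> (int ^ 'd)) set" assume "finite S"
  have "pairing T w (trig_comb T c S) = (LINT t|itv T. (\<Sum>i\<in>S. c i * (v (snd i) t * tcos T (fst i) t)))"
   unfolding pairing_def
  proof (rule integral_cong_AE)
   show "(%t. inn torus (w t) (trig_comb T c S t)) \<in> borel_measurable (itv T)"
    by (intro strongly_measurable_inn wsm L1_sm trig_comb_L1)
   show "(%t. \<Sum>i\<in>S. c i * (v (snd i) t * tcos T (fst i) t)) \<in> borel_measurable (itv T)"
    by (intro borel_measurable_sum borel_measurable_times borel_measurable_const sqi_measurable[OF v] sqi_measurable[OF tcos_sqi])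
   show "AE t in itv T. inn torus (w t) (trig_comb T c S t) = (\<Sum>i\<in>S. c i * (v (snd i) t * tcos T (fst i) t))"
    using aeW
   proof eventually_elim
    case (elim t)
    then have "inn torus (w t) (trig_comb T c S t) = (\<Sum>i\<in>S. c i * inn torus (w t) (%x. tcos T (fst i) t * cas (snd i) x))"
     unfolding trig_comb_def[abs_def] by (intro inn_lincomb_right) (auto simp: W_def L2_sqi sqi_scale)
    also have "... = (\<Sum>i\<in>S. c i * (v (snd i) t * tcos T (fst i) t))"
     unfolding inn_scale_right using elim by (intro sum.cong) (auto simp: W_def mult.commute)
    finally show ?case .
   qed
  qed
  also have "... = (\<Sum>i\<in>S. (LINT t|itv T. c i * (v (snd i) t * tcos T (fst i) t)))"
   by (intro Bochner_Integration.integral_sum integrable_mult_right sqi_integrable_mult v tcos_sqi)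
  also have "... = (\<Sum>i\<in>S. c i * a i)"
   using va by (simp add: inn_def)
  finally show "pairing T w (trig_comb T c S) = (\<Sum>i\<in>S. c i * a i)" .
 qed
qed

text \<open>
  The Hahn--Banach theorem for the dual pair \<open>L\<^sup>1(0,T;L\<^sup>2)\<close>, \<open>L\<^sup>\<infinity>(0,T;L\<^sup>2)\<close>, in the form of a
  Farkas lemma for a convex cone of linear constraints.
\<close>

lemma Linf_solve_cone:
 fixes K :: "((real => real ^ 'd::finite => real) \<times> real) set"
 assumes T: "0 < T" and C: "0 <= C"
  and K0: "((%t x. 0), 0) \<in> K"
  and Kadd: "!!r l r' l'. (r, l) \<in> K ==> (r', l') \<in> K ==> ((%t x. r t x + r' t x), l + l') \<in> K"
  and Kscale: "!!r l s. (r, l) \<in> K ==> 0 <= s ==> ((%t x. s * r t x), s * l) \<in> K"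
  and KL1: "!!r l. (r, l) \<in> K ==> r \<in> Lp_L2 1 T"
  and Kb: "!!r l. (r, l) \<in> K ==> - l <= C * nrm1 T r"
 obtains w where "w \<in> Linf_L2 T" "AE t in itv T. nrm torus (w t) <= C"
  "!!r l. (r, l) \<in> K ==> pairing T w r <= l"
proof -
 define X where "X c = trig_comb T c {i. c i ~= 0}" for c :: "nat \<times> (int ^ 'd) => real"
 have X_eq: "X c = trig_comb T c S" if "finite S" "!!i. i \<notin> S ==> c i = 0" for c S
 proof -
  have "{i. c i ~= 0} \<subseteq> S" using that(2) by blast
  then show ?thesis
   unfolding X_def using that by (intro trig_comb_superset[symmetric]) (auto intro: finite_subset)
 qed
 have XL1: "X c \<in> Lp_L2 1 T" for c unfolding X_def by (rule trig_comb_L1)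
 define V where "V c = (%(r, l). C * nrm1 T (%t x. X c t x - r t x) + l) ` K" for c
 define p where "p c = Inf (V c)" for c
 \<comment> \<open>The compatibility assumption on \<open>K\<close> and the triangle inequality
   bound the values from below, so that the infimum is finite.\<close>
 have low: "- C * nrm1 T (X c) <= C * nrm1 T (%t x. X c t x - r t x) + l" if "(r, l) \<in> K" for c r l
 proof -
  have "nrm1 T r <= nrm1 T (%t x. r t x - X c t x) + nrm1 T (X c)"
   using nrm1_add[OF L1_diff[OF KL1[OF that] XL1] XL1, of c c] by simp
  then have "C * nrm1 T r <= C * (nrm1 T (%t x. r t x - X c t x) + nrm1 T (X c))" using C by (rule mult_left_mono)
  then show ?thesis using Kb[OF that] by (simp add: nrm1_minus_commute[of T r] distrib_left)
 qed
 have bdd: "bdd_below (V c)" for c unfolding V_def using low by (intro bdd_belowI2) auto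
 have p_le: "p c <= C * nrm1 T (%t x. X c t x - r t x) + l" if "(r, l) \<in> K" for c r l
  unfolding p_def using that by (intro cInf_lower bdd) (auto simp: V_def intro!: image_eqI[of _ _ "(r, l)"])
 have p_near: "\<exists>r l. (r, l) \<in> K & C * nrm1 T (%t x. X c t x - r t x) + l < p c + e" if "0 < e" for c e
 proof -
  have "V c ~= {}" using K0 by (auto simp: V_def)
  then have "\<exists>y\<in>V c. y < p c + e" using that unfolding p_def by (intro cInf_lessD) auto
  then show ?thesis by (auto simp: V_def)
 qed
 obtain a where a: "!!c S. finite S ==> (!!i. i \<notin> S ==> c i = 0) ==> (\<Sum>i\<in>S. c i * a i) <= p c"
 proof (rule hahn_banach_countable[of p])
  fix c d :: "nat \<times> (int ^ 'd) => real" assume fin: "finite {i. c i ~= 0}" "finite {i. d i ~= 0}"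
  let ?S = "{i. c i ~= 0} \<union> {i. d i ~= 0}"
  have Xadd: "X (%i. c i + d i) t x = X c t x + X d t x" for t x
   using fin by (subst (1 2 3) X_eq[of ?S]) (auto simp: trig_comb_def distrib_right sum.distrib)
  show "p (%i. c i + d i) <= p c + p d"
  proof (rule field_le_epsilon)
   fix e :: real assume "0 < e"
   then obtain r l r' l' where rl: "(r, l) \<in> K" "C * nrm1 T (%t x. X c t x - r t x) + l < p c + e / 2"
    and rl': "(r', l') \<in> K" "C * nrm1 T (%t x. X d t x - r' t x) + l' < p d + e / 2"
    using p_near[of "e / 2" c] p_near[of "e / 2" d] by auto
   have "p (%i. c i + d i) <= C * nrm1 T (%t x. X (%i. c i + d i) t x - (r t x + r' t x)) + (l + l')"
    by (intro p_le Kadd rl rl')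
   also have "(%t x. X (%i. c i + d i) t x - (r t x + r' t x)) = (%t x. (X c t x - r t x) + (X d t x - r' t x))"
    by (simp add: Xadd algebra_simps)
   also have "C * nrm1 T ... <= C * (nrm1 T (%t x. X c t x - r t x) + nrm1 T (%t x. X d t x - r' t x))"
    by (intro mult_left_mono nrm1_add L1_diff XL1 C) (use rl rl' KL1 in auto)
   finally show "p (%i. c i + d i) <= p c + p d + e" using rl(2) rl'(2) by (simp add: distrib_left)
  qed
 next
  fix c :: "nat \<times> (int ^ 'd) => real" and s :: real assume fin: "finite {i. c i ~= 0}" and s: "0 <= s"
  have Xs: "X (%i. s * c i) t x = s * X c t x" for t x
   using fin by (subst (1 2) X_eq[of "{i. c i ~= 0}"]) (auto simp: trig_comb_def sum_distrib_left mult.assoc)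
  show "p (%i. s * c i) <= s * p c"
  proof (rule field_le_epsilon)
   fix e :: real assume e: "0 < e"
   define e' where "e' = e / (s + 1)"
   have e': "0 < e'" using e s by (simp add: e'_def)
   obtain r l where rl: "(r, l) \<in> K" "C * nrm1 T (%t x. X c t x - r t x) + l < p c + e'"
    using p_near[OF e'] by blast
   have "p (%i. s * c i) <= C * nrm1 T (%t x. X (%i. s * c i) t x - s * r t x) + s * l"
    by (intro p_le Kscale rl s)
   also have "(%t x. X (%i. s * c i) t x - s * r t x) = (%t x. s * (X c t x - r t x))"
    by (simp add: Xs right_diff_distrib)
   also have "C * nrm1 T ... + s * l = s * (C * nrm1 T (%t x. X c t x - r t x) + l)"
    unfolding nrm1_scale using s by (simp add: algebra_simps)
   also have "... <= s * (p c + e')" using rl(2) s by (intro mult_left_mono) auto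
   also have "... <= s * p c + e" using s e by (simp add: e'_def field_simps)
   finally show "p (%i. s * c i) <= s * p c + e" .
  qed
 qed blast
 have aC: "(\<Sum>i\<in>S. c i * a i) <= C * nrm1 T (trig_comb T c S)" if "finite S" "!!i. i \<notin> S ==> c i = 0" for c S
 proof -
  have "(\<Sum>i\<in>S. c i * a i) <= p c" by (rule a) (fact that)+
  then show ?thesis using p_le[OF K0, of c] by (simp add: X_eq[OF that])
 qed
 obtain w where w: "w \<in> Linf_L2 T" "AE t in itv T. nrm torus (w t) <= C"
  "!!c S. finite S ==> pairing T w (trig_comb T c S) = (\<Sum>i\<in>S. c i * a i)"
  using Linf_representation[OF T C aC] by blast
 show thesis
 proof
  fix r l assume rl: "(r, l) \<in> K"
  have r: "r \<in> Lp_L2 1 T" by (rule KL1[OF rl])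
  show "pairing T w r <= l"
  proof (rule field_le_epsilon)
   fix e :: real assume e: "0 < e"
   \<comment> \<open>Constraint functions need not be trigonometric sums. Approximating
     \<open>r\<close> within \<open>d\<close> costs \<open>C * d\<close> twice, at most
     \<open>e\<close> together.\<close>
   define d where "d = e / (2 * C + 1)"
   have d: "0 < d" using e C by (simp add: d_def)
   obtain c S where S: "finite S" "!!i. i \<notin> S ==> c i = 0" "nrm1 T (%t x. r t x - trig_comb T c S t x) < d"
    by (rule trig_comb_dense[OF T r d], rule that)
   have ap: "(\<Sum>i\<in>S. c i * a i) <= p c" by (rule a) (fact S)+
   have "pairing T w r = pairing T w (trig_comb T c S) + pairing T w (%t x. r t x - trig_comb T c S t x)"
    using pairing_combine[OF w(1) r trig_comb_L1, of 1 "-1" c S] by simp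
   also have "... <= p c + C * nrm1 T (%t x. r t x - trig_comb T c S t x)"
    using ap w(3)[OF S(1), of c]
     pairing_bound(2)[OF Linf_sm[OF w(1)] w(2) L1_diff[OF r trig_comb_L1], of c S] by linarith
   also have "... <= (C * nrm1 T (%t x. r t x - trig_comb T c S t x) + l) + C * nrm1 T (%t x. r t x - trig_comb T c S t x)"
    using p_le[OF rl, of c] by (simp add: X_eq[OF S(1,2)] nrm1_minus_commute[of T r])
   also have "... <= l + 2 * C * d" using mult_left_mono[OF less_imp_le[OF S(3)] C] by simp
   also have "... <= l + e" using e C by (simp add: d_def field_simps)
   finally show "pairing T w r <= l + e" .
  qed
 qed (fact w)+
qed

subsection \<open>Calculus on the time interval\<close>

lemma itv_subinterval:
 fixes f :: "real => real"
 assumes f: "integrable (itv T) f" and ab: "0 <= a" "b <= T"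
 shows "(LINT t|itv T. indicator {a..b} t * f t) = integral {a..b} f"
  and "(LINT t:{a..b}|lebesgue. f t) = integral {a..b} f"
proof -
 have "integrable (lebesgue_on {a..b}) f"
  using ab by (intro integrable_subinterval[OF f]) auto
 then have 1: "integral\<^sup>L (lebesgue_on {a..b}) f = integral {a..b} f"
  by (intro lebesgue_integral_eq_integral) auto
 show 2: "(LINT t:{a..b}|lebesgue. f t) = integral {a..b} f"
  unfolding 1[symmetric] set_lebesgue_integral_def by (subst integral_restrict_space) auto
 have "(LINT t|itv T. indicator {a..b} t * f t) = (LINT t|lebesgue. indicator {0..T} t *\<^sub>R (indicator {a..b} t * f t))"
  by (subst integral_restrict_space) auto
 also have "... = (LINT t:{a..b}|lebesgue. f t)"
  unfolding set_lebesgue_integral_def using ab by (intro Bochner_Integration.integral_cong) (auto simp: indicator_def)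
 finally show "(LINT t|itv T. indicator {a..b} t * f t) = integral {a..b} f" using 2 by simp
qed

lemma integrable_itv_HK: "integrable (itv T) f ==> (f :: real => real) integrable_on {0..T}"
 by (simp add: integrable_on_lebesgue_on)

lemma FTC_subinterval:
 fixes F f :: "real => real"
 assumes F: "!!t. t \<in> {0..T} ==> (F has_real_derivative f t) (at t within {0..T})"
  and ab: "0 <= a" "a <= b" "b <= T"
 shows "integral {a..b} f = F b - F a"
proof -
 have "(F has_real_derivative f t) (at t within {a..b})" if "t \<in> {a..b}" for t
  using that ab by (intro has_field_derivative_subset[OF F]) auto
 then have "(f has_integral F b - F a) {a..b}"
  using ab by (intro fundamental_theorem_of_calculus) (auto simp: has_real_derivative_iff_has_vector_derivative)
 then show ?thesis by (rule integral_unique)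
qed

text \<open>The antiderivative of \<open>- eta\<close> that vanishes at \<open>T\<close>. Taking
  \<open>eta\<close> as the datum makes the terminal condition of the test function
  automatic.\<close>

definition tail_integral :: "real => (real => real) => real => real" where
 "tail_integral T eta t = integral {0..T} eta - integral {0..t} eta"

lemma tail_integral_T [simp]: "tail_integral T eta T = 0"
 by (simp add: tail_integral_def)

lemma tail_integral_deriv:
 assumes "continuous_on {0..T} eta" "t \<in> {0..T}"
 shows "(tail_integral T eta has_real_derivative - eta t) (at t within {0..T})"
 unfolding tail_integral_def[abs_def] using integral_has_real_derivative[OF assms]
 by (auto intro!: derivative_eq_intros)

lemma tail_integral_continuous:
 "continuous_on {0..T} eta ==> continuous_on {0..T} (tail_integral T eta)"
 using tail_integral_deriv by (meson DERIV_continuous_on)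

lemma tail_integral_scale: "tail_integral T (%t. c * eta t) t = c * tail_integral T eta t"
 by (simp add: tail_integral_def algebra_simps)

lemma measurable_itv_continuous:
 "continuous_on {0..T} f ==> f \<in> borel_measurable (itv T)"
 by (intro measurable_itv_borel borel_measurable_continuous_on_restrict)

text \<open>Integration by parts for a merely integrable \<open>ga\<close>: both sides are the
  integral of \<open>ga t * eta s\<close> over the triangle \<open>t <= s\<close>.\<close>

lemma tail_integral_Fubini:
 assumes eta: "continuous_on {0..T} eta" and ga: "integrable (itv T) ga"
 shows "(LINT t|itv T. tail_integral T eta t * ga t) = (LINT s|itv T. eta s * integral {0..s} ga)"
proof -
 interpret finite_measure "itv T" by (rule finite_measure_itv)
 interpret pair_sigma_finite "itv T" "itv T" ..
 have etai: "integrable (itv T) eta" by (rule continuous_integrable_itv[OF eta])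
 have [measurable]: "eta \<in> borel_measurable (itv T)" "ga \<in> borel_measurable (itv T)" using etai ga by auto
 have id: "(%t. t) \<in> borel_measurable (itv T)" by (intro borel_measurable_itv_borel) auto
 have le [measurable]: "Measurable.pred (itv T \<Otimes>\<^sub>M itv T) (%p. fst p <= snd p)"
  using measurable_compose[OF measurable_fst id] measurable_compose[OF measurable_snd id] by measurable
 let ?f = "%t s. (if t <= s then 1 else 0) * (ga t * eta s)"
 have int: "integrable (itv T \<Otimes>\<^sub>M itv T) (case_prod ?f)"
 proof (rule Bochner_Integration.integrable_bound)
  show "integrable (itv T \<Otimes>\<^sub>M itv T) (%(t, s). ga t * eta s)"
  proof (rule Fubini_integrable)
   show "integrable (itv T) (%t. LINT s|itv T. norm (case (t, s) of (t, s) => ga t * eta s))"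
    using ga by (simp add: abs_mult)
   show "AE t in itv T. integrable (itv T) (%s. case (t, s) of (t, s) => ga t * eta s)"
    using etai by simp
  qed measurable
 qed (auto simp: case_prod_beta)
 have "(LINT t|itv T. tail_integral T eta t * ga t) = (LINT t|itv T. (LINT s|itv T. ?f t s))"
 proof (rule Bochner_Integration.integral_cong[OF refl])
  fix t assume "t \<in> space (itv T)"
  then have t: "0 <= t" "t <= T" by auto
  have "tail_integral T eta t = integral {t..T} eta"
   using Henstock_Kurzweil_Integration.integral_combine[of 0 t T eta] t integrable_itv_HK[OF etai]
   by (simp add: tail_integral_def)
  also have "... = (LINT s|itv T. indicator {t..T} s * eta s)" using t by (intro itv_subinterval[OF etai, symmetric]) auto
  also have "... = (LINT s|itv T. (if t <= s then 1 else 0) * eta s)"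
   by (intro Bochner_Integration.integral_cong) (auto simp: indicator_def)
  finally show "tail_integral T eta t * ga t = (LINT s|itv T. ?f t s)"
   by (simp add: mult.commute[of _ "ga t"] mult.left_commute[of _ "ga t"])
 qed
 also have "... = (LINT s|itv T. (LINT t|itv T. ?f t s))"
  by (rule Fubini_integral[OF int, symmetric])
 also have "... = (LINT s|itv T. eta s * integral {0..s} ga)"
 proof (rule Bochner_Integration.integral_cong[OF refl])
  fix s assume "s \<in> space (itv T)"
  then have s: "0 <= s" "s <= T" by auto
  have "(LINT t|itv T. ?f t s) = (LINT t|itv T. (indicator {0..s} t * ga t) * eta s)"
   by (intro Bochner_Integration.integral_cong) (auto simp: indicator_def)
  then show "(LINT t|itv T. ?f t s) = eta s * integral {0..s} ga"
   using itv_subinterval(1)[OF ga, of 0 s] s by simp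
 qed
 finally show ?thesis .
qed

text \<open>
  A Gronwall inequality with an integrable coefficient \<open>\<beta>\<close>. The interval is cut into finitely many
  pieces on which the integral of \<open>\<beta>\<close> is at most \<open>1/2\<close>, so that the last term can be absorbed.
\<close>

lemma gronwall_backward:
 assumes T: "0 < T" and bt: "integrable (itv T) bt" "!!t. 0 <= bt t"
 obtains C where "0 <= C"
  "!!m l :: real => real. continuous_on {0..T} m ==> (!!t. 0 <= m t) ==> m T = 0 ==>
   integrable (itv T) l ==> (!!t. 0 <= l t) ==>
   (!!s t. 0 <= s ==> s <= t ==> t <= T ==>
    (m s)\<^sup>2 <= (m t)\<^sup>2 + (LINT r|itv T. indicator {s..t} r * (2 * l r * m r + bt r * (m r)\<^sup>2))) ==>
   m 0 <= C * (LINT r|itv T. l r)"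
proof -
 have "uniformly_continuous_on {0..T} (%t. integral {0..t} bt)"
  by (intro compact_uniformly_continuous indefinite_integral_continuous_1 integrable_itv_HK bt) auto
 then obtain d where d: "0 < d"
  "!!s t. s \<in> {0..T} ==> t \<in> {0..T} ==> \<bar>t - s\<bar> < d ==> \<bar>integral {0..t} bt - integral {0..s} bt\<bar> < 1 / 2"
  unfolding uniformly_continuous_on_def dist_real_def by (meson half_gt_zero zero_less_one)
 obtain n where n: "0 < n" "T / real n < d"
 proof -
  obtain n where "T / d < real n" using reals_Archimedean2 by blast
  moreover have "0 < T / d" using T d by simp
  ultimately have n: "0 < real n" "T / d < real n" by linarith+
  then have "T / real n < d" using d(1) by (simp add: divide_less_eq mult.commute)
  then show thesis using that n by simp
 qed
 define h where "h = T / real n"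
 have h: "0 < h" "h < d" "real n * h = T" using n T by (auto simp: h_def)
 have small: "integral {s..t} bt <= 1 / 2" if "0 <= s" "s <= t" "t <= T" "t - s <= h" for s t
 proof -
  have "integral {0..s} bt + integral {s..t} bt = integral {0..t} bt"
   using that by (intro Henstock_Kurzweil_Integration.integral_combine integrable_on_subinterval[OF integrable_itv_HK[OF bt(1)]]) auto
  moreover have "\<bar>integral {0..t} bt - integral {0..s} bt\<bar> < 1 / 2"
   using that h by (intro d(2)) auto
  ultimately show ?thesis by linarith
 qed
 \<comment> \<open>One piece turns a bound \<open>k * N\<close> at its right end into
   \<open>(2 * k + 4) * N\<close> on the whole piece. The recursion starts at 0 because
   \<open>m\<close> vanishes at \<open>T\<close>, and the resulting constant depends on
   \<open>bt\<close> and \<open>T\<close> but on neither \<open>m\<close> nor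
   \<open>l\<close>.\<close>
 define c where "c i = ((%x. 2 * x + 4) ^^ i) (0 :: real)" for i
 have c: "0 <= c i" "c (Suc i) = 2 * c i + 4" for i by (induction i) (auto simp: c_def)
 show thesis
 proof
  show "0 <= c n" by (rule c)
  fix m l :: "real => real"
  assume m: "continuous_on {0..T} m" "!!t. 0 <= m t" "m T = 0"
   and l: "integrable (itv T) l" "!!t. 0 <= l t"
   and ineq: "!!s t. 0 <= s ==> s <= t ==> t <= T ==>
    (m s)\<^sup>2 <= (m t)\<^sup>2 + (LINT r|itv T. indicator {s..t} r * (2 * l r * m r + bt r * (m r)\<^sup>2))"
  define N where "N = (LINT r|itv T. l r)"
  have N: "0 <= N" unfolding N_def by (intro Bochner_Integration.integral_nonneg l)
  have step: "m s <= (2 * k + 4) * N"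
   if s: "0 <= s" "s <= t" "t <= T" "t - s <= h" and k: "0 <= k" "m t <= k * N" for s t k
  proof -
   have "continuous_on {s..t} m" using s by (intro continuous_on_subset[OF m(1)]) auto
   then obtain p where p: "p \<in> {s..t}" "!!r. r \<in> {s..t} ==> m r <= m p"
    using continuous_attains_sup[of "{s..t}" m] s by auto
   \<comment> \<open>The maximum over the piece is attained at \<open>p\<close>. Using the
     inequality from \<open>p\<close> to \<open>t\<close> allows \<open>m r\<close> to be replaced
     by \<open>M\<close> under the integral.\<close>
   define M where "M = m p"
   have M: "0 <= M" by (simp add: M_def m)
   have ind: "integrable (itv T) (%r. indicator {p..t} r * f r)" if "integrable (itv T) f" for f :: "real => real"
   proof (rule Bochner_Integration.integrable_bound[OF that])
    have "indicator {p..t} \<in> borel_measurable (itv T)" by (rule borel_measurable_itv_borel) auto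
    then show "(%r. indicator {p..t} r * f r) \<in> borel_measurable (itv T)"
     using that by (intro borel_measurable_times) auto
   qed (auto simp: indicator_def)
   have mi: "integrable (itv T) (%r. indicator {p..t} r * (2 * l r * M + bt r * M\<^sup>2))"
    using l(1) bt(1) by (intro ind) auto
   have "M\<^sup>2 <= (m t)\<^sup>2 + (LINT r|itv T. indicator {p..t} r * (2 * l r * m r + bt r * (m r)\<^sup>2))"
    unfolding M_def using p s by (intro ineq) auto
   also have "(LINT r|itv T. indicator {p..t} r * (2 * l r * m r + bt r * (m r)\<^sup>2))
     <= (LINT r|itv T. indicator {p..t} r * (2 * l r * M + bt r * M\<^sup>2))"
   proof (rule integral_mono_AE')
    show "integrable (itv T) (%r. indicator {p..t} r * (2 * l r * M + bt r * M\<^sup>2))" by (rule mi)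
    show "AE r in itv T. indicator {p..t} r * (2 * l r * m r + bt r * (m r)\<^sup>2) <= indicator {p..t} r * (2 * l r * M + bt r * M\<^sup>2)"
    proof (rule AE_I2)
     fix r
     show "indicator {p..t} r * (2 * l r * m r + bt r * (m r)\<^sup>2) <= indicator {p..t} r * (2 * l r * M + bt r * M\<^sup>2)"
     proof (cases "r \<in> {p..t}")
      case True
      then have "m r <= M" unfolding M_def using p by (intro p(2)) auto
      then have "2 * l r * m r + bt r * (m r)\<^sup>2 <= 2 * l r * M + bt r * M\<^sup>2"
       using l(2)[of r] bt(2)[of r] m(2)[of r] by (intro add_mono mult_left_mono power_mono) auto
      then show ?thesis using True by simp
     qed simp
    qed
    show "AE r in itv T. 0 <= indicator {p..t} r * (2 * l r * M + bt r * M\<^sup>2)"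
     using l(2) bt(2) M by (intro AE_I2) auto
   qed
   also have "... <= 2 * N * M + 1 / 2 * M\<^sup>2"
   proof -
    have li: "integrable (itv T) (%r. indicator {p..t} r * l r)" "integrable (itv T) (%r. indicator {p..t} r * bt r)"
     by (intro ind l bt)+
    have "(LINT r|itv T. indicator {p..t} r * (2 * l r * M + bt r * M\<^sup>2))
      = (LINT r|itv T. (2 * M) * (indicator {p..t} r * l r) + M\<^sup>2 * (indicator {p..t} r * bt r))"
     by (intro Bochner_Integration.integral_cong) (auto simp: algebra_simps)
    also have "... = (2 * M) * (LINT r|itv T. indicator {p..t} r * l r) + M\<^sup>2 * (LINT r|itv T. indicator {p..t} r * bt r)"
     using li by simp
    also have "... <= (2 * M) * N + M\<^sup>2 * (1 / 2)"
    proof (intro add_mono mult_left_mono)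
     have "(LINT r|itv T. indicator {p..t} r * bt r) = integral {p..t} bt"
      using p s by (intro itv_subinterval bt) auto
     also have "... <= 1 / 2" using p s by (intro small) auto
     finally show "(LINT r|itv T. indicator {p..t} r * bt r) <= 1 / 2" .
     show "(LINT r|itv T. indicator {p..t} r * l r) <= N"
      unfolding N_def using li l by (intro integral_mono) (auto simp: indicator_def)
    qed (use M in auto)
    also have "... = 2 * N * M + 1 / 2 * M\<^sup>2" by simp
    finally show ?thesis .
   qed
   also have "(m t)\<^sup>2 <= (k * N)\<^sup>2" using k m(2) by (intro power_mono) auto
   finally have q: "M\<^sup>2 <= 2 * (k * N)\<^sup>2 + 4 * N * M" by (simp add: algebra_simps)
   \<comment> \<open>If \<open>M\<close> exceeded the bound, then also \<open>k * N <= M\<close>,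
     and the quadratic inequality divided by \<open>M\<close> would contradict this.\<close>
   have "M <= (2 * k + 4) * N"
   proof (rule ccontr)
    assume "\<not> M <= (2 * k + 4) * N"
    then have less: "(2 * k + 4) * N < M" by simp
    have kN: "0 <= k * N" using k N by simp
    have "2 * (k * N)\<^sup>2 <= 2 * (k * N) * M"
    proof -
     have "k * N <= M" using less kN N by (simp add: algebra_simps)
     then have "(k * N) * (k * N) <= (k * N) * M" by (rule mult_left_mono[OF _ kN])
     then show ?thesis unfolding power2_eq_square by linarith
    qed
    then have "M * M <= ((2 * k + 4) * N) * M" using q by (simp add: power2_eq_square algebra_simps)
    moreover have "0 < M" using less kN N by (smt (verit, best) mult_nonneg_nonneg k(1))
    ultimately show False using less by simp
   qed
   then show ?thesis using p(2)[of s] s by (simp add: M_def)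
  qed
  have "\<forall>t. T - real i * h <= t & 0 <= t & t <= T --> m t <= c i * N" if "i <= n" for i
   using that
  proof (induction i)
   case 0
   have "t = T" if "T <= t" "t <= T" for t using that by simp
   then show ?case using m(3) by (auto simp: c_def)
  next
   case (Suc i)
   show ?case
   proof (intro allI impI)
    fix t assume t: "T - real (Suc i) * h <= t & 0 <= t & t <= T"
    have "real i * h <= real n * h" using Suc.prems h by (intro mult_right_mono) auto
    then have ge: "0 <= T - real i * h" using h by simp
    define s where "s = max t (T - real i * h)"
    have ih: "m s <= c i * N" using Suc ge t h by (auto simp: s_def)
    have "m t <= (2 * c i + 4) * N"
     using t ge h by (intro step[of t s "c i"] c ih) (auto simp: s_def algebra_simps)
    then show "m t <= c (Suc i) * N" by (simp add: c)
   qed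
  qed
  from this[of n] show "m 0 <= c n * N" using h T by auto
 qed
qed

section \<open>Finite sums and multipliers in time\<close>

lemma DERIV_sum_list:
 assumes "!!p. p \<in> set ps ==> (F p has_real_derivative F' p) (at t within A)"
 shows "((%t. \<Sum>p\<leftarrow>ps. F p t) has_real_derivative (\<Sum>p\<leftarrow>ps. F' p)) (at t within A)"
 using assms by (induction ps) (auto intro!: derivative_intros)

lemma continuous_on_sum_list:
 assumes "!!p. p \<in> set ps ==> continuous_on A (F p :: real => real)"
 shows "continuous_on A (%t. \<Sum>p\<leftarrow>ps. F p t)"
 using assms by (induction ps) (auto intro!: continuous_intros)

lemma inn_sum_list_left:
 "(!!p. p \<in> set ps ==> F p \<in> sqi M) ==> k \<in> sqi M ==>
  inn M (%x. \<Sum>p\<leftarrow>ps. F p x) k = (\<Sum>p\<leftarrow>ps. inn M (F p) k) & (%x. \<Sum>p\<leftarrow>ps. F p x) \<in> sqi M"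
 by (induction ps) (auto simp: inn_add_left intro: sqi_add sqi_zero)

lemma L1_bounded_mult:
 assumes c: "continuous_on {0..T} c" and f: "f \<in> Lp_L2 1 T"
 shows "(%t x. c t * f t x) \<in> Lp_L2 1 T"
proof -
 have cm: "c \<in> borel_measurable (itv T)" by (rule measurable_itv_continuous[OF c])
 have "strongly_measurable T (%t x. c t * f t x + 0 * f t x)"
  by (intro strongly_measurable_combine L1_sm f cm) auto
 then have sm: "strongly_measurable T (%t x. c t * f t x)" by simp
 have "bounded (c ` {0..T})" using c by (intro compact_imp_bounded compact_continuous_image) auto
 then obtain B where "\<forall>y\<in>c ` {0..T}. norm y <= B" unfolding bounded_iff by blast
 then have B: "\<bar>c t\<bar> <= B" if "t \<in> {0..T}" for t using that by auto
 have "integrable (itv T) (%t. nrm torus (%x. c t * f t x))"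
 proof (rule Bochner_Integration.integrable_bound)
  show "integrable (itv T) (%t. B * nrm torus (f t))" using f by (simp add: Lp_L2_1_iff)
  show "(%t. nrm torus (%x. c t * f t x)) \<in> borel_measurable (itv T)" by (rule strongly_measurable_nrm[OF sm])
  show "AE t in itv T. norm (nrm torus (%x. c t * f t x)) <= norm (B * nrm torus (f t))"
  proof (rule AE_I2)
   fix t assume "t \<in> space (itv T)"
   then have "\<bar>c t\<bar> <= \<bar>B\<bar>" using B[of t] by simp
   then show "norm (nrm torus (%x. c t * f t x)) <= norm (B * nrm torus (f t))"
    by (simp add: nrm_scale abs_mult mult_right_mono)
  qed
 qed
 then show ?thesis using sm by (simp add: Lp_L2_1_iff)
qed

lemma L1_smooth_mult:
 assumes p: "ph \<in> Csmooth" and f: "f \<in> Lp_L2 1 T"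
 shows "(%t x. ph x * f t x) \<in> Lp_L2 1 T"
proof -
 obtain C where C: "0 <= C" "AE x in torus. \<bar>ph x\<bar> <= C" using Csmooth_bounded[OF p] by blast
 have le: "nrm torus (%x. ph x * g x) <= C * nrm torus g" if g: "g \<in> L2" for g
 proof (rule power2_le_imp_le)
  have s: "(%x. ph x * g x) \<in> sqi torus" by (intro L2_sqi L2_smooth_mult g p)
  have "(LINT x|torus. (ph x * g x)\<^sup>2) <= (LINT x|torus. C\<^sup>2 * (g x)\<^sup>2)"
  proof (rule integral_mono_AE)
   show "AE x in torus. (ph x * g x)\<^sup>2 <= C\<^sup>2 * (g x)\<^sup>2"
    using C(2)
   proof eventually_elim
    case (elim x)
    then have "\<bar>ph x\<bar>\<^sup>2 <= C\<^sup>2" by (intro power_mono) auto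
    then show ?case by (simp add: power_mult_distrib mult_right_mono)
   qed
  qed (use sqi_integrable_power2[OF s] sqi_integrable_power2[OF L2_sqi[OF g]] in auto)
  then show "(nrm torus (%x. ph x * g x))\<^sup>2 <= (C * nrm torus g)\<^sup>2"
   unfolding power_mult_distrib[of C] nrm_power2 inn_def by (simp add: power2_eq_square)
 qed (use C in simp)
 have sm: "strongly_measurable T (%t x. ph x * f t x)"
 proof (rule strongly_measurableI)
  show "AE t in itv T. (%x. ph x * f t x) \<in> L2"
   using L1_AE[OF f] by eventually_elim (rule L2_smooth_mult[OF _ p])
  have "(%t. inn torus (f t) (%x. ph x * cas k x)) \<in> borel_measurable (itv T)" for k
   by (intro strongly_measurableD(2) L1_sm f L2_smooth_mult cas_L2 p)
  then show "(%t. inn torus (%x. ph x * f t x) (cas k)) \<in> borel_measurable (itv T)" for k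
   by (simp add: inn_def mult_ac)
 qed
 have "integrable (itv T) (%t. nrm torus (%x. ph x * f t x))"
 proof (rule Bochner_Integration.integrable_bound)
  show "integrable (itv T) (%t. C * nrm torus (f t))" using f by (simp add: Lp_L2_1_iff)
  show "(%t. nrm torus (%x. ph x * f t x)) \<in> borel_measurable (itv T)" by (rule strongly_measurable_nrm[OF sm])
  show "AE t in itv T. norm (nrm torus (%x. ph x * f t x)) <= norm (C * nrm torus (f t))"
   using L1_AE[OF f] by eventually_elim (use le C in auto)
 qed
 then show ?thesis using sm by (simp add: Lp_L2_1_iff)
qed

lemma Lp_L2_2_subset_1: "f \<in> Lp_L2 2 T ==> f \<in> Lp_L2 1 T"
proof -
 interpret finite_measure "itv T" by (rule finite_measure_itv)
 assume f: "f \<in> Lp_L2 2 T"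
 then have sm: "strongly_measurable T f" by (simp add: Lp_L2_def)
 have "(\<integral>\<^sup>+t. ennreal ((nrm torus (f t))\<^sup>2) \<partial>itv T) < \<infinity>"
  using f unfolding Lp_L2_def set_nn_integral_itv by (simp add: L2norm_eq powr_numeral)
 then have "integrable (itv T) (%t. (nrm torus (f t))\<^sup>2)"
  by (intro integrableI_bounded borel_measurable_power strongly_measurable_nrm sm) auto
 then have "integrable (itv T) (%t. 1 + (nrm torus (f t))\<^sup>2)" by simp
 then have "integrable (itv T) (%t. nrm torus (f t))"
 proof (rule Bochner_Integration.integrable_bound)
  have "x <= 1 + x\<^sup>2" for x :: real
  proof -
   have "2 * x <= 1 + x\<^sup>2" using sum_squares_bound[of 1 x] by simp
   then show ?thesis using zero_le_power2[of x] by linarith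
  qed
  then show "AE t in itv T. norm (nrm torus (f t)) <= norm (1 + (nrm torus (f t))\<^sup>2)" by auto
 qed (rule strongly_measurable_nrm[OF sm])
 then show ?thesis using sm by (simp add: Lp_L2_1_iff)
qed

subsection \<open>The deterministic problem\<close>

locale drift =
 fixes T :: real and b :: "real => real ^ 'd::finite => real ^ 'd"
 assumes T: "0 < T"
  and b_L2: "!!i. (%t x. b t x $ i) \<in> Lp_L2 2 T"
  and b_div: "AE t in itv T. \<exists>g. has_weak_div (b t) g"
  and wdiv_L2: "(%t. wdiv (b t)) \<in> Lp_L2 2 T"
  and wdiv_Linf: "(\<integral>\<^sup>+t\<in>{0..T}. Linf_norm (wdiv (b t)) \<partial>lebesgue) < \<infinity>"
begin

lemma b_div': "AE t in itv T. has_weak_div (b t) (wdiv (b t))"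
 using b_div by eventually_elim (rule has_weak_div_wdiv)

text \<open>The formal adjoint of \<open>\<nu> \<Delta> + b \<cdot> \<nabla>\<close> at time \<open>t\<close>.\<close>

definition adj :: "real => real => (real ^ 'd => real) => real ^ 'd => real" where
 "adj nu t ph x = nu * laplacian ph x - (ph x * wdiv (b t) x + b t x \<bullet> grad ph x)"

lemma adj_L1:
 assumes p: "ph \<in> Csmooth"
 shows "(%t. adj nu t ph) \<in> Lp_L2 1 T"
proof -
 interpret finite_measure "itv T" by (rule finite_measure_itv)
 have "(%t x. nu * laplacian ph x) \<in> Lp_L2 1 T"
  by (rule L1_product) (auto intro: Csmooth_L2 laplacian_Csmooth p)
 moreover have "(%t x. ph x * wdiv (b t) x) \<in> Lp_L2 1 T"
  by (intro L1_smooth_mult p Lp_L2_2_subset_1 wdiv_L2)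
 moreover have "(%t x. b t x \<bullet> grad ph x) \<in> Lp_L2 1 T"
  unfolding inner_grad by (intro L1_sum L1_smooth_mult Csmooth_pdiff p Lp_L2_2_subset_1 b_L2)
 ultimately show ?thesis
  unfolding adj_def[abs_def] by (intro L1_diff L1_add)
qed

lemma inn_adj:
 assumes p: "ph \<in> Csmooth" and w: "has_weak_div (b t) (wdiv (b t))" and v: "v \<in> L2"
 shows "inn torus v (adj nu t ph) = nu * inn torus v (laplacian ph) - inn torus v (wdiv (%x. ph x *\<^sub>R b t x))"
proof -
 let ?g = "%x. ph x * wdiv (b t) x + b t x \<bullet> grad ph x"
 have l: "laplacian ph \<in> sqi torus" by (intro Csmooth_sqi laplacian_Csmooth p)
 have g: "?g \<in> sqi torus"
  using w p by (intro L2_sqi L2_add L2_smooth_mult L2_inner_grad) (auto simp: has_weak_div_def)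
 have "inn torus v (adj nu t ph) = nu * inn torus v (laplacian ph) - inn torus v ?g"
  unfolding adj_def[abs_def]
  by (subst inn_diff_right) (auto simp: inn_scale_right intro: sqi_scale l g L2_sqi v)
 also have "inn torus v ?g = inn torus v (wdiv (%x. ph x *\<^sub>R b t x))"
  using eqT_inn[OF wdiv_smooth_mult(2)[OF w p] L2_sqi[OF wdiv_smooth_mult(1)[OF w p]] g L2_sqi[OF v]]
  by (simp add: inn_commute)
 finally show ?thesis .
qed

lemma wdiv_pairing_integrable:
 assumes p: "ph \<in> Csmooth" and u: "u \<in> Linf_L2 T"
 shows "integrable (itv T) (%t. inn torus (u t) (adj nu t ph))"
  and "integrable (itv T) (%t. inn torus (u t) (laplacian ph))"
  and "AE t in itv T. inn torus (u t) (adj nu t ph) =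
   nu * inn torus (u t) (laplacian ph) - inn torus (u t) (wdiv (%x. ph x *\<^sub>R b t x))"
  and "integrable (itv T) (%t. inn torus (u t) (wdiv (%x. ph x *\<^sub>R b t x)))"
proof -
 interpret finite_measure "itv T" by (rule finite_measure_itv)
 obtain C where C: "AE t in itv T. nrm torus (u t) <= C" using Linf_bound[OF u] by blast
 note P = pairing_bound(1)[OF Linf_sm[OF u] C]
 show 1: "integrable (itv T) (%t. inn torus (u t) (adj nu t ph))" for nu by (rule P[OF adj_L1[OF p]])
 show "AE t in itv T. inn torus (u t) (adj nu t ph) =
   nu * inn torus (u t) (laplacian ph) - inn torus (u t) (wdiv (%x. ph x *\<^sub>R b t x))" for nu
  using strongly_measurableD(1)[OF Linf_sm[OF u]] b_div' by eventually_elim (rule inn_adj[OF p])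
 from this[of 0] have ae: "AE t in itv T. - inn torus (u t) (adj 0 t ph) = inn torus (u t) (wdiv (%x. ph x *\<^sub>R b t x))"
  by eventually_elim simp
 have "(%t x. 1 * laplacian ph x) \<in> Lp_L2 1 T"
  by (rule L1_product) (auto intro: Csmooth_L2 laplacian_Csmooth p)
 then show "integrable (itv T) (%t. inn torus (u t) (laplacian ph))" using P by force
 have i0: "integrable (itv T) (%t. - inn torus (u t) (adj 0 t ph))" using 1[of 0] by simp
 have meas: "(%t. inn torus (u t) (wdiv (%x. ph x *\<^sub>R b t x))) \<in> borel_measurable (itv T)"
  by (rule borel_measurable_itv_AE[OF borel_measurable_integrable[OF i0] ae])
 show "integrable (itv T) (%t. inn torus (u t) (wdiv (%x. ph x *\<^sub>R b t x)))"
  by (rule integrable_cong_AE_imp[OF i0 meas]) (use ae in \<open>auto elim: eventually_mono\<close>)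
qed

lemma HK_cong_AE:
 fixes f g :: "real => real"
 assumes f: "integrable (itv T) f" and g: "integrable (itv T) g" and fg: "AE t in itv T. f t = g t" and t: "t \<in> {0..T}"
 shows "integral {0..t} f = integral {0..t} g"
proof -
 have "indicator {0..t} \<in> borel_measurable (itv T)" by (rule borel_measurable_itv_borel) auto
 then have "(LINT s|itv T. indicator {0..t} s * f s) = (LINT s|itv T. indicator {0..t} s * g s)"
  using f g fg by (intro integral_cong_AE borel_measurable_times) (auto elim: eventually_mono)
 then show ?thesis using itv_subinterval(1)[OF f, of 0 t] itv_subinterval(1)[OF g, of 0 t] t by simp
qed

text \<open>The formulation uses set integrals over Lebesgue measure. The gauge integral on the left
  is the form for which continuity in \<open>t\<close> and the exchange with
  \<open>tail_integral\<close> are available.\<close>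

lemma adj_integral_split:
 assumes p: "ph \<in> Csmooth" and u: "u \<in> Linf_L2 T" and t: "t \<in> {0..T}"
 shows "integral {0..t} (%s. inn torus (u s) (adj nu s ph)) =
  - (LINT s:{0..t}|lebesgue. ip (u s) (wdiv (%x. ph x *\<^sub>R b s x))) + nu * (LINT s:{0..t}|lebesgue. ip (u s) (laplacian ph))"
proof -
 note w = wdiv_pairing_integrable[OF p u]
 have "integral {0..t} (%s. inn torus (u s) (adj nu s ph))
   = integral {0..t} (%s. nu * inn torus (u s) (laplacian ph) - inn torus (u s) (wdiv (%x. ph x *\<^sub>R b s x)))"
  using w(1,2,3,4) by (intro HK_cong_AE t) auto
 also have "... = nu * integral {0..t} (%s. inn torus (u s) (laplacian ph)) - integral {0..t} (%s. inn torus (u s) (wdiv (%x. ph x *\<^sub>R b s x)))"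
  using t integrable_on_subinterval[OF integrable_itv_HK[OF integrable_mult_right[OF w(2), of nu]], of 0 t]
   integrable_on_subinterval[OF integrable_itv_HK[OF w(4)], of 0 t]
  by (subst Henstock_Kurzweil_Integration.integral_diff) auto
 finally show ?thesis
  using itv_subinterval(2)[OF w(2), of 0 t] itv_subinterval(2)[OF w(4), of 0 t] t by (simp add: ip_real)
qed

text \<open>The failure of the integrated weak formulation at time \<open>t\<close>. It vanishes for
  weak solutions of the parabolic problem and is minus the stochastic integral for energy
  solutions.\<close>

definition defect :: "real => (real ^ 'd => real) => (real => real ^ 'd => real) => (real ^ 'd => real) => real => real" where
 "defect nu u0 u ph t = inn torus (u t) ph - inn torus u0 ph - integral {0..t} (%s. inn torus (u s) (adj nu s ph))"

lemma weak_solution_iff_defect: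
 "parabolic_weak_solution T b nu u0 u \<longleftrightarrow> u \<in> Linf_L2 T & (\<forall>ph\<in>Csmooth. AE t in itv T. defect nu u0 u ph t = 0)"
proof (cases "u \<in> Linf_L2 T")
 case True
 have sp: "AE t in itv T. t \<in> {0..T}" unfolding AE_itv by simp
 have "(AE t in itv T. ip (u t) ph - ip u0 ph = - (LINT s:{0..t}|lebesgue. ip (u s) (wdiv (%x. ph x *\<^sub>R b s x)))
   + nu * (LINT s:{0..t}|lebesgue. ip (u s) (laplacian ph))) \<longleftrightarrow> (AE t in itv T. defect nu u0 u ph t = 0)"
  if p: "ph \<in> Csmooth" for ph
 proof (rule AE_cong)
  fix t assume "t \<in> space (itv T)"
  then show "(ip (u t) ph - ip u0 ph = - (LINT s:{0..t}|lebesgue. ip (u s) (wdiv (%x. ph x *\<^sub>R b s x)))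
   + nu * (LINT s:{0..t}|lebesgue. ip (u s) (laplacian ph))) \<longleftrightarrow> (defect nu u0 u ph t = 0)"
   using adj_integral_split[OF p True, of t nu] by (simp add: defect_def ip_real)
 qed
 then show ?thesis using True by (simp add: parabolic_weak_solution_def)
qed (simp add: parabolic_weak_solution_def)

text \<open>
  Test functions \<open>\<Sum> \<psi>\<^sub>p(t) \<phi>\<^sub>p(x)\<close> with \<open>\<psi>\<^sub>p(T) = 0\<close> are encoded by the lists of pairs
  \<open>(- \<psi>\<^sub>p', \<phi>\<^sub>p)\<close>; \<open>bwd\<close> is the backward operator \<open>- \<partial>\<^sub>t - adj\<close> applied to such a function.
\<close>

definition admissible :: "((real => real) \<times> (real ^ 'd => real)) list => bool" where
 "admissible ps \<longleftrightarrow> (\<forall>p\<in>set ps. continuous_on {0..T} (fst p) & snd p \<in> Csmooth)"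

definition bwd :: "real => ((real => real) \<times> (real ^ 'd => real)) list => real => real ^ 'd => real" where
 "bwd nu ps t x = (\<Sum>p\<leftarrow>ps. fst p t * snd p x - tail_integral T (fst p) t * adj nu t (snd p) x)"

definition test_fun :: "((real => real) \<times> (real ^ 'd => real)) list => real => real ^ 'd => real" where
 "test_fun ps t x = (\<Sum>p\<leftarrow>ps. tail_integral T (fst p) t * snd p x)"

definition source :: "((real => real) \<times> (real ^ 'd => real)) list => real => real ^ 'd => real" where
 "source ps t x = (\<Sum>p\<leftarrow>ps. fst p t * snd p x)"

lemma bwd_Nil: "bwd nu [] = (%t x. 0)" by (simp add: bwd_def fun_eq_iff)

lemma bwd_Cons: "bwd nu (p # ps) t x = (fst p t * snd p x - tail_integral T (fst p) t * adj nu t (snd p) x) + bwd nu ps t x"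
 by (simp add: bwd_def)

lemma bwd_append: "bwd nu (ps @ qs) t x = bwd nu ps t x + bwd nu qs t x"
 by (simp add: bwd_def)

definition scale_test :: "real => ((real => real) \<times> (real ^ 'd => real)) list => ((real => real) \<times> (real ^ 'd => real)) list" where
 "scale_test c = map (%p. (%t. c * fst p t, snd p))"

lemma bwd_scale: "bwd nu (scale_test c ps) t x = c * bwd nu ps t x"
 by (induction ps) (auto simp: bwd_def scale_test_def tail_integral_scale algebra_simps)

lemma test_fun_scale: "test_fun (scale_test c ps) t x = c * test_fun ps t x"
 by (induction ps) (auto simp: test_fun_def scale_test_def tail_integral_scale algebra_simps)

lemma test_fun_append: "test_fun (ps @ qs) t x = test_fun ps t x + test_fun qs t x"
 by (simp add: test_fun_def)

lemma admissible_append: "admissible ps ==> admissible qs ==> admissible (ps @ qs)"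
 by (auto simp: admissible_def)

lemma admissible_scale: "admissible ps ==> admissible (scale_test c ps)"
 by (auto simp: admissible_def scale_test_def intro!: continuous_intros)

lemma single_L1:
 assumes "continuous_on {0..T} eta" "ph \<in> Csmooth"
 shows "(%t x. eta t * ph x) \<in> Lp_L2 1 T" "(%t x. tail_integral T eta t * adj nu t ph x) \<in> Lp_L2 1 T"
 using assms
 by (rule L1_product[OF continuous_integrable_itv Csmooth_L2])
  (rule L1_bounded_mult[OF tail_integral_continuous[OF assms(1)] adj_L1[OF assms(2)]])

lemma bwd_L1: "admissible ps ==> bwd nu ps \<in> Lp_L2 1 T"
proof (induction ps)
 case Nil then show ?case by (simp add: bwd_Nil L1_zero)
next
 case (Cons p ps)
 then show ?case
  unfolding bwd_Cons[abs_def] by (intro L1_add L1_diff single_L1) (auto simp: admissible_def)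
qed

lemma test_fun_Csmooth: "admissible ps ==> test_fun ps t \<in> Csmooth"
 unfolding test_fun_def[abs_def] by (intro Csmooth_sum_list Csmooth_scale) (auto simp: admissible_def)

lemma source_Csmooth: "admissible ps ==> source ps t \<in> Csmooth"
 unfolding source_def[abs_def] by (intro Csmooth_sum_list Csmooth_scale) (auto simp: admissible_def)

text \<open>Multiplying the defect by \<open>eta\<close> and integrating,
  \<open>tail_integral_Fubini\<close> moves the time integral onto the test function. The initial
  datum is multiplied by the integral of \<open>eta\<close>, the value of the tail integral at
  0.\<close>

lemma pairing_bwd:
 assumes u: "u \<in> Linf_L2 T" and u0: "u0 \<in> L2" and ps: "admissible ps"
 shows "pairing T u (bwd nu ps) - inn torus u0 (test_fun ps 0)
  = (\<Sum>p\<leftarrow>ps. (LINT t|itv T. fst p t * defect nu u0 u (snd p) t))"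
 using ps
proof (induction ps)
 case Nil
 then show ?case by (simp add: bwd_Nil test_fun_def pairing_def)
next
 case (Cons p ps)
 obtain eta ph where p: "p = (eta, ph)" by fastforce
 have eta: "continuous_on {0..T} eta" and ph: "ph \<in> Csmooth" and ps: "admissible ps"
  using Cons.prems p by (auto simp: admissible_def)
 obtain C where C: "AE t in itv T. nrm torus (u t) <= C" using Linf_bound[OF u] by blast
 note P = pairing_bound(1)[OF Linf_sm[OF u] C]
 have etai: "integrable (itv T) eta" by (rule continuous_integrable_itv[OF eta])
 let ?ga = "%t. inn torus (u t) (adj nu t ph)"
 have ga: "integrable (itv T) ?ga" by (rule P[OF adj_L1[OF ph]])
 have i1: "integrable (itv T) (%t. eta t * inn torus (u t) ph)"
  using P[OF single_L1(1)[OF eta ph]] by (simp add: inn_scale_right)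
 have i3: "integrable (itv T) (%t. eta t * integral {0..t} ?ga)"
  by (intro continuous_integrable_itv continuous_intros eta indefinite_integral_continuous_1 integrable_itv_HK ga)
 have "pairing T u (bwd nu (p # ps)) = pairing T u (%t x. eta t * ph x - tail_integral T eta t * adj nu t ph x) + pairing T u (bwd nu ps)"
  using pairing_combine[OF u L1_diff[OF single_L1[OF eta ph]] bwd_L1[OF ps], of 1 nu 1 nu] p
  by (simp add: bwd_Cons[abs_def])
 also have "pairing T u (%t x. eta t * ph x - tail_integral T eta t * adj nu t ph x)
   = pairing T u (%t x. eta t * ph x) - pairing T u (%t x. tail_integral T eta t * adj nu t ph x)"
  using pairing_combine[OF u single_L1[OF eta ph], of 1 "-1"] by simp
 also have "... = (LINT t|itv T. eta t * inn torus (u t) ph) - (LINT t|itv T. tail_integral T eta t * ?ga t)"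
  by (simp add: pairing_def inn_scale_right)
 also have "(LINT t|itv T. tail_integral T eta t * ?ga t) = (LINT t|itv T. eta t * integral {0..t} ?ga)"
  by (rule tail_integral_Fubini[OF eta ga])
 finally have pair: "pairing T u (bwd nu (p # ps))
   = (LINT t|itv T. eta t * inn torus (u t) ph) - (LINT t|itv T. eta t * integral {0..t} ?ga) + pairing T u (bwd nu ps)" .
 have "(LINT t|itv T. eta t) = tail_integral T eta 0"
  using lebesgue_integral_eq_integral[OF etai] by (simp add: tail_integral_def)
 then have "(LINT t|itv T. eta t * defect nu u0 u ph t)
   = (LINT t|itv T. eta t * inn torus (u t) ph) - tail_integral T eta 0 * inn torus u0 ph - (LINT t|itv T. eta t * integral {0..t} ?ga)"
  using i1 i3 etai by (simp add: defect_def right_diff_distrib)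
 moreover have "inn torus u0 (test_fun (p # ps) 0) = tail_integral T eta 0 * inn torus u0 ph + inn torus u0 (test_fun ps 0)"
 proof -
  have "test_fun (p # ps) 0 = (%x. tail_integral T eta 0 * ph x + test_fun ps 0 x)" by (simp add: test_fun_def p fun_eq_iff)
  then show ?thesis
   using u0 ph test_fun_Csmooth[OF ps] by (simp add: inn_add_right inn_scale_right L2_sqi Csmooth_sqi sqi_scale)
 qed
 ultimately show ?case using Cons.IH[OF ps] pair p by simp
qed

lemma defect_sqi:
 assumes u: "u \<in> Linf_L2 T" and ph: "ph \<in> Csmooth"
 shows "defect nu u0 u ph \<in> sqi (itv T)"
proof -
 obtain C where C: "AE t in itv T. nrm torus (u t) <= C" using Linf_bound[OF u] by blast
 have c: "continuous_on {0..T} (%t. integral {0..t} (%s. inn torus (u s) (adj nu s ph)))"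
  by (intro indefinite_integral_continuous_1 integrable_itv_HK pairing_bound(1)[OF Linf_sm[OF u] C] adj_L1 ph)
 have 1: "(%t. inn torus (u t) ph) \<in> sqi (itv T)"
 proof (rule sqi_bounded[OF finite_measure_itv])
  show "(%t. inn torus (u t) ph) \<in> borel_measurable (itv T)"
   by (intro strongly_measurableD(2) Linf_sm u Csmooth_L2 ph)
  show "AE t in itv T. \<bar>inn torus (u t) ph\<bar> <= C * nrm torus ph"
   using C strongly_measurableD(1)[OF Linf_sm[OF u]]
  proof eventually_elim
   case (elim t)
   then have "\<bar>inn torus (u t) ph\<bar> <= nrm torus (u t) * nrm torus ph"
    by (intro cauchy_schwarz_inn[OF L2_sqi Csmooth_sqi[OF ph]])
   also have "... <= C * nrm torus ph" using elim by (intro mult_right_mono) auto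
   finally show ?case .
  qed
 qed
 have cont: "f \<in> sqi (itv T)" if "continuous_on {0..T} f" for f
  unfolding sqi_def using that by (auto intro!: measurable_itv_continuous continuous_integrable_itv continuous_intros)
 show ?thesis unfolding defect_def[abs_def]
  by (intro sqi_diff 1 cont c continuous_on_const)
qed

text \<open>Cosines are admissible time factors, and they are total, so testing with them makes the
  defect vanish almost everywhere.\<close>

lemma weak_solution_of_pairing:
 assumes u: "u \<in> Linf_L2 T" and u0: "u0 \<in> L2"
  and eq: "!!ps. admissible ps ==> pairing T u (bwd nu ps) = inn torus u0 (test_fun ps 0)"
 shows "parabolic_weak_solution T b nu u0 u"
 unfolding weak_solution_iff_defect
proof (intro conjI u ballI)
 fix ph :: "real ^ 'd => real" assume ph: "ph \<in> Csmooth"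
 show "AE t in itv T. defect nu u0 u ph t = 0"
 proof (rule tcos_total[OF T defect_sqi[OF u ph]])
  fix m
  have "admissible [(tcos T m, ph)]" using ph by (simp add: admissible_def tcos_continuous)
  from pairing_bwd[OF u u0 this, of nu] eq[OF this]
  show "inn (itv T) (defect nu u0 u ph) (tcos T m) = 0" by (simp add: inn_def mult.commute)
 qed
qed

lemma weak_solution_pairing:
 assumes u: "parabolic_weak_solution T b nu u0 u" and u0: "u0 \<in> L2" and ps: "admissible ps"
 shows "pairing T u (bwd nu ps) = inn torus u0 (test_fun ps 0)"
proof -
 have L: "u \<in> Linf_L2 T" and z: "!!ph. ph \<in> Csmooth ==> AE t in itv T. defect nu u0 u ph t = 0"
  using u unfolding weak_solution_iff_defect by blast+
 have "(LINT t|itv T. fst p t * defect nu u0 u (snd p) t) = 0" if "p \<in> set ps" for p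
 proof -
  have "AE t in itv T. fst p t * defect nu u0 u (snd p) t = 0"
   using z[of "snd p"] that ps by (auto simp: admissible_def elim: eventually_mono)
  then show ?thesis by (rule integral_eq_zero_AE)
 qed
 then have "(\<Sum>p\<leftarrow>ps. (LINT t|itv T. fst p t * defect nu u0 u (snd p) t)) = (\<Sum>p\<leftarrow>ps. 0)"
  by (intro arg_cong[where f = sum_list] map_cong) auto
 then show ?thesis using pairing_bwd[OF L u0 ps, of nu] by simp
qed

section \<open>Energy estimate for the backward operator\<close>

text \<open>Measurability in time comes from a Borel representative of \<open>wdiv\<close> through
  \<open>Linf_norm_measurable\<close>. Values at times with infinite norm are replaced by a real
  default, and such times are negligible.\<close>

lemma div_bound:
 obtains bt where "integrable (itv T) bt" "!!t. 0 <= bt t" "AE t in itv T. AE x in torus. \<bar>wdiv (b t) x\<bar> <= bt t"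
proof -
 obtain g where g: "g \<in> restrict_space borel {0..T} \<rightarrow>\<^sub>M borel_of L2_topology"
  and fg: "AE t in itv T. wdiv (b t) \<in> L2 & eqT (wdiv (b t)) (g t)"
  using wdiv_L2 unfolding Lp_L2_def strongly_measurable_def by blast
 have sp: "AE t in itv T. g t \<in> L2"
  using measurable_space[OF g] unfolding AE_itv by (auto simp: space_restrict_space)
 have m: "(%t. Linf_norm (g t)) \<in> borel_measurable (itv T)"
  by (rule measurable_compose[OF measurable_itv_borel[OF g] Linf_norm_measurable])
 have "AE t in itv T. Linf_norm (g t) = Linf_norm (wdiv (b t))"
  using fg sp
 proof eventually_elim
  case (elim t)
  then have [measurable]: "g t \<in> borel_measurable borel" "wdiv (b t) \<in> borel_measurable borel"
   by (auto simp: L2_def)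
  show ?case unfolding Linf_norm_def
   using elim by (intro esssup_AE_cong) (auto simp: eqT_def elim: eventually_mono)
 qed
 then have "(\<integral>\<^sup>+t. Linf_norm (g t) \<partial>itv T) = (\<integral>\<^sup>+t. Linf_norm (wdiv (b t)) \<partial>itv T)"
  by (rule nn_integral_cong_AE)
 then have fin: "(\<integral>\<^sup>+t. Linf_norm (g t) \<partial>itv T) < \<infinity>"
  using wdiv_Linf by (simp add: set_nn_integral_itv)
 then have ae: "AE t in itv T. Linf_norm (g t) ~= \<infinity>"
  by (intro nn_integral_PInf_AE m) auto
 define bt where "bt t = enn2real (Linf_norm (g t))" for t
 have btm: "bt \<in> borel_measurable (itv T)" unfolding bt_def[abs_def] using m by measurable
 have "(\<integral>\<^sup>+t. ennreal (norm (bt t)) \<partial>itv T) <= (\<integral>\<^sup>+t. Linf_norm (g t) \<partial>itv T)"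
  by (intro nn_integral_mono) (simp add: bt_def ennreal_enn2real_if)
 then have "integrable (itv T) bt" using btm fin by (intro integrableI_bounded) auto
 moreover have "AE t in itv T. AE x in torus. \<bar>wdiv (b t) x\<bar> <= bt t"
  using fg ae
 proof eventually_elim
  case (elim t)
  have "AE x in torus. ennreal \<bar>g t x\<bar> <= Linf_norm (g t)" unfolding Linf_norm_def by (rule esssup_AE)
  moreover have "AE x in torus. wdiv (b t) x = g t x" using elim by (simp add: eqT_def)
  ultimately show ?case
  proof eventually_elim
   case (elim x)
   then have "ennreal \<bar>g t x\<bar> <= ennreal (bt t)"
    using \<open>Linf_norm (g t) ~= \<infinity>\<close> by (simp add: bt_def ennreal_enn2real_if)
   then show ?case using elim by (simp add: bt_def)
  qed
 qed
 ultimately show thesis using that[of bt] by (simp add: bt_def)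
qed

text \<open>Testing the divergence with \<open>ph^2\<close> shows that the transport term is minus
  half of the zero-order term. Twice the pairing therefore leaves just the divergence against
  \<open>ph^2\<close> and a nonpositive Laplacian term.\<close>

lemma adj_energy:
 assumes p: "ph \<in> Csmooth" and w: "has_weak_div (b t) (wdiv (b t))" and nu: "0 <= nu"
  and bt: "AE x in torus. \<bar>wdiv (b t) x\<bar> <= bt"
 shows "2 * inn torus (adj nu t ph) ph <= bt * (nrm torus ph)\<^sup>2"
proof -
 have bL: "(%x. b t x $ i) \<in> L2" and dL: "wdiv (b t) \<in> L2" for i using w by (auto simp: has_weak_div_def)
 have ps: "ph \<in> sqi torus" by (rule Csmooth_sqi[OF p])
 have s1: "(%x. ph x * wdiv (b t) x) \<in> sqi torus" by (intro L2_sqi L2_smooth_mult dL p)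
 have s2: "(%x. b t x \<bullet> grad ph x) \<in> sqi torus" by (intro L2_sqi L2_inner_grad bL p)
 have l: "laplacian ph \<in> sqi torus" by (intro Csmooth_sqi laplacian_Csmooth p)
 have "inn torus (adj nu t ph) ph = nu * inn torus (laplacian ph) ph
   - (inn torus (%x. ph x * wdiv (b t) x) ph + inn torus (%x. b t x \<bullet> grad ph x) ph)"
  unfolding adj_def[abs_def] using ps s1 s2 l
  by (simp add: inn_diff_left inn_add_left sqi_add sqi_scale inn_scale_left)
 moreover have "inn torus (%x. ph x * wdiv (b t) x) ph = - 2 * inn torus (%x. b t x \<bullet> grad ph x) ph"
 proof -
  have gr: "b t x \<bullet> grad (%x. ph x * ph x) x = 2 * ((b t x \<bullet> grad ph x) * ph x)" for x
   using p by (simp add: inner_vec_def grad_def pdiff_mult Csmooth_differentiable sum_distrib_left sum_distrib_right algebra_simps)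
  have "inn torus (%x. ph x * wdiv (b t) x) ph = ip (wdiv (b t)) (%x. ph x * ph x)"
   by (simp add: ip_real inn_def mult_ac)
  also have "... = - (LINT x|torus. b t x \<bullet> grad (%x. ph x * ph x) x)"
   using w Csmooth_mult[OF p p] unfolding has_weak_div_def by blast
  also have "... = - 2 * inn torus (%x. b t x \<bullet> grad ph x) ph" unfolding gr by (simp add: inn_def)
  finally show ?thesis .
 qed
 moreover have "nu * inn torus (laplacian ph) ph <= 0"
  using laplacian_nonpos[OF p] nu by (simp add: mult_nonneg_nonpos)
 moreover have "- inn torus (%x. ph x * wdiv (b t) x) ph <= bt * (nrm torus ph)\<^sup>2"
 proof -
  have "(LINT x|torus. - (ph x * wdiv (b t) x * ph x)) <= (LINT x|torus. bt * (ph x * ph x))"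
  proof (rule integral_mono_AE)
   show "integrable torus (%x. - (ph x * wdiv (b t) x * ph x))" using sqi_integrable_mult[OF s1 ps] by simp
   show "integrable torus (%x. bt * (ph x * ph x))" using sqi_integrable_mult[OF ps ps] by simp
   show "AE x in torus. - (ph x * wdiv (b t) x * ph x) <= bt * (ph x * ph x)"
    using bt
   proof eventually_elim
    case (elim x)
    then have "- wdiv (b t) x * (ph x * ph x) <= bt * (ph x * ph x)" by (intro mult_right_mono) auto
    then show ?case by (simp add: mult_ac)
   qed
  qed
  then show ?thesis by (simp add: nrm_power2 inn_def)
 qed
 ultimately show ?thesis by linarith
qed

lemma sum_list_mult_affine:
 fixes f A B C :: "'p => real"
 shows "(\<Sum>p\<leftarrow>ps. f p * (nu * A p - (B p + C p)))
  = nu * (\<Sum>p\<leftarrow>ps. f p * A p) - ((\<Sum>p\<leftarrow>ps. f p * B p) + (\<Sum>p\<leftarrow>ps. f p * C p))"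
 by (induction ps) (auto simp: algebra_simps)

text \<open>Linearity of \<open>adj\<close> in the test function: since \<open>source\<close> is
  minus the time derivative of \<open>test_fun\<close>, the list encoding is the backward operator
  applied to the single function \<open>test_fun ps\<close>.\<close>

lemma bwd_eq:
 assumes ps: "admissible ps"
 shows "bwd nu ps t x = source ps t x - adj nu t (test_fun ps t) x"
proof -
 have sm: "(%x. tail_integral T (fst p) t * snd p x) \<in> Csmooth" if "p \<in> set ps" for p
  using that ps by (auto simp: admissible_def intro: Csmooth_scale)
 have d: "pdiff i (test_fun ps t) x = (\<Sum>p\<leftarrow>ps. tail_integral T (fst p) t * pdiff i (snd p) x)" for i x
  unfolding test_fun_def[abs_def] using ps sm
  by (subst pdiff_sum_list) (auto simp: admissible_def pdiff_scale intro!: arg_cong[where f = sum_list] map_cong)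
 have dd: "pdiff i (pdiff i (test_fun ps t)) x = (\<Sum>p\<leftarrow>ps. tail_integral T (fst p) t * pdiff i (pdiff i (snd p)) x)" for i x
 proof -
  have "pdiff i (test_fun ps t) = (%x. \<Sum>p\<leftarrow>ps. tail_integral T (fst p) t * pdiff i (snd p) x)" using d by auto
  then show ?thesis using ps
   by (simp add: pdiff_sum_list admissible_def Csmooth_scale Csmooth_pdiff pdiff_scale cong: map_cong)
 qed
 have "laplacian (test_fun ps t) x = (\<Sum>p\<leftarrow>ps. tail_integral T (fst p) t * laplacian (snd p) x)"
  unfolding laplacian_def dd by (induction ps) (auto simp: sum.distrib sum_distrib_left)
 moreover have "b t x \<bullet> grad (test_fun ps t) x = (\<Sum>p\<leftarrow>ps. tail_integral T (fst p) t * (b t x \<bullet> grad (snd p) x))"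
  unfolding inner_grad d
  by (induction ps) (simp_all add: sum.distrib sum_distrib_left distrib_right mult.assoc)
 moreover have "test_fun ps t x * wdiv (b t) x = (\<Sum>p\<leftarrow>ps. tail_integral T (fst p) t * (snd p x * wdiv (b t) x))"
  unfolding test_fun_def by (induction ps) (auto simp: distrib_right)
 ultimately have "adj nu t (test_fun ps t) x = (\<Sum>p\<leftarrow>ps. tail_integral T (fst p) t * adj nu t (snd p) x)"
  unfolding adj_def by (simp only: sum_list_mult_affine)
 then show ?thesis
  unfolding bwd_def source_def by (simp only: sum_list_subtractf)
qed

lemma sum_list_neg_mult:
 fixes f g A B :: "'p => real"
 shows "(\<Sum>p\<leftarrow>ps. - f p * A p + (- B p) * g p) = - (\<Sum>p\<leftarrow>ps. f p * A p) - (\<Sum>p\<leftarrow>ps. g p * B p)"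
 by (induction ps) (auto simp: algebra_simps)

text \<open>All time dependence sits in finitely many scalar factors, so the ordinary product rule
  differentiates the squared norm and no calculus with values in L2 is involved.\<close>

lemma test_fun_energy_deriv:
 assumes ps: "admissible ps" and t: "t \<in> {0..T}"
 shows "((%t. (nrm torus (test_fun ps t))\<^sup>2) has_real_derivative - 2 * inn torus (source ps t) (test_fun ps t)) (at t within {0..T})"
  and "continuous_on {0..T} (%t. inn torus (source ps t) (test_fun ps t))"
proof -
 have sq: "snd p \<in> sqi torus" and ct: "continuous_on {0..T} (fst p)" if "p \<in> set ps" for p
  using that ps by (auto simp: admissible_def intro: Csmooth_sqi)
 have left: "inn torus (test_fun ps t) k = (\<Sum>p\<leftarrow>ps. tail_integral T (fst p) t * inn torus (snd p) k)"
  "inn torus (source ps t) k = (\<Sum>p\<leftarrow>ps. fst p t * inn torus (snd p) k)" if "k \<in> sqi torus" for k t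
  unfolding test_fun_def[abs_def] source_def[abs_def]
  using inn_sum_list_left[of ps "%p x. tail_integral T (fst p) t * snd p x" torus k]
   inn_sum_list_left[of ps "%p x. fst p t * snd p x" torus k] that sq
  by (auto simp: sqi_scale inn_scale_left)
 have tf: "test_fun ps t \<in> sqi torus" for t by (intro Csmooth_sqi test_fun_Csmooth ps)
 have sf: "source ps t \<in> sqi torus" for t by (intro Csmooth_sqi source_Csmooth ps)
 have dk: "((%t. inn torus (test_fun ps t) k) has_real_derivative - inn torus (source ps t) k) (at t within {0..T})"
  if k: "k \<in> sqi torus" and t: "t \<in> {0..T}" for k t
 proof -
  have "((%t. \<Sum>p\<leftarrow>ps. tail_integral T (fst p) t * inn torus (snd p) k) has_real_derivative
    (\<Sum>p\<leftarrow>ps. - fst p t * inn torus (snd p) k)) (at t within {0..T})"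
   using ct t by (intro DERIV_sum_list DERIV_cmult_right tail_integral_deriv) auto
  also have "(\<Sum>p\<leftarrow>ps. - fst p t * inn torus (snd p) k) = - inn torus (source ps t) k"
   unfolding left[OF k] by (induction ps) auto
  finally show ?thesis unfolding left[OF k] .
 qed
 have ck: "continuous_on {0..T} (%t. inn torus (test_fun ps t) k)" if "k \<in> sqi torus" for k
  by (rule DERIV_continuous_on) (rule dk[OF that])
 have "((%t. \<Sum>p\<leftarrow>ps. tail_integral T (fst p) t * inn torus (test_fun ps t) (snd p)) has_real_derivative
   (\<Sum>p\<leftarrow>ps. - fst p t * inn torus (test_fun ps t) (snd p) + (- inn torus (source ps t) (snd p)) * tail_integral T (fst p) t))
   (at t within {0..T})"
  using ct t sq by (intro DERIV_sum_list DERIV_mult tail_integral_deriv dk) auto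
 also have "(\<Sum>p\<leftarrow>ps. - fst p t * inn torus (test_fun ps t) (snd p) + (- inn torus (source ps t) (snd p)) * tail_integral T (fst p) t)
   = - (\<Sum>p\<leftarrow>ps. fst p t * inn torus (snd p) (test_fun ps t)) - (\<Sum>p\<leftarrow>ps. tail_integral T (fst p) t * inn torus (snd p) (source ps t))"
  unfolding sum_list_neg_mult
  by (intro arg_cong2[where f = minus] arg_cong[where f = uminus] arg_cong[where f = sum_list] map_cong refl
    arg_cong2[where f = "(*)"] inn_commute)
 also have "... = - 2 * inn torus (source ps t) (test_fun ps t)"
  unfolding left[OF tf, symmetric] left[OF sf, symmetric] by (simp add: inn_commute[of torus "test_fun ps t" "source ps t"])
 also have "(%t. \<Sum>p\<leftarrow>ps. tail_integral T (fst p) t * inn torus (test_fun ps t) (snd p)) = (%t. (nrm torus (test_fun ps t))\<^sup>2)"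
  unfolding nrm_power2 left(1)[OF tf]
  by (intro ext arg_cong[where f = sum_list] map_cong refl arg_cong2[where f = "(*)"] inn_commute)
 finally show "((%t. (nrm torus (test_fun ps t))\<^sup>2) has_real_derivative - 2 * inn torus (source ps t) (test_fun ps t)) (at t within {0..T})" .
 show "continuous_on {0..T} (%t. inn torus (source ps t) (test_fun ps t))"
  unfolding left(2)[OF tf] inn_commute[of torus "snd _"]
  using ct sq by (intro continuous_on_sum_list continuous_intros ck) auto
qed

text \<open>Backward Gronwall with \<open>m\<close> the norm of \<open>test_fun\<close>, zero at
  \<open>T\<close>, and \<open>l\<close> the norm of \<open>bwd\<close>: the derivative of
  \<open>m^2\<close> contains \<open>source\<close>, which is \<open>bwd\<close> plus the adjoint
  term controlled by \<open>adj_energy\<close>. The constant is the same for all lists.\<close>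

lemma energy_estimate:
 assumes nu: "0 <= nu"
 obtains C where "0 <= C" "!!ps. admissible ps ==> nrm torus (test_fun ps 0) <= C * nrm1 T (bwd nu ps)"
proof -
 obtain bt where bt: "integrable (itv T) bt" "!!t. 0 <= bt t" "AE t in itv T. AE x in torus. \<bar>wdiv (b t) x\<bar> <= bt t"
  using div_bound by blast
 show thesis
 proof (rule gronwall_backward[OF T bt(1,2)], rule that)
  fix C :: real assume "0 <= C"
  then show "0 <= C" .
 next
  fix C :: real and ps
  assume C: "0 <= C" "!!m l :: real => real. continuous_on {0..T} m ==> (!!t. 0 <= m t) ==> m T = 0 ==>
   integrable (itv T) l ==> (!!t. 0 <= l t) ==>
   (!!s t. 0 <= s ==> s <= t ==> t <= T ==>
    (m s)\<^sup>2 <= (m t)\<^sup>2 + (LINT r|itv T. indicator {s..t} r * (2 * l r * m r + bt r * (m r)\<^sup>2))) ==>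
   m 0 <= C * (LINT r|itv T. l r)"
  assume ps: "admissible ps"
  let ?m = "%t. nrm torus (test_fun ps t)" and ?l = "%t. nrm torus (bwd nu ps t)"
  have tf: "test_fun ps t \<in> sqi torus" for t by (intro Csmooth_sqi test_fun_Csmooth ps)
  have sf: "source ps t \<in> sqi torus" for t by (intro Csmooth_sqi source_Csmooth ps)
  have m2: "continuous_on {0..T} (%t. (?m t)\<^sup>2)"
   by (rule DERIV_continuous_on) (rule test_fun_energy_deriv(1)[OF ps])
  have mc: "continuous_on {0..T} ?m"
   using continuous_on_real_sqrt[OF m2] by simp
  have li: "integrable (itv T) ?l" using bwd_L1[OF ps] by (simp add: Lp_L2_1_iff)
  have "?m 0 <= C * (LINT r|itv T. ?l r)"
  proof (rule C(2)[OF mc _ _ li])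
   show "?m T = 0" by (simp add: test_fun_def[abs_def])
   fix s t assume st: "0 <= s" "s <= t" "t <= T"
   let ?f = "%r. 2 * inn torus (source ps r) (test_fun ps r)"
   have fi: "integrable (itv T) ?f"
    by (intro continuous_integrable_itv continuous_intros test_fun_energy_deriv(2)[OF ps, of 0]) (use T in auto)
   have "integral {s..t} (%r. - 2 * inn torus (source ps r) (test_fun ps r)) = (?m t)\<^sup>2 - (?m s)\<^sup>2"
    by (rule FTC_subinterval[OF test_fun_energy_deriv(1)[OF ps] st])
   then have 1: "(?m s)\<^sup>2 = (?m t)\<^sup>2 + integral {s..t} ?f" by simp
   have 2: "integral {s..t} ?f = (LINT r|itv T. indicator {s..t} r * ?f r)"
    using st by (intro itv_subinterval(1)[OF fi, symmetric])
   have 3: "(LINT r|itv T. indicator {s..t} r * ?f r) <= (LINT r|itv T. indicator {s..t} r * (2 * ?l r * ?m r + bt r * (?m r)\<^sup>2))"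
   proof (rule integral_mono_AE)
    have ind: "integrable (itv T) (%r. indicator {s..t} r * f r)" if "integrable (itv T) f" for f :: "real => real"
    proof (rule Bochner_Integration.integrable_bound[OF that])
     have "indicator {s..t} \<in> borel_measurable (itv T)" by (rule borel_measurable_itv_borel) auto
     then show "(%r. indicator {s..t} r * f r) \<in> borel_measurable (itv T)"
      using that by (intro borel_measurable_times) auto
    qed (auto simp: indicator_def)
    have cb: "integrable (itv T) (%r. f r * c r)" if "integrable (itv T) f" "continuous_on {0..T} c" for f c :: "real => real"
    proof -
     have "bounded (c ` {0..T})" using that(2) by (intro compact_imp_bounded compact_continuous_image) auto
     then obtain B where "\<forall>y\<in>c ` {0..T}. norm y <= B" unfolding bounded_iff by blast
     then have B: "\<bar>c r\<bar> <= \<bar>B\<bar>" if "r \<in> {0..T}" for r using that by force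
     show ?thesis
     proof (rule Bochner_Integration.integrable_bound)
      show "integrable (itv T) (%r. f r * B)" using that(1) by simp
      show "(%r. f r * c r) \<in> borel_measurable (itv T)"
       by (rule borel_measurable_times[OF borel_measurable_integrable[OF that(1)] measurable_itv_continuous[OF that(2)]])
      show "AE r in itv T. norm (f r * c r) <= norm (f r * B)"
       by (rule AE_I2) (use B in \<open>auto simp: abs_mult intro!: mult_left_mono\<close>)
     qed
    qed
    show "integrable (itv T) (%r. indicator {s..t} r * ?f r)" by (rule ind[OF fi])
    show "integrable (itv T) (%r. indicator {s..t} r * (2 * ?l r * ?m r + bt r * (?m r)\<^sup>2))"
     by (intro ind Bochner_Integration.integrable_add cb mc m2 bt(1) integrable_mult_right li)
    show "AE r in itv T. indicator {s..t} r * ?f r <= indicator {s..t} r * (2 * ?l r * ?m r + bt r * (?m r)\<^sup>2)"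
     using b_div' bt(3) L1_AE[OF bwd_L1[OF ps, of nu]]
    proof eventually_elim
     case (elim r)
     have bs: "bwd nu ps r \<in> sqi torus" using elim by (simp add: L2_sqi)
     have ga: "adj nu r (test_fun ps r) \<in> sqi torus"
     proof -
      have "adj nu r (test_fun ps r) = (%x. source ps r x - bwd nu ps r x)" by (auto simp: bwd_eq[OF ps])
      then show ?thesis using sqi_diff[OF sf bs] by simp
     qed
     have "source ps r = (%x. bwd nu ps r x + adj nu r (test_fun ps r) x)" by (auto simp: bwd_eq[OF ps])
     then have "?f r = 2 * inn torus (bwd nu ps r) (test_fun ps r) + 2 * inn torus (adj nu r (test_fun ps r)) (test_fun ps r)"
      using bs ga tf by (simp add: inn_add_left)
     also have "... <= 2 * (?l r * ?m r) + bt r * (?m r)\<^sup>2"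
      using cauchy_schwarz_inn[OF bs tf[of r]] adj_energy[OF test_fun_Csmooth[OF ps, of r] elim(1) nu elim(2)] by linarith
     finally have "?f r <= 2 * ?l r * ?m r + bt r * (?m r)\<^sup>2" by simp
     then show ?case by (intro mult_left_mono) auto
    qed
   qed
   show "(?m s)\<^sup>2 <= (?m t)\<^sup>2 + (LINT r|itv T. indicator {s..t} r * (2 * ?l r * ?m r + bt r * (?m r)\<^sup>2))"
    unfolding 1 2 using 3 by (rule add_left_mono)
  qed auto
  then show "nrm torus (test_fun ps 0) <= C * nrm1 T (bwd nu ps)" by (simp add: nrm1_def)
 qed
qed

section \<open>Existence and density by duality\<close>

text \<open>A weak solution is an element with prescribed pairings on the range of
  \<open>bwd\<close>. The energy estimate makes this prescription consistent and bounded. The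
  constraints form a linear space, so applying the inequality to \<open>scale_test (- 1)\<close>
  turns it into equality.\<close>

lemma weak_solution_exists:
 assumes nu: "0 <= nu" and u0: "u0 \<in> L2"
 obtains u where "parabolic_weak_solution T b nu u0 u"
proof -
 obtain C where C: "0 <= C" "!!ps. admissible ps ==> nrm torus (test_fun ps 0) <= C * nrm1 T (bwd nu ps)"
  using energy_estimate[OF nu] by blast
 define K where "K = {(bwd nu ps, inn torus u0 (test_fun ps 0)) | ps. admissible ps}"
 have tf: "test_fun ps 0 \<in> sqi torus" if "admissible ps" for ps by (intro Csmooth_sqi test_fun_Csmooth that)
 have u0s: "u0 \<in> sqi torus" by (rule L2_sqi[OF u0])
 have KI: "(bwd nu ps, inn torus u0 (test_fun ps 0)) \<in> K" if "admissible ps" for ps using that by (auto simp: K_def)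
 obtain w where w: "w \<in> Linf_L2 T" and le: "!!r l. (r, l) \<in> K ==> pairing T w r <= l"
 proof (rule Linf_solve_cone[where K = K and C = "nrm torus u0 * C" and T = T])
  show "0 < T" by (rule T)
  show "0 <= nrm torus u0 * C" using C by simp
  have "admissible []" by (simp add: admissible_def)
  from KI[OF this] show "((%t x. 0), 0) \<in> K" by (simp add: bwd_Nil test_fun_def[abs_def])
  fix r l assume "(r, l) \<in> K"
  then obtain ps where ps: "r = bwd nu ps" "l = inn torus u0 (test_fun ps 0)" "admissible ps" by (auto simp: K_def)
  show "r \<in> Lp_L2 1 T" using ps bwd_L1 by simp
  have "- l <= nrm torus u0 * nrm torus (test_fun ps 0)"
   using cauchy_schwarz_inn[OF u0s tf[OF ps(3)]] ps(2) by linarith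
  also have "... <= nrm torus u0 * (C * nrm1 T r)" using C(2)[OF ps(3)] ps(1) by (intro mult_left_mono) auto
  finally show "- l <= nrm torus u0 * C * nrm1 T r" by (simp add: mult.assoc)
  show "((%t x. s * r t x), s * l) \<in> K" for s
   using KI[OF admissible_scale[OF ps(3)], of s] ps
   by (simp add: bwd_scale[abs_def] test_fun_scale[abs_def] inn_scale_right)
  fix r' l' assume "(r', l') \<in> K"
  then obtain qs where qs: "r' = bwd nu qs" "l' = inn torus u0 (test_fun qs 0)" "admissible qs" by (auto simp: K_def)
  show "((%t x. r t x + r' t x), l + l') \<in> K"
   using KI[OF admissible_append[OF ps(3) qs(3)]] ps qs
   by (simp add: bwd_append[abs_def] test_fun_append[abs_def] inn_add_right u0s tf)
 qed blast
 have "pairing T w (bwd nu ps) = inn torus u0 (test_fun ps 0)" if ps: "admissible ps" for ps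
 proof (rule antisym)
  show "pairing T w (bwd nu ps) <= inn torus u0 (test_fun ps 0)" by (rule le[OF KI[OF ps]])
  have "pairing T w (bwd nu (scale_test (-1) ps)) <= inn torus u0 (test_fun (scale_test (-1) ps) 0)"
   by (rule le[OF KI[OF admissible_scale[OF ps]]])
  then have "pairing T w (%t x. (-1) * bwd nu ps t x) <= (-1) * inn torus u0 (test_fun ps 0)"
   by (simp only: bwd_scale[abs_def] test_fun_scale[abs_def] inn_scale_right)
  moreover have "pairing T w (%t x. (-1) * bwd nu ps t x) = - pairing T w (bwd nu ps)"
   using pairing_combine[OF w bwd_L1[OF ps] bwd_L1[OF ps], of "-1" nu 0 nu] by simp
  ultimately show "inn torus u0 (test_fun ps 0) <= pairing T w (bwd nu ps)" by simp
 qed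
 then show thesis using that weak_solution_of_pairing[OF w u0] by blast
qed

text \<open>Uniqueness of the forward problem makes the range of the backward operator dense, by duality.\<close>

lemma bwd_dense:
 assumes uniq: "!!w. parabolic_weak_solution T b nu (%x. 0) w ==> AE t in itv T. eqT (w t) (%x. 0)"
  and g: "g \<in> Lp_L2 1 T" and e: "0 < e"
 obtains ps where "admissible ps" "nrm1 T (%t x. g t x - bwd nu ps t x) < e"
proof -
 have "\<exists>ps. admissible ps & nrm1 T (%t x. g t x - bwd nu ps t x) < e"
 proof (rule ccontr)
 assume "\<nexists>ps. admissible ps & nrm1 T (%t x. g t x - bwd nu ps t x) < e"
 then have far: "e <= nrm1 T (%t x. g t x - bwd nu ps t x)" if "admissible ps" for ps
  using that by (metis not_le)
 \<comment> \<open>A separating functional written as a cone of constraints: elements with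
   \<open>s = 0\<close> force \<open>w\<close> to vanish on the range, and \<open>s > 0\<close>
   forces its pairing with \<open>g\<close> to be at least \<open>e\<close>. The distance bound
   \<open>far\<close>, rescaled by \<open>s\<close>, is the compatibility condition.\<close>
 define K where "K = {((%t x. bwd nu ps t x - s * g t x), - s * e) | ps s. admissible ps & 0 <= s}"
 have KI: "((%t x. bwd nu ps t x - s * g t x), - s * e) \<in> K" if "admissible ps" "0 <= s" for ps s
  using that by (auto simp: K_def)
 have nil: "admissible []" by (simp add: admissible_def)
 obtain w where w: "w \<in> Linf_L2 T" and le: "!!r l. (r, l) \<in> K ==> pairing T w r <= l"
 proof (rule Linf_solve_cone[where K = K and C = 1 and T = T])
  show "0 < T" by (rule T)
  show "((%t x. 0), 0) \<in> K" using KI[OF nil, of 0] by (simp add: bwd_Nil)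
  fix r l assume "(r, l) \<in> K"
  then obtain ps s where ps: "r = (%t x. bwd nu ps t x - s * g t x)" "l = - s * e" "admissible ps" "0 <= s" by (auto simp: K_def)
  show "r \<in> Lp_L2 1 T" unfolding ps(1) by (intro L1_diff L1_scale bwd_L1 ps g)
  show "- l <= 1 * nrm1 T r"
  proof (cases "s = 0")
   case True then show ?thesis using ps(2) nrm1_nonneg by simp
  next
   case False
   then have s: "0 < s" using ps by simp
   have "s * e <= s * nrm1 T (%t x. g t x - bwd nu (scale_test (1 / s) ps) t x)"
    by (intro mult_left_mono far admissible_scale ps(3,4))
   also have "... = nrm1 T (%t x. s * (g t x - bwd nu (scale_test (1 / s) ps) t x))" unfolding nrm1_scale using s by simp
   also have "(%t x. s * (g t x - bwd nu (scale_test (1 / s) ps) t x)) = (%t x. s * g t x - bwd nu ps t x)"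
    using s by (simp add: bwd_scale right_diff_distrib)
   also have "nrm1 T ... = nrm1 T r" unfolding ps(1) by (rule nrm1_minus_commute)
   finally show ?thesis using ps(2) by simp
  qed
  show "((%t x. c * r t x), c * l) \<in> K" if "0 <= c" for c
   using KI[OF admissible_scale[OF ps(3)], of "c * s" c] ps that
   by (simp add: bwd_scale right_diff_distrib mult.assoc)
  fix r' l' assume "(r', l') \<in> K"
  then obtain qs s' where qs: "r' = (%t x. bwd nu qs t x - s' * g t x)" "l' = - s' * e" "admissible qs" "0 <= s'" by (auto simp: K_def)
  have "((%t x. bwd nu (ps @ qs) t x - (s + s') * g t x), - (s + s') * e) \<in> K"
   using ps qs by (intro KI admissible_append) auto
  moreover have "(%t x. bwd nu (ps @ qs) t x - (s + s') * g t x) = (%t x. r t x + r' t x)"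
   unfolding ps(1) qs(1) by (simp add: bwd_append algebra_simps)
  moreover have "- (s + s') * e = l + l'" unfolding ps(2) qs(2) by (simp add: algebra_simps)
  ultimately show "((%t x. r t x + r' t x), l + l') \<in> K" by simp
 qed auto
 \<comment> \<open>The range is a linear space, so nonpositive pairings vanish. Hence
   \<open>w\<close> solves the problem with zero datum and is zero by uniqueness.\<close>
 have z: "pairing T w (bwd nu ps) <= 0" if "admissible ps" for ps
  using le[OF KI[OF that, of 0]] by simp
 have "pairing T w (bwd nu ps) = inn torus (%x. 0) (test_fun ps 0)" if ps: "admissible ps" for ps
 proof -
  have "pairing T w (%t x. (-1) * bwd nu ps t x) <= 0"
   using z[OF admissible_scale[OF ps, of "-1"]] by (simp only: bwd_scale[abs_def])
  moreover have "pairing T w (%t x. (-1) * bwd nu ps t x) = - pairing T w (bwd nu ps)"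
   using pairing_combine[OF w bwd_L1[OF ps] bwd_L1[OF ps], of "-1" nu 0 nu] by simp
  ultimately show ?thesis using z[OF ps] by simp
 qed
 then have "parabolic_weak_solution T b nu (%x. 0) w" by (intro weak_solution_of_pairing w L2_zero)
 then have "AE t in itv T. eqT (w t) (%x. 0)" by (rule uniq)
 then have "AE t in itv T. inn torus (w t) (g t) = 0"
  using strongly_measurableD(1)[OF Linf_sm[OF w]] L1_AE[OF g]
  by eventually_elim (use eqT_inn[OF _ L2_sqi sqi_zero L2_sqi] in auto)
 then have "pairing T w g = 0" unfolding pairing_def by (rule integral_eq_zero_AE)
 moreover have "pairing T w (%t x. (-1) * g t x) = - pairing T w g"
  using pairing_combine[OF w g g, of "-1" 0] by simp
 ultimately have "pairing T w (%t x. - g t x) = 0" by simp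
 \<comment> \<open>The constraint for the empty list and \<open>s = 1\<close> says that the pairing
   with \<open>g\<close> is at least \<open>e\<close>.\<close>
 then show False using le[OF KI[OF nil, of 1]] e by (simp add: bwd_Nil)
 qed
 then show thesis using that by blast
qed

end

subsection \<open>Increments of the Brownian family\<close>

locale noise = prob_space M for M :: "'w measure" +
 fixes F :: "real => 'w measure" and B :: "int ^ 'd::finite => nat => real => 'w => real"
  and \<Lambda> :: "(int ^ 'd) set"
 assumes filtration: "normal_filtration M F"
  and brownian: "brownian_family M F B"
  and half: "half_lattice \<Lambda>"
begin

abbreviation modes :: "((int ^ 'd) \<times> nat) set" where
 "modes \<equiv> (UNIV - {0}) \<times> {1..CARD('d) - 1}"

abbreviation bm :: "(int ^ 'd) \<times> nat => real => 'w => real" where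
 "bm p \<equiv> B (fst p) (snd p)"

lemma subalg: "0 <= t ==> subalgebra M (F t)"
proof -
 have "\<forall>t\<ge>0. subalgebra M (F t)" using filtration unfolding normal_filtration_def by (elim conjE)
 then show "0 <= t ==> subalgebra M (F t)" by simp
qed

lemma space_F [simp]: "0 <= t ==> space (F t) = space M"
 using subalg[of t] by (simp add: subalgebra_def)

lemma measurable_F_M: "f \<in> F t \<rightarrow>\<^sub>M N ==> 0 <= t ==> f \<in> M \<rightarrow>\<^sub>M N"
 by (rule measurable_from_subalg[OF subalg])

lemma measurable_F_mono: "f \<in> F s \<rightarrow>\<^sub>M N ==> 0 <= s ==> s <= t ==> f \<in> F t \<rightarrow>\<^sub>M N"
proof (rule measurable_from_subalg)
 assume st: "0 <= s" "s <= t"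
 have "\<forall>s t. 0 <= s & s <= t --> sets (F s) \<subseteq> sets (F t)"
  using filtration unfolding normal_filtration_def by (elim conjE)
 with st have "sets (F s) \<subseteq> sets (F t)" by simp
 then show "subalgebra (F t) (F s)" using st by (simp add: subalgebra_def)
qed

lemma bm_bm:
 assumes "p \<in> modes"
 shows "brownian_motion M F (bm p)"
proof -
 have "fst p \<in> UNIV - {0}" "snd p \<in> {1..CARD('d) - 1}" using assms unfolding mem_Times_iff by blast+
 moreover have "\<forall>k\<in>UNIV - {0}. \<forall>j\<in>{1..CARD('d) - 1}. brownian_motion M F (B k j)"
  using brownian unfolding brownian_family_def by (elim conjE)
 ultimately show ?thesis by blast
qed

lemma bm_F:
 assumes p: "p \<in> modes" and st: "0 <= s" "s <= t"
 shows "bm p s \<in> borel_measurable (F t)"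
proof (rule measurable_F_mono[OF _ st])
 show "bm p s \<in> borel_measurable (F s)"
 proof -
  have "\<forall>t\<ge>0. bm p t \<in> borel_measurable (F t)" using bm_bm[OF p] unfolding brownian_motion_def by (elim conjE)
  then show ?thesis using st(1) by simp
 qed
qed

lemma bm_M: "p \<in> modes ==> 0 <= s ==> bm p s \<in> borel_measurable M"
 by (rule measurable_F_M[OF bm_F[of p s s]]) auto

definition inc :: "(int ^ 'd) \<times> nat => real => real => 'w => real" where
 "inc p s t w = bm p t w - bm p s w"

lemma inc_F: "p \<in> modes ==> 0 <= s ==> s <= t ==> t <= r ==> inc p s t \<in> borel_measurable (F r)"
 unfolding inc_def[abs_def] by (intro borel_measurable_diff bm_F) auto

lemma inc_M: "p \<in> modes ==> 0 <= s ==> s <= t ==> inc p s t \<in> borel_measurable M"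
 by (rule measurable_F_M[OF inc_F[of p s t t]]) auto

lemma inc_moments:
 assumes p: "p \<in> modes" and st: "0 <= s" "s <= t"
 shows "inc p s t \<in> sqi M" "(LINT w|M. inc p s t w) = 0" "(LINT w|M. (inc p s t w)\<^sup>2) = t - s"
proof -
 have m: "inc p s t \<in> borel_measurable M" by (rule inc_M[OF p st])
 have "integrable M (%w. (inc p s t w)\<^sup>2) & (LINT w|M. inc p s t w) = 0 & (LINT w|M. (inc p s t w)\<^sup>2) = t - s"
 proof (cases "s = t")
  case True
  then show ?thesis by (simp add: inc_def)
 next
  case False
  define sg where "sg = sqrt (t - s)"
  have sg: "0 < sg" "sg\<^sup>2 = t - s" using False st by (auto simp: sg_def)
  have d: "distributed M lborel (inc p s t) (%x. ennreal (normal_density 0 sg x))"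
  proof -
   have "\<forall>s t. 0 <= s & s < t -->
     distributed M lborel (%w. bm p t w - bm p s w) (%x. ennreal (normal_density 0 (sqrt (t - s)) x)) &
     indep_set (sets (F s)) (sets (vimage_algebra (space M) (%w. bm p t w - bm p s w) borel))"
    using bm_bm[OF p] unfolding brownian_motion_def by (elim conjE)
   then show ?thesis using False st unfolding inc_def[abs_def] sg_def by simp
  qed
  have "integrable M (%w. (inc p s t w)\<^sup>2)"
   using distributed_integrable[OF d, of "%x. x\<^sup>2"] integrable_normal_moment[OF sg(1), of 0 2] by simp
  moreover have "(LINT w|M. inc p s t w) = 0"
   using distributed_integral[OF d, of "%x. x"] integral_normal_moment_nz_1[OF sg(1), of 0] by simp
  moreover have "(LINT w|M. (inc p s t w)\<^sup>2) = t - s"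
   using distributed_integral[OF d, of "%x. x\<^sup>2"] integral_normal_moment_even[OF sg(1), of 0 1] sg
   by (simp add: fact_numeral)
  ultimately show ?thesis by simp
 qed
 then show "inc p s t \<in> sqi M" "(LINT w|M. inc p s t w) = 0" "(LINT w|M. (inc p s t w)\<^sup>2) = t - s"
  using m by (auto simp: sqi_def)
qed

lemma inc_integrable: "p \<in> modes ==> 0 <= s ==> s <= t ==> integrable M (inc p s t)"
 by (rule integral_abs_le_nrm(1)[OF finite_measure_axioms inc_moments(1)])

lemma inc_indep:
 fixes Z :: "'w => complex" and g :: "real => complex"
 assumes p: "p \<in> modes" and st: "0 <= s" "s < t" and Z: "Z \<in> borel_measurable (F s)"
  and g [measurable]: "g \<in> borel_measurable borel"
 shows "indep_var borel Z borel (%w. g (inc p s t w))"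
proof -
 let ?V = "vimage_algebra (space M) (inc p s t) borel"
 have ind: "indep_set (sets (F s)) (sets ?V)"
 proof -
  have "\<forall>s t. 0 <= s & s < t -->
    distributed M lborel (%w. bm p t w - bm p s w) (%x. ennreal (normal_density 0 (sqrt (t - s)) x)) &
    indep_set (sets (F s)) (sets (vimage_algebra (space M) (%w. bm p t w - bm p s w) borel))"
   using bm_bm[OF p] unfolding brownian_motion_def by (elim conjE)
  then show ?thesis using st unfolding inc_def[abs_def] by simp
 qed
 have ZM: "Z \<in> borel_measurable M" using measurable_F_M[OF Z] st by simp
 have gM: "(%w. g (inc p s t w)) \<in> borel_measurable M"
  using inc_M[OF p, of s t] st by (intro measurable_compose[OF _ g]) auto
 have 1: "sigma_sets (space M) {Z -` A \<inter> space M |A. A \<in> sets borel} \<subseteq> sets (F s)"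
 proof -
  have "{Z -` A \<inter> space M |A. A \<in> sets borel} \<subseteq> sets (F s)"
   using measurable_sets[OF Z] st by auto
  then show ?thesis using sets.sigma_sets_subset[of _ "F s"] st by simp
 qed
 have 2: "sigma_sets (space M) {(%w. g (inc p s t w)) -` A \<inter> space M |A. A \<in> sets borel} \<subseteq> sets ?V"
 proof -
  have "{(%w. g (inc p s t w)) -` A \<inter> space M |A. A \<in> sets borel} \<subseteq> sets ?V"
  proof clarify
   fix A :: "complex set" assume "A \<in> sets borel"
   then have "g -` A \<in> sets borel" using measurable_sets[OF g, of A] by simp
   then have "inc p s t -` (g -` A) \<inter> space M \<in> sets ?V" by (rule in_vimage_algebra)
   then show "(%w. g (inc p s t w)) -` A \<inter> space M \<in> sets ?V" by (simp add: vimage_def)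
  qed
  then show ?thesis using sets.sigma_sets_subset[of _ ?V] by simp
 qed
 have "indep_set (sigma_sets (space M) {Z -` A \<inter> space M |A. A \<in> sets borel})
   (sigma_sets (space M) {(%w. g (inc p s t w)) -` A \<inter> space M |A. A \<in> sets borel})"
  using ind unfolding indep_set_def
  by (rule indep_sets_mono_sets) (use 1 2 in \<open>auto split: bool.splits\<close>)
 then show ?thesis using ZM gM by (simp add: indep_var_eq)
qed

lemma inc_mean:
 assumes p: "p \<in> modes" and st: "0 <= s" "s <= t" and Z: "Z \<in> borel_measurable (F s)" "integrable M Z"
 shows "integrable M (%w. Z w * complex_of_real (inc p s t w))"
  and "(LINT w|M. Z w * complex_of_real (inc p s t w)) = 0"
proof -
 have "integrable M (%w. Z w * complex_of_real (inc p s t w)) & (LINT w|M. Z w * complex_of_real (inc p s t w)) = 0"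
 proof (cases "s = t")
  case True then show ?thesis by (simp add: inc_def)
 next
  case False
  then have ind: "indep_var borel Z borel (%w. complex_of_real (inc p s t w))"
   using st by (intro inc_indep p Z) auto
  have i: "integrable M (%w. complex_of_real (inc p s t w))" using inc_integrable[OF p st] by simp
  show ?thesis
   using indep_var_integrable[OF ind Z(2) i] indep_var_lebesgue_integral[OF ind Z(2) i] inc_moments(2)[OF p st] by simp
 qed
 then show "integrable M (%w. Z w * complex_of_real (inc p s t w))"
  "(LINT w|M. Z w * complex_of_real (inc p s t w)) = 0" by auto
qed

lemma inc_square:
 assumes p: "p \<in> modes" and st: "0 <= s" "s <= t" and Z: "Z \<in> borel_measurable (F s)" "integrable M Z"
 shows "integrable M (%w. Z w * complex_of_real (inc p s t w * inc p s t w))"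
  and "(LINT w|M. Z w * complex_of_real (inc p s t w * inc p s t w)) = (LINT w|M. Z w) * (t - s)"
proof -
 have "integrable M (%w. Z w * complex_of_real (inc p s t w * inc p s t w))
  & (LINT w|M. Z w * complex_of_real (inc p s t w * inc p s t w)) = (LINT w|M. Z w) * (t - s)"
 proof (cases "s = t")
  case True then show ?thesis by (simp add: inc_def)
 next
  case False
  then have ind: "indep_var borel Z borel (%w. complex_of_real (inc p s t w * inc p s t w))"
   using st by (intro inc_indep[where g = "%x. complex_of_real (x * x)"] p Z) auto
  have i: "integrable M (%w. complex_of_real (inc p s t w * inc p s t w))"
   using sqi_integrable_mult[OF inc_moments(1)[OF p st] inc_moments(1)[OF p st]] by (rule integrable_of_real)
  show ?thesis
   using indep_var_integrable[OF ind Z(2) i] indep_var_lebesgue_integral[OF ind Z(2) i]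
    inc_moments(3)[OF p st] by (simp add: power2_eq_square del: of_real_mult)
 qed
 then show "integrable M (%w. Z w * complex_of_real (inc p s t w * inc p s t w))"
  "(LINT w|M. Z w * complex_of_real (inc p s t w * inc p s t w)) = (LINT w|M. Z w) * (t - s)" by auto
qed

lemma bounded_integrable_mult:
 fixes ze :: "'w => complex"
 assumes "ze \<in> borel_measurable M" "!!w. w \<in> space M ==> norm (ze w) <= C" "integrable M f"
 shows "integrable M (%w. ze w * complex_of_real (f w))"
proof (rule Bochner_Integration.integrable_bound)
 show "integrable M (%w. C * f w)" using assms by simp
 show "(%w. ze w * complex_of_real (f w)) \<in> borel_measurable M"
  using assms borel_measurable_integrable[OF assms(3)] by measurable
 show "AE w in M. norm (ze w * complex_of_real (f w)) <= norm (C * f w)"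
 proof (rule AE_I2)
  fix w assume "w \<in> space M"
  then have "norm (ze w) <= \<bar>C\<bar>" using assms(2)[of w] by linarith
  then show "norm (ze w * complex_of_real (f w)) <= norm (C * f w)"
   by (simp add: norm_mult abs_mult mult_right_mono)
 qed
qed

text \<open>Independence of the family concerns whole paths, so increments of one mode over several
  intervals are jointly independent of those of another mode and the product factorizes.\<close>

lemma inc_four:
 assumes p: "p \<in> modes" and q: "q \<in> modes" and pq: "p ~= q"
  and st: "0 <= s" "s <= t" "0 <= s'" "s' <= t'"
 shows "integrable M (%w. (inc p s t w * inc p s' t' w) * (inc q s t w * inc q s' t' w))"
  and "(LINT w|M. (inc p s t w * inc p s' t' w) * (inc q s t w * inc q s' t' w))
   = (LINT w|M. inc p s t w * inc p s' t' w) * (LINT w|M. inc q s t w * inc q s' t' w)"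
proof -
 let ?P = "Pi\<^sub>M {0..} (%_. borel) :: (real => real) measure"
 let ?X = "%(k, j) w. \<lambda>t\<in>{0..}. B k j t w"
 have iv: "indep_vars (%_. ?P) ?X modes" using brownian by (simp add: brownian_family_def)
 have "indep_var (PiM {p} (%_. ?P)) (%w. restrict (%i. ?X i w) {p}) (PiM {q} (%_. ?P)) (%w. restrict (%i. ?X i w) {q})"
  by (rule indep_var_restrict[OF iv]) (use p q pq in auto)
 moreover have m: "(%y. (y r t - y r s) * (y r t' - y r s')) \<in> borel_measurable (PiM {r} (%_. ?P))" for r :: "(int ^ 'd) \<times> nat"
 proof -
  have c1: "(%y. y r) \<in> PiM {r} (%_. ?P) \<rightarrow>\<^sub>M ?P" by (rule measurable_component_singleton) simp
  have c2: "(%v. v u) \<in> ?P \<rightarrow>\<^sub>M borel" if "0 <= u" for u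
   using that by (intro measurable_component_singleton) auto
  have "(%y. y r u) \<in> borel_measurable (PiM {r} (%_. ?P))" if "0 <= u" for u
   by (rule measurable_compose[OF c1 c2[OF that]])
  then show ?thesis using st by (intro borel_measurable_times borel_measurable_diff) auto
 qed
 ultimately have "indep_var borel ((%y. (y p t - y p s) * (y p t' - y p s')) \<circ> (%w. restrict (%i. ?X i w) {p}))
   borel ((%y. (y q t - y q s) * (y q t' - y q s')) \<circ> (%w. restrict (%i. ?X i w) {q}))"
  using m by (rule indep_var_compose)
 moreover have "((%y. (y r t - y r s) * (y r t' - y r s')) \<circ> (%w. restrict (%i. ?X i w) {r})) = (%w. inc r s t w * inc r s' t' w)" for r
  using st by (auto simp: fun_eq_iff inc_def case_prod_beta)
 ultimately have ind: "indep_var borel (%w. inc p s t w * inc p s' t' w) borel (%w. inc q s t w * inc q s' t' w)"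
  by simp
 have i: "integrable M (%w. inc r s t w * inc r s' t' w)" if "r \<in> modes" for r
  using that st by (intro sqi_integrable_mult inc_moments(1))
 show "integrable M (%w. (inc p s t w * inc p s' t' w) * (inc q s t w * inc q s' t' w))"
  by (rule indep_var_integrable[OF ind i[OF p] i[OF q]])
 show "(LINT w|M. (inc p s t w * inc p s' t' w) * (inc q s t w * inc q s' t' w))
   = (LINT w|M. inc p s t w * inc p s' t' w) * (LINT w|M. inc q s t w * inc q s' t' w)"
  by (rule indep_var_lebesgue_integral[OF ind i[OF p] i[OF q]])
qed

lemma inc_disjoint:
 assumes p: "p \<in> modes" and st: "0 <= s" "s <= t" "t <= s'" "s' <= t'"
 shows "(LINT w|M. inc p s t w * inc p s' t' w) = 0"
proof -
 have "(%w. complex_of_real (inc p s t w)) \<in> borel_measurable (F s')"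
  using st inc_F[OF p, of s t s'] by measurable
 moreover have "integrable M (%w. complex_of_real (inc p s t w))"
  using inc_integrable[OF p, of s t] st by simp
 ultimately have "(LINT w|M. complex_of_real (inc p s t w) * complex_of_real (inc p s' t' w)) = 0"
  using st by (intro inc_mean[OF p]) auto
 then have "complex_of_real (LINT w|M. inc p s t w * inc p s' t' w) = 0"
  unfolding of_real_mult[symmetric] integral_complex_of_real .
 then show ?thesis by simp
qed

text \<open>The factor \<open>ze\<close> and the earlier increment are both known at time
  \<open>s'\<close>, and the later increment has mean zero independently of
  \<open>F s'\<close>.\<close>

lemma cross_disjoint:
 assumes p: "p \<in> modes" and q: "q \<in> modes" and st: "0 <= s" "s <= t" "t <= s'" "s' <= t'"
  and Z: "ze \<in> borel_measurable (F s)" "!!w. w \<in> space M ==> norm (ze w) <= C"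
 shows "(LINT w|M. ze w * complex_of_real (inc p s t w * inc q s' t' w)) = 0"
proof -
 have zeM: "ze \<in> borel_measurable M" by (rule measurable_F_M[OF Z(1) st(1)])
 have "(%w. ze w * complex_of_real (inc p s t w)) \<in> borel_measurable (F s')"
 proof (rule borel_measurable_times)
  show "ze \<in> borel_measurable (F s')" by (rule measurable_F_mono[OF Z(1)]) (use st in auto)
  show "(%w. complex_of_real (inc p s t w)) \<in> borel_measurable (F s')"
   using inc_F[OF p, of s t s'] st by measurable
 qed
 moreover have "integrable M (%w. ze w * complex_of_real (inc p s t w))"
  using st by (intro bounded_integrable_mult[OF zeM Z(2)] inc_integrable p) auto
 ultimately have "(LINT w|M. (ze w * complex_of_real (inc p s t w)) * complex_of_real (inc q s' t' w)) = 0"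
  using st by (intro inc_mean[OF q]) auto
 then show ?thesis by (simp add: mult.assoc)
qed

text \<open>
  Independence of the two Brownian motions does not give joint independence of their increments from
  \<open>F s\<close>. Instead the interval is subdivided: off-diagonal products vanish by the martingale property
  and the sum of the diagonal ones, the discrete covariation, tends to zero in \<open>L\<^sup>2\<close>.
\<close>

lemma cross_same:
 assumes p: "p \<in> modes" and q: "q \<in> modes" and pq: "p ~= q" and st: "0 <= s" "s <= t"
  and Z: "ze \<in> borel_measurable (F s)" "!!w. w \<in> space M ==> norm (ze w) <= C"
 shows "(LINT w|M. ze w * complex_of_real (inc p s t w * inc q s t w)) = 0"
proof -
 have zeM: "ze \<in> borel_measurable M" by (rule measurable_F_M[OF Z(1) st(1)])
 have C: "0 <= C" using Z(2) not_empty by (metis ex_in_conv norm_ge_zero order_trans)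
 have bound: "norm (LINT w|M. ze w * complex_of_real (inc p s t w * inc q s t w)) <= C * ((t - s) / sqrt (real n))"
  if n: "0 < n" for n
 proof -
  define h where "h = (t - s) / real n"
  have h: "0 <= h" using st by (simp add: h_def)
  define tau where "tau i = s + real i * h" for i
  have tau: "0 <= tau i" "s <= tau i" "tau i <= tau (Suc i)" "tau (Suc i) - tau i = h" for i
   using st h by (auto simp: tau_def algebra_simps)
  have taumono: "tau i <= tau j" if "i <= j" for i j
   using that h by (auto simp: tau_def intro!: mult_right_mono)
  have ends: "tau 0 = s" "tau n = t" using n by (auto simp: tau_def h_def)
  define dl where "dl r i = inc r (tau i) (tau (Suc i))" for r i
  have tele: "inc r s t w = (\<Sum>i<n. dl r i w)" for r w
   unfolding dl_def inc_def using sum_lessThan_telescope[of "%i. bm r (tau i) w" n] by (simp add: ends)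
  have dls: "dl r i \<in> sqi M" if "r \<in> modes" for r i
   unfolding dl_def using that tau by (intro inc_moments(1)) auto
  have dli: "integrable M (%w. ze w * complex_of_real (dl p i w * dl q j w))" for i j
   by (intro bounded_integrable_mult[OF zeM Z(2)] sqi_integrable_mult dls p q)
  have zetau: "ze \<in> borel_measurable (F (tau i))" for i
   using tau(2) st by (intro measurable_F_mono[OF Z(1)]) auto
  have off: "(LINT w|M. ze w * complex_of_real (dl p i w * dl q j w)) = 0" if "i ~= j" for i j
  proof (cases "i < j")
   case True
   then show ?thesis unfolding dl_def
    using tau taumono[of "Suc i" j] by (intro cross_disjoint[OF p q _ _ _ _ zetau Z(2)]) auto
  next
   case False
   then have "j < i" using that by simp
   then have "(LINT w|M. ze w * complex_of_real (dl q j w * dl p i w)) = 0" unfolding dl_def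
    using tau taumono[of "Suc j" i] by (intro cross_disjoint[OF q p _ _ _ _ zetau Z(2)]) auto
   then show ?thesis by (simp add: mult.commute)
  qed
  \<comment> \<open>The discrete covariation: off-diagonal products integrate to zero against
    \<open>ze\<close>, so only this diagonal sum survives.\<close>
  define V where "V w = (\<Sum>i<n. dl p i w * dl q i w)" for w
  have "(LINT w|M. ze w * complex_of_real (inc p s t w * inc q s t w))
    = (LINT w|M. (\<Sum>i<n. \<Sum>j<n. ze w * complex_of_real (dl p i w * dl q j w)))"
  proof -
   have "inc p s t w * inc q s t w = (\<Sum>i<n. \<Sum>j<n. dl p i w * dl q j w)" for w
    unfolding tele by (rule sum_product)
   then show ?thesis by (simp only: of_real_sum sum_distrib_left)
  qed
  also have "... = (\<Sum>i<n. \<Sum>j<n. (LINT w|M. ze w * complex_of_real (dl p i w * dl q j w)))"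
   by (subst Bochner_Integration.integral_sum, intro Bochner_Integration.integrable_sum dli)
    (intro sum.cong refl Bochner_Integration.integral_sum dli)
  also have "... = (\<Sum>i<n. (LINT w|M. ze w * complex_of_real (dl p i w * dl q i w)))"
  proof (rule sum.cong[OF refl])
   fix i assume i: "i \<in> {..<n}"
   have "(\<Sum>j<n. (LINT w|M. ze w * complex_of_real (dl p i w * dl q j w)))
     = (\<Sum>j<n. if j = i then (LINT w|M. ze w * complex_of_real (dl p i w * dl q i w)) else 0)"
    by (intro sum.cong) (auto simp: off simp del: of_real_mult)
   then show "(\<Sum>j<n. (LINT w|M. ze w * complex_of_real (dl p i w * dl q j w)))
     = (LINT w|M. ze w * complex_of_real (dl p i w * dl q i w))" using i by simp
  qed
  also have "... = (LINT w|M. ze w * complex_of_real (V w))"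
   unfolding V_def of_real_sum sum_distrib_left by (rule Bochner_Integration.integral_sum[symmetric]) (rule dli)
  finally have eq: "(LINT w|M. ze w * complex_of_real (inc p s t w * inc q s t w)) = (LINT w|M. ze w * complex_of_real (V w))" .
  \<comment> \<open>Different modes factorize and increments of one mode over different pieces are
    uncorrelated. The second moment of \<open>V\<close> is thus \<open>n * h^2\<close>, which equals
    \<open>(t - s)^2 / n\<close>.\<close>
  have four: "integrable M (%w. (dl p i w * dl p j w) * (dl q i w * dl q j w))"
   "(LINT w|M. (dl p i w * dl p j w) * (dl q i w * dl q j w)) = (if i = j then h * h else 0)" for i j
  proof -
   show "integrable M (%w. (dl p i w * dl p j w) * (dl q i w * dl q j w))"
    unfolding dl_def using tau by (intro inc_four(1)[OF p q pq])
   have e: "(LINT w|M. dl r i w * dl r j w) = (if i = j then h else 0)" if r: "r \<in> modes" for r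
   proof (cases i j rule: linorder_cases)
    case less
    then show ?thesis unfolding dl_def using tau taumono[of "Suc i" j] by (subst inc_disjoint[OF r]) auto
   next
    case equal
    then show ?thesis
     unfolding dl_def using inc_moments(3)[OF r tau(1,3), of i] tau(4)[of i] by (simp add: power2_eq_square)
   next
    case greater
    then have "(LINT w|M. dl r j w * dl r i w) = 0"
     unfolding dl_def using tau taumono[of "Suc j" i] by (subst inc_disjoint[OF r]) auto
    then show ?thesis using greater by (simp add: mult.commute)
   qed
   show "(LINT w|M. (dl p i w * dl p j w) * (dl q i w * dl q j w)) = (if i = j then h * h else 0)"
    using inc_four(2)[OF p q pq tau(1)[of i] tau(3)[of i] tau(1)[of j] tau(3)[of j]] e[OF p] e[OF q]
    by (simp add: dl_def)
  qed
  have V2: "(V w)\<^sup>2 = (\<Sum>i<n. \<Sum>j<n. (dl p i w * dl p j w) * (dl q i w * dl q j w))" for w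
   unfolding V_def power2_eq_square sum_product by (intro sum.cong refl) (simp add: mult_ac)
  have Vs: "V \<in> sqi M"
  proof -
   have "V \<in> borel_measurable M" unfolding V_def[abs_def]
    using dls p q by (intro borel_measurable_sum borel_measurable_times) (auto intro: sqi_measurable)
   moreover have "integrable M (%w. (V w)\<^sup>2)" unfolding V2 by (intro Bochner_Integration.integrable_sum four)
   ultimately show ?thesis by (simp add: sqi_def)
  qed
  have "(nrm M V)\<^sup>2 = (LINT w|M. (V w)\<^sup>2)" unfolding nrm_power2 inn_def by (simp add: power2_eq_square)
  also have "... = (\<Sum>i<n. \<Sum>j<n. (LINT w|M. (dl p i w * dl p j w) * (dl q i w * dl q j w)))"
   unfolding V2 by (subst Bochner_Integration.integral_sum, intro Bochner_Integration.integrable_sum four)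
    (intro sum.cong refl Bochner_Integration.integral_sum four)
  also have "... = real n * (h * h)" unfolding four(2) by simp
  also have "... = ((t - s) / sqrt (real n))\<^sup>2" using n by (simp add: h_def power_divide power2_eq_square)
  finally have nV: "nrm M V = (t - s) / sqrt (real n)"
   using st by (simp add: power2_eq_iff_nonneg)
  have "norm (LINT w|M. ze w * complex_of_real (V w)) <= (LINT w|M. norm (ze w * complex_of_real (V w)))"
   by (rule integral_norm_bound)
  also have "(LINT w|M. norm (ze w * complex_of_real (V w))) <= (LINT w|M. C * \<bar>V w\<bar>)"
  proof (rule integral_mono)
   have Vi: "integrable M V" by (rule integral_abs_le_nrm(1)[OF finite_measure_axioms Vs])
   show "integrable M (%w. C * \<bar>V w\<bar>)" using Vi by simp
   show "integrable M (%w. norm (ze w * complex_of_real (V w)))"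
    using bounded_integrable_mult[OF zeM Z(2) Vi] by simp
   show "norm (ze w * complex_of_real (V w)) <= C * \<bar>V w\<bar>" if "w \<in> space M" for w
    using Z(2)[OF that] by (simp add: norm_mult mult_right_mono)
  qed
  also have "... = C * (LINT w|M. \<bar>V w\<bar>)" by simp
  also have "... <= C * nrm M V"
   using integral_abs_le_nrm(2)[OF finite_measure_axioms Vs] C by (intro mult_left_mono) (auto simp: prob_space)
  finally show ?thesis unfolding eq nV .
 qed
 \<comment> \<open>The left side does not depend on the number of pieces.\<close>
 have "(%n. C * ((t - s) / sqrt (real n))) \<longlonglongrightarrow> C * 0"
  by (intro tendsto_mult_left) real_asymp
 then have "norm (LINT w|M. ze w * complex_of_real (inc p s t w * inc q s t w)) <= C * 0"
  by (rule LIMSEQ_le_const) (use bound in \<open>auto intro!: exI[of _ 1]\<close>)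
 then show ?thesis by simp
qed

definition overlap :: "real => real => real => real => real" where
 "overlap a b c d = max 0 (min b d - max a c)"

text \<open>Isometry for single increments. Both coefficients are known at the later starting time;
  cutting there and at the earlier end point leaves products over disjoint intervals, which vanish,
  and one product over the common interval.\<close>

lemma bracket:
 assumes p: "p \<in> modes" and q: "q \<in> modes" and ab: "0 <= a" "a <= b" and cd: "0 <= c" "c <= d"
  and xi: "xi \<in> borel_measurable (F a)" "!!w. w \<in> space M ==> norm (xi w) <= C"
  and eta: "eta \<in> borel_measurable (F c)" "!!w. w \<in> space M ==> norm (eta w) <= C'"
 shows "integrable M (%w. (xi w * eta w) * complex_of_real (inc p a b w * inc q c d w))"
  and "(LINT w|M. (xi w * eta w) * complex_of_real (inc p a b w * inc q c d w))
   = (if p = q then (LINT w|M. xi w * eta w) * overlap a b c d else 0)"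
proof -
 have main: "integrable M (%w. (xi w * eta w) * complex_of_real (inc p a b w * inc q c d w)) &
  (LINT w|M. (xi w * eta w) * complex_of_real (inc p a b w * inc q c d w))
   = (if p = q then (LINT w|M. xi w * eta w) * overlap a b c d else 0)"
  if p: "p \<in> modes" and q: "q \<in> modes" and ab: "0 <= a" "a <= b" and cd: "0 <= c" "c <= d"
  and xi: "xi \<in> borel_measurable (F a)" "!!w. w \<in> space M ==> norm (xi w) <= C"
  and eta: "eta \<in> borel_measurable (F c)" "!!w. w \<in> space M ==> norm (eta w) <= C'"
  and ac: "a <= c" for p q a b c d xi eta C C'
 proof -
  define ze where "ze w = xi w * eta w" for w
  have zeF: "ze \<in> borel_measurable (F c)"
   unfolding ze_def[abs_def] by (intro borel_measurable_times eta(1) measurable_F_mono[OF xi(1) ab(1) ac])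
  have zeb: "norm (ze w) <= \<bar>C\<bar> * \<bar>C'\<bar>" if "w \<in> space M" for w
   unfolding ze_def norm_mult using xi(2)[OF that] eta(2)[OF that] by (intro mult_mono) auto
  have zeM: "ze \<in> borel_measurable M" by (rule measurable_F_M[OF zeF cd(1)])
  have zei: "integrable M ze" by (rule integrable_const_bound[OF _ zeM]) (use zeb in auto)
  have int: "integrable M (%w. ze w * complex_of_real (inc p x y w * inc q x' y' w))"
   if "0 <= x" "x <= y" "0 <= x'" "x' <= y'" for x y x' y'
   using that by (intro bounded_integrable_mult[OF zeM zeb] sqi_integrable_mult inc_moments(1) p q)
  note i0 = int[OF ab cd]
  have "(LINT w|M. ze w * complex_of_real (inc p a b w * inc q c d w)) = (if p = q then (LINT w|M. ze w) * overlap a b c d else 0)"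
  proof (cases "b <= c")
   case True
   have "(%w. ze w * complex_of_real (inc p a b w)) \<in> borel_measurable (F c)"
    using inc_F[OF p ab True] zeF by measurable
   moreover have "integrable M (%w. ze w * complex_of_real (inc p a b w))"
    by (intro bounded_integrable_mult[OF zeM zeb] inc_integrable p ab)
   ultimately have "(LINT w|M. (ze w * complex_of_real (inc p a b w)) * complex_of_real (inc q c d w)) = 0"
    by (intro inc_mean[OF q cd])
   moreover have "overlap a b c d = 0" using True by (auto simp: overlap_def)
   ultimately show ?thesis by (simp add: mult.assoc)
  next
   case False
   \<comment> \<open>Here \<open>a <= c < b\<close>, so the common part of the two intervals runs
     from \<open>c\<close> to \<open>e\<close>.\<close>
   define e where "e = min b d"
   have e: "0 <= e" "c <= e" "e <= b" "e <= d" "e = b \<or> e = d" "0 <= c" "a <= c" "0 <= a"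
    using False cd ac ab by (auto simp: e_def)
   have ol: "overlap a b c d = e - c" using e ac by (auto simp: overlap_def e_def)
   let ?E = "%x y x' y'. (LINT w|M. ze w * complex_of_real (inc p x y w * inc q x' y' w))"
   have "inc p a b w * inc q c d w = inc p a c w * inc q c d w + inc p c e w * inc q c e w
     + inc p c e w * inc q e d w + inc p e b w * inc q c e w" for w
    using e(5) by (auto simp: inc_def algebra_simps)
   then have "?E a b c d = (LINT w|M. ze w * complex_of_real (inc p a c w * inc q c d w) + ze w * complex_of_real (inc p c e w * inc q c e w)
     + ze w * complex_of_real (inc p c e w * inc q e d w) + ze w * complex_of_real (inc p e b w * inc q c e w))"
    by (simp only: of_real_add distrib_left)
   also have "... = ?E a c c d + ?E c e c e + ?E c e e d + ?E e b c e"
    using e cd by (simp add: int del: of_real_mult)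
   also have "?E a c c d = 0"
   proof -
    have "(%w. ze w * complex_of_real (inc p a c w)) \<in> borel_measurable (F c)"
     using inc_F[OF p ab(1) ac order_refl] zeF by measurable
    moreover have "integrable M (%w. ze w * complex_of_real (inc p a c w))"
     by (intro bounded_integrable_mult[OF zeM zeb] inc_integrable p ab ac)
    ultimately have "(LINT w|M. (ze w * complex_of_real (inc p a c w)) * complex_of_real (inc q c d w)) = 0"
     by (intro inc_mean[OF q cd])
    then show ?thesis by (simp add: mult.assoc)
   qed
   also have "?E c e e d = 0"
    using e by (intro cross_disjoint[OF p q _ _ _ _ zeF zeb]) auto
   also have "?E e b c e = 0"
   proof -
    have "(LINT w|M. ze w * complex_of_real (inc q c e w * inc p e b w)) = 0"
     using e by (intro cross_disjoint[OF q p _ _ _ _ zeF zeb]) auto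
    then show ?thesis by (simp add: mult.commute)
   qed
   finally have E: "?E a b c d = ?E c e c e" by simp
   show ?thesis
   proof (cases "p = q")
    case True
    then show ?thesis using inc_square(2)[OF q e(6,2) zeF zei] E ol by simp
   next
    case False
    then show ?thesis using cross_same[OF p q False e(6,2) zeF zeb] E by simp
   qed
  qed
  then show ?thesis using i0 unfolding ze_def[abs_def] by blast
 qed
 have "integrable M (%w. (xi w * eta w) * complex_of_real (inc p a b w * inc q c d w)) &
  (LINT w|M. (xi w * eta w) * complex_of_real (inc p a b w * inc q c d w))
   = (if p = q then (LINT w|M. xi w * eta w) * overlap a b c d else 0)"
 proof (cases "a <= c")
  case True
  then show ?thesis by (intro main[OF p q ab cd xi eta])
 next
  case False
  then have "c <= a" by simp
  then have "integrable M (%w. (eta w * xi w) * complex_of_real (inc q c d w * inc p a b w)) &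
   (LINT w|M. (eta w * xi w) * complex_of_real (inc q c d w * inc p a b w))
   = (if q = p then (LINT w|M. eta w * xi w) * overlap c d a b else 0)"
   by (intro main[OF q p cd ab eta xi])
  moreover have "overlap c d a b = overlap a b c d" by (simp add: overlap_def min.commute max.commute)
  ultimately show ?thesis by (simp add: mult.commute eq_commute[of q p])
 qed
 then show "integrable M (%w. (xi w * eta w) * complex_of_real (inc p a b w * inc q c d w))"
  "(LINT w|M. (xi w * eta w) * complex_of_real (inc p a b w * inc q c d w))
   = (if p = q then (LINT w|M. xi w * eta w) * overlap a b c d else 0)" by auto
qed

end

section \<open>Complex modes and the isometry for simple processes\<close>

context noise begin

text \<open>The modes \<open>k\<close> and \<open>- k\<close> are conjugate and share two real
  Brownian motions. \<open>re_mode\<close> and \<open>im_mode\<close> index the real and imaginary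
  parts of a mode, and \<open>im_sign\<close> records the conjugation outside
  \<open>\<Lambda>\<close>.\<close>

definition re_mode :: "(int ^ 'd) \<times> nat => (int ^ 'd) \<times> nat" where
 "re_mode q = (if fst q \<in> \<Lambda> then fst q else - fst q, snd q)"

definition im_mode :: "(int ^ 'd) \<times> nat => (int ^ 'd) \<times> nat" where
 "im_mode q = (if fst q \<in> \<Lambda> then - fst q else fst q, snd q)"

definition im_sign :: "(int ^ 'd) \<times> nat => complex" where
 "im_sign q = (if fst q \<in> \<Lambda> then 1 else - 1)"

lemma half_cases: "k ~= 0 ==> k \<in> \<Lambda> \<longleftrightarrow> - k \<notin> \<Lambda>"
proof -
 assume k: "k ~= 0"
 have d: "\<Lambda> \<inter> uminus ` \<Lambda> = {}" and u: "\<Lambda> \<union> uminus ` \<Lambda> = UNIV - {0}"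
  using half[unfolded half_lattice_def] by (rule conjunct1, rule conjunct2)
 have "k \<in> \<Lambda> \<union> uminus ` \<Lambda>" unfolding u using k by simp
 moreover have "k \<in> uminus ` \<Lambda> \<longleftrightarrow> - k \<in> \<Lambda>" by (metis imageE image_eqI minus_minus)
 moreover have "\<not> (k \<in> \<Lambda> & k \<in> uminus ` \<Lambda>)"
  using d by (metis IntI empty_iff)
 ultimately show ?thesis by (simp add: Un_iff) metis
qed

lemma mode_facts:
 assumes q: "q \<in> modes"
 shows "re_mode q \<in> modes" "im_mode q \<in> modes" "fst (re_mode q) \<in> \<Lambda>" "fst (im_mode q) \<notin> \<Lambda>"
  "im_mode q = (- fst (re_mode q), snd (re_mode q))"
 using q half_cases[of "fst q"] by (auto simp: re_mode_def im_mode_def mem_Times_iff)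

lemma mode_eq: "q \<in> modes ==> q' \<in> modes ==> re_mode q = re_mode q' ==> im_sign q = im_sign q' ==> q = q'"
 by (auto simp: re_mode_def im_sign_def prod_eq_iff split: if_splits)

lemma sign_sq: "im_sign q * im_sign q = 1" "cnj (im_sign q) = im_sign q" "im_sign q = im_sign q' \<or> im_sign q * im_sign q' = - 1"
 by (auto simp: im_sign_def)

abbreviation cbm :: "(int ^ 'd) \<times> nat => real => 'w => complex" where
 "cbm q \<equiv> cplx_bm \<Lambda> B (fst q) (snd q)"

lemma cbm_inc:
 "cbm q t w - cbm q s w = complex_of_real (inc (re_mode q) s t w) + \<i> * im_sign q * complex_of_real (inc (im_mode q) s t w)"
 by (auto simp: cplx_bm_def inc_def re_mode_def im_mode_def im_sign_def complex_eq_iff)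

lemma cbm_measurable:
 assumes q: "q \<in> modes" and t: "0 <= t"
 shows "cbm q t \<in> borel_measurable M"
proof -
 have [measurable]: "bm (re_mode q) t \<in> borel_measurable M" "bm (im_mode q) t \<in> borel_measurable M"
  using bm_M[OF mode_facts(1)[OF q] t] bm_M[OF mode_facts(2)[OF q] t] by this+
 have "cbm q t = (%w. complex_of_real (bm (re_mode q) t w) + \<i> * im_sign q * complex_of_real (bm (im_mode q) t w))"
  by (auto simp: cplx_bm_def re_mode_def im_mode_def im_sign_def complex_eq_iff fun_eq_iff)
 then show ?thesis by (simp only:) measurable
qed

text \<open>Because the second factor is conjugated, the contributions of real and imaginary parts
  add up for equal modes, hence the factor 2. For the conjugate pair \<open>k\<close>,
  \<open>- k\<close>, built from the same Brownian motions, the signs are opposite and the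
  contributions cancel.\<close>

lemma complex_bracket:
 assumes q: "q \<in> modes" and q': "q' \<in> modes" and ab: "0 <= a" "a <= b" and cd: "0 <= c" "c <= d"
  and xi: "xi \<in> borel_measurable (F a)" "!!w. w \<in> space M ==> norm (xi w) <= C"
  and eta: "eta \<in> borel_measurable (F c)" "!!w. w \<in> space M ==> norm (eta w) <= C'"
 shows "integrable M (%w. (xi w * (cbm q b w - cbm q a w)) * cnj (eta w * (cbm q' d w - cbm q' c w)))"
  and "(LINT w|M. (xi w * (cbm q b w - cbm q a w)) * cnj (eta w * (cbm q' d w - cbm q' c w)))
   = (if q = q' then 2 * (LINT w|M. xi w * cnj (eta w)) * overlap a b c d else 0)"
proof -
 define eta' where "eta' w = cnj (eta w)" for w
 have eta': "eta' \<in> borel_measurable (F c)" "!!w. w \<in> space M ==> norm (eta' w) <= C'"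
  using eta measurable_compose[OF eta(1) borel_measurable_continuous_onI[OF continuous_on_cnj[OF continuous_on_id]]] unfolding eta'_def[abs_def] by auto
 let ?T = "%p p' w. (xi w * eta' w) * complex_of_real (inc p a b w * inc p' c d w)"
 note br = bracket[OF _ _ ab cd xi eta']
 note m = mode_facts[OF q] and m' = mode_facts[OF q']
 have exp: "(xi w * (cbm q b w - cbm q a w)) * cnj (eta w * (cbm q' d w - cbm q' c w))
   = ?T (re_mode q) (re_mode q') w + (- \<i> * im_sign q') * ?T (re_mode q) (im_mode q') w
    + (\<i> * im_sign q) * ?T (im_mode q) (re_mode q') w + (im_sign q * im_sign q') * ?T (im_mode q) (im_mode q') w" for w
  unfolding cbm_inc eta'_def by (simp add: sign_sq(2) algebra_simps) (simp add: algebra_simps flip: mult.assoc)?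
 note i = br(1)[OF m(1) m'(1)] br(1)[OF m(1) m'(2)] br(1)[OF m(2) m'(1)] br(1)[OF m(2) m'(2)]
 show "integrable M (%w. (xi w * (cbm q b w - cbm q a w)) * cnj (eta w * (cbm q' d w - cbm q' c w)))"
  unfolding exp by (intro Bochner_Integration.integrable_add integrable_mult_right i)
 define E where "E = (LINT w|M. xi w * eta' w) * overlap a b c d"
 have "(LINT w|M. (xi w * (cbm q b w - cbm q a w)) * cnj (eta w * (cbm q' d w - cbm q' c w)))
  = (LINT w|M. ?T (re_mode q) (re_mode q') w) + (- \<i> * im_sign q') * (LINT w|M. ?T (re_mode q) (im_mode q') w)
    + (\<i> * im_sign q) * (LINT w|M. ?T (im_mode q) (re_mode q') w) + (im_sign q * im_sign q') * (LINT w|M. ?T (im_mode q) (im_mode q') w)"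
  unfolding exp using i by (simp del: of_real_mult)
 also have "... = (if re_mode q = re_mode q' then E else 0) + (im_sign q * im_sign q') * (if im_mode q = im_mode q' then E else 0)"
 proof -
  have "re_mode q ~= im_mode q'" "im_mode q ~= re_mode q'" using m m' by metis+
  then show ?thesis
   by (simp add: br(2)[OF m(1) m'(1)] br(2)[OF m(1) m'(2)] br(2)[OF m(2) m'(1)] br(2)[OF m(2) m'(2)] E_def del: of_real_mult)
 qed
 also have "... = (if q = q' then 2 * E else 0)"
 proof (cases "re_mode q = re_mode q'")
  case True
  then have "im_mode q = im_mode q'" using m(5) m'(5) by simp
  moreover have "im_sign q * im_sign q' = (if q = q' then 1 else - 1)"
   using sign_sq(1)[of q] sign_sq(3)[of q q'] mode_eq[OF q q' True] by (cases "q = q'") auto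
  ultimately show ?thesis using True by simp
 next
  case False
  then have "im_mode q ~= im_mode q'" using m(5) m'(5) by (metis fst_conv minus_minus prod_eqI snd_conv)
  then show ?thesis using False by auto
 qed
 finally show "(LINT w|M. (xi w * (cbm q b w - cbm q a w)) * cnj (eta w * (cbm q' d w - cbm q' c w)))
   = (if q = q' then 2 * (LINT w|M. xi w * cnj (eta w)) * overlap a b c d else 0)"
  by (simp add: E_def eta'_def mult.assoc)
qed

text \<open>Stopping a simple process at time \<open>t\<close> makes every partition interval lie in \<open>[0,t]\<close>.\<close>

lemma simple_process_stop:
 assumes sp: "simple_process M F T n tau xi" and t: "0 <= t" "t <= T"
 obtains xi' a b C where
  "!!i. i < n ==> 0 <= a i & a i <= b i & b i - a i <= tau (Suc i) - tau i"
  "!!i j. i < j ==> j < n ==> b i <= a j"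
  "!!i. i < n ==> xi' i \<in> borel_measurable (F (a i))"
  "!!i w. i < n ==> w \<in> space M ==> norm (xi' i w) <= C"
  "!!i w. i < n ==> norm (xi' i w) <= norm (xi i w)"
  "!!W w. simple_integral W n tau xi t w = (\<Sum>i<n. xi' i w * (W (b i) w - W (a i) w))"
proof -
 have tau: "0 <= tau i" "tau i <= tau (Suc i)" "xi i \<in> borel_measurable (F (tau i))" if "i < n" for i
  using sp that by (auto simp: simple_process_def)
 obtain C where C: "!!i w. i < n ==> w \<in> space M ==> norm (xi i w) <= C"
  using sp unfolding simple_process_def by blast
 have mono: "tau (Suc i) <= tau j" if "i < j" "j < n" for i j
  using that
 proof (induction j)
  case (Suc j)
  show ?case
  proof (cases "i = j")
   case False
   then have "tau (Suc i) <= tau j" using Suc by simp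
   also have "tau j <= tau (Suc j)" using tau(2)[of j] Suc.prems by simp
   finally show ?thesis .
  qed simp
 qed simp
 define xi' where "xi' i = (if tau i < t then xi i else (%w. 0))" for i
 show thesis
 proof
  fix i assume i: "i < n"
  show "0 <= min t (tau i) & min t (tau i) <= min t (tau (Suc i)) & min t (tau (Suc i)) - min t (tau i) <= tau (Suc i) - tau i"
   using tau[OF i] t by auto
  show "xi' i \<in> borel_measurable (F (min t (tau i)))"
   using tau(3)[OF i] by (auto simp: xi'_def)
  show "norm (xi' i w) <= norm (xi i w)" for w by (simp add: xi'_def)
  show "norm (xi' i w) <= \<bar>C\<bar>" if "w \<in> space M" for w
   using C[OF i that] by (auto simp: xi'_def)
 next
  fix i j assume "i < j" "j < n"
  from mono[OF this] show "min t (tau (Suc i)) <= min t (tau j)" by auto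
 next
  fix W w
  show "simple_integral W n tau xi t w = (\<Sum>i<n. xi' i w * (W (min t (tau (Suc i))) w - W (min t (tau i)) w))"
   unfolding simple_integral_def
  proof (rule sum.cong[OF refl])
   fix i assume "i \<in> {..<n}"
   then have "tau i <= tau (Suc i)" using tau(2) by simp
   then show "xi i w * (W (min t (tau (Suc i))) w - W (min t (tau i)) w) = xi' i w * (W (min t (tau (Suc i))) w - W (min t (tau i)) w)"
    by (auto simp: xi'_def)
  qed
 qed
qed

text \<open>The partition intervals are disjoint, so at each time at most one coefficient is active
  and the square of the sum is the sum of squares.\<close>

lemma simple_value_energy:
 assumes sp: "simple_process M F T n tau xi"
 shows "(\<integral>\<^sup>+s. (\<integral>\<^sup>+w. ennreal ((norm (simple_value n tau xi s w))\<^sup>2) \<partial>M) \<partial>itv T)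
  = (\<Sum>i<n. (\<integral>\<^sup>+w. ennreal ((norm (xi i w))\<^sup>2) \<partial>M) * ennreal (tau (Suc i) - tau i))"
proof -
 have tau: "0 <= tau i" "tau i <= tau (Suc i)" "tau (Suc i) <= T" "xi i \<in> borel_measurable M" if "i < n" for i
  using sp that by (auto simp: simple_process_def intro: measurable_F_M)
 have mono: "tau (Suc i) <= tau j" if "i < j" "j < n" for i j
  using that
 proof (induction j)
  case (Suc j)
  show ?case
  proof (cases "i = j")
   case False
   then have "tau (Suc i) <= tau j" using Suc by simp
   also have "tau j <= tau (Suc j)" using tau(2)[of j] Suc.prems by simp
   finally show ?thesis .
  qed simp
 qed simp
 let ?J = "%i. {tau i<..tau (Suc i)}"
 have disj: "i = j" if "s \<in> ?J i" "s \<in> ?J j" "i < n" "j < n" for s i j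
  using that mono[of i j] mono[of j i] by (cases i j rule: linorder_cases) auto
 have sq: "ennreal ((norm (simple_value n tau xi s w))\<^sup>2) = (\<Sum>i<n. indicator (?J i) s * ennreal ((norm (xi i w))\<^sup>2))" for s w
 proof (cases "\<exists>i<n. s \<in> ?J i")
  case True
  then obtain i where i: "i < n" "s \<in> ?J i" by blast
  have ind: "s \<in> ?J j \<longleftrightarrow> j = i" if "j \<in> {..<n}" for j
   using i disj[OF i(2) _ i(1), of j] that by (metis lessThan_iff)
  have "simple_value n tau xi s w = (\<Sum>j<n. if j = i then xi i w else 0)"
   unfolding simple_value_def indicator_def by (rule sum.cong[OF refl]) (simp only: ind, simp)
  moreover have "(\<Sum>j<n. indicator (?J j) s * ennreal ((norm (xi j w))\<^sup>2)) = (\<Sum>j<n. if j = i then ennreal ((norm (xi i w))\<^sup>2) else 0)"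
   unfolding indicator_def by (rule sum.cong[OF refl]) (simp only: ind, simp)
  ultimately show ?thesis using i by simp
 next
  case False
  then have "indicator (?J j) s = (0 :: complex)" "indicator (?J j) s = (0 :: ennreal)" if "j < n" for j
   using that by auto
  then show ?thesis by (simp add: simple_value_def)
 qed
 have "(\<integral>\<^sup>+s. (\<integral>\<^sup>+w. ennreal ((norm (simple_value n tau xi s w))\<^sup>2) \<partial>M) \<partial>itv T)
   = (\<integral>\<^sup>+s. (\<Sum>i<n. (\<integral>\<^sup>+w. ennreal ((norm (xi i w))\<^sup>2) \<partial>M) * indicator (?J i) s) \<partial>itv T)"
 proof (rule nn_integral_cong)
  fix s
  have "(\<integral>\<^sup>+w. ennreal ((norm (simple_value n tau xi s w))\<^sup>2) \<partial>M)
    = (\<Sum>i<n. (\<integral>\<^sup>+w. indicator (?J i) s * ennreal ((norm (xi i w))\<^sup>2) \<partial>M))"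
   unfolding sq
   by (rule nn_integral_sum) (use tau(4) in \<open>auto intro!: borel_measurable_times_ennreal\<close>)
  also have "... = (\<Sum>i<n. (\<integral>\<^sup>+w. ennreal ((norm (xi i w))\<^sup>2) \<partial>M) * indicator (?J i) s)"
  proof (rule sum.cong[OF refl])
   fix i assume "i \<in> {..<n}"
   then have [measurable]: "xi i \<in> borel_measurable M" using tau(4) by simp
   show "(\<integral>\<^sup>+w. indicator (?J i) s * ennreal ((norm (xi i w))\<^sup>2) \<partial>M) = (\<integral>\<^sup>+w. ennreal ((norm (xi i w))\<^sup>2) \<partial>M) * indicator (?J i) s"
    by (subst nn_integral_cmult) (auto simp: mult.commute)
  qed
  finally show "(\<integral>\<^sup>+w. ennreal ((norm (simple_value n tau xi s w))\<^sup>2) \<partial>M)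
    = (\<Sum>i<n. (\<integral>\<^sup>+w. ennreal ((norm (xi i w))\<^sup>2) \<partial>M) * indicator (?J i) s)" .
 qed
 also have "... = (\<Sum>i<n. (\<integral>\<^sup>+s. (\<integral>\<^sup>+w. ennreal ((norm (xi i w))\<^sup>2) \<partial>M) * indicator (?J i) s \<partial>itv T))"
  by (rule nn_integral_sum) (intro borel_measurable_times_ennreal measurable_const measurable_itv_borel measurable_restrict_space1 borel_measurable_indicator, auto)
 also have "... = (\<Sum>i<n. (\<integral>\<^sup>+w. ennreal ((norm (xi i w))\<^sup>2) \<partial>M) * ennreal (tau (Suc i) - tau i))"
 proof (rule sum.cong[OF refl])
  fix i assume "i \<in> {..<n}"
  then have i: "i < n" by simp
  have sub: "?J i \<subseteq> {0..T}" using tau[OF i] by auto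
  then have J: "?J i \<in> sets (itv T)" by (subst sets_restrict_space) (auto intro!: image_eqI[of _ _ "?J i"])
  have "emeasure (itv T) (?J i) = emeasure lborel (?J i)"
   using sub by (subst emeasure_restrict_space) auto
  also have "... = ennreal (tau (Suc i) - tau i)" using tau[OF i] by simp
  finally show "(\<integral>\<^sup>+s. (\<integral>\<^sup>+w. ennreal ((norm (xi i w))\<^sup>2) \<partial>M) * indicator (?J i) s \<partial>itv T)
    = (\<integral>\<^sup>+w. ennreal ((norm (xi i w))\<^sup>2) \<partial>M) * ennreal (tau (Suc i) - tau i)"
   using J by (simp add: nn_integral_cmult_indicator)
 qed
 finally show ?thesis .
qed

lemma simple_integral_measurable:
 assumes sp: "simple_process M F T n tau xi" and q: "q \<in> modes" and t: "0 <= t"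
 shows "simple_integral (cbm q) n tau xi t \<in> borel_measurable M"
proof -
 have "xi i \<in> borel_measurable M" "cbm q (min t (tau i)) \<in> borel_measurable M" "cbm q (min t (tau (Suc i))) \<in> borel_measurable M"
  if "i < n" for i
 proof -
  have tau: "0 <= tau i" "tau i <= tau (Suc i)" "xi i \<in> borel_measurable (F (tau i))" using sp that by (auto simp: simple_process_def)
  then show "xi i \<in> borel_measurable M" by (auto intro: measurable_F_M)
  show "cbm q (min t (tau i)) \<in> borel_measurable M" "cbm q (min t (tau (Suc i))) \<in> borel_measurable M"
   using tau t by (auto intro!: cbm_measurable q)
 qed
 then show ?thesis
  unfolding simple_integral_def[abs_def] by (intro borel_measurable_sum borel_measurable_times borel_measurable_diff) auto
qed

text \<open>Expanding the square, \<open>complex_bracket\<close> removes all pairs of different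
  modes or different intervals. An inequality remains because stopping at \<open>t\<close> shortens
  the intervals.\<close>

lemma simple_isometry:
 fixes A :: "((int ^ 'd) \<times> nat) set" and c :: "(int ^ 'd) \<times> nat => real"
 assumes A: "finite A" "A \<subseteq> modes" and t: "0 <= t" "t <= T"
  and sp: "!!q. q \<in> A ==> simple_process M F T (n q) (tau q) (xi q)"
 shows "(\<integral>\<^sup>+w. ennreal ((norm (\<Sum>q\<in>A. complex_of_real (c q) * simple_integral (cbm q) (n q) (tau q) (xi q) t w))\<^sup>2) \<partial>M)
  <= (\<Sum>q\<in>A. ennreal (2 * (c q)\<^sup>2) * (\<integral>\<^sup>+s. (\<integral>\<^sup>+w. ennreal ((norm (simple_value (n q) (tau q) (xi q) s w))\<^sup>2) \<partial>M) \<partial>itv T))"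
proof -
 \<comment> \<open>Collects the data of the stopped representation so that they can be chosen
   simultaneously for all modes in \<open>A\<close>.\<close>
 define P where "P q a b xi' C \<longleftrightarrow>
  (\<forall>i. i < n q --> 0 <= a i & a i <= b i & b i - a i <= tau q (Suc i) - tau q i) &
  (\<forall>i j. i < j --> j < n q --> b i <= a j) &
  (\<forall>i. i < n q --> xi' i \<in> borel_measurable (F (a i))) &
  (\<forall>i w. i < n q --> w \<in> space M --> norm (xi' i w) <= C) &
  (\<forall>i w. i < n q --> norm (xi' i w) <= norm (xi q i w)) &
  (\<forall>W w. simple_integral W (n q) (tau q) (xi q) t w = (\<Sum>i<n q. xi' i w * (W (b i) w - W (a i) w)))"
  for q and a b :: "nat => real" and xi' :: "nat => 'w => complex" and C :: real
 have "\<exists>a b xi' C. P q a b xi' C" if "q \<in> A" for q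
  by (rule simple_process_stop[OF sp[OF that] t]) (unfold P_def, blast)
 then obtain a b xi' C where "!!q. q \<in> A ==> P q (a q) (b q) (xi' q) (C q)" by metis
 then have P: "P q (a q) (b q) (xi' q) (C q)" if "q \<in> A" for q using that by this
 note P' = P[unfolded P_def]
 have ab: "0 <= a q i" "a q i <= b q i" "b q i - a q i <= tau q (Suc i) - tau q i"
   and xi': "xi' q i \<in> borel_measurable (F (a q i))" "!!w. w \<in> space M ==> norm (xi' q i w) <= C q" "!!w. norm (xi' q i w) <= norm (xi q i w)"
  if "q \<in> A" "i < n q" for q i
  using P'[OF that(1)] that(2) by blast+
 have ord: "b q i <= a q j" if "q \<in> A" "i < j" "j < n q" for q i j
  using P'[OF that(1)] that(2,3) by blast
 have si: "simple_integral W (n q) (tau q) (xi q) t w = (\<Sum>i<n q. xi' q i w * (W (b q i) w - W (a q i) w))" if "q \<in> A" for q W w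
  using P'[OF that] by (elim conjE allE) assumption
 let ?e = "%q i w. xi' q i w * (cbm q (b q i) w - cbm q (a q i) w)"
 define I where "I q w = (\<Sum>i<n q. ?e q i w)" for q w
 define S where "S w = (\<Sum>q\<in>A. complex_of_real (c q) * I q w)" for w
 define E where "E q i = (LINT w|M. (norm (xi' q i w))\<^sup>2)" for q i
 have e_int: "integrable M (%w. ?e q i w * cnj (?e q' i' w))"
  and e_val: "(LINT w|M. ?e q i w * cnj (?e q' i' w)) = (if q = q' & i = i' then complex_of_real (2 * E q i * (b q i - a q i)) else 0)"
  if qi: "q \<in> A" "i < n q" "q' \<in> A" "i' < n q'" for q i q' i'
 proof -
  have md: "q \<in> modes" "q' \<in> modes" using A qi by auto
  note cb = complex_bracket[OF md ab(1,2)[OF qi(1,2)] ab(1,2)[OF qi(3,4)] xi'(1,2)[OF qi(1,2)] xi'(1,2)[OF qi(3,4)]]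
  show "integrable M (%w. ?e q i w * cnj (?e q' i' w))" by (rule cb(1))
  show "(LINT w|M. ?e q i w * cnj (?e q' i' w)) = (if q = q' & i = i' then complex_of_real (2 * E q i * (b q i - a q i)) else 0)"
  proof (cases "q = q'")
   case False
   have r: "\<not> (q = q' & i = i')" using False by (rule contrapos_nn) (erule conjunct1)
   show ?thesis by (rule trans[OF cb(2)], assumption, assumption) (unfold if_not_P[OF False] if_not_P[OF r], rule refl)
  next
   case q: True
   show ?thesis
   proof (cases "i = i'")
    case True
    have "(LINT w|M. xi' q i w * cnj (xi' q i w)) = complex_of_real (E q i)"
     unfolding E_def complex_norm_square[symmetric] by (rule integral_complex_of_real)
    moreover have "overlap (a q i) (b q i) (a q i) (b q i) = b q i - a q i"
     using ab[OF qi(1,2)] by (simp add: overlap_def)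
    ultimately show ?thesis using q True by (subst cb(2)) simp_all
   next
    case False
    then have "overlap (a q i) (b q i) (a q i') (b q i') = 0"
     using ord[of q i i'] ord[of q i' i] qi q by (cases i i' rule: linorder_cases) (auto simp: overlap_def)
    then show ?thesis using q False by (subst cb(2)) simp_all
   qed
  qed
 qed
 have S_exp: "S w * cnj (S w) = (\<Sum>q\<in>A. \<Sum>q'\<in>A. \<Sum>i<n q. \<Sum>i'<n q'. complex_of_real (c q * c q') * (?e q i w * cnj (?e q' i' w)))" for w
 proof -
  have "S w * cnj (S w) = (\<Sum>q\<in>A. \<Sum>q'\<in>A. complex_of_real (c q * c q') * (I q w * cnj (I q' w)))"
   unfolding S_def cnj_sum sum_product by (intro sum.cong refl) (simp add: mult_ac)
  also have "... = (\<Sum>q\<in>A. \<Sum>q'\<in>A. \<Sum>i<n q. \<Sum>i'<n q'. complex_of_real (c q * c q') * (?e q i w * cnj (?e q' i' w)))"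
   unfolding I_def cnj_sum sum_product unfolding sum_distrib_left by (rule refl)
  finally show ?thesis .
 qed
 have S_int: "integrable M (%w. S w * cnj (S w))"
  unfolding S_exp by (intro Bochner_Integration.integrable_sum integrable_mult_right e_int) auto
 have "(LINT w|M. S w * cnj (S w))
   = (\<Sum>q\<in>A. \<Sum>q'\<in>A. \<Sum>i<n q. \<Sum>i'<n q'. complex_of_real (c q * c q') * (LINT w|M. ?e q i w * cnj (?e q' i' w)))"
 proof -
  let ?g = "%q q' i i' w. complex_of_real (c q * c q') * (?e q i w * cnj (?e q' i' w))"
  have g: "integrable M (?g q q' i i')" if "q \<in> A" "q' \<in> A" "i < n q" "i' < n q'" for q q' i i'
   using that by (intro integrable_mult_right e_int)
  have 1: "(LINT w|M. S w * cnj (S w)) = (\<Sum>q\<in>A. (LINT w|M. (\<Sum>q'\<in>A. \<Sum>i<n q. \<Sum>i'<n q'. ?g q q' i i' w)))"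
   unfolding S_exp by (intro Bochner_Integration.integral_sum Bochner_Integration.integrable_sum g) auto
  have 2: "(LINT w|M. (\<Sum>q'\<in>A. \<Sum>i<n q. \<Sum>i'<n q'. ?g q q' i i' w)) = (\<Sum>q'\<in>A. (LINT w|M. (\<Sum>i<n q. \<Sum>i'<n q'. ?g q q' i i' w)))" if "q \<in> A" for q
   using that by (intro Bochner_Integration.integral_sum Bochner_Integration.integrable_sum g) auto
  have 3: "(LINT w|M. (\<Sum>i<n q. \<Sum>i'<n q'. ?g q q' i i' w)) = (\<Sum>i<n q. (LINT w|M. (\<Sum>i'<n q'. ?g q q' i i' w)))" if "q \<in> A" "q' \<in> A" for q q'
   using that by (intro Bochner_Integration.integral_sum Bochner_Integration.integrable_sum g) auto
  have 4: "(LINT w|M. (\<Sum>i'<n q'. ?g q q' i i' w)) = (\<Sum>i'<n q'. complex_of_real (c q * c q') * (LINT w|M. ?e q i w * cnj (?e q' i' w)))"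
   if "q \<in> A" "q' \<in> A" "i < n q" for q q' i
  proof -
   have "(LINT w|M. (\<Sum>i'<n q'. ?g q q' i i' w)) = (\<Sum>i'<n q'. (LINT w|M. ?g q q' i i' w))"
    using that by (intro Bochner_Integration.integral_sum g) auto
   then show ?thesis by (simp only: integral_mult_right_zero)
  qed
  show ?thesis
   unfolding 1 by (rule sum.cong[OF refl], subst 2, assumption, rule sum.cong[OF refl], subst 3, assumption, assumption,
    rule sum.cong[OF refl], rule 4, assumption, assumption, rule lessThan_iff[THEN iffD1], assumption)
 qed
 also have "... = (\<Sum>q\<in>A. \<Sum>q'\<in>A. if q' = q then (\<Sum>i<n q. complex_of_real ((c q)\<^sup>2 * (2 * E q i * (b q i - a q i)))) else 0)"
 proof (intro sum.cong refl)
  fix q q' assume q: "q \<in> A" "q' \<in> A"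
  show "(\<Sum>i<n q. \<Sum>i'<n q'. complex_of_real (c q * c q') * (LINT w|M. ?e q i w * cnj (?e q' i' w)))
    = (if q' = q then (\<Sum>i<n q. complex_of_real ((c q)\<^sup>2 * (2 * E q i * (b q i - a q i)))) else 0)"
  proof (cases "q' = q")
   case False
   then show ?thesis using q by (simp add: e_val del: complex_cnj_mult)
  next
   case True
   have "(\<Sum>i'<n q. complex_of_real (c q * c q) * (LINT w|M. ?e q i w * cnj (?e q i' w)))
     = complex_of_real ((c q)\<^sup>2 * (2 * E q i * (b q i - a q i)))" if i: "i < n q" for i
   proof -
    have "(\<Sum>i'<n q. complex_of_real (c q * c q) * (LINT w|M. ?e q i w * cnj (?e q i' w)))
      = (\<Sum>i'<n q. if i' = i then complex_of_real ((c q)\<^sup>2 * (2 * E q i * (b q i - a q i))) else 0)"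
     using q(1) i by (intro sum.cong refl) (simp add: e_val power2_eq_square del: complex_cnj_mult)
    then show ?thesis using i by simp
   qed
   then show ?thesis using True by (simp del: complex_cnj_mult)
  qed
 qed
 also have "... = complex_of_real (\<Sum>q\<in>A. (\<Sum>i<n q. (c q)\<^sup>2 * (2 * E q i * (b q i - a q i))))"
  using A(1) by simp
 finally have S_val: "(LINT w|M. S w * cnj (S w)) = complex_of_real (\<Sum>q\<in>A. (\<Sum>i<n q. (c q)\<^sup>2 * (2 * E q i * (b q i - a q i))))" .
 have S2: "integrable M (%w. (norm (S w))\<^sup>2)"
  using S_int unfolding complex_norm_square[symmetric] by (simp only: complex_of_real_integrable_eq)
 have "complex_of_real (LINT w|M. (norm (S w))\<^sup>2) = (LINT w|M. S w * cnj (S w))"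
  unfolding complex_norm_square[symmetric] by (rule integral_complex_of_real[symmetric])
 then have S2_val: "(LINT w|M. (norm (S w))\<^sup>2) = (\<Sum>q\<in>A. (\<Sum>i<n q. (c q)\<^sup>2 * (2 * E q i * (b q i - a q i))))"
  unfolding S_val of_real_eq_iff .
 have E0: "0 <= E q i" for q i by (simp add: E_def)
 have E_le: "ennreal (E q i) <= (\<integral>\<^sup>+w. ennreal ((norm (xi q i w))\<^sup>2) \<partial>M)" if "q \<in> A" "i < n q" for q i
 proof -
  have m: "xi' q i \<in> borel_measurable M" by (rule measurable_F_M[OF xi'(1)[OF that] ab(1)[OF that]])
  have "integrable M (%w. (norm (xi' q i w))\<^sup>2)"
  proof (rule integrable_const_bound[of _ "(C q)\<^sup>2"])
   show "AE w in M. norm ((norm (xi' q i w))\<^sup>2) <= (C q)\<^sup>2"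
    using xi'(2)[OF that] by (intro AE_I2) (auto intro!: power_mono)
  qed (use m in measurable)
  then have "ennreal (E q i) = (\<integral>\<^sup>+w. ennreal ((norm (xi' q i w))\<^sup>2) \<partial>M)"
   unfolding E_def by (intro nn_integral_eq_integral[symmetric]) auto
  also have "... <= (\<integral>\<^sup>+w. ennreal ((norm (xi q i w))\<^sup>2) \<partial>M)"
   using xi'(3)[OF that] by (intro nn_integral_mono ennreal_leI power_mono) auto
  finally show ?thesis .
 qed
 have "(\<integral>\<^sup>+w. ennreal ((norm (\<Sum>q\<in>A. complex_of_real (c q) * simple_integral (cbm q) (n q) (tau q) (xi q) t w))\<^sup>2) \<partial>M)
   = (\<integral>\<^sup>+w. ennreal ((norm (S w))\<^sup>2) \<partial>M)"
  by (intro nn_integral_cong arg_cong[where f = ennreal] arg_cong[where f = "%z. (norm z)\<^sup>2"]) (auto simp: S_def I_def si intro!: sum.cong)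
 also have "... = ennreal (\<Sum>q\<in>A. (\<Sum>i<n q. (c q)\<^sup>2 * (2 * E q i * (b q i - a q i))))"
  unfolding S2_val[symmetric] by (rule nn_integral_eq_integral[OF S2]) auto
 also have "... = (\<Sum>q\<in>A. ennreal (\<Sum>i<n q. (c q)\<^sup>2 * (2 * E q i * (b q i - a q i))))"
  using E0 ab by (intro sum_ennreal[symmetric] sum_nonneg mult_nonneg_nonneg) auto
 also have "... <= (\<Sum>q\<in>A. ennreal (2 * (c q)\<^sup>2) * (\<integral>\<^sup>+s. (\<integral>\<^sup>+w. ennreal ((norm (simple_value (n q) (tau q) (xi q) s w))\<^sup>2) \<partial>M) \<partial>itv T))"
 proof (rule sum_mono)
  fix q assume q: "q \<in> A"
  have "ennreal (\<Sum>i<n q. (c q)\<^sup>2 * (2 * E q i * (b q i - a q i))) = (\<Sum>i<n q. ennreal ((c q)\<^sup>2 * (2 * E q i * (b q i - a q i))))"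
   using E0 ab q by (intro sum_ennreal[symmetric] mult_nonneg_nonneg) auto
  also have "... <= (\<Sum>i<n q. ennreal (2 * (c q)\<^sup>2) * ((\<integral>\<^sup>+w. ennreal ((norm (xi q i w))\<^sup>2) \<partial>M) * ennreal (tau q (Suc i) - tau q i)))"
  proof (rule sum_mono)
   fix i assume "i \<in> {..<n q}"
   then have i: "i < n q" by simp
   have "ennreal ((c q)\<^sup>2 * (2 * E q i * (b q i - a q i))) = ennreal (2 * (c q)\<^sup>2) * (ennreal (E q i) * ennreal (b q i - a q i))"
    using E0[of q i] ab[OF q i] by (simp add: ennreal_mult[symmetric] mult_ac)
   also have "... <= ennreal (2 * (c q)\<^sup>2) * ((\<integral>\<^sup>+w. ennreal ((norm (xi q i w))\<^sup>2) \<partial>M) * ennreal (tau q (Suc i) - tau q i))"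
    by (intro mult_left_mono mult_mono E_le q i ennreal_leI ab(3)) auto
   finally show "ennreal ((c q)\<^sup>2 * (2 * E q i * (b q i - a q i)))
     <= ennreal (2 * (c q)\<^sup>2) * ((\<integral>\<^sup>+w. ennreal ((norm (xi q i w))\<^sup>2) \<partial>M) * ennreal (tau q (Suc i) - tau q i))" .
  qed
  also have "... = ennreal (2 * (c q)\<^sup>2) * (\<integral>\<^sup>+s. (\<integral>\<^sup>+w. ennreal ((norm (simple_value (n q) (tau q) (xi q) s w))\<^sup>2) \<partial>M) \<partial>itv T)"
   unfolding simple_value_energy[OF sp[OF q]] sum_distrib_left ..
  finally show "ennreal (\<Sum>i<n q. (c q)\<^sup>2 * (2 * E q i * (b q i - a q i)))
    <= ennreal (2 * (c q)\<^sup>2) * (\<integral>\<^sup>+s. (\<integral>\<^sup>+w. ennreal ((norm (simple_value (n q) (tau q) (xi q) s w))\<^sup>2) \<partial>M) \<partial>itv T)" .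
 qed
 finally show ?thesis .
qed

end

section \<open>Ito integrals and series over the modes\<close>

context noise begin

lemma progressive_joint:
 assumes X: "progressive F T N X" and T: "0 <= T"
 shows "(%(s, w). X s w) \<in> restrict_space borel {0..T} \<Otimes>\<^sub>M M \<rightarrow>\<^sub>M N"
proof -
 have "(%(s, w). X s w) \<in> restrict_space borel {0..T} \<Otimes>\<^sub>M F T \<rightarrow>\<^sub>M N"
  using X T unfolding progressive_def by simp
 moreover have "(%p. (fst p, snd p)) \<in> restrict_space borel {0..T} \<Otimes>\<^sub>M M \<rightarrow>\<^sub>M restrict_space borel {0..T} \<Otimes>\<^sub>M F T"
  by (rule measurable_Pair[OF measurable_fst measurable_compose[OF measurable_snd measurable_F_M[OF measurable_ident T, unfolded id_def]]])
 ultimately show ?thesis using measurable_compose by fastforce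
qed

lemma time_energy_measurable:
 fixes X :: "real => 'w => 'z::real_normed_vector"
 assumes "(%(s, w). X s w) \<in> borel_measurable (restrict_space borel {0..T} \<Otimes>\<^sub>M M)"
 shows "(%s. \<integral>\<^sup>+w. ennreal ((norm (X s w))\<^sup>2) \<partial>M) \<in> borel_measurable (itv T)"
proof (rule measurable_itv_borel, rule borel_measurable_nn_integral)
 have "(%p. ennreal ((norm (case p of (s, w) => X s w))\<^sup>2)) \<in> borel_measurable (restrict_space borel {0..T} \<Otimes>\<^sub>M M)"
  by (rule measurable_compose[OF borel_measurable_power[OF measurable_compose[OF assms borel_measurable_norm]] measurable_ennreal])
 then show "(%(s, w). ennreal ((norm (X s w))\<^sup>2)) \<in> borel_measurable (restrict_space borel {0..T} \<Otimes>\<^sub>M M)"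
  by (simp add: case_prod_beta')
qed

lemma simple_value_joint:
 assumes sp: "simple_process M F T n tau xi"
 shows "(%(s, w). simple_value n tau xi s w) \<in> borel_measurable (restrict_space borel {0..T} \<Otimes>\<^sub>M M)"
proof -
 have xi: "xi i \<in> borel_measurable M" if "i < n" for i
  using sp that by (auto simp: simple_process_def intro: measurable_F_M)
 have ind: "(%s. indicator {tau i<..tau (Suc i)} s :: complex) \<in> borel_measurable (restrict_space borel {0..T})" for i
  by (rule measurable_restrict_space1) simp
 show ?thesis
  unfolding simple_value_def case_prod_beta'
  by (intro borel_measurable_sum borel_measurable_times measurable_compose[OF measurable_fst ind] measurable_compose[OF measurable_snd xi]) simp
qed

lemma norm_sum_le_twice: "ennreal ((norm (x :: complex))\<^sup>2) <= 2 * ennreal ((norm (x - y))\<^sup>2) + 2 * ennreal ((norm y)\<^sup>2)"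
proof -
 have "(norm x)\<^sup>2 <= (norm (x - y) + norm y)\<^sup>2"
  using norm_triangle_ineq[of "x - y" y] by (intro power_mono) auto
 also have "... <= 2 * (norm (x - y))\<^sup>2 + 2 * (norm y)\<^sup>2"
  using sum_squares_bound[of "norm (x - y)" "norm y"] by (simp add: power2_sum)
 finally have "ennreal ((norm x)\<^sup>2) <= ennreal (2 * (norm (x - y))\<^sup>2 + 2 * (norm y)\<^sup>2)" by (rule ennreal_leI)
 then show ?thesis by (simp add: ennreal_plus ennreal_mult)
qed

lemma nn_integral_norm_twice:
 fixes f g :: "'v => complex"
 assumes [measurable]: "f \<in> borel_measurable N" "g \<in> borel_measurable N"
 shows "(\<integral>\<^sup>+x. ennreal ((norm (f x))\<^sup>2) \<partial>N)
  <= 2 * (\<integral>\<^sup>+x. ennreal ((norm (f x - g x))\<^sup>2) \<partial>N) + 2 * (\<integral>\<^sup>+x. ennreal ((norm (g x))\<^sup>2) \<partial>N)"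
proof -
 have "(\<integral>\<^sup>+x. ennreal ((norm (f x))\<^sup>2) \<partial>N) <= (\<integral>\<^sup>+x. 2 * ennreal ((norm (f x - g x))\<^sup>2) + 2 * ennreal ((norm (g x))\<^sup>2) \<partial>N)"
  by (intro nn_integral_mono norm_sum_le_twice)
 also have "... = 2 * (\<integral>\<^sup>+x. ennreal ((norm (f x - g x))\<^sup>2) \<partial>N) + 2 * (\<integral>\<^sup>+x. ennreal ((norm (g x))\<^sup>2) \<partial>N)"
  by (simp add: nn_integral_add nn_integral_cmult)
 finally show ?thesis .
qed

lemma is_ito_integralD:
 assumes "is_ito_integral M F T W H I"
 shows "progressive F T borel H"
  and "t \<in> {0..T} ==> I t \<in> borel_measurable M"
  and "\<exists>n tau xi. (\<forall>m. simple_process M F T (n m) (tau m) (xi m)) &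
    (%m. \<integral>\<^sup>+s. (\<integral>\<^sup>+w. ennreal ((norm (H s w - simple_value (n m) (tau m) (xi m) s w))\<^sup>2) \<partial>M) \<partial>itv T) \<longlonglongrightarrow> 0 &
    (\<forall>t\<in>{0..T}. (%m. \<integral>\<^sup>+w. ennreal ((norm (I t w - simple_integral W (n m) (tau m) (xi m) t w))\<^sup>2) \<partial>M) \<longlonglongrightarrow> 0)"
proof -
 show "progressive F T borel H" using assms unfolding is_ito_integral_def by (rule conjunct1)
 have "\<forall>t\<in>{0..T}. I t \<in> borel_measurable (F t)" using assms unfolding is_ito_integral_def by (elim conjE)
 then show "t \<in> {0..T} ==> I t \<in> borel_measurable M" using measurable_F_M[of "I t" t] by simp
 show "\<exists>n tau xi. (\<forall>m. simple_process M F T (n m) (tau m) (xi m)) &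
    (%m. \<integral>\<^sup>+s. (\<integral>\<^sup>+w. ennreal ((norm (H s w - simple_value (n m) (tau m) (xi m) s w))\<^sup>2) \<partial>M) \<partial>itv T) \<longlonglongrightarrow> 0 &
    (\<forall>t\<in>{0..T}. (%m. \<integral>\<^sup>+w. ennreal ((norm (I t w - simple_integral W (n m) (tau m) (xi m) t w))\<^sup>2) \<partial>M) \<longlonglongrightarrow> 0)"
  using assms unfolding is_ito_integral_def set_nn_integral_itv by (elim conjE)
qed

text \<open>The isometry is transported to the mean square limits by two uses of the quadratic
  triangle inequality, for the integrals and for the integrands. Each contributes a factor 2 to the
  2 of \<open>simple_isometry\<close>, whence 8.\<close>

lemma ito_sum_bound:
 fixes A :: "((int ^ 'd) \<times> nat) set" and c :: "(int ^ 'd) \<times> nat => real"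
 assumes A: "finite A" "A \<subseteq> modes" and t: "t \<in> {0..T}"
  and I: "!!q. q \<in> A ==> is_ito_integral M F T (cbm q) (H q) (I q)"
 shows "(\<integral>\<^sup>+w. ennreal ((norm (\<Sum>q\<in>A. complex_of_real (c q) * I q t w))\<^sup>2) \<partial>M)
  <= (\<Sum>q\<in>A. ennreal (8 * (c q)\<^sup>2) * (\<integral>\<^sup>+s. (\<integral>\<^sup>+w. ennreal ((norm (H q s w))\<^sup>2) \<partial>M) \<partial>itv T))"
proof -
 have t0: "0 <= t" "t <= T" "0 <= T" using t by auto
 have "\<forall>q\<in>A. \<exists>n tau xi. (\<forall>m. simple_process M F T (n m) (tau m) (xi m)) &
    (%m. \<integral>\<^sup>+s. (\<integral>\<^sup>+w. ennreal ((norm (H q s w - simple_value (n m) (tau m) (xi m) s w))\<^sup>2) \<partial>M) \<partial>itv T) \<longlonglongrightarrow> 0 &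
    (\<forall>t\<in>{0..T}. (%m. \<integral>\<^sup>+w. ennreal ((norm (I q t w - simple_integral (cbm q) (n m) (tau m) (xi m) t w))\<^sup>2) \<partial>M) \<longlonglongrightarrow> 0)"
  by (rule ballI) (rule is_ito_integralD(3)[OF I])
 then obtain n tau xi where app: "\<forall>q\<in>A. (\<forall>m. simple_process M F T (n q m) (tau q m) (xi q m)) &
    (%m. \<integral>\<^sup>+s. (\<integral>\<^sup>+w. ennreal ((norm (H q s w - simple_value (n q m) (tau q m) (xi q m) s w))\<^sup>2) \<partial>M) \<partial>itv T) \<longlonglongrightarrow> 0 &
    (\<forall>t\<in>{0..T}. (%m. \<integral>\<^sup>+w. ennreal ((norm (I q t w - simple_integral (cbm q) (n q m) (tau q m) (xi q m) t w))\<^sup>2) \<partial>M) \<longlonglongrightarrow> 0)"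
  unfolding bchoice_iff by (elim exE)
 define V where "V q m s w = simple_value (n q m) (tau q m) (xi q m) s w" for q m s w
 define J where "J q m w = simple_integral (cbm q) (n q m) (tau q m) (xi q m) t w" for q m w
 define dl where "dl q m = (\<integral>\<^sup>+s. (\<integral>\<^sup>+w. ennreal ((norm (V q m s w - H q s w))\<^sup>2) \<partial>M) \<partial>itv T)" for q m
 define eps where "eps q m = (\<integral>\<^sup>+w. ennreal ((norm (I q t w - J q m w))\<^sup>2) \<partial>M)" for q m
 define h where "h q = (\<integral>\<^sup>+s. (\<integral>\<^sup>+w. ennreal ((norm (H q s w))\<^sup>2) \<partial>M) \<partial>itv T)" for q
 have sp: "simple_process M F T (n q m) (tau q m) (xi q m)" if "q \<in> A" for q m
  using bspec[OF app that] by (elim conjE) (rule spec)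
 have dl0: "dl q \<longlonglongrightarrow> 0" if "q \<in> A" for q
  unfolding dl_def[abs_def] V_def norm_minus_commute[of _ "H _ _ _"] using bspec[OF app that] by (elim conjE)
 have eps0: "eps q \<longlonglongrightarrow> 0" if "q \<in> A" for q
 proof -
  have "\<forall>t\<in>{0..T}. (%m. \<integral>\<^sup>+w. ennreal ((norm (I q t w - simple_integral (cbm q) (n q m) (tau q m) (xi q m) t w))\<^sup>2) \<partial>M) \<longlonglongrightarrow> 0"
   using bspec[OF app that] by (elim conjE)
  then show ?thesis unfolding eps_def[abs_def] J_def by (rule bspec[OF _ t])
 qed
 have Im: "I q t \<in> borel_measurable M" and Jm: "J q m \<in> borel_measurable M" if "q \<in> A" for q m
 proof -
  show "I q t \<in> borel_measurable M" by (rule is_ito_integralD(2)[OF I[OF that] t])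
  show "J q m \<in> borel_measurable M" unfolding J_def[abs_def]
   using that A(2) by (intro simple_integral_measurable[OF sp[OF that] _ t0(1)]) auto
 qed
 have Vm: "(%(s, w). V q m s w) \<in> borel_measurable (restrict_space borel {0..T} \<Otimes>\<^sub>M M)"
  and Hm: "(%(s, w). H q s w) \<in> borel_measurable (restrict_space borel {0..T} \<Otimes>\<^sub>M M)" if "q \<in> A" for q m
  unfolding V_def by (rule simple_value_joint[OF sp[OF that]], rule progressive_joint[OF is_ito_integralD(1)[OF I[OF that]] t0(3)])
 have V_le: "(\<integral>\<^sup>+s. (\<integral>\<^sup>+w. ennreal ((norm (V q m s w))\<^sup>2) \<partial>M) \<partial>itv T) <= 2 * dl q m + 2 * h q" if q: "q \<in> A" for q m
 proof -
  have sec: "(%w. X s w) \<in> borel_measurable M"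
   if "(%(s, w). X s w) \<in> borel_measurable (restrict_space borel {0..T} \<Otimes>\<^sub>M M)" "s \<in> {0..T}" for X :: "real => 'w => complex" and s
   using measurable_Pair2[OF that(1), of s] that(2) by (simp add: space_restrict_space)
  have "(\<integral>\<^sup>+s. (\<integral>\<^sup>+w. ennreal ((norm (V q m s w))\<^sup>2) \<partial>M) \<partial>itv T)
   <= (\<integral>\<^sup>+s. 2 * (\<integral>\<^sup>+w. ennreal ((norm (V q m s w - H q s w))\<^sup>2) \<partial>M) + 2 * (\<integral>\<^sup>+w. ennreal ((norm (H q s w))\<^sup>2) \<partial>M) \<partial>itv T)"
   by (rule nn_integral_mono, rule nn_integral_norm_twice) (rule sec[OF Vm[OF q]] sec[OF Hm[OF q]], simp)+
  also have "... = 2 * dl q m + 2 * h q"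
  proof -
   have d: "(%(s, w). V q m s w - H q s w) \<in> borel_measurable (restrict_space borel {0..T} \<Otimes>\<^sub>M M)"
    using borel_measurable_diff[OF Vm[OF q] Hm[OF q]] by (simp add: case_prod_beta')
   note [measurable] = time_energy_measurable[OF d] time_energy_measurable[OF Hm[OF q]]
   show ?thesis unfolding dl_def h_def by (subst nn_integral_add) (simp_all add: nn_integral_cmult)
  qed
  finally show ?thesis .
 qed
 define S where "S w = (\<Sum>q\<in>A. complex_of_real (c q) * I q t w)" for w
 define Sm where "Sm m w = (\<Sum>q\<in>A. complex_of_real (c q) * J q m w)" for m w
 have bound: "(\<integral>\<^sup>+w. ennreal ((norm (S w))\<^sup>2) \<partial>M)
   <= 2 * (ennreal (card A) * (\<Sum>q\<in>A. ennreal ((c q)\<^sup>2) * eps q m)) + 2 * (\<Sum>q\<in>A. ennreal (2 * (c q)\<^sup>2) * (2 * dl q m + 2 * h q))" for m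
 proof -
  have [measurable]: "S \<in> borel_measurable M" "Sm m \<in> borel_measurable M"
   unfolding S_def[abs_def] Sm_def[abs_def] by (intro borel_measurable_sum borel_measurable_times borel_measurable_const Im Jm; assumption)+
  have "(\<integral>\<^sup>+w. ennreal ((norm (S w))\<^sup>2) \<partial>M)
   <= 2 * (\<integral>\<^sup>+w. ennreal ((norm (S w - Sm m w))\<^sup>2) \<partial>M) + 2 * (\<integral>\<^sup>+w. ennreal ((norm (Sm m w))\<^sup>2) \<partial>M)"
   by (rule nn_integral_norm_twice) simp_all
  also have "(\<integral>\<^sup>+w. ennreal ((norm (S w - Sm m w))\<^sup>2) \<partial>M) <= ennreal (card A) * (\<Sum>q\<in>A. ennreal ((c q)\<^sup>2) * eps q m)"
  proof -
   have "ennreal ((norm (S w - Sm m w))\<^sup>2) <= ennreal (card A) * (\<Sum>q\<in>A. ennreal ((c q)\<^sup>2) * ennreal ((norm (I q t w - J q m w))\<^sup>2))" for w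
   proof -
    have e: "S w - Sm m w = (\<Sum>q\<in>A. complex_of_real (c q) * (I q t w - J q m w))"
     by (simp add: S_def Sm_def sum_subtractf right_diff_distrib)
    have "norm (S w - Sm m w) <= (\<Sum>q\<in>A. \<bar>c q\<bar> * norm (I q t w - J q m w))"
     unfolding e by (rule order_trans[OF norm_sum]) (simp add: norm_mult)
    then have "(norm (S w - Sm m w))\<^sup>2 <= (\<Sum>q\<in>A. \<bar>c q\<bar> * norm (I q t w - J q m w))\<^sup>2" by (intro power_mono) auto
    \<comment> \<open>The factor \<open>card A\<close> from Cauchy--Schwarz is harmless, since
      \<open>A\<close> is fixed while the approximation improves.\<close>
    also have "... <= (\<Sum>q\<in>A. (\<bar>c q\<bar> * norm (I q t w - J q m w))\<^sup>2) * card A" by (rule sum_squared_le_sum_of_squares[THEN order_trans]) (simp add: mult.commute)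
    also have "... = card A * (\<Sum>q\<in>A. (c q)\<^sup>2 * (norm (I q t w - J q m w))\<^sup>2)" by (simp add: power_mult_distrib mult.commute)
    finally have "ennreal ((norm (S w - Sm m w))\<^sup>2) <= ennreal (card A * (\<Sum>q\<in>A. (c q)\<^sup>2 * (norm (I q t w - J q m w))\<^sup>2))" by (rule ennreal_leI)
    also have "... = ennreal (card A) * (\<Sum>q\<in>A. ennreal ((c q)\<^sup>2 * (norm (I q t w - J q m w))\<^sup>2))"
     by (subst ennreal_mult) (simp_all add: sum_nonneg sum_ennreal)
    also have "... = ennreal (card A) * (\<Sum>q\<in>A. ennreal ((c q)\<^sup>2) * ennreal ((norm (I q t w - J q m w))\<^sup>2))"
     by (simp add: ennreal_mult)
    finally show ?thesis .
   qed
   then have "(\<integral>\<^sup>+w. ennreal ((norm (S w - Sm m w))\<^sup>2) \<partial>M)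
     <= (\<integral>\<^sup>+w. ennreal (card A) * (\<Sum>q\<in>A. ennreal ((c q)\<^sup>2) * ennreal ((norm (I q t w - J q m w))\<^sup>2)) \<partial>M)"
    by (intro nn_integral_mono)
   also have "... = ennreal (card A) * (\<Sum>q\<in>A. ennreal ((c q)\<^sup>2) * eps q m)"
   proof -
    have m: "(%w. ennreal ((norm (I q t w - J q m w))\<^sup>2)) \<in> borel_measurable M" if "q \<in> A" for q
     using Im[OF that] Jm[OF that, of m] by simp
    show ?thesis unfolding eps_def
     by (subst nn_integral_cmult, intro borel_measurable_sum borel_measurable_times_ennreal borel_measurable_const m, assumption,
       subst nn_integral_sum, intro borel_measurable_times_ennreal borel_measurable_const m, assumption,
       rule arg_cong[where f = "%z. ennreal (card A) * z"], rule sum.cong[OF refl], rule nn_integral_cmult, rule m)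
   qed
   finally show ?thesis .
  qed
  also have "(\<integral>\<^sup>+w. ennreal ((norm (Sm m w))\<^sup>2) \<partial>M)
    <= (\<Sum>q\<in>A. ennreal (2 * (c q)\<^sup>2) * (\<integral>\<^sup>+s. (\<integral>\<^sup>+w. ennreal ((norm (V q m s w))\<^sup>2) \<partial>M) \<partial>itv T))"
   unfolding Sm_def J_def V_def by (rule simple_isometry[OF A t0(1,2) sp])
  also have "... <= (\<Sum>q\<in>A. ennreal (2 * (c q)\<^sup>2) * (2 * dl q m + 2 * h q))"
   by (intro sum_mono mult_left_mono V_le) auto
  finally show ?thesis by (simp add: add_mono mult_left_mono)
 qed
 have "(%m. 2 * (ennreal (card A) * (\<Sum>q\<in>A. ennreal ((c q)\<^sup>2) * eps q m)) + 2 * (\<Sum>q\<in>A. ennreal (2 * (c q)\<^sup>2) * (2 * dl q m + 2 * h q)))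
   \<longlonglongrightarrow> 2 * (ennreal (card A) * (\<Sum>q\<in>A. ennreal ((c q)\<^sup>2) * 0)) + 2 * (\<Sum>q\<in>A. ennreal (2 * (c q)\<^sup>2) * (2 * 0 + 2 * h q))"
  by (intro tendsto_add ennreal_tendsto_cmult tendsto_sum tendsto_const eps0 dl0) auto
 then have "(\<integral>\<^sup>+w. ennreal ((norm (S w))\<^sup>2) \<partial>M)
   <= 2 * (ennreal (card A) * (\<Sum>q\<in>A. ennreal ((c q)\<^sup>2) * 0)) + 2 * (\<Sum>q\<in>A. ennreal (2 * (c q)\<^sup>2) * (2 * 0 + 2 * h q))"
  by (rule LIMSEQ_le_const) (use bound in blast)
 also have "... = (\<Sum>q\<in>A. ennreal (8 * (c q)\<^sup>2) * h q)"
 proof -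
  have "2 * (ennreal (2 * (c q)\<^sup>2) * (2 * h q)) = ennreal (8 * (c q)\<^sup>2) * h q" for q
  proof -
   have "ennreal (8 * (c q)\<^sup>2) = 2 * (ennreal (2 * (c q)\<^sup>2) * 2)"
   proof -
    have "ennreal (8 * (c q)\<^sup>2) = ennreal (2 * (2 * (c q)\<^sup>2 * 2))" by simp
    also have "... = ennreal 2 * (ennreal (2 * (c q)\<^sup>2) * ennreal 2)"
     by (subst ennreal_mult, simp, simp, subst ennreal_mult, simp_all)
    finally show ?thesis by simp
   qed
   then show ?thesis by (simp add: mult_ac)
  qed
  then show ?thesis by (simp add: sum_distrib_left)
 qed
 finally show ?thesis unfolding S_def h_def .
qed

text \<open>The largest squared coefficient is taken out of the sum, leaving the total energy
  \<open>K\<close> of the integrands, bounded independently of the coefficients. This is how a small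
  supremum yields a small variance.\<close>

lemma ito_series_bound:
 assumes t: "t \<in> {0..T}"
  and I: "!!q. q \<in> modes ==> is_ito_integral M F T (cbm q) (H q) (I q)"
  and Sm: "S \<in> borel_measurable M"
  and S: "((%A. \<integral>\<^sup>+w. ennreal ((norm (S w - (\<Sum>q\<in>A. complex_of_real (c q) * I q t w)))\<^sup>2) \<partial>M) \<longlongrightarrow> 0)
   (finite_subsets_at_top modes)"
  and c: "!!q. q \<in> modes ==> (c q)\<^sup>2 <= sg"
  and K: "!!A. finite A ==> A \<subseteq> modes ==> (\<Sum>q\<in>A. \<integral>\<^sup>+s. (\<integral>\<^sup>+w. ennreal ((norm (H q s w))\<^sup>2) \<partial>M) \<partial>itv T) <= K"
 shows "(\<integral>\<^sup>+w. ennreal ((norm (S w))\<^sup>2) \<partial>M) <= 2 * (ennreal (8 * sg) * K)"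
proof -
 let ?P = "%A w. \<Sum>q\<in>A. complex_of_real (c q) * I q t w"
 have bound: "(\<integral>\<^sup>+w. ennreal ((norm (S w))\<^sup>2) \<partial>M)
   <= 2 * (\<integral>\<^sup>+w. ennreal ((norm (S w - ?P A w))\<^sup>2) \<partial>M) + 2 * (ennreal (8 * sg) * K)"
  if A: "finite A" "A \<subseteq> modes" for A
 proof -
  have P: "?P A \<in> borel_measurable M"
   using A by (intro borel_measurable_sum borel_measurable_times borel_measurable_const is_ito_integralD(2)[OF I t]) auto
  have "(\<integral>\<^sup>+w. ennreal ((norm (?P A w))\<^sup>2) \<partial>M)
    <= (\<Sum>q\<in>A. ennreal (8 * (c q)\<^sup>2) * (\<integral>\<^sup>+s. (\<integral>\<^sup>+w. ennreal ((norm (H q s w))\<^sup>2) \<partial>M) \<partial>itv T))"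
   using A by (intro ito_sum_bound[OF A t] I) auto
  also have "... <= (\<Sum>q\<in>A. ennreal (8 * sg) * (\<integral>\<^sup>+s. (\<integral>\<^sup>+w. ennreal ((norm (H q s w))\<^sup>2) \<partial>M) \<partial>itv T))"
   using A c by (intro sum_mono mult_right_mono ennreal_leI) auto
  also have "... <= ennreal (8 * sg) * K"
   unfolding sum_distrib_left[symmetric] by (intro mult_left_mono K A) simp
  finally have le: "(\<integral>\<^sup>+w. ennreal ((norm (?P A w))\<^sup>2) \<partial>M) <= ennreal (8 * sg) * K" .
  show ?thesis
   by (rule order_trans[OF nn_integral_norm_twice[OF Sm P]]) (intro add_left_mono mult_left_mono le, simp)
 qed
 have "((%A. 2 * (\<integral>\<^sup>+w. ennreal ((norm (S w - ?P A w))\<^sup>2) \<partial>M) + 2 * (ennreal (8 * sg) * K)) \<longlongrightarrow> 2 * 0 + 2 * (ennreal (8 * sg) * K))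
   (finite_subsets_at_top modes)"
  by (intro tendsto_add ennreal_tendsto_cmult tendsto_const S) auto
 then have "(\<integral>\<^sup>+w. ennreal ((norm (S w))\<^sup>2) \<partial>M) <= 2 * 0 + 2 * (ennreal (8 * sg) * K)"
  by (rule tendsto_lowerbound[OF _ eventually_finite_subsets_at_top_weakI[OF bound] finite_subsets_at_top_neq_bot])
 then show ?thesis by simp
qed

section \<open>Energy of the integrands over all modes\<close>

lemma frame_norm:
 assumes fr: "noise_frame \<Lambda> a" and q: "q \<in> modes"
 shows "norm (a (fst q) (snd q)) = 1"
proof -
 have j: "snd q \<in> {1..CARD('d) - 1}" and k: "fst q ~= 0" using q by auto
 have 1: "a l (snd q) \<bullet> a l (snd q) = 1" and m: "a (- l) (snd q) = a l (snd q)" if "l \<in> \<Lambda>" for l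
 proof -
  note f = bspec[OF fr[unfolded noise_frame_def] that]
  have "\<forall>j\<in>{1..CARD('d) - 1}. \<forall>m\<in>{1..CARD('d) - 1}. a l j \<bullet> a l m = (if j = m then 1 else 0)" using f by (rule conjunct1)
  from bspec[OF bspec[OF this j] j] show "a l (snd q) \<bullet> a l (snd q) = 1" by simp
  have "\<forall>j\<in>{1..CARD('d) - 1}. a (- l) j = a l j" using f by (elim conjE)
  from bspec[OF this j] show "a (- l) (snd q) = a l (snd q)" .
 qed
 show ?thesis
 proof (cases "fst q \<in> \<Lambda>")
  case True
  from 1[OF True] show ?thesis by (simp add: norm_eq_1)
 next
  case False
  then have "- fst q \<in> \<Lambda>" using half_cases[OF k] by simp
  from 1[OF this] m[OF this] show ?thesis by (simp add: norm_eq_1)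
 qed
qed

text \<open>Bessel's inequality for the functions \<open>u \<partial>\<^sub>i\<phi>\<close>.\<close>

lemma mode_energy:
 fixes a :: "int ^ 'd => nat => real ^ 'd"
 assumes fr: "noise_frame \<Lambda> a" and ph: "ph \<in> Csmooth"
 obtains K where "0 <= K"
  "!!u A. u \<in> sqi torus ==> finite A ==> A \<subseteq> modes ==>
   (\<Sum>q\<in>A. (norm (ip (%x. complex_of_real (u x)) (%x. fourier (fst q) x * complex_of_real (a (fst q) (snd q) \<bullet> grad ph x))))\<^sup>2)
   <= K * (nrm torus u)\<^sup>2"
proof -
 have "\<exists>C. 0 <= C & (AE x in torus. \<bar>pdiff i ph x\<bar> <= C)" for i
  using Csmooth_bounded[OF Csmooth_pdiff[OF ph, of i]] by metis
 then obtain C where C: "!!i. 0 <= C i" "!!i. AE x in torus. \<bar>pdiff i ph x\<bar> <= C i" by metis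
 let ?h = "%u q. ip (%x. complex_of_real (u x)) (%x. fourier (fst q) x * complex_of_real (a (fst q) (snd q) \<bullet> grad ph x))"
 let ?K = "real CARD('d) * (\<Sum>i\<in>UNIV. (C i)\<^sup>2)"
 have "(\<Sum>q\<in>A. (norm (?h u q))\<^sup>2) <= ?K * (nrm torus u)\<^sup>2"
  if u: "u \<in> sqi torus" and A: "finite A" "A \<subseteq> modes" for u A
 proof -
  define g where "g i x = pdiff i ph x * u x" for i x
  have g: "g i \<in> sqi torus" for i
   unfolding g_def[abs_def] using Csmooth_measurable[OF Csmooth_pdiff[OF ph]] C(2) by (intro sqi_mult_bounded[OF u]) auto
  have ng: "(nrm torus (g i))\<^sup>2 <= (C i)\<^sup>2 * (nrm torus u)\<^sup>2" for i
  proof -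
   have "(nrm torus (g i))\<^sup>2 = (LINT x|torus. (g i x)\<^sup>2)" unfolding nrm_power2 inn_def by (simp add: power2_eq_square)
   also have "... <= (LINT x|torus. (C i)\<^sup>2 * (u x)\<^sup>2)"
   proof (rule integral_mono_AE)
    show "AE x in torus. (g i x)\<^sup>2 <= (C i)\<^sup>2 * (u x)\<^sup>2"
     using C(2)[of i] by eventually_elim (auto simp: g_def power_mult_distrib intro!: mult_right_mono power2_le_iff_abs_le[THEN iffD2] C(1))
   qed (use sqi_integrable_power2[OF g] sqi_integrable_power2[OF u] in simp_all)
   also have "... = (C i)\<^sup>2 * (nrm torus u)\<^sup>2" unfolding nrm_power2 inn_def by (simp add: power2_eq_square)
   finally show ?thesis .
  qed
  let ?c = "%i k. inn torus (g i) (cas k)"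
  have one: "(norm (?h u q))\<^sup>2 <= (\<Sum>i\<in>UNIV. ((?c i (fst q))\<^sup>2 + (?c i (- fst q))\<^sup>2) / 2)" if q: "q \<in> A" for q
  proof -
   define k v where "k = fst q" and "v = a (fst q) (snd q)"
   have v: "norm v = 1" unfolding v_def using frame_norm[OF fr] q A by blast
   \<comment> \<open>The directional derivative along the frame vector \<open>v\<close>, times
     \<open>u\<close>. As \<open>v\<close> is a unit vector, the squared coefficients of
     \<open>G\<close> are at most the sum of those of the \<open>g i\<close>.\<close>
   define G where "G x = (\<Sum>i\<in>UNIV. v $ i * g i x)" for x
   have G: "G \<in> sqi torus" unfolding G_def[abs_def] by (intro sqi_lincomb g)
   have Gc: "inn torus G (cas l) = v \<bullet> (\<chi> i. ?c i l)" for l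
    unfolding G_def[abs_def] by (simp add: inn_lincomb_left g inner_vec_def)
   have Gc2: "(inn torus G (cas l))\<^sup>2 <= (\<Sum>i\<in>UNIV. (?c i l)\<^sup>2)" for l
   proof -
    have "(v \<bullet> (\<chi> i. ?c i l))\<^sup>2 <= (norm v * norm (\<chi> i. ?c i l))\<^sup>2"
     using Cauchy_Schwarz_ineq2[of v "\<chi> i. ?c i l"] by (intro power2_le_iff_abs_le[THEN iffD2]) auto
    then have "(v \<bullet> (\<chi> i. ?c i l))\<^sup>2 <= (norm (\<chi> i. ?c i l))\<^sup>2" by (simp only: v mult_1)
    also have "... = (\<Sum>i\<in>UNIV. (?c i l)\<^sup>2)" unfolding power2_norm_eq_inner inner_vec_def by (simp add: power2_eq_square)
    finally show ?thesis unfolding Gc .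
   qed
   have Gi: "integrable torus (%x. G x * cas l x)" for l by (rule sqi_integrable_mult[OF G cas_sqi])
   \<comment> \<open>Euler's formula in the real basis: the complex coefficient at \<open>k\<close>
     involves the real ones at \<open>k\<close> and \<open>- k\<close>, each with weight one half
     after squaring.\<close>
   have fe: "fourier k x = complex_of_real ((cas k x + cas (- k) x) / 2) + \<i> * complex_of_real ((cas k x - cas (- k) x) / 2)" for x
    unfolding fourier_def cos_cas[symmetric] sin_cas[symmetric] exp_Euler cos_of_real sin_of_real ..
   have "?h u q = (LINT x|torus. complex_of_real ((G x * cas k x + G x * cas (- k) x) / 2) + \<i> * complex_of_real ((G x * cas k x - G x * cas (- k) x) / 2))"
   proof -
    have gr: "u x * (v \<bullet> grad ph x) = G x" for x
     by (simp add: G_def g_def inner_vec_def grad_def sum_distrib_left mult_ac)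
    have "complex_of_real (u x) * (fourier k x * complex_of_real (v \<bullet> grad ph x)) = complex_of_real (G x) * fourier k x" for x
     unfolding gr[symmetric] by (simp add: mult_ac)
    then have "complex_of_real (u x) * (fourier k x * complex_of_real (v \<bullet> grad ph x))
      = complex_of_real ((G x * cas k x + G x * cas (- k) x) / 2) + \<i> * complex_of_real ((G x * cas k x - G x * cas (- k) x) / 2)" for x
     by (simp add: fe distrib_left right_diff_distrib add_divide_distrib diff_divide_distrib mult_ac)
    then show ?thesis unfolding ip_def unfolding v_def[symmetric] unfolding k_def[symmetric] by (simp only:)
   qed
   also have "... = complex_of_real ((inn torus G (cas k) + inn torus G (cas (- k))) / 2) + \<i> * complex_of_real ((inn torus G (cas k) - inn torus G (cas (- k))) / 2)"
   proof -
    have 1: "integrable torus (%x. (G x * cas k x + G x * cas (- k) x) / 2)" "integrable torus (%x. (G x * cas k x - G x * cas (- k) x) / 2)"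
     by (intro integrable_divide Bochner_Integration.integrable_add Bochner_Integration.integrable_diff Gi)+
    have 2: "(LINT x|torus. (G x * cas k x + G x * cas (- k) x) / 2) = (inn torus G (cas k) + inn torus G (cas (- k))) / 2"
     "(LINT x|torus. (G x * cas k x - G x * cas (- k) x) / 2) = (inn torus G (cas k) - inn torus G (cas (- k))) / 2"
     unfolding inn_def using Gi by simp_all
    have "(LINT x|torus. complex_of_real ((G x * cas k x + G x * cas (- k) x) / 2) + \<i> * complex_of_real ((G x * cas k x - G x * cas (- k) x) / 2))
      = (LINT x|torus. complex_of_real ((G x * cas k x + G x * cas (- k) x) / 2)) + (LINT x|torus. \<i> * complex_of_real ((G x * cas k x - G x * cas (- k) x) / 2))"
     by (rule Bochner_Integration.integral_add) (intro integrable_mult_right integrable_of_real 1)+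
    then show ?thesis by (simp only: integral_mult_right_zero integral_complex_of_real 2)
   qed
   finally have "(norm (?h u q))\<^sup>2 = ((inn torus G (cas k) + inn torus G (cas (- k))) / 2)\<^sup>2 + ((inn torus G (cas k) - inn torus G (cas (- k))) / 2)\<^sup>2"
    unfolding cmod_power2 by simp
   also have "... = ((inn torus G (cas k))\<^sup>2 + (inn torus G (cas (- k)))\<^sup>2) / 2" by (simp add: power2_eq_square field_simps)
   also have "... <= ((\<Sum>i\<in>UNIV. (?c i k)\<^sup>2) + (\<Sum>i\<in>UNIV. (?c i (- k))\<^sup>2)) / 2"
    by (intro divide_right_mono add_mono Gc2) simp
   also have "... = (\<Sum>i\<in>UNIV. ((?c i k)\<^sup>2 + (?c i (- k))\<^sup>2) / 2)"
    by (simp add: sum.distrib sum_divide_distrib add_divide_distrib)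
   finally show ?thesis unfolding k_def .
  qed
  let ?w = "%k. \<Sum>i\<in>UNIV. ((?c i k)\<^sup>2 + (?c i (- k))\<^sup>2) / 2"
  have "(\<Sum>q\<in>A. (norm (?h u q))\<^sup>2) <= (\<Sum>q\<in>A. ?w (fst q))" by (intro sum_mono one)
  \<comment> \<open>Each lattice point occurs with at most \<open>CARD('d) - 1\<close> polarizations
    and the bound does not depend on the polarization. The sum is enlarged to a full product so that
    Bessel's inequality applies to lattice points.\<close>
  also have "... <= (\<Sum>q\<in>fst ` A \<times> {1..CARD('d) - 1}. ?w (fst q))"
  proof (rule sum_mono2)
   show "A \<subseteq> fst ` A \<times> {1..CARD('d) - 1}" using A(2) by (force simp: mem_Times_iff)
  qed (use A in \<open>auto intro!: sum_nonneg\<close>)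
  also have "... = (\<Sum>k\<in>fst ` A. \<Sum>j\<in>{1..CARD('d) - 1}. ?w k)"
   by (rule trans[OF sum.cong[OF refl] sum.cartesian_product[symmetric]]) (simp only: case_prod_beta')
  also have "... = real (CARD('d) - 1) * (\<Sum>k\<in>fst ` A. ?w k)" by (simp add: sum_distrib_left)
  also have "... <= real CARD('d) * (\<Sum>k\<in>fst ` A. ?w k)" by (intro mult_right_mono sum_nonneg) auto
  also have "(\<Sum>k\<in>fst ` A. ?w k) <= (\<Sum>i\<in>UNIV. (C i)\<^sup>2 * (nrm torus u)\<^sup>2)"
  proof (subst sum.swap, rule sum_mono)
   fix i
   have b1: "(\<Sum>k\<in>fst ` A. (?c i k)\<^sup>2) <= (nrm torus (g i))\<^sup>2" using A by (intro torus.bessel g) auto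
   have "(\<Sum>k\<in>fst ` A. (?c i (- k))\<^sup>2) = (\<Sum>k\<in>uminus ` fst ` A. (?c i k)\<^sup>2)" by (subst sum.reindex) (auto simp: inj_on_def)
   also have "... <= (nrm torus (g i))\<^sup>2" using A by (intro torus.bessel g) auto
   finally have "(\<Sum>k\<in>fst ` A. ((?c i k)\<^sup>2 + (?c i (- k))\<^sup>2) / 2) <= (nrm torus (g i))\<^sup>2"
    using b1 by (simp add: sum.distrib flip: sum_divide_distrib)
   then show "(\<Sum>k\<in>fst ` A. ((?c i k)\<^sup>2 + (?c i (- k))\<^sup>2) / 2) <= (C i)\<^sup>2 * (nrm torus u)\<^sup>2" using ng[of i] by simp
  qed
  finally show ?thesis by (simp add: sum_distrib_right mult_left_mono mult.assoc)
 qed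
 then show thesis by (intro that[of ?K]) (auto intro!: mult_nonneg_nonneg sum_nonneg)
qed

end

subsection \<open>Weakly continuous functions\<close>

text \<open>Gliding hump: a series of multiples of the functions \<open>u t\<close> on which the functionals are unbounded.\<close>

lemma uniformly_bounded_L2:
 fixes u :: "'i => real ^ 'd::finite => real"
 assumes u: "!!t. t \<in> S ==> u t \<in> L2"
  and b: "!!f. f \<in> L2 ==> \<exists>B. \<forall>t\<in>S. \<bar>inn torus (u t) f\<bar> <= B"
 shows "\<exists>C. \<forall>t\<in>S. nrm torus (u t) <= C"
proof (rule ccontr)
 assume "\<nexists>C. \<forall>t\<in>S. nrm torus (u t) <= C"
 \<comment> \<open>The size is tuned to the series below: its \<open>n\<close>-th term contributes
   at least \<open>(1/3)^(n+1)\<close> times the norm of \<open>U n\<close>, the remainder at most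
   half of that, and the surplus must be at least \<open>n\<close>.\<close>
 then have "\<forall>n::nat. \<exists>t. t \<in> S & 2 * 3 ^ Suc n * real n < nrm torus (u t)" by (meson not_le)
 then obtain t where t: "!!n. t n \<in> S" "!!n. 2 * 3 ^ Suc n * real n < nrm torus (u (t n))" by metis
 define U where "U n = u (t n)" for n
 have U: "U n \<in> L2" for n using u t by (simp add: U_def)
 have U0: "0 < nrm torus (U n)" for n
  unfolding U_def by (rule le_less_trans[OF _ t(2)]) simp
 define s where "s n = (1 / 3) ^ Suc n / nrm torus (U n)" for n
 \<comment> \<open>The sign of the new term agrees with the pairing of \<open>U n\<close> with the
   earlier terms, so they cannot cancel it.\<close>
 define f where "f = rec_nat (%x. 0) (%n g x. g x + (if 0 <= inn torus (U n) g then s n else - s n) * U n x)"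
 have f0: "f 0 = (%x. 0)" and fS: "f (Suc n) = (%x. f n x + (if 0 <= inn torus (U n) (f n) then s n else - s n) * U n x)" for n
  by (simp_all add: f_def)
 have fL: "f n \<in> L2" for n
  by (induction n) (simp_all only: f0 fS L2_zero L2_add L2_scale U)
 note sq = fL[THEN L2_sqi] U[THEN L2_sqi]
 have s0: "0 < s n" "s n * nrm torus (U n) = (1 / 3) ^ Suc n" for n using U0[of n] by (simp_all add: s_def)
 have step: "nrm torus (%x. f (Suc n) x - f n x) = (1 / 3) ^ Suc n" for n
 proof -
  have "nrm torus (%x. f (Suc n) x - f n x) = \<bar>if 0 <= inn torus (U n) (f n) then s n else - s n\<bar> * nrm torus (U n)"
   unfolding fS nrm_scale[symmetric] by simp
  then show ?thesis using s0[of n] by (simp split: if_splits)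
 qed
 have hump: "(1 / 3) ^ Suc n * nrm torus (U n) <= \<bar>inn torus (U n) (f (Suc n))\<bar>" for n
 proof -
  have "inn torus (U n) (f (Suc n)) = inn torus (U n) (f n) + (if 0 <= inn torus (U n) (f n) then s n else - s n) * (nrm torus (U n))\<^sup>2"
   unfolding fS nrm_power2 by (subst inn_add_right[OF sq(1) sqi_scale[OF sq(2)] sq(2)]) (simp only: inn_scale_right)
  moreover have "(1 / 3) ^ Suc n * nrm torus (U n) = s n * (nrm torus (U n))\<^sup>2"
   unfolding s0(2)[symmetric] by (simp add: power2_eq_square)
  moreover have "0 <= s n * (nrm torus (U n))\<^sup>2" using s0(1)[of n] by simp
  ultimately show ?thesis by (simp split: if_splits)
 qed
 define F where "F x = lim (%n. f n x)" for x
 have c: "nrm torus (%x. f (Suc n) x - f n x) <= 1 * (1 / 2) ^ n" for n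
 proof -
  have "(1 / 3) ^ Suc n <= (1 / 2 :: real) ^ Suc n" by (rule power_mono) simp_all
  also have "... <= (1 / 2) ^ n" by simp
  finally show ?thesis unfolding step by simp
 qed
 note cmp = sqi_complete[OF finite_measure_torus sq(1) c, folded F_def]
 have "periodic F"
  using fL by (simp add: F_def periodic_def L2_def)
 then have FL: "F \<in> L2" using cmp(1) by (simp add: L2_iff F_def[abs_def])
 have tail: "nrm torus (%x. f (n + j) x - f n x) <= ((1 / 3) ^ n - (1 / 3) ^ (n + j)) / 2" for n j
 proof (induction j)
  case (Suc j)
  have "nrm torus (%x. f (n + Suc j) x - f n x) <= nrm torus (%x. f (Suc (n + j)) x - f (n + j) x) + nrm torus (%x. f (n + j) x - f n x)"
   using nrm_diff_triangle[OF sq(1) sq(1) sq(1)] by simp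
  also have "... <= (1 / 3) ^ Suc (n + j) + ((1 / 3) ^ n - (1 / 3) ^ (n + j)) / 2"
   unfolding step by (intro add_left_mono Suc)
  also have "... = ((1 / 3) ^ n - (1 / 3) ^ (n + Suc j)) / 2" by (simp add: field_simps)
  finally show ?case .
 qed simp
 \<comment> \<open>With ratio \<open>1/3\<close> the remainder after stage \<open>n\<close> is at
   most half of the last power. At \<open>Suc n\<close> this is half of the hump.\<close>
 have lim: "nrm torus (%x. F x - f n x) <= (1 / 3) ^ n / 2" for n
 proof (rule LIMSEQ_le_const)
  have "(%j. nrm torus (%x. f (j + n) x - F x)) \<longlonglongrightarrow> 0"
   using LIMSEQ_ignore_initial_segment[OF cmp(2), of n] by (simp add: F_def)
  then have "(%j. nrm torus (%x. F x - f (n + j) x) + (1 / 3) ^ n / 2) \<longlonglongrightarrow> 0 + (1 / 3) ^ n / 2"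
   unfolding nrm_minus_commute[of _ F] add.commute[of n] by (intro tendsto_add tendsto_const)
  then show "(%j. nrm torus (%x. F x - f (n + j) x) + (1 / 3) ^ n / 2) \<longlonglongrightarrow> (1 / 3) ^ n / 2" by simp
  have "nrm torus (%x. F x - f n x) <= nrm torus (%x. F x - f (n + j) x) + (1 / 3) ^ n / 2" for j
  proof -
   have "nrm torus (%x. f (n + j) x - f n x) <= (1 / 3) ^ n / 2"
    using tail[of n j] zero_le_power[of "1 / 3 :: real" "n + j"] by argo
   then show ?thesis using nrm_diff_triangle[OF FL[THEN L2_sqi] sq(1)[of "n + j"] sq(1)[of n]] by argo
  qed
  then show "\<exists>N. \<forall>j\<ge>N. nrm torus (%x. F x - f n x) <= nrm torus (%x. F x - f (n + j) x) + (1 / 3) ^ n / 2" by blast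
 qed
 obtain B where B: "!!t. t \<in> S ==> \<bar>inn torus (u t) F\<bar> <= B" using b[OF FL] by blast
 obtain n :: nat where n: "B < n" using reals_Archimedean2 by blast
 have "\<bar>inn torus (U n) (%x. F x - f (Suc n) x)\<bar> <= nrm torus (U n) * ((1 / 3) ^ Suc n / 2)"
  by (rule order_trans[OF cauchy_schwarz_inn[OF sq(2) sqi_diff[OF FL[THEN L2_sqi] sq(1)]]]) (intro mult_left_mono lim nrm_nonneg)
 moreover have "inn torus (U n) (%x. F x - f (Suc n) x) = inn torus (U n) F - inn torus (U n) (f (Suc n))"
  by (rule inn_diff_right[OF FL[THEN L2_sqi] sq])
 moreover have "real n <= (1 / 3) ^ Suc n * nrm torus (U n) / 2"
  using t(2)[of n] by (simp add: U_def field_simps)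
 moreover have "\<bar>inn torus (U n) (f (Suc n))\<bar> <= \<bar>inn torus (U n) F\<bar> + \<bar>inn torus (U n) F - inn torus (U n) (f (Suc n))\<bar>" by linarith
 ultimately show False
  using hump[of n] B[OF t(1)[of n]] n by (simp add: U_def[symmetric] mult.commute)
qed

lemma weakly_continuous_inn:
 assumes "weakly_continuous T u"
 shows "t \<in> {0..T} ==> u t \<in> L2" "f \<in> L2 ==> continuous_on {0..T} (%t. inn torus (u t) f)"
 using assms unfolding weakly_continuous_def ip_real by simp_all

lemma weakly_continuous_bounded:
 assumes u: "weakly_continuous T u"
 shows "\<exists>C. \<forall>t\<in>{0..T}. nrm torus (u t) <= C"
proof (rule uniformly_bounded_L2[OF weakly_continuous_inn(1)[OF u]])
 fix f :: "real ^ 'a => real" assume "f \<in> L2"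
 then have "bounded ((%t. inn torus (u t) f) ` {0..T})"
  by (intro compact_imp_bounded compact_continuous_image weakly_continuous_inn(2)[OF u]) auto
 then show "\<exists>B. \<forall>t\<in>{0..T}. \<bar>inn torus (u t) f\<bar> <= B" unfolding bounded_iff by auto
qed

lemma weakly_continuous_sm:
 assumes u: "weakly_continuous T u"
 shows "strongly_measurable T u"
 by (rule strongly_measurableI)
  (use weakly_continuous_inn[OF u] in \<open>auto intro!: AE_I2 measurable_itv_continuous cas_L2\<close>)

lemma weakly_continuous_Linf:
 assumes u: "weakly_continuous T u"
 shows "u \<in> Linf_L2 T"
proof -
 obtain C where "!!t. t \<in> {0..T} ==> nrm torus (u t) <= C" using weakly_continuous_bounded[OF u] by blast
 then have "AE t in itv T. L2norm (u t) <= C" by (intro AE_I2) (simp add: L2norm_eq)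
 then show ?thesis using weakly_continuous_sm[OF u] unfolding Linf_L2_def by blast
qed

text \<open>The norm is weakly lower semicontinuous, seen by testing with \<open>u t\<close> itself.
  A uniform bound thus depends on countably many times, which makes it a measurable event.\<close>

lemma weakly_continuous_rational_bound:
 assumes u: "weakly_continuous T u" and T: "0 < T" and C: "!!t. t \<in> {0..T} \<inter> \<rat> ==> nrm torus (u t) <= C"
  and t: "t \<in> {0..T}"
 shows "nrm torus (u t) <= C"
proof -
 note ut = weakly_continuous_inn(1)[OF u t]
 have clos: "s \<in> closure ({0..T} \<inter> \<rat>)" if s: "s \<in> {0..T}" for s
  unfolding closure_approachable
 proof (intro allI impI)
  fix e :: real assume "0 < e"
  then have "max 0 (s - e) < min T (s + e)" using s T by auto
  then obtain r where "r \<in> \<rat>" "max 0 (s - e) < r" "r < min T (s + e)" using Rats_dense_in_real by blast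
  then show "\<exists>y\<in>{0..T} \<inter> \<rat>. dist y s < e" by (intro bexI[of _ r]) (auto simp: dist_real_def)
 qed
 have sub: "closure ({0..T} \<inter> \<rat>) \<subseteq> {0..T}" by (rule closure_minimal) auto
 have "inn torus (u t) (u t) <= C * nrm torus (u t)"
 proof (rule continuous_le_on_closure[OF _ clos[OF t], where f = "%s. inn torus (u s) (u t)"])
  show "continuous_on (closure ({0..T} \<inter> \<rat>)) (%s. inn torus (u s) (u t))"
   by (rule continuous_on_subset[OF weakly_continuous_inn(2)[OF u ut] sub])
  fix s assume s: "s \<in> {0..T} \<inter> \<rat>"
  have "inn torus (u s) (u t) <= nrm torus (u s) * nrm torus (u t)"
   using cauchy_schwarz_inn[OF L2_sqi[OF weakly_continuous_inn(1)[OF u, of s]] L2_sqi[OF ut]] s by auto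
  also have "... <= C * nrm torus (u t)" by (intro mult_right_mono C s) simp
  finally show "inn torus (u s) (u t) <= C * nrm torus (u t)" .
 qed
 then have "nrm torus (u t) * nrm torus (u t) <= C * nrm torus (u t)" by (simp add: nrm_power2[symmetric] power2_eq_square)
 moreover have "0 <= C" using C[of 0] T nrm_nonneg[of torus "u 0"] by (meson IntI Rats_0 atLeastAtMost_iff less_imp_le order_trans order_refl)
 ultimately show ?thesis using nrm_nonneg[of torus "u t"] by (cases "nrm torus (u t) = 0") auto
qed

text \<open>Evaluating at the grid point below \<open>t\<close>, clipped to the interval, gives a
  countable combination of measurable functions; continuity gives convergence as the grid is
  refined.\<close>

lemma continuous_measurable_pair:
 fixes f :: "real => 'w => real"
 assumes m: "!!t. t \<in> {0..T} ==> f t \<in> borel_measurable N"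
  and c: "!!w. w \<in> space N ==> continuous_on {0..T} (%t. f t w)" and T: "0 <= T"
 shows "(%p. f (fst p) (snd p)) \<in> borel_measurable (itv T \<Otimes>\<^sub>M N)"
proof -
 define r where "r n i = max 0 (min T (real_of_int i / real (Suc n)))" for n i
 have r: "r n i \<in> {0..T}" for n i using T by (simp add: r_def)
 have fl: "(%t. \<lfloor>t * real (Suc n)\<rfloor>) \<in> itv T \<rightarrow>\<^sub>M count_space UNIV" for n
 proof -
  have "(%t. t * real (Suc n)) \<in> borel_measurable (itv T)" by (rule borel_measurable_itv_borel) simp
  then show ?thesis by measurable
 qed
 show ?thesis
 proof (rule borel_measurable_LIMSEQ_real)
  show "(%p. f (r n \<lfloor>fst p * real (Suc n)\<rfloor>) (snd p)) \<in> borel_measurable (itv T \<Otimes>\<^sub>M N)" for n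
   by (rule measurable_compose_countable[where f = "%i p. f (r n i) (snd p)"])
    (intro measurable_compose[OF measurable_snd] measurable_compose[OF measurable_fst] m r fl)+
  fix p assume "p \<in> space (itv T \<Otimes>\<^sub>M N)"
  then have p: "fst p \<in> {0..T}" "snd p \<in> space N" by (auto simp: space_pair_measure)
  have "(%n. real_of_int \<lfloor>fst p * real (Suc n)\<rfloor> / real (Suc n)) \<longlonglongrightarrow> fst p"
  proof (rule tendsto_sandwich[of "%n. fst p - 1 / real (Suc n)" _ _ "%n. fst p"])
   show "\<forall>\<^sub>F n in sequentially. fst p - 1 / real (Suc n) <= real_of_int \<lfloor>fst p * real (Suc n)\<rfloor> / real (Suc n)"
   proof (intro always_eventually allI)
    fix n
    have "fst p * real (Suc n) - 1 <= real_of_int \<lfloor>fst p * real (Suc n)\<rfloor>" by linarith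
    then show "fst p - 1 / real (Suc n) <= real_of_int \<lfloor>fst p * real (Suc n)\<rfloor> / real (Suc n)"
     by (simp add: pos_le_divide_eq left_diff_distrib del: of_nat_Suc)
   qed
   show "\<forall>\<^sub>F n in sequentially. real_of_int \<lfloor>fst p * real (Suc n)\<rfloor> / real (Suc n) <= fst p"
    by (intro always_eventually allI) (simp add: pos_divide_le_eq del: of_nat_Suc)
   have "(%n. fst p - 1 / real (Suc n)) \<longlonglongrightarrow> fst p - 0"
    using LIMSEQ_inverse_real_of_nat by (intro tendsto_diff tendsto_const) (simp add: inverse_eq_divide)
   then show "(%n. fst p - 1 / real (Suc n)) \<longlonglongrightarrow> fst p" by simp
  qed simp
  then have "(%n. r n \<lfloor>fst p * real (Suc n)\<rfloor>) \<longlonglongrightarrow> max 0 (min T (fst p))"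
   unfolding r_def by (intro tendsto_max tendsto_min tendsto_const)
  then have "(%n. r n \<lfloor>fst p * real (Suc n)\<rfloor>) \<longlonglongrightarrow> fst p" using p(1) by simp
  then show "(%n. f (r n \<lfloor>fst p * real (Suc n)\<rfloor>) (snd p)) \<longlonglongrightarrow> f (fst p) (snd p)"
   by (rule continuous_on_tendsto_compose[OF c[OF p(2)] _ p(1)]) (intro always_eventually allI r)
 qed
qed

subsection \<open>Measurability and convergence in the weak-star topology\<close>

lemma pairing_trig_comb:
 assumes u: "u \<in> Linf_L2 T" and S: "finite S"
 shows "pairing T u (trig_comb T c S) = (\<Sum>i\<in>S. c i * pairing T u (%t x. tcos T (fst i) t * cas (snd i) x))"
 using S
proof induction
 case empty
 have "trig_comb T c {} = (%t x. 0)" by (simp add: trig_comb_def fun_eq_iff)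
 then show ?case by (simp add: pairing_def)
next
 case (insert i S)
 have "trig_comb T c (insert i S) = (%t x. c i * (tcos T (fst i) t * cas (snd i) x) + 1 * trig_comb T c S t x)"
  using insert by (simp add: trig_comb_def fun_eq_iff)
 then show ?case using insert by (simp only: pairing_combine[OF u tcos_cas_L1 trig_comb_L1]) simp
qed

lemma pairing_diff_bound:
 assumes u: "u \<in> Linf_L2 T" and C: "AE t in itv T. nrm torus (u t) <= C"
  and f: "f \<in> Lp_L2 1 T" and g: "g \<in> Lp_L2 1 T"
 shows "\<bar>pairing T u f - pairing T u g\<bar> <= C * nrm1 T (%t x. f t x - g t x)"
 using pairing_bound(2)[OF Linf_sm[OF u] C L1_diff[OF f g]] pairing_combine[OF u f g, of 1 "- 1"] by simp

lemma pairing_tcos_cas: "pairing T u (%t x. tcos T m t * cas k x) = (LINT t|itv T. tcos T m t * inn torus (u t) (cas k))"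
 unfolding pairing_def by (simp only: inn_scale_right)

text \<open>Basis pairings control trigonometric sums. These approximate \<open>g\<close> in
  L1(0,T;L2), and the common bound \<open>C\<close> makes the approximation error uniform in
  \<open>n\<close>.\<close>

lemma bounded_pairing_tendsto:
 assumes T: "0 < T" and u: "!!n. u n \<in> Linf_L2 T" "!!n. AE t in itv T. nrm torus (u n t) <= C"
  and v: "v \<in> Linf_L2 T" "AE t in itv T. nrm torus (v t) <= C"
  and lim: "!!i. (%n. pairing T (u n) (%t x. tcos T (fst i) t * cas (snd i) x)) \<longlonglongrightarrow> pairing T v (%t x. tcos T (fst i) t * cas (snd i) x)"
  and g: "g \<in> Lp_L2 1 T"
 shows "(%n. pairing T (u n) g) \<longlonglongrightarrow> pairing T v g"
proof (rule tendstoI)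
 fix e :: real assume e: "0 < e"
 define dl where "dl = e / (3 * (\<bar>C\<bar> + 1))"
 have "0 < dl" using e by (simp add: dl_def)
 then obtain c S where S: "finite S" "nrm1 T (%t x. g t x - trig_comb T c S t x) < dl" using trig_comb_dense[OF T g] by metis
 have small: "\<bar>pairing T w g - pairing T w (trig_comb T c S)\<bar> < e / 3"
  if w: "w \<in> Linf_L2 T" "AE t in itv T. nrm torus (w t) <= C" for w
 proof -
  have "\<bar>pairing T w g - pairing T w (trig_comb T c S)\<bar> <= C * nrm1 T (%t x. g t x - trig_comb T c S t x)"
   by (rule pairing_diff_bound[OF w g trig_comb_L1])
  also have "... <= (\<bar>C\<bar> + 1) * nrm1 T (%t x. g t x - trig_comb T c S t x)" by (intro mult_right_mono nrm1_nonneg) simp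
  also have "... < (\<bar>C\<bar> + 1) * dl" by (intro mult_strict_left_mono S) simp
  also have "... = e / 3" by (simp add: dl_def field_simps)
  finally show ?thesis .
 qed
 have "(%n. pairing T (u n) (trig_comb T c S)) \<longlonglongrightarrow> pairing T v (trig_comb T c S)"
  unfolding pairing_trig_comb[OF u(1) S(1)] pairing_trig_comb[OF v(1) S(1)] by (intro tendsto_sum tendsto_mult_left lim)
 then have "\<forall>\<^sub>F n in sequentially. dist (pairing T (u n) (trig_comb T c S)) (pairing T v (trig_comb T c S)) < e / 3"
  using e by (intro tendstoD) auto
 then show "\<forall>\<^sub>F n in sequentially. dist (pairing T (u n) g) (pairing T v g) < e"
 proof eventually_elim
  case (elim n)
  then show ?case using small[OF u(1)[of n] u(2)[of n]] small[OF v] unfolding dist_real_def by argo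
 qed
qed

abbreviation weak_star_map :: "real => (real => real ^ 'd::finite => real) => (real => real ^ 'd => real) => real" where
 "weak_star_map T u \<equiv> restrict (pairing T u) (Lp_L2 1 T)"

lemma openin_weak_star:
 "openin (weak_star T) U \<longleftrightarrow>
  (\<exists>V. openin (product_topology (%_. euclideanreal) (Lp_L2 1 T)) V & U = weak_star_map T -` V \<inter> Linf_L2 T)"
 unfolding weak_star_def openin_pullback_topology set_integral_itv ip_real pairing_def[abs_def] by (rule refl)

lemma limitin_weak_star:
 assumes u: "!!n. u n \<in> Linf_L2 T" and v: "v \<in> Linf_L2 T"
  and lim: "!!g. g \<in> Lp_L2 1 T ==> (%n. pairing T (u n) g) \<longlonglongrightarrow> pairing T v g"
 shows "limitin (weak_star T) u v sequentially"
proof -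
 have "limitin (product_topology (%_. euclideanreal) (Lp_L2 1 T)) (%n. weak_star_map T (u n)) (weak_star_map T v) sequentially"
  unfolding limitin_componentwise using lim by simp
 then have *: "\<forall>\<^sub>F n in sequentially. weak_star_map T (u n) \<in> V"
  if "openin (product_topology (%_. euclideanreal) (Lp_L2 1 T)) V" "weak_star_map T v \<in> V" for V
  using that unfolding limitin_def by blast
 show ?thesis
  unfolding limitin_def topspace_weak_star openin_weak_star
 proof (intro conjI v allI impI, elim conjE exE)
  fix U V assume V: "v \<in> U" "openin (product_topology (%_. euclideanreal) (Lp_L2 1 T)) V" "U = weak_star_map T -` V \<inter> Linf_L2 T"
  then have "\<forall>\<^sub>F n in sequentially. weak_star_map T (u n) \<in> V" by (intro *) auto
  then show "\<forall>\<^sub>F n in sequentially. u n \<in> U" by eventually_elim (use V(3) u in auto)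
 qed
qed

text \<open>On bounded sets, weakly-star open sets are open for the countably many pairings with basis functions.\<close>

lemma weak_star_open_bounded:
 fixes U :: "(real => real ^ 'd::finite => real) set"
 assumes T: "0 < T" and U: "openin (weak_star T) U" and u: "u \<in> U" and C: "0 <= C" "AE t in itv T. nrm torus (u t) <= C"
 obtains W :: "(nat \<times> (int ^ 'd) => real) set" where "open W"
  "(%i. pairing T u (%t x. tcos T (fst i) t * cas (snd i) x)) \<in> W"
  "!!v. v \<in> Linf_L2 T ==> AE t in itv T. nrm torus (v t) <= C ==>
   (%i. pairing T v (%t x. tcos T (fst i) t * cas (snd i) x)) \<in> W ==> v \<in> U"
proof -
 let ?e = "%i t x. tcos T (fst i) t * cas (snd i) x"
 obtain V where V: "openin (product_topology (%_. euclideanreal) (Lp_L2 1 T)) V" "U = weak_star_map T -` V \<inter> Linf_L2 T"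
  using U unfolding openin_weak_star by blast
 have uL: "u \<in> Linf_L2 T" "weak_star_map T u \<in> V" using u V(2) by auto
 have "\<exists>Z. finite {g \<in> Lp_L2 1 T. Z g ~= topspace euclideanreal} & (\<forall>g\<in>Lp_L2 1 T. openin euclideanreal (Z g)) &
   weak_star_map T u \<in> Pi\<^sub>E (Lp_L2 1 T) Z & Pi\<^sub>E (Lp_L2 1 T) Z \<subseteq> V"
  using V(1) uL(2) unfolding openin_product_topology_alt by (rule bspec)
 then obtain Z where Z': "finite {g \<in> Lp_L2 1 T. Z g ~= topspace euclideanreal} & (\<forall>g\<in>Lp_L2 1 T. openin euclideanreal (Z g)) &
   weak_star_map T u \<in> Pi\<^sub>E (Lp_L2 1 T) Z & Pi\<^sub>E (Lp_L2 1 T) Z \<subseteq> V" by (elim exE)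
 note Z = conjunct1[OF Z'[unfolded topspace_euclidean]] conjunct1[OF conjunct2[OF conjunct2[OF Z']]] conjunct2[OF conjunct2[OF conjunct2[OF Z']]]
 have Zo: "open (Z g)" if "g \<in> Lp_L2 1 T" for g
  by (rule open_openin[THEN iffD2]) (rule bspec[OF conjunct1[OF conjunct2[OF Z']] that])
 \<comment> \<open>A basic open set of the product topology restricts finitely many coordinates
   only.\<close>
 define G where "G = {g \<in> Lp_L2 1 T. Z g ~= UNIV}"
 have "\<exists>W. open W & (%i. pairing T u (?e i)) \<in> W &
   (\<forall>v. v \<in> Linf_L2 T --> (AE t in itv T. nrm torus (v t) <= C) --> (%i. pairing T v (?e i)) \<in> W --> pairing T v g \<in> Z g)"
  if g: "g \<in> Lp_L2 1 T" for g
 proof -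
  have "pairing T u g \<in> Z g" using PiE_mem[OF Z(2) g] g by simp
  then obtain e where e: "0 < e" "!!y. dist y (pairing T u g) < e ==> y \<in> Z g" using Zo[OF g] unfolding open_dist by blast
  define dl where "dl = e / (3 * (C + 1))"
  have "0 < dl" using e C by (simp add: dl_def)
  then obtain c S where S: "finite S" "nrm1 T (%t x. g t x - trig_comb T c S t x) < dl" using trig_comb_dense[OF T g] by metis
  have small: "\<bar>pairing T w g - pairing T w (trig_comb T c S)\<bar> < e / 3"
   if w: "w \<in> Linf_L2 T" "AE t in itv T. nrm torus (w t) <= C" for w
  proof -
   have "\<bar>pairing T w g - pairing T w (trig_comb T c S)\<bar> <= C * nrm1 T (%t x. g t x - trig_comb T c S t x)"
    by (rule pairing_diff_bound[OF w g trig_comb_L1])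
   also have "... <= (C + 1) * nrm1 T (%t x. g t x - trig_comb T c S t x)" by (intro mult_right_mono nrm1_nonneg) simp
   also have "... < (C + 1) * dl" using C by (intro mult_strict_left_mono S) simp
   also have "... = e / 3" using C by (simp add: dl_def field_simps)
   finally show ?thesis .
  qed
  \<comment> \<open>A condition on finitely many basis pairings. Approximating \<open>g\<close> for
    \<open>u\<close> and for \<open>v\<close>, and the deviation between the two trigonometric sums,
    each use one third of \<open>e\<close>.\<close>
  define W where "W = {y :: nat \<times> (int ^ 'd) => real. \<bar>(\<Sum>i\<in>S. c i * y i) - (\<Sum>i\<in>S. c i * pairing T u (?e i))\<bar> < e / 3}"
  have "open W" unfolding W_def
   by (intro open_Collect_less continuous_on_rabs continuous_on_diff continuous_on_sum continuous_on_mult continuous_on_const continuous_on_product_coordinates)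
  moreover have "(%i. pairing T u (?e i)) \<in> W" using e by (simp add: W_def)
  moreover have "pairing T v g \<in> Z g" if v: "v \<in> Linf_L2 T" "AE t in itv T. nrm torus (v t) <= C" "(%i. pairing T v (?e i)) \<in> W" for v
  proof (rule e(2))
   have "\<bar>pairing T v (trig_comb T c S) - pairing T u (trig_comb T c S)\<bar> < e / 3"
    using v(3) unfolding pairing_trig_comb[OF v(1) S(1)] pairing_trig_comb[OF uL(1) S(1)] W_def by simp
   then show "dist (pairing T v g) (pairing T u g) < e"
    using small[OF v(1,2)] small[OF uL(1) C(2)] unfolding dist_real_def by argo
  qed
  ultimately show ?thesis by (intro exI[of _ W] conjI allI impI)
 qed
 then have "\<forall>g\<in>Lp_L2 1 T. \<exists>W. open W & (%i. pairing T u (?e i)) \<in> W &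
   (\<forall>v. v \<in> Linf_L2 T --> (AE t in itv T. nrm torus (v t) <= C) --> (%i. pairing T v (?e i)) \<in> W --> pairing T v g \<in> Z g)"
  by (rule ballI)
 from bchoice[OF this] obtain W where W': "\<forall>g\<in>Lp_L2 1 T. open (W g) & (%i. pairing T u (?e i)) \<in> W g &
   (\<forall>v. v \<in> Linf_L2 T --> (AE t in itv T. nrm torus (v t) <= C) --> (%i. pairing T v (?e i)) \<in> W g --> pairing T v g \<in> Z g)"
  by (elim exE)
 note W = bspec[OF W', THEN conjunct1] bspec[OF W', THEN conjunct2, THEN conjunct1]
  bspec[OF W', THEN conjunct2, THEN conjunct2, THEN spec, THEN mp, THEN mp, THEN mp]
 show thesis
 proof (rule that[of "\<Inter>g\<in>G. W g"])
  show "open (\<Inter>g\<in>G. W g)" using Z(1) W(1) by (intro open_INT) (auto simp: G_def)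
  show "(%i. pairing T u (?e i)) \<in> (\<Inter>g\<in>G. W g)" using W(2) by (simp add: G_def)
  fix v assume v: "v \<in> Linf_L2 T" "AE t in itv T. nrm torus (v t) <= C" "(%i. pairing T v (?e i)) \<in> (\<Inter>g\<in>G. W g)"
  have "pairing T v g \<in> Z g" if g: "g \<in> Lp_L2 1 T" for g
  proof (cases "g \<in> G")
   case True
   then have "(%i. pairing T v (?e i)) \<in> W g" using v(3) by simp
   then show ?thesis by (rule W(3)[OF g v(1,2)])
  next
   case False
   then have "Z g = UNIV" using g by (simp add: G_def)
   then show ?thesis by simp
  qed
  then have "weak_star_map T v \<in> V" by (intro subsetD[OF Z(3)] PiE_I) simp_all
  then show "v \<in> U" using v(1) V(2) by simp
 qed
qed

section \<open>Measurability of weakly continuous processes\<close>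

context
 fixes N :: "'w measure" and T :: real and X :: "real => 'w => real ^ 'd::finite => real"
 assumes T: "0 < T"
  and wc: "!!w. w \<in> space N ==> weakly_continuous T (%t. X t w)"
  and meas: "!!t f. t \<in> {0..T} ==> f \<in> L2 ==> (%w. inn torus (X t w) f) \<in> borel_measurable N"
begin

lemma pairing_basis_measurable:
 "(%w. pairing T (%t. X t w) (%t x. tcos T m t * cas k x)) \<in> borel_measurable N"
proof -
 have "(%p. tcos T m (fst p) * inn torus (X (fst p) (snd p)) (cas k)) \<in> borel_measurable (itv T \<Otimes>\<^sub>M N)"
  using T by (intro continuous_measurable_pair[where f = "%t w. tcos T m t * inn torus (X t w) (cas k)"] borel_measurable_times
   borel_measurable_const meas cas_L2 continuous_on_mult tcos_continuous weakly_continuous_inn(2)[OF wc]) auto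
 then have "(%p. tcos T m (snd p) * inn torus (X (snd p) (fst p)) (cas k)) \<in> borel_measurable (N \<Otimes>\<^sub>M itv T)"
  using measurable_compose[OF measurable_pair_swap'[of N "itv T"], of "%p. tcos T m (fst p) * inn torus (X (fst p) (snd p)) (cas k)"]
  by (simp only: case_prod_beta' fst_conv snd_conv)
 then have "(%w. LINT t|itv T. tcos T m t * inn torus (X t w) (cas k)) \<in> borel_measurable N"
  by (intro sigma_finite_measure.borel_measurable_lebesgue_integral[OF finite_measure.axioms(1)[OF finite_measure_itv]]) (simp add: case_prod_beta')
 then show ?thesis by (simp only: pairing_tcos_cas)
qed

lemma pairing_measurable:
 assumes g: "g \<in> Lp_L2 1 T"
 shows "(%w. pairing T (%t. X t w) g) \<in> borel_measurable N"
proof -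
 have "\<forall>n::nat. \<exists>c S. finite S & nrm1 T (%t x. g t x - trig_comb T c S t x) < 1 / real (Suc n)"
 proof
  fix n :: nat
  have "0 < 1 / real (Suc n)" by simp
  then show "\<exists>c S. finite S & nrm1 T (%t x. g t x - trig_comb T c S t x) < 1 / real (Suc n)"
   by (rule trig_comb_dense[OF T g]) blast
 qed
 then obtain c S where S: "!!n. finite (S n)" "!!n. nrm1 T (%t x. g t x - trig_comb T (c n) (S n) t x) < 1 / real (Suc n)"
  unfolding choice_iff by (elim exE) (simp only: all_conj_distrib, blast)
 show ?thesis
 proof (rule borel_measurable_LIMSEQ_real)
  show "(%w. \<Sum>i\<in>S n. c n i * pairing T (%t. X t w) (%t x. tcos T (fst i) t * cas (snd i) x)) \<in> borel_measurable N" for n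
   by (intro borel_measurable_sum borel_measurable_times borel_measurable_const pairing_basis_measurable)
  fix w assume w: "w \<in> space N"
  note L = weakly_continuous_Linf[OF wc[OF w]]
  obtain C where C: "0 <= C" "AE t in itv T. nrm torus (X t w) <= C" using Linf_bound[OF L] by blast
  have "(%n. pairing T (%t. X t w) (trig_comb T (c n) (S n)) - pairing T (%t. X t w) g) \<longlonglongrightarrow> 0"
  proof (rule Lim_null_comparison)
   show "\<forall>\<^sub>F n in sequentially. norm (pairing T (%t. X t w) (trig_comb T (c n) (S n)) - pairing T (%t. X t w) g) <= C * (1 / real (Suc n))"
   proof (intro always_eventually allI)
    fix n
    have "norm (pairing T (%t. X t w) (trig_comb T (c n) (S n)) - pairing T (%t. X t w) g)
      <= C * nrm1 T (%t x. g t x - trig_comb T (c n) (S n) t x)"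
     unfolding real_norm_def abs_minus_commute[of "pairing T (%t. X t w) (trig_comb T (c n) (S n))"]
     by (rule pairing_diff_bound[OF L C(2) g trig_comb_L1])
    also have "... <= C * (1 / real (Suc n))" by (intro mult_left_mono less_imp_le[OF S(2)] C)
    finally show "norm (pairing T (%t. X t w) (trig_comb T (c n) (S n)) - pairing T (%t. X t w) g) <= C * (1 / real (Suc n))" .
   qed
   show "(%n. C * (1 / real (Suc n))) \<longlonglongrightarrow> 0"
    using tendsto_mult_left[OF LIMSEQ_inverse_real_of_nat, of C] by (simp add: inverse_eq_divide)
  qed
  then show "(%n. \<Sum>i\<in>S n. c n i * pairing T (%t. X t w) (%t x. tcos T (fst i) t * cas (snd i) x)) \<longlonglongrightarrow> pairing T (%t. X t w) g"
   unfolding pairing_trig_comb[OF L S(1)] by (rule LIM_zero_cancel)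
 qed
qed

text \<open>A weak-star open set need not be determined by countably many pairings, but on
  norm-bounded sets it is. The probability space is therefore split into the measurable sets
  \<open>D n\<close>, on each of which membership in \<open>U\<close> is a Borel condition on the
  sequence of basis pairings.\<close>

lemma measurable_weak_star: "(%w t. X t w) \<in> N \<rightarrow>\<^sub>M borel_of (weak_star T)"
 unfolding borel_of_def topspace_weak_star
proof (rule measurable_sigma_sets[OF sets_measure_of])
 show "{U. openin (weak_star T) U} \<subseteq> Pow (Linf_L2 T)"
  using openin_subset[of "weak_star T"] by (auto simp: topspace_weak_star)
 then show "{U. openin (weak_star T) U} \<subseteq> Pow (Linf_L2 T)" .
 show "(%w t. X t w) \<in> space N \<rightarrow> Linf_L2 T" using weakly_continuous_Linf[OF wc] by blast
 fix U :: "(real => real ^ 'd => real) set" assume "U \<in> {U. openin (weak_star T) U}"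
 then have U: "openin (weak_star T) U" by simp
 define \<Phi> where "\<Phi> u i = pairing T u (%t x. tcos T (fst i) t * cas (snd i) x)" for u :: "real => real ^ 'd => real" and i
 \<comment> \<open>The union of all open sets that force membership in \<open>U\<close> is itself
   open, so no neighbourhood has to be selected for each sample point.\<close>
 define W where "W n = \<Union>{W. open W & (\<forall>v. v \<in> Linf_L2 T --> (AE t in itv T. nrm torus (v t) <= real n) --> \<Phi> v \<in> W --> v \<in> U)}" for n
 define D where "D n = {w \<in> space N. \<forall>t\<in>{0..T} \<inter> \<rat>. nrm torus (X t w) <= real n}" for n
 have D: "D n \<in> sets N" for n
 proof -
  have "D n = {w \<in> space N. \<forall>q. real_of_rat q \<in> {0..T} --> nrm torus (X (real_of_rat q) w) <= real n}" by (auto simp: D_def Rats_def)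
  also have "... \<in> sets N"
  proof (rule sets.sets_Collect_countable_All)
   fix q
   define t where "t = real_of_rat q"
   have "(%w. nrm torus (X t w)) \<in> borel_measurable N" if t: "t \<in> {0..T}"
    by (rule nrm_torus_measurable) (use weakly_continuous_inn(1)[OF wc t] L2_sqi meas[OF t cas_L2] in auto)
   then show "{w \<in> space N. real_of_rat q \<in> {0..T} --> nrm torus (X (real_of_rat q) w) <= real n} \<in> sets N"
    unfolding t_def[symmetric] by (cases "t \<in> {0..T}") simp_all
  qed
  finally show ?thesis .
 qed
 have \<Phi>m: "(%w. \<Phi> (%t. X t w)) \<in> borel_measurable N"
  unfolding \<Phi>_def by (rule measurable_coordinatewise_then_product) (rule pairing_basis_measurable)
 have bd: "AE t in itv T. nrm torus (X t w) <= real n" if "w \<in> D n" for w n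
 proof (rule AE_I2)
  fix t assume "t \<in> space (itv T)"
  then have t: "t \<in> {0..T}" by simp
  have w: "w \<in> space N" "!!t. t \<in> {0..T} \<inter> \<rat> ==> nrm torus (X t w) <= real n" using that unfolding D_def by simp_all
  show "nrm torus (X t w) <= real n" by (rule weakly_continuous_rational_bound[OF wc[OF w(1)] T w(2) t])
 qed
 have "(%w t. X t w) -` U \<inter> space N = (\<Union>n. D n \<inter> ((%w. \<Phi> (%t. X t w)) -` W n \<inter> space N))"
 proof (intro equalityI subsetI)
  fix w assume "w \<in> (%w t. X t w) -` U \<inter> space N"
  then have w: "w \<in> space N" "(%t. X t w) \<in> U" by auto
  obtain C where C: "!!t. t \<in> {0..T} ==> nrm torus (X t w) <= C" using weakly_continuous_bounded[OF wc[OF w(1)]] by blast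
  obtain n :: nat where Cn: "C <= real n" using real_arch_simple by blast
  have n: "w \<in> D n" unfolding D_def using w(1) order_trans[OF C Cn] by simp
  obtain W' where "open W'" "\<Phi> (%t. X t w) \<in> W'" "!!v. v \<in> Linf_L2 T ==> AE t in itv T. nrm torus (v t) <= real n ==> \<Phi> v \<in> W' ==> v \<in> U"
   unfolding \<Phi>_def by (rule weak_star_open_bounded[OF T U w(2) of_nat_0_le_iff bd[OF n]]) blast
  then have "\<Phi> (%t. X t w) \<in> W n" unfolding W_def by blast
  then show "w \<in> (\<Union>n. D n \<inter> ((%w. \<Phi> (%t. X t w)) -` W n \<inter> space N))" using n w(1) by auto
 next
  fix w assume "w \<in> (\<Union>n. D n \<inter> ((%w. \<Phi> (%t. X t w)) -` W n \<inter> space N))"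
  then obtain n where n: "w \<in> D n" "\<Phi> (%t. X t w) \<in> W n" "w \<in> space N" by auto
  then show "w \<in> (%w t. X t w) -` U \<inter> space N"
   using bd[OF n(1)] weakly_continuous_Linf[OF wc[OF n(3)]] unfolding W_def by auto
 qed
 moreover have "(%w. \<Phi> (%t. X t w)) -` W n \<inter> space N \<in> sets N" for n
  by (rule measurable_sets[OF \<Phi>m]) (auto simp: W_def intro!: borel_open open_Union)
 ultimately show "(%w t. X t w) -` U \<inter> space N \<in> sets N" using D by auto
qed

end

subsection \<open>Convergence of the energy solutions\<close>

text \<open>A diagonal choice: at stage \<open>k\<close> the first indices all have expectation
  below \<open>(1/2)^k\<close>, so each series of expectations converges after finitely many terms
  and almost sure convergence follows.\<close>

lemma AE_subsequence_countable:
 fixes D :: "nat => 'i::countable => 'w => real"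
 assumes m: "!!n i. D n i \<in> borel_measurable M" and D0: "!!n i w. 0 <= D n i w"
  and lim: "!!i. (%n. \<integral>\<^sup>+w. ennreal (D n i w) \<partial>M) \<longlonglongrightarrow> 0" and r: "strict_mono (r :: nat => nat)"
 obtains s :: "nat => nat" where "strict_mono s" "AE w in M. \<forall>i. (%n. D (r (s n)) i w) \<longlonglongrightarrow> 0"
proof -
 have "\<exists>N. \<forall>n\<ge>N. \<forall>i\<in>to_nat -` {..k}. (\<integral>\<^sup>+w. ennreal (D (r n) i w) \<partial>M) < ennreal ((1 / 2) ^ k)" for k :: nat
 proof -
  have "\<forall>\<^sub>F n in sequentially. \<forall>i\<in>to_nat -` {..k}. (\<integral>\<^sup>+w. ennreal (D (r n) i w) \<partial>M) < ennreal ((1 / 2) ^ k)"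
  proof (rule eventually_ball_finite)
   show "finite (to_nat -` {..k} :: 'i set)" by (intro finite_vimageI inj_to_nat) simp
   show "\<forall>i\<in>to_nat -` {..k}. \<forall>\<^sub>F n in sequentially. (\<integral>\<^sup>+w. ennreal (D (r n) i w) \<partial>M) < ennreal ((1 / 2) ^ k)"
   proof
    fix i
    have "(%n. \<integral>\<^sup>+w. ennreal (D (r n) i w) \<partial>M) \<longlonglongrightarrow> 0"
     using LIMSEQ_subseq_LIMSEQ[OF lim[of i] r] by (simp add: o_def)
    then show "\<forall>\<^sub>F n in sequentially. (\<integral>\<^sup>+w. ennreal (D (r n) i w) \<partial>M) < ennreal ((1 / 2) ^ k)"
     by (rule order_tendstoD(2)) simp
   qed
  qed
  then show ?thesis unfolding eventually_sequentially .
 qed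
 then have "\<forall>k::nat. \<exists>N. \<forall>n\<ge>N. \<forall>i\<in>to_nat -` {..k}. (\<integral>\<^sup>+w. ennreal (D (r n) i w) \<partial>M) < ennreal ((1 / 2) ^ k)" by (rule allI)
 from choice[OF this] obtain N where N': "\<forall>k::nat. \<forall>n\<ge>N k. \<forall>i\<in>to_nat -` {..k}. (\<integral>\<^sup>+w. ennreal (D (r n) i w) \<partial>M) < ennreal ((1 / 2) ^ k)"
  by (elim exE)
 have N: "(\<integral>\<^sup>+w. ennreal (D (r n) i w) \<partial>M) < ennreal ((1 / 2) ^ k)" if "N k <= n" "to_nat i <= k" for k n i
  using N' that by simp
 \<comment> \<open>The partial sums of \<open>N\<close> make the sequence strictly increasing and at
   least \<open>N n\<close>.\<close>
 define s where "s n = n + (\<Sum>k\<le>n. N k)" for n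
 have s: "strict_mono s" by (rule strict_monoI_Suc) (simp add: s_def)
 have sN: "N n <= s n" for n unfolding s_def by (rule trans_le_add2) (rule member_le_sum, auto)
 have "AE w in M. (%n. D (r (s n)) i w) \<longlonglongrightarrow> 0" for i
 proof -
  \<comment> \<open>Index \<open>i\<close> is controlled from stage \<open>to_nat i\<close> on, so
    the series is shifted by that amount.\<close>
  let ?j = "to_nat i"
  have "(\<integral>\<^sup>+w. (\<Sum>n. ennreal (D (r (s (n + ?j))) i w)) \<partial>M) = (\<Sum>n. \<integral>\<^sup>+w. ennreal (D (r (s (n + ?j))) i w) \<partial>M)"
   by (rule nn_integral_suminf) (rule measurable_compose[OF m measurable_ennreal])
  also have "... <= (\<Sum>n. ennreal ((1 / 2) ^ n))"
  proof (rule suminf_le)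
   fix n
   have "(\<integral>\<^sup>+w. ennreal (D (r (s (n + ?j))) i w) \<partial>M) <= ennreal ((1 / 2) ^ (n + ?j))"
    by (rule less_imp_le, rule N[OF sN]) simp
   also have "... <= ennreal ((1 / 2) ^ n)" by (intro ennreal_leI power_decreasing) auto
   finally show "(\<integral>\<^sup>+w. ennreal (D (r (s (n + ?j))) i w) \<partial>M) <= ennreal ((1 / 2) ^ n)" .
  qed auto
  also have "... = ennreal (\<Sum>n. (1 / 2) ^ n)" by (rule suminf_ennreal2) (auto intro: summable_geometric)
  finally have "(\<integral>\<^sup>+w. (\<Sum>n. ennreal (D (r (s (n + ?j))) i w)) \<partial>M) ~= \<infinity>" by (auto simp: top_unique)
  then have "AE w in M. (\<Sum>n. ennreal (D (r (s (n + ?j))) i w)) ~= \<infinity>"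
   by (intro nn_integral_PInf_AE borel_measurable_suminf_order measurable_compose[OF m measurable_ennreal])
  then show ?thesis
  proof eventually_elim
   case (elim w)
   then have "summable (%n. D (r (s (n + ?j))) i w)" by (intro summable_suminf_not_top D0) simp
   then have "(%n. D (r (s (n + ?j))) i w) \<longlonglongrightarrow> 0" by (rule summable_LIMSEQ_zero)
   then show ?case by (rule LIMSEQ_offset[where f = "%n. D (r (s n)) i w"])
  qed
 qed
 then have "AE w in M. \<forall>i. (%n. D (r (s n)) i w) \<longlonglongrightarrow> 0" unfolding AE_all_countable by blast
 with s show thesis by (rule that)
qed

lemma L1_indicator:
 assumes f: "f \<in> Lp_L2 1 T" and A: "A \<in> sets borel"
 shows "(%t x. indicator A t * f t x) \<in> Lp_L2 1 T"
proof -
 have i: "(indicator A :: real => real) \<in> borel_measurable (itv T)" by (rule borel_measurable_itv_borel) (use A in simp)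
 have "strongly_measurable T (%t x. indicator A t * f t x)"
  using strongly_measurable_combine[OF L1_sm[OF f] L1_sm[OF f] i borel_measurable_const[of 0]] by simp
 moreover have "integrable (itv T) (%t. nrm torus (%x. indicator A t * f t x))"
 proof (rule Bochner_Integration.integrable_bound)
  show "integrable (itv T) (%t. nrm torus (f t))" using f by (simp add: Lp_L2_1_iff)
  show "(%t. nrm torus (%x. indicator A t * f t x)) \<in> borel_measurable (itv T)"
   by (rule strongly_measurable_nrm) fact
  show "AE t in itv T. norm (nrm torus (%x. indicator A t * f t x)) <= norm (nrm torus (f t))"
   by (intro AE_I2) (simp add: nrm_scale mult_left_le_one_le)
 qed
 ultimately show ?thesis by (simp add: Lp_L2_1_iff)
qed

locale transport = drift T b + noise M F B \<Lambda>
 for T and b :: "real => real ^ 'd::finite => real ^ 'd" and M :: "'w measure" and F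
  and B :: "int ^ 'd => nat => real => 'w => real" and \<Lambda> +
 fixes a :: "int ^ 'd => nat => real ^ 'd"
 assumes frame: "noise_frame \<Lambda> a"
begin

text \<open>The largest amplification allowed by the energy inequality on the whole interval; it is
  deterministic and independent of the noise.\<close>

definition growth :: real where
 "growth = exp (1 / 2 * enn2real (\<integral>\<^sup>+s\<in>{0..T}. Linf_norm (wdiv (b s)) \<partial>lebesgue))"

lemma growth_pos: "0 < growth" by (simp add: growth_def)

lemma energy_solutionD:
 assumes sol: "energy_solution M F \<Lambda> B a T b th u0 u"
 shows "!!w. w \<in> space M ==> weakly_continuous T (%t. u t w)"
  and "!!t f. t \<in> {0..T} ==> f \<in> L2 ==> (%w. inn torus (u t w) f) \<in> borel_measurable M"
  and "AE w in M. \<forall>t\<in>{0..T}. nrm torus (u t w) <= growth * nrm torus u0"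
proof -
 have sp: "spde_weak_solution M F \<Lambda> B a T b th u" using sol unfolding energy_solution_def by (rule conjunct1)
 have "\<forall>w\<in>space M. weakly_continuous T (%t. u t w)" using sp unfolding spde_weak_solution_def by (elim conjE)
 then show "weakly_continuous T (%t. u t w)" if "w \<in> space M" for w using that by (rule bspec)
 have pr: "progressive F T (borel_of L2_topology) u" using sp unfolding spde_weak_solution_def by (rule conjunct1)
 show "(%w. inn torus (u t w) f) \<in> borel_measurable M" if t: "t \<in> {0..T}" and f: "f \<in> L2" for t f
 proof -
  have "(%w. u t w) \<in> M \<rightarrow>\<^sub>M borel_of L2_topology"
   using measurable_Pair2[OF progressive_joint[OF pr], of t] t T by (simp add: space_restrict_space)
  then show ?thesis by (rule measurable_L2_coeff[OF _ f])
 qed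
 have "AE w in M. (SUP t\<in>{0..T}. ennreal
     (exp (- (1/2) * enn2real (\<integral>\<^sup>+s\<in>{0..t}. Linf_norm (wdiv (b s)) \<partial>lebesgue)) * L2norm (u t w)))
    <= ennreal (L2norm u0)" using sol unfolding energy_solution_def by (elim conjE)
 then show "AE w in M. \<forall>t\<in>{0..T}. nrm torus (u t w) <= growth * nrm torus u0"
 proof eventually_elim
  case (elim w)
  show ?case
  proof
   fix t assume t: "t \<in> {0..T}"
   define e where "e = enn2real (\<integral>\<^sup>+s\<in>{0..t}. Linf_norm (wdiv (b s)) \<partial>lebesgue)"
   have "ennreal (exp (- (1/2) * e) * nrm torus (u t w)) <= ennreal (nrm torus u0)"
    unfolding e_def L2norm_eq[symmetric] by (rule order_trans[OF SUP_upper[OF t] elim])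
   then have le: "exp (- (1/2) * e) * nrm torus (u t w) <= nrm torus u0" by (simp add: ennreal_le_iff)
   have "(\<integral>\<^sup>+s\<in>{0..t}. Linf_norm (wdiv (b s)) \<partial>lebesgue) <= (\<integral>\<^sup>+s\<in>{0..T}. Linf_norm (wdiv (b s)) \<partial>lebesgue)"
    using t by (intro nn_integral_mono mult_left_mono) (auto simp: indicator_def)
   then have "e <= enn2real (\<integral>\<^sup>+s\<in>{0..T}. Linf_norm (wdiv (b s)) \<partial>lebesgue)"
    unfolding e_def using wdiv_Linf by (intro enn2real_mono) auto
   then have "exp (1 / 2 * e) <= growth" by (simp add: growth_def)
   have "nrm torus (u t w) = exp (1 / 2 * e) * (exp (- (1/2) * e) * nrm torus (u t w))"
    by (simp add: mult.assoc[symmetric] flip: exp_add)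
   also have "... <= exp (1 / 2 * e) * nrm torus u0" by (intro mult_left_mono le) simp
   also have "... <= growth * nrm torus u0" by (intro mult_right_mono) (fact, simp)
   finally show "nrm torus (u t w) <= growth * nrm torus u0" .
  qed
 qed
qed

lemma defect_regular:
 assumes sol: "energy_solution M F \<Lambda> B a T b th u0 u" and p: "ph \<in> Csmooth"
 shows "t \<in> {0..T} ==> (%w. defect nu u0 (%t. u t w) ph t) \<in> borel_measurable M"
  and "w \<in> space M ==> continuous_on {0..T} (%t. defect nu u0 (%t. u t w) ph t)"
proof -
 note sD = energy_solutionD[OF sol]
 have int: "integrable (itv T) (%s. inn torus (u s w) (adj nu s ph))" if "w \<in> space M" for w
  by (rule wdiv_pairing_integrable(1)[OF p weakly_continuous_Linf[OF sD(1)[OF that]]])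
 show "continuous_on {0..T} (%t. defect nu u0 (%t. u t w) ph t)" if w: "w \<in> space M"
  unfolding defect_def by (intro continuous_on_diff continuous_on_const weakly_continuous_inn(2)[OF sD(1)[OF w]] Csmooth_L2[OF p]
   indefinite_integral_continuous_1 integrable_itv_HK int[OF w])
 show "(%w. defect nu u0 (%t. u t w) ph t) \<in> borel_measurable M" if t: "t \<in> {0..T}"
 proof -
  \<comment> \<open>The time integral up to \<open>t\<close> is a pairing with the adjoint cut off
    at \<open>t\<close>, so its measurability in the sample point comes from
    \<open>pairing_measurable\<close>.\<close>
  have "(%w. pairing T (%s. u s w) (%s x. indicator {0..t} s * adj nu s ph x)) \<in> borel_measurable M"
   by (rule pairing_measurable[OF T sD(1,2) L1_indicator[OF adj_L1[OF p]]]) auto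
  moreover have "integral {0..t} (%s. inn torus (u s w) (adj nu s ph)) = pairing T (%s. u s w) (%s x. indicator {0..t} s * adj nu s ph x)"
   if "w \<in> space M" for w
   unfolding pairing_def inn_scale_right using itv_subinterval(1)[OF int[OF that], of 0 t] t by simp
  ultimately have "(%w. integral {0..t} (%s. inn torus (u s w) (adj nu s ph))) \<in> borel_measurable M"
   by (subst measurable_cong) auto
  then show ?thesis
   unfolding defect_def by (intro borel_measurable_diff borel_measurable_const sD(2)[OF t Csmooth_L2[OF p]])
 qed
qed

text \<open>The defect is minus the stochastic integral, whose variance Ito's isometry and Bessel's inequality bound.\<close>

lemma defect_bound:
 assumes u0: "u0 \<in> L2" and p: "ph \<in> Csmooth"
 obtains K where "0 <= K"
  "!!th u sg t. energy_solution M F \<Lambda> B a T b th u0 u ==> noise_const th = nu ==>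
   (!!k. k ~= 0 ==> (th k)\<^sup>2 <= sg) ==> 0 <= sg ==> t \<in> {0..T} ==>
   (\<integral>\<^sup>+w. ennreal \<bar>defect nu u0 (%t. u t w) ph t\<bar> \<partial>M) <= ennreal (K * sqrt sg)"
proof -
 let ?h = "%v q. ip (%x. complex_of_real (v x)) (%x. fourier (fst q) x * complex_of_real (a (fst q) (snd q) \<bullet> grad ph x))"
 obtain K0 where K0: "0 <= K0" "!!v A. v \<in> sqi torus ==> finite A ==> A \<subseteq> modes ==> (\<Sum>q\<in>A. (norm (?h v q))\<^sup>2) <= K0 * (nrm torus v)\<^sup>2"
  using mode_energy[OF frame p] by blast
 define R where "R = growth * nrm torus u0"
 have R0: "0 <= R" using growth_pos by (simp add: R_def)
 \<comment> \<open>The factor 16 is the 2 times 8 of \<open>ito_series_bound\<close>,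
   \<open>K0\<close> is the Bessel constant, and \<open>R^2 * T\<close> bounds the squared norms
   integrated over time.\<close>
 define K where "K = sqrt (16 * K0 * R\<^sup>2 * T)"
 have "(\<integral>\<^sup>+w. ennreal \<bar>defect nu u0 (%t. u t w) ph t\<bar> \<partial>M) <= ennreal (K * sqrt sg)"
  if sol: "energy_solution M F \<Lambda> B a T b th u0 u" and nc: "noise_const th = nu"
   and sg: "!!k. k ~= 0 ==> (th k)\<^sup>2 <= sg" "0 <= sg" and t: "t \<in> {0..T}" for th u sg t
 proof -
  note sD = energy_solutionD[OF sol]
  have sp: "spde_weak_solution M F \<Lambda> B a T b th u" using sol unfolding energy_solution_def by (rule conjunct1)
  have ic: "AE w in M. eqT (u 0 w) u0" using sol unfolding energy_solution_def by (elim conjE)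
  have "\<forall>ph\<in>Csmooth. \<exists>I S.
    (\<forall>k\<in>UNIV - {0}. \<forall>j\<in>{1..CARD('d) - 1}.
     is_ito_integral M F T (cplx_bm \<Lambda> B k j)
      (%s w. ip (%x. complex_of_real (u s w x))
           (%x. fourier k x * complex_of_real (a k j \<bullet> grad ph x)))
      (I k j)) &
    (\<forall>t\<in>{0..T}. S t \<in> borel_measurable M &
     ((%A. \<integral>\<^sup>+w. ennreal ((norm (S t w - (\<Sum>(k, j)\<in>A. complex_of_real (th k) * I k j t w)))\<^sup>2) \<partial>M)
       \<longlongrightarrow> 0) (finite_subsets_at_top modes)) &
    (AE w in M. \<forall>t\<in>{0..T}.
     complex_of_real (ip (u t w) ph - ip (u 0 w) ph) =
      complex_of_real
       (- (LINT s:{0..t}|lebesgue. ip (u s w) (wdiv (%x. ph x *\<^sub>R b s x)))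
        + noise_const th * (LINT s:{0..t}|lebesgue. ip (u s w) (laplacian ph)))
      - S t w)"
   using sp unfolding spde_weak_solution_def by (elim conjE)
  from bspec[OF this p] obtain I S where
   ito: "\<forall>k\<in>UNIV - {0}. \<forall>j\<in>{1..CARD('d) - 1}.
     is_ito_integral M F T (cplx_bm \<Lambda> B k j)
      (%s w. ip (%x. complex_of_real (u s w x))
           (%x. fourier k x * complex_of_real (a k j \<bullet> grad ph x)))
      (I k j)"
   and S: "\<forall>t\<in>{0..T}. S t \<in> borel_measurable M &
     ((%A. \<integral>\<^sup>+w. ennreal ((norm (S t w - (\<Sum>(k, j)\<in>A. complex_of_real (th k) * I k j t w)))\<^sup>2) \<partial>M)
       \<longlongrightarrow> 0) (finite_subsets_at_top modes)"
   and eq: "AE w in M. \<forall>t\<in>{0..T}.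
     complex_of_real (ip (u t w) ph - ip (u 0 w) ph) =
      complex_of_real
       (- (LINT s:{0..t}|lebesgue. ip (u s w) (wdiv (%x. ph x *\<^sub>R b s x)))
        + noise_const th * (LINT s:{0..t}|lebesgue. ip (u s w) (laplacian ph)))
      - S t w" by (elim exE conjE)
  define H where "H q s w = ?h (u s w) q" for q s w
  have ito': "is_ito_integral M F T (cbm q) (H q) (I (fst q) (snd q))" if "q \<in> modes" for q
   unfolding H_def using ito that by (simp add: mem_Times_iff)
  have Hm: "(%(s, w). H q s w) \<in> borel_measurable (restrict_space borel {0..T} \<Otimes>\<^sub>M M)" if "q \<in> modes" for q
   by (rule progressive_joint[OF is_ito_integralD(1)[OF ito'[OF that]]]) (use T in simp)
  have energy: "(\<Sum>q\<in>A. \<integral>\<^sup>+s. (\<integral>\<^sup>+w. ennreal ((norm (H q s w))\<^sup>2) \<partial>M) \<partial>itv T) <= ennreal (K0 * R\<^sup>2 * T)"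
   if A: "finite A" "A \<subseteq> modes" for A
  proof -
   have "(\<Sum>q\<in>A. \<integral>\<^sup>+s. (\<integral>\<^sup>+w. ennreal ((norm (H q s w))\<^sup>2) \<partial>M) \<partial>itv T)
     = (\<integral>\<^sup>+s. (\<Sum>q\<in>A. (\<integral>\<^sup>+w. ennreal ((norm (H q s w))\<^sup>2) \<partial>M)) \<partial>itv T)"
    using A by (intro nn_integral_sum[symmetric] time_energy_measurable Hm) auto
   also have "... <= (\<integral>\<^sup>+s. ennreal (K0 * R\<^sup>2) \<partial>itv T)"
   proof (rule nn_integral_mono)
    fix s assume "s \<in> space (itv T)"
    then have s: "s \<in> {0..T}" by simp
    have Hs: "H q s \<in> borel_measurable M" if "q \<in> A" for q
     using measurable_Pair2[OF Hm, of q s] that A s by (auto simp: space_restrict_space)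
    have "(\<Sum>q\<in>A. (\<integral>\<^sup>+w. ennreal ((norm (H q s w))\<^sup>2) \<partial>M)) = (\<integral>\<^sup>+w. (\<Sum>q\<in>A. ennreal ((norm (H q s w))\<^sup>2)) \<partial>M)"
     by (intro nn_integral_sum[symmetric] measurable_compose[OF borel_measurable_power[OF measurable_compose[OF Hs borel_measurable_norm]] measurable_ennreal])
    also have "... <= (\<integral>\<^sup>+w. ennreal (K0 * R\<^sup>2) \<partial>M)"
    proof (rule nn_integral_mono_AE)
     show "AE w in M. (\<Sum>q\<in>A. ennreal ((norm (H q s w))\<^sup>2)) <= ennreal (K0 * R\<^sup>2)"
      using sD(3) AE_space
     proof eventually_elim
      case (elim w)
      have "(\<Sum>q\<in>A. (norm (H q s w))\<^sup>2) <= K0 * (nrm torus (u s w))\<^sup>2"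
       unfolding H_def by (rule K0(2)[OF L2_sqi[OF weakly_continuous_inn(1)[OF sD(1)[OF elim(2)] s]] A])
      also have "... <= K0 * R\<^sup>2" using bspec[OF elim(1) s] K0(1) by (intro mult_left_mono power_mono) (auto simp: R_def)
      finally show ?case by (subst sum_ennreal) (auto intro: ennreal_leI)
     qed
    qed
    also have "... = ennreal (K0 * R\<^sup>2)" by (simp add: emeasure_space_1)
    finally show "(\<Sum>q\<in>A. (\<integral>\<^sup>+w. ennreal ((norm (H q s w))\<^sup>2) \<partial>M)) <= ennreal (K0 * R\<^sup>2)" .
   qed
   also have "... = ennreal (K0 * R\<^sup>2 * T)"
   proof -
    have "emeasure (itv T) {0..T} = ennreal T"
     using finite_measure.emeasure_eq_measure[OF finite_measure_itv, of T "{0..T}"] measure_itv[of T] T by simp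
    then show ?thesis using K0(1) T by (simp add: ennreal_mult')
   qed
   finally show ?thesis .
  qed
  note St = bspec[OF S t]
  have "(\<integral>\<^sup>+w. ennreal ((norm (S t w))\<^sup>2) \<partial>M) <= 2 * (ennreal (8 * sg) * ennreal (K0 * R\<^sup>2 * T))"
  proof (rule ito_series_bound[OF t ito' conjunct1[OF St] _ _ energy, where c = "%q. th (fst q)"])
   show "((%A. \<integral>\<^sup>+w. ennreal ((norm (S t w - (\<Sum>q\<in>A. complex_of_real (th (fst q)) * I (fst q) (snd q) t w)))\<^sup>2) \<partial>M) \<longlongrightarrow> 0)
     (finite_subsets_at_top modes)" using conjunct2[OF St] unfolding case_prod_beta' .
   show "(th (fst q))\<^sup>2 <= sg" if "q \<in> modes" for q using that by (intro sg(1)) auto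
  qed
  also have "... = ennreal ((K * sqrt sg)\<^sup>2)"
  proof -
   have "(K * sqrt sg)\<^sup>2 = 2 * (8 * sg * (K0 * R\<^sup>2 * T))"
    using sg(2) K0(1) T by (simp add: K_def power_mult_distrib)
   also have "ennreal ... = 2 * (ennreal (8 * sg) * ennreal (K0 * R\<^sup>2 * T))"
    using sg(2) K0(1) T by (simp only: ennreal_mult'' ennreal_mult' mult_nonneg_nonneg zero_le_power2 zero_le_numeral less_imp_le ennreal_numeral)
   finally show ?thesis ..
  qed
  finally have S2: "(\<integral>\<^sup>+w. ennreal ((norm (S t w))\<^sup>2) \<partial>M) <= ennreal ((K * sqrt sg)\<^sup>2)" .
  have nS: "(%w. norm (S t w)) \<in> borel_measurable M" by (rule measurable_compose[OF conjunct1[OF St] borel_measurable_norm])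
  note sq = sqi_of_nn_integral[OF nS S2]
  have K': "0 <= K * sqrt sg" using K0(1) T sg(2) by (simp add: K_def)
  \<comment> \<open>On a probability space the L1 norm of the stochastic integral is at most its L2
    norm; the latter is bounded by \<open>K * sqrt sg\<close>.\<close>
  have "(\<integral>\<^sup>+w. ennreal \<bar>defect nu u0 (%t. u t w) ph t\<bar> \<partial>M) <= (\<integral>\<^sup>+w. ennreal (norm (S t w)) \<partial>M)"
  proof (rule nn_integral_mono_AE)
   show "AE w in M. ennreal \<bar>defect nu u0 (%t. u t w) ph t\<bar> <= ennreal (norm (S t w))"
    using eq ic AE_space
   proof eventually_elim
    case (elim w)
    note wc = sD(1)[OF elim(3)]
    have "inn torus (u 0 w) ph = inn torus u0 ph"
     using weakly_continuous_inn(1)[OF wc, of 0] T by (intro eqT_inn[OF elim(2)] L2_sqi u0 Csmooth_sqi[OF p]) auto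
    then have "complex_of_real (defect nu u0 (%t. u t w) ph t) = - S t w"
     using bspec[OF elim(1) t] unfolding defect_def adj_integral_split[OF p weakly_continuous_Linf[OF wc] t] nc ip_real by simp
    then have "\<bar>defect nu u0 (%t. u t w) ph t\<bar> = norm (S t w)" by (metis norm_minus_cancel norm_of_real)
    then show ?case by simp
   qed
  qed
  also have "... = ennreal (LINT w|M. norm (S t w))"
   by (rule nn_integral_eq_integral[OF integral_abs_le_nrm(1)[OF finite_measure_axioms sq(1)]]) simp
  also have "... <= ennreal (K * sqrt sg)"
  proof (rule ennreal_leI)
   have "(LINT w|M. norm (S t w)) <= nrm M (%w. norm (S t w))"
    using integral_abs_le_nrm(2)[OF finite_measure_axioms sq(1)] unfolding prob_space real_sqrt_one mult_1 abs_norm_cancel .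
   also have "... <= K * sqrt sg" by (rule power2_le_imp_le[OF sq(2)[OF zero_le_power2] K'])
   finally show "(LINT w|M. norm (S t w)) <= K * sqrt sg" .
  qed
  finally show ?thesis .
 qed
 moreover have "0 <= K" using K0(1) T by (simp add: K_def)
 ultimately show thesis by (rule that[rotated])
qed

end

context transport begin

text \<open>By \<open>pairing_bwd\<close> the error is a finite sum of defects integrated against
  bounded time factors. Exchanging expectation and time integral reduces it to
  \<open>defect_bound\<close>, with a constant depending on the list but on neither the coefficients
  nor the solution.\<close>

lemma pairing_error:
 assumes u0: "u0 \<in> L2" and ps: "admissible ps"
 obtains K where "0 <= K"
  "!!th u sg. energy_solution M F \<Lambda> B a T b th u0 u ==> noise_const th = nu ==>
   (!!k. k ~= 0 ==> (th k)\<^sup>2 <= sg) ==> 0 <= sg ==>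
   (\<integral>\<^sup>+w. ennreal \<bar>pairing T (%t. u t w) (bwd nu ps) - inn torus u0 (test_fun ps 0)\<bar> \<partial>M) <= ennreal (K * sqrt sg)"
proof -
 have pD: "continuous_on {0..T} (fst p)" "snd p \<in> Csmooth" if "p \<in> set ps" for p
  using ps that by (auto simp: admissible_def)
 have "\<exists>K. 0 <= K & (\<forall>th u sg. energy_solution M F \<Lambda> B a T b th u0 u --> noise_const th = nu -->
   (\<forall>k. k ~= 0 --> (th k)\<^sup>2 <= sg) --> 0 <= sg -->
   (\<integral>\<^sup>+w. ennreal \<bar>LINT t|itv T. fst p t * defect nu u0 (%t. u t w) (snd p) t\<bar> \<partial>M) <= ennreal (K * sqrt sg))"
  if p: "p \<in> set ps" for p
 proof -
  obtain K where K: "0 <= K" "!!th u sg t. energy_solution M F \<Lambda> B a T b th u0 u ==> noise_const th = nu ==>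
   (!!k. k ~= 0 ==> (th k)\<^sup>2 <= sg) ==> 0 <= sg ==> t \<in> {0..T} ==>
   (\<integral>\<^sup>+w. ennreal \<bar>defect nu u0 (%t. u t w) (snd p) t\<bar> \<partial>M) <= ennreal (K * sqrt sg)"
  proof (rule defect_bound[OF u0 pD(2)[OF p], of nu], goal_cases)
   case (1 K)
   show ?case by (rule 1(1)[OF 1(2,3)])
  qed
  have "bounded (fst p ` {0..T})" by (intro compact_imp_bounded compact_continuous_image pD(1)[OF p]) simp
  then obtain C where C: "0 < C" "!!t. t \<in> {0..T} ==> \<bar>fst p t\<bar> <= C" unfolding bounded_pos by auto
  have "(\<integral>\<^sup>+w. ennreal \<bar>LINT t|itv T. fst p t * defect nu u0 (%t. u t w) (snd p) t\<bar> \<partial>M) <= ennreal (C * K * T * sqrt sg)"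
   if sol: "energy_solution M F \<Lambda> B a T b th u0 u" and nc: "noise_const th = nu" and sg: "!!k. k ~= 0 ==> (th k)\<^sup>2 <= sg" "0 <= sg" for th u sg
  proof -
   let ?d = "%t w. defect nu u0 (%t. u t w) (snd p) t"
   have "(%q. ?d (fst q) (snd q)) \<in> borel_measurable (itv T \<Otimes>\<^sub>M M)"
    using T defect_regular[OF sol pD(2)[OF p]] by (intro continuous_measurable_pair[where f = ?d]) auto
   then have m: "(%q. ennreal (C * \<bar>?d (fst q) (snd q)\<bar>)) \<in> borel_measurable (itv T \<Otimes>\<^sub>M M)"
    by (intro measurable_compose[OF _ measurable_ennreal] borel_measurable_times borel_measurable_const borel_measurable_abs)
   interpret pair_sigma_finite "itv T" M
    by (intro pair_sigma_finite.intro finite_measure.axioms(1)[OF finite_measure_itv] sigma_finite_measure_axioms)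
   have "(\<integral>\<^sup>+w. ennreal \<bar>LINT t|itv T. fst p t * ?d t w\<bar> \<partial>M) <= (\<integral>\<^sup>+w. (\<integral>\<^sup>+t. ennreal (C * \<bar>?d t w\<bar>) \<partial>itv T) \<partial>M)"
   proof (rule nn_integral_mono)
    fix w
    show "ennreal \<bar>LINT t|itv T. fst p t * ?d t w\<bar> <= (\<integral>\<^sup>+t. ennreal (C * \<bar>?d t w\<bar>) \<partial>itv T)"
    proof (cases "integrable (itv T) (%t. fst p t * ?d t w)")
     case True
     have "ennreal \<bar>LINT t|itv T. fst p t * ?d t w\<bar> <= (\<integral>\<^sup>+t. ennreal \<bar>fst p t * ?d t w\<bar> \<partial>itv T)"
      using integral_norm_bound_ennreal[OF True] by simp
     also have "... <= (\<integral>\<^sup>+t. ennreal (C * \<bar>?d t w\<bar>) \<partial>itv T)"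
      unfolding abs_mult by (intro nn_integral_mono ennreal_leI mult_right_mono C(2)) simp_all
     finally show ?thesis .
    next
     \<comment> \<open>The Bochner integral of a nonintegrable function is zero by
       convention.\<close>
     case False
     then show ?thesis by (simp add: not_integrable_integral_eq)
    qed
   qed
   also have "... = (\<integral>\<^sup>+t. (\<integral>\<^sup>+w. ennreal (C * \<bar>?d t w\<bar>) \<partial>M) \<partial>itv T)"
    using Fubini[OF m] by simp
   also have "... <= (\<integral>\<^sup>+t. ennreal (C * (K * sqrt sg)) \<partial>itv T)"
   proof (rule nn_integral_mono)
    fix t assume "t \<in> space (itv T)"
    then have t: "t \<in> {0..T}" by simp
    have dm: "(%w. ennreal \<bar>?d t w\<bar>) \<in> borel_measurable M"
     by (intro measurable_compose[OF _ measurable_ennreal] borel_measurable_abs defect_regular(1)[OF sol pD(2)[OF p] t])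
    have "(\<integral>\<^sup>+w. ennreal (C * \<bar>?d t w\<bar>) \<partial>M) = ennreal C * (\<integral>\<^sup>+w. ennreal \<bar>?d t w\<bar> \<partial>M)"
     unfolding nn_integral_cmult[OF dm, symmetric] using C(1) by (intro nn_integral_cong) (simp add: ennreal_mult)
    also have "... <= ennreal C * ennreal (K * sqrt sg)" by (intro mult_left_mono K(2)[OF sol nc sg t]) simp_all
    also have "... = ennreal (C * (K * sqrt sg))" using C(1) K(1) sg(2) by (simp add: ennreal_mult)
    finally show "(\<integral>\<^sup>+w. ennreal (C * \<bar>?d t w\<bar>) \<partial>M) <= ennreal (C * (K * sqrt sg))" .
   qed
   also have "... = ennreal (C * K * T * sqrt sg)"
   proof -
    have "emeasure (itv T) {0..T} = ennreal T"
     using finite_measure.emeasure_eq_measure[OF finite_measure_itv, of T "{0..T}"] measure_itv[of T] T by simp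
    then have "(\<integral>\<^sup>+t. ennreal (C * (K * sqrt sg)) \<partial>itv T) = ennreal (C * (K * sqrt sg)) * ennreal T" by simp
    also have "... = ennreal (C * (K * sqrt sg) * T)" using C(1) K(1) sg(2) T by (intro ennreal_mult[symmetric]) auto
    finally show ?thesis by (simp add: mult_ac)
   qed
   finally show ?thesis .
  qed
  then show ?thesis using C(1) K(1) T by (intro exI[of _ "C * K * T"]) auto
 qed
 then have "\<forall>p\<in>set ps. \<exists>K. 0 <= K & (\<forall>th u sg. energy_solution M F \<Lambda> B a T b th u0 u --> noise_const th = nu -->
   (\<forall>k. k ~= 0 --> (th k)\<^sup>2 <= sg) --> 0 <= sg -->
   (\<integral>\<^sup>+w. ennreal \<bar>LINT t|itv T. fst p t * defect nu u0 (%t. u t w) (snd p) t\<bar> \<partial>M) <= ennreal (K * sqrt sg))" by (rule ballI)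
 from bchoice[OF this] obtain K where K: "\<forall>p\<in>set ps. 0 <= K p & (\<forall>th u sg. energy_solution M F \<Lambda> B a T b th u0 u --> noise_const th = nu -->
   (\<forall>k. k ~= 0 --> (th k)\<^sup>2 <= sg) --> 0 <= sg -->
   (\<integral>\<^sup>+w. ennreal \<bar>LINT t|itv T. fst p t * defect nu u0 (%t. u t w) (snd p) t\<bar> \<partial>M) <= ennreal (K p * sqrt sg))"
  by (elim exE)
 have "(\<integral>\<^sup>+w. ennreal \<bar>pairing T (%t. u t w) (bwd nu ps) - inn torus u0 (test_fun ps 0)\<bar> \<partial>M) <= ennreal ((\<Sum>p\<leftarrow>ps. K p) * sqrt sg)"
  if sol: "energy_solution M F \<Lambda> B a T b th u0 u" and nc: "noise_const th = nu" and sg: "!!k. k ~= 0 ==> (th k)\<^sup>2 <= sg" "0 <= sg" for th u sg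
 proof -
  let ?D = "%p w. LINT t|itv T. fst p t * defect nu u0 (%t. u t w) (snd p) t"
  note sD = energy_solutionD[OF sol]
  have m: "?D p \<in> borel_measurable M" if "p \<in> set ps" for p
  proof -
   have "(%q. fst p (fst q) * defect nu u0 (%t. u t (snd q)) (snd p) (fst q)) \<in> borel_measurable (itv T \<Otimes>\<^sub>M M)"
    using T defect_regular[OF sol pD(2)[OF that]] pD(1)[OF that]
    by (intro continuous_measurable_pair[where f = "%t w. fst p t * defect nu u0 (%t. u t w) (snd p) t"] borel_measurable_times continuous_on_mult) auto
   then have "(%q. fst p (snd q) * defect nu u0 (%t. u t (fst q)) (snd p) (snd q)) \<in> borel_measurable (M \<Otimes>\<^sub>M itv T)"
    using measurable_compose[OF measurable_pair_swap'[of M "itv T"], of "%q. fst p (fst q) * defect nu u0 (%t. u t (snd q)) (snd p) (fst q)"]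
    by (simp only: case_prod_beta' fst_conv snd_conv)
   then show ?thesis
    by (intro sigma_finite_measure.borel_measurable_lebesgue_integral[OF finite_measure.axioms(1)[OF finite_measure_itv]]) (simp only: case_prod_beta')
  qed
  have sum_le: "(\<integral>\<^sup>+w. ennreal \<bar>\<Sum>p\<leftarrow>qs. ?D p w\<bar> \<partial>M) <= ennreal ((\<Sum>p\<leftarrow>qs. K p) * sqrt sg) & 0 <= (\<Sum>p\<leftarrow>qs. K p)" if "set qs \<subseteq> set ps" for qs
   using that
  proof (induction qs)
   case (Cons p qs)
   then have p: "p \<in> set ps" and IH: "(\<integral>\<^sup>+w. ennreal \<bar>\<Sum>p\<leftarrow>qs. ?D p w\<bar> \<partial>M) <= ennreal ((\<Sum>p\<leftarrow>qs. K p) * sqrt sg)" "0 <= (\<Sum>p\<leftarrow>qs. K p)" by auto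
   have K0: "0 <= K p" using bspec[OF K p] by (rule conjunct1)
   have Kp: "(\<integral>\<^sup>+w. ennreal \<bar>?D p w\<bar> \<partial>M) <= ennreal (K p * sqrt sg)"
    using bspec[OF K p, THEN conjunct2, THEN spec, THEN spec, THEN spec, THEN mp, THEN mp, THEN mp, THEN mp, OF sol nc] sg by blast
   have mq: "(%w. \<Sum>p\<leftarrow>qs. ?D p w) \<in> borel_measurable M"
    using Cons.prems m by (induction qs) auto
   have "(\<integral>\<^sup>+w. ennreal \<bar>\<Sum>p\<leftarrow>p # qs. ?D p w\<bar> \<partial>M) <= (\<integral>\<^sup>+w. ennreal \<bar>?D p w\<bar> + ennreal \<bar>\<Sum>p\<leftarrow>qs. ?D p w\<bar> \<partial>M)"
    by (intro nn_integral_mono) (simp add: abs_triangle_ineq flip: ennreal_plus)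
   also have "... = (\<integral>\<^sup>+w. ennreal \<bar>?D p w\<bar> \<partial>M) + (\<integral>\<^sup>+w. ennreal \<bar>\<Sum>p\<leftarrow>qs. ?D p w\<bar> \<partial>M)"
    by (intro nn_integral_add measurable_compose[OF _ measurable_ennreal] borel_measurable_abs m[OF p] mq)
   also have "... <= ennreal (K p * sqrt sg) + ennreal ((\<Sum>p\<leftarrow>qs. K p) * sqrt sg)" by (rule add_mono[OF Kp IH(1)])
   also have "... = ennreal ((\<Sum>p\<leftarrow>p # qs. K p) * sqrt sg)"
    using K0 IH(2) sg(2) by (simp add: distrib_right flip: ennreal_plus)
   finally show ?case using K0 IH(2) by simp
  qed simp
  have "(\<integral>\<^sup>+w. ennreal \<bar>pairing T (%t. u t w) (bwd nu ps) - inn torus u0 (test_fun ps 0)\<bar> \<partial>M) = (\<integral>\<^sup>+w. ennreal \<bar>\<Sum>p\<leftarrow>ps. ?D p w\<bar> \<partial>M)"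
   by (rule nn_integral_cong) (simp only: pairing_bwd[OF weakly_continuous_Linf[OF sD(1)] u0 ps])
  then show ?thesis using sum_le[OF order_refl] by simp
 qed
 moreover have "0 <= (\<Sum>p\<leftarrow>ps. K p)" using K by (intro sum_list_nonneg) auto
 ultimately show thesis by (rule that[rotated])
qed

text \<open>
  Tested against \<open>bwd \<nu> ps\<close>, the energy solutions and the weak solution give the same value up to a
  small error; such functions are dense by uniqueness for the parabolic problem.
\<close>

lemma pairing_converges:
 assumes u0: "u0 \<in> L2" and u: "parabolic_weak_solution T b nu u0 u"
  and uniq: "!!y. parabolic_weak_solution T b nu (%x. 0) y ==> AE t in itv T. eqT (y t) (%x. 0)"
  and sol: "!!N. energy_solution M F \<Lambda> B a T b (th N) u0 (uN N)" and nc: "!!N. noise_const (th N) = nu"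
  and sg: "!!N k. k ~= 0 ==> (th N k)\<^sup>2 <= sg N" "!!N. 0 <= sg N" "sg \<longlonglongrightarrow> 0"
  and g: "g \<in> Lp_L2 1 T"
 shows "(%N. \<integral>\<^sup>+w. ennreal \<bar>pairing T (%t. uN N t w) g - pairing T u g\<bar> \<partial>M) \<longlonglongrightarrow> 0"
proof (rule tendsto_zero_ennreal)
 fix r :: real assume r: "0 < r"
 have uL: "u \<in> Linf_L2 T" using u unfolding parabolic_weak_solution_def by (rule conjunct1)
 obtain C where C: "0 <= C" "AE t in itv T. nrm torus (u t) <= C" using Linf_bound[OF uL] by blast
 define R where "R = C + growth * nrm torus u0"
 have R: "0 <= R" using C(1) growth_pos by (simp add: R_def)
 \<comment> \<open>\<open>R\<close> bounds both the limit and the energy solutions. Replacing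
   \<open>g\<close> costs at most \<open>r / 4\<close> for each, leaving half of \<open>r\<close>
   for the stochastic error.\<close>
 define dl where "dl = r / (4 * (R + 1))"
 have dl: "0 < dl" using r R by (simp add: dl_def)
 obtain ps where ps: "admissible ps" "nrm1 T (%t x. g t x - bwd nu ps t x) < dl" using bwd_dense[OF uniq g dl] by blast
 note bL = bwd_L1[OF ps(1), of nu]
 have Rdl: "R * dl <= r / 4"
  unfolding dl_def using R r by (simp add: field_simps)
 have close: "\<bar>pairing T y g - pairing T y (bwd nu ps)\<bar> <= r / 4" if y: "y \<in> Linf_L2 T" "AE t in itv T. nrm torus (y t) <= R" for y
 proof -
  have "\<bar>pairing T y g - pairing T y (bwd nu ps)\<bar> <= R * nrm1 T (%t x. g t x - bwd nu ps t x)" by (rule pairing_diff_bound[OF y g bL])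
  also have "... <= R * dl" by (intro mult_left_mono less_imp_le[OF ps(2)] R)
  finally show ?thesis using Rdl by simp
 qed
 have uR: "AE t in itv T. nrm torus (u t) <= R"
  using C(2) by eventually_elim (use growth_pos in \<open>simp add: R_def add_increasing2\<close>)
 obtain K where K: "0 <= K"
  "!!th u sg. energy_solution M F \<Lambda> B a T b th u0 u ==> noise_const th = nu ==>
   (!!k. k ~= 0 ==> (th k)\<^sup>2 <= sg) ==> 0 <= sg ==>
   (\<integral>\<^sup>+w. ennreal \<bar>pairing T (%t. u t w) (bwd nu ps) - inn torus u0 (test_fun ps 0)\<bar> \<partial>M) <= ennreal (K * sqrt sg)"
 proof (rule pairing_error[OF u0 ps(1), of nu], goal_cases)
  case (1 K)
  show ?case by (rule 1(1)[OF 1(2,3)])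
 qed
 have bound: "(\<integral>\<^sup>+w. ennreal \<bar>pairing T (%t. uN N t w) g - pairing T u g\<bar> \<partial>M) <= ennreal (r / 2 + K * sqrt (sg N))" for N
 proof -
  note sD = energy_solutionD[OF sol[of N]]
  let ?E = "%w. \<bar>pairing T (%t. uN N t w) (bwd nu ps) - inn torus u0 (test_fun ps 0)\<bar>"
  have Em: "(%w. ennreal (?E w)) \<in> borel_measurable M"
   by (intro measurable_compose[OF _ measurable_ennreal] borel_measurable_abs borel_measurable_diff borel_measurable_const
    pairing_measurable[OF T sD(1,2) bL])
  have "(\<integral>\<^sup>+w. ennreal \<bar>pairing T (%t. uN N t w) g - pairing T u g\<bar> \<partial>M) <= (\<integral>\<^sup>+w. ennreal (r / 2) + ennreal (?E w) \<partial>M)"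
  proof (rule nn_integral_mono_AE)
   show "AE w in M. ennreal \<bar>pairing T (%t. uN N t w) g - pairing T u g\<bar> <= ennreal (r / 2) + ennreal (?E w)"
    using sD(3) AE_space
   proof eventually_elim
    case (elim w)
    have "AE t in itv T. nrm torus (uN N t w) <= R"
     using elim(1) C(1) by (intro AE_I2) (auto simp: R_def intro: add_increasing)
    from close[OF weakly_continuous_Linf[OF sD(1)[OF elim(2)]] this] close[OF uL uR]
    have "\<bar>pairing T (%t. uN N t w) g - pairing T u g\<bar> <= r / 2 + ?E w"
     unfolding weak_solution_pairing[OF u u0 ps(1)] by argo
    then have "ennreal \<bar>pairing T (%t. uN N t w) g - pairing T u g\<bar> <= ennreal (r / 2 + ?E w)" by (rule ennreal_leI)
    then show ?case using r by (subst ennreal_plus[symmetric]) auto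
   qed
  qed
  also have "... = ennreal (r / 2) + (\<integral>\<^sup>+w. ennreal (?E w) \<partial>M)"
   by (subst nn_integral_add[OF borel_measurable_const Em]) (simp add: emeasure_space_1)
  also have "... <= ennreal (r / 2) + ennreal (K * sqrt (sg N))"
   by (intro add_left_mono K(2)[OF sol nc sg(1,2)])
  also have "... = ennreal (r / 2 + K * sqrt (sg N))" using r K(1) sg(2) by (intro ennreal_plus[symmetric]) auto
  finally show ?thesis .
 qed
 have "(%N. r / 2 + K * sqrt (sg N)) \<longlonglongrightarrow> r / 2 + K * sqrt 0"
  by (intro tendsto_add tendsto_mult_left tendsto_const tendsto_real_sqrt sg(3))
 then have "\<forall>\<^sub>F N in sequentially. r / 2 + K * sqrt (sg N) < r"
  by (rule order_tendstoD(2)) (use r in simp)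
 then show "\<forall>\<^sub>F N in sequentially. (\<integral>\<^sup>+w. ennreal \<bar>pairing T (%t. uN N t w) g - pairing T u g\<bar> \<partial>M) < ennreal r"
 proof eventually_elim
  case (elim N)
  then have "ennreal (r / 2 + K * sqrt (sg N)) < ennreal r" by (rule ennreal_lessI[OF r])
  then show ?case by (rule le_less_trans[OF bound])
 qed
qed

text \<open>The subsequence must not depend on the test function. It is extracted for the countably
  many basis pairings, and the almost sure common bound then extends convergence to every test
  function.\<close>

lemma energy_solutions_converge:
 assumes u0: "u0 \<in> L2" and u: "parabolic_weak_solution T b nu u0 u"
  and uniq: "!!y. parabolic_weak_solution T b nu (%x. 0) y ==> AE t in itv T. eqT (y t) (%x. 0)"
  and sol: "!!N. energy_solution M F \<Lambda> B a T b (th N) u0 (uN N)" and nc: "!!N. noise_const (th N) = nu"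
  and sg: "!!N k. k ~= 0 ==> (th N k)\<^sup>2 <= sg N" "!!N. 0 <= sg N" "sg \<longlonglongrightarrow> 0"
 shows "converges_in_prob M (weak_star T) (%N w t. uN N t w) (%w. u)"
 unfolding converges_in_prob_def
proof (intro conjI allI impI)
 note sD = energy_solutionD[OF sol]
 have uL: "u \<in> Linf_L2 T" using u unfolding parabolic_weak_solution_def by (rule conjunct1)
 show "(%w t. uN N t w) \<in> M \<rightarrow>\<^sub>M borel_of (weak_star T)" for N by (rule measurable_weak_star[OF T sD(1,2)])
 have "space (borel_of (weak_star T)) = (Linf_L2 T :: (real => real ^ 'd => real) set)"
  unfolding borel_of_def using openin_subset[of "weak_star T"] by (subst space_measure_of) (auto simp: topspace_weak_star)
 then show "(%w. u) \<in> M \<rightarrow>\<^sub>M borel_of (weak_star T)" using uL by (intro measurable_const) simp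
 fix r :: "nat => nat" assume r: "strict_mono r"
 let ?e = "%i t x. tcos T (fst i) t * cas (snd i) x"
 let ?D = "%N i w. \<bar>pairing T (%t. uN N t w) (?e i) - pairing T u (?e i)\<bar>"
 obtain s where s: "strict_mono s" "AE w in M. \<forall>i. (%n. ?D (r (s n)) i w) \<longlonglongrightarrow> 0"
 proof (rule AE_subsequence_countable[where D = ?D and M = M, OF _ _ _ r])
  show "?D N i \<in> borel_measurable M" for N i
   by (intro borel_measurable_abs borel_measurable_diff borel_measurable_const pairing_measurable[OF T sD(1,2) tcos_cas_L1])
  show "(%N. \<integral>\<^sup>+w. ennreal (?D N i w) \<partial>M) \<longlonglongrightarrow> 0" for i
   by (rule pairing_converges[OF u0 u uniq sol nc sg tcos_cas_L1])
 qed simp_all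
 obtain C where C: "0 <= C" "AE t in itv T. nrm torus (u t) <= C" using Linf_bound[OF uL] by blast
 define R where "R = max C (growth * nrm torus u0)"
 have uR: "AE t in itv T. nrm torus (u t) <= R" using C(2) by eventually_elim (unfold R_def, erule max.coboundedI1)
 have "AE w in M. \<forall>N. \<forall>t\<in>{0..T}. nrm torus (uN N t w) <= growth * nrm torus u0"
  unfolding AE_all_countable using sD(3) by blast
 then have "AE w in M. limitin (weak_star T) (%n t. uN (r (s n)) t w) u sequentially"
  using s(2) AE_space
 proof eventually_elim
  case (elim w)
  note wL = weakly_continuous_Linf[OF sD(1)[OF elim(3)]]
  have bd: "AE t in itv T. nrm torus (uN N t w) <= R" for N 
   unfolding R_def by (rule AE_I2, rule max.coboundedI2, rule bspec[OF spec[OF elim(1)]], simp)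
  have lim: "(%n. pairing T (%t. uN (r (s n)) t w) (?e i)) \<longlonglongrightarrow> pairing T u (?e i)" for i
   by (rule LIM_zero_cancel, rule tendsto_rabs_zero_cancel, rule spec[OF elim(2)])
  show ?case
   by (rule limitin_weak_star[OF wL uL bounded_pairing_tendsto[OF T wL bd uL uR lim]])
 qed
 with s(1) show "\<exists>s. strict_mono s & (AE w in M. limitin (weak_star T) (%n t. uN (r (s n)) t w) u sequentially)" by blast
qed

end

section \<open>Choice of the noise intensity and conclusion\<close>

theorem theorem3p1:
  fixes T :: real
    and b :: "real \<Rightarrow> real ^ 'd::finite \<Rightarrow> real ^ 'd"
    and M :: "'w measure"
    and F :: "real \<Rightarrow> 'w measure"
    and \<Lambda> :: "(int ^ 'd) set"
    and B :: "int ^ 'd \<Rightarrow> nat \<Rightarrow> real \<Rightarrow> 'w \<Rightarrow> real"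
    and a :: "int ^ 'd \<Rightarrow> nat \<Rightarrow> real ^ 'd"
    and \<theta> :: "nat \<Rightarrow> int ^ 'd \<Rightarrow> real"
  assumes dim: "CARD('d) \<ge> 2" and T: "T > 0"
    and prob: "prob_space M" "normal_filtration M F" "brownian_family M F B"
    and frame: "half_lattice \<Lambda>" "noise_frame \<Lambda> a"
    and A1_b: "\<And>i. (\<lambda>t x. b t x $ i) \<in> Lp_L2 2 T"
    and A1_div: "AE t in lebesgue_on {0..T}. \<exists>g. has_weak_div (b t) g"
                "(\<lambda>t. wdiv (b t)) \<in> Lp_L2 2 T"
    and A2: "(\<integral>\<^sup>+t\<in>{0..T}. Linf_norm (wdiv (b t)) \<partial>lebesgue) < \<infinity>"
    and A3: "\<And>\<nu> u0 u v. \<nu> > 0 \<Longrightarrow> u0 \<in> L2 \<Longrightarrow>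
               parabolic_weak_solution T b \<nu> u0 u \<Longrightarrow> parabolic_weak_solution T b \<nu> u0 v \<Longrightarrow>
               AE t in lebesgue_on {0..T}. eqT (u t) (v t)"
    and coeffs: "\<And>N. noise_coeffs (\<theta> N)"
                "\<And>N. (\<Sum>\<^sub>\<infinity>k\<in>UNIV - {0}. (\<theta> N k)\<^sup>2) > 0"
    and vanish: "(\<lambda>N. (SUP k\<in>UNIV - {0}. (\<theta> N k)\<^sup>2) / (\<Sum>\<^sub>\<infinity>k\<in>UNIV - {0}. (\<theta> N k)\<^sup>2)) \<longlonglongrightarrow> 0"
  shows "\<forall>\<nu>>0. \<exists>\<epsilon> :: nat \<Rightarrow> real. (\<forall>N. \<epsilon> N > 0) \<and>
           (\<forall>N. \<epsilon> N = \<nu> * (real CARD('d) / (real CARD('d) - 1)) * inverse (\<Sum>\<^sub>\<infinity>k\<in>UNIV - {0}. (\<theta> N k)\<^sup>2)) \<and>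
           (\<forall>u0\<in>L2. \<exists>u.
              parabolic_weak_solution T b \<nu> u0 u \<and>
              (\<forall>v. parabolic_weak_solution T b \<nu> u0 v \<longrightarrow>
                 (AE t in lebesgue_on {0..T}. eqT (v t) (u t))) \<and>
              (\<forall>uN. (\<forall>N. energy_solution M F \<Lambda> B a T b (\<lambda>k. sqrt (\<epsilon> N) * \<theta> N k) u0 (uN N)) \<longrightarrow>
                 converges_in_prob M (weak_star T) (\<lambda>N \<omega> t. uN N t \<omega>) (\<lambda>\<omega>. u)))"
proof (intro allI impI)
  fix \<nu> :: real assume \<nu>: "0 < \<nu>"
  interpret transport T b M F B \<Lambda> a
    by (intro transport.intro drift.intro noise.intro noise_axioms.intro transport_axioms.intro T A1_b A1_div A2 prob frame)
  define s where "s N = (\<Sum>\<^sub>\<infinity>k\<in>UNIV - {0}. (\<theta> N k)\<^sup>2)" for N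
  define S where "S N = (SUP k\<in>UNIV - {0}. (\<theta> N k)\<^sup>2)" for N
  define c where "c = real CARD('d) / (real CARD('d) - 1)"
  define \<epsilon> where "\<epsilon> N = \<nu> * c * inverse (s N)" for N
  have s: "0 < s N" for N unfolding s_def by (rule coeffs(2))
  have c: "0 < c" using dim by (simp add: c_def)
  have \<epsilon>: "0 < \<epsilon> N" for N using \<nu> c s by (simp add: \<epsilon>_def)
  have sm: "(\<lambda>k. (\<theta> N k)\<^sup>2) summable_on (UNIV - {0})" for N using coeffs(1)[of N] unfolding noise_coeffs_def by (elim conjE)
  have "(\<theta> N k)\<^sup>2 \<le> s N" if "k \<noteq> 0" for N k
    using finite_sum_le_infsum[OF sm[of N], of "{k}"] that by (simp add: s_def)
  then have bdd: "bdd_above ((\<lambda>k. (\<theta> N k)\<^sup>2) ` (UNIV - {0}))" for N by (intro bdd_aboveI2) auto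
  have le: "(\<theta> N k)\<^sup>2 \<le> S N" if "k \<noteq> 0" for N k unfolding S_def using that by (intro cSUP_upper bdd) auto
  \<comment> \<open>The intensity cancels both the dimensional factor and the square sum, so the
    corrector is \<open>\<nu>\<close> for every \<open>N\<close>.\<close>
  have nc: "noise_const (\<lambda>k. sqrt (\<epsilon> N) * \<theta> N k) = \<nu>" for N
  proof -
    have "(\<Sum>\<^sub>\<infinity>k\<in>UNIV - {0}. (sqrt (\<epsilon> N) * \<theta> N k)\<^sup>2) = \<epsilon> N * s N"
      unfolding s_def power_mult_distrib real_sqrt_pow2[OF less_imp_le[OF \<epsilon>]] by (rule infsum_cmult_right) (rule sm)
    then show ?thesis
      using s[of N] dim by (simp add: noise_const_def \<epsilon>_def c_def)
  qed
  have \<sigma>: "(sqrt (\<epsilon> N) * \<theta> N k)\<^sup>2 \<le> \<nu> * c * (S N / s N)" if "k \<noteq> 0" for N k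
  proof -
    have "(sqrt (\<epsilon> N) * \<theta> N k)\<^sup>2 = \<epsilon> N * (\<theta> N k)\<^sup>2" unfolding power_mult_distrib real_sqrt_pow2[OF less_imp_le[OF \<epsilon>]] ..
    also have "\<dots> \<le> \<epsilon> N * S N" using \<epsilon>[of N] by (intro mult_left_mono le that) simp
    finally show ?thesis by (simp add: \<epsilon>_def divide_inverse mult_ac)
  qed
  \<comment> \<open>Any nonzero lattice point shows that the bound dominates a square; a coordinate
    vector serves as such a point.\<close>
  have \<sigma>0: "0 \<le> \<nu> * c * (S N / s N)" for N
    using order_trans[OF zero_le_power2 \<sigma>[of "axis undefined 1" N]] by (simp add: axis_eq_0_iff)
  have "(\<lambda>N. \<nu> * c * (S N / s N)) \<longlonglongrightarrow> \<nu> * c * 0"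
    unfolding S_def s_def by (intro tendsto_mult_left vanish)
  then have lim: "(\<lambda>N. \<nu> * c * (S N / s N)) \<longlonglongrightarrow> 0" by simp
  \<comment> \<open>The zero function solves the problem with zero datum, so the uniqueness
    assumption says that every such solution vanishes, as \<open>bwd_dense\<close> requires.\<close>
  have zero: "parabolic_weak_solution T b \<nu> (\<lambda>x. 0) (\<lambda>t x. 0)"
    by (rule weak_solution_of_pairing[OF _ L2_zero])
      (auto simp: pairing_def Linf_L2_def strongly_measurable_const[OF L2_zero] L2norm_eq)
  have uniq: "AE t in itv T. eqT (w t) (\<lambda>x. 0)" if "parabolic_weak_solution T b \<nu> (\<lambda>x. 0) w" for w
    by (rule A3[OF \<nu> L2_zero that zero])
  show "\<exists>\<epsilon> :: nat \<Rightarrow> real. (\<forall>N. \<epsilon> N > 0) \<and>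
           (\<forall>N. \<epsilon> N = \<nu> * (real CARD('d) / (real CARD('d) - 1)) * inverse (\<Sum>\<^sub>\<infinity>k\<in>UNIV - {0}. (\<theta> N k)\<^sup>2)) \<and>
           (\<forall>u0\<in>L2. \<exists>u.
              parabolic_weak_solution T b \<nu> u0 u \<and>
              (\<forall>v. parabolic_weak_solution T b \<nu> u0 v \<longrightarrow>
                 (AE t in lebesgue_on {0..T}. eqT (v t) (u t))) \<and>
              (\<forall>uN. (\<forall>N. energy_solution M F \<Lambda> B a T b (\<lambda>k. sqrt (\<epsilon> N) * \<theta> N k) u0 (uN N)) \<longrightarrow>
                 converges_in_prob M (weak_star T) (\<lambda>N \<omega> t. uN N t \<omega>) (\<lambda>\<omega>. u)))"
  proof (intro exI[of _ \<epsilon>] conjI allI ballI)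
    show "0 < \<epsilon> N" for N by (rule \<epsilon>)
    show "\<epsilon> N = \<nu> * (real CARD('d) / (real CARD('d) - 1)) * inverse (\<Sum>\<^sub>\<infinity>k\<in>UNIV - {0}. (\<theta> N k)\<^sup>2)" for N
      unfolding \<epsilon>_def c_def s_def ..
    fix u0 :: "real ^ 'd \<Rightarrow> real" assume u0: "u0 \<in> L2"
    obtain u where u: "parabolic_weak_solution T b \<nu> u0 u" by (rule weak_solution_exists[OF less_imp_le[OF \<nu>] u0])
    show "\<exists>u. parabolic_weak_solution T b \<nu> u0 u \<and>
              (\<forall>v. parabolic_weak_solution T b \<nu> u0 v \<longrightarrow>
                 (AE t in lebesgue_on {0..T}. eqT (v t) (u t))) \<and>
              (\<forall>uN. (\<forall>N. energy_solution M F \<Lambda> B a T b (\<lambda>k. sqrt (\<epsilon> N) * \<theta> N k) u0 (uN N)) \<longrightarrow>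
                 converges_in_prob M (weak_star T) (\<lambda>N \<omega> t. uN N t \<omega>) (\<lambda>\<omega>. u))"
    proof (intro exI[of _ u] conjI allI impI u)
      fix v assume "parabolic_weak_solution T b \<nu> u0 v"
      then show "AE t in lebesgue_on {0..T}. eqT (v t) (u t)" by (rule A3[OF \<nu> u0 _ u])
    next
      fix uN assume "\<forall>N. energy_solution M F \<Lambda> B a T b (\<lambda>k. sqrt (\<epsilon> N) * \<theta> N k) u0 (uN N)"
      then have sol: "energy_solution M F \<Lambda> B a T b (\<lambda>k. sqrt (\<epsilon> N) * \<theta> N k) u0 (uN N)" for N by (rule spec)
      show "converges_in_prob M (weak_star T) (\<lambda>N \<omega> t. uN N t \<omega>) (\<lambda>\<omega>. u)"
        by (rule energy_solutions_converge[OF u0 u uniq sol nc \<sigma> \<sigma>0 lim])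
    qed
  qed
qed

end
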